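(* Let $k$ be a finite field of characteristic $p$ and $G$ a compact $p$-adic analytic group with finite radical $\Delta^+$. Let $H$ be an open normal subgroup of $G$ containing $\Delta^+$ such that $H/\Delta^+$ is pro-$p$. Let $\mathfrak{M}$ be a minimal prime ideal of $kG$ and suppose that $\mathfrak{M}\cap k\Delta^+$ is a prime ideal of $k\Delta^+$. Let $\psi: kH/(\mathfrak{M}\cap kH) \to M_t\big( k'[[H/\Delta^+]]\big)$ be an untwisting isomorphism, and let $\alpha$ be a central 2-cocycle such that $\psi$ extends to an isomorphism $\tilde\psi:kG/\mathfrak{M}\to M_t\big((k'[[G/\Delta^+]])_\alpha\big)$ (terms as defined in the context). Let $A$ be an ideal of $kH$ containing $\mathfrak{M}\cap kH$, and write $\psi(A/(\mathfrak{M}\cap kH)) = M_t(\mathfrak{a})$ for an ideal $\mathfrak{a}$ of $k'[[H/\Delta^+]]$. Then: (i) $A$ is prime in $kH$ if and only if $\mathfrak{a}$ is prime in $k'[[H/\Delta^+]]$. (ii) $A$ is stable under conjugation by $G$ if and only if $\mathfrak{a}$ is stable under conjugation by $G/\Delta^+$ in the ring $\big(k'[[G/\Delta^+]]\big)_\alpha$. (iii) $A$ is almost faithful as an ideal of $kH$ if and only if $\mathfrak{a}$ is (almost) faithful as an ideal of $k'[[H/\Delta^+]]$.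
   Context: Completed group rings: $kG=k[[G]]=\varprojlim_N k[G/N]$ over open normal subgroups $N$. Finite radical: $\Delta^+=\{x\in G: o(x)<\infty,\ [G:\mathbf{C}_G(x)]<\infty\}$, the largest finite normal subgroup of $G$. We write $x^g=g^{-1}xg$. Faithfulness. For an ideal $I$ of a completed group ring $kG$, $I^\dagger=\{x\in G: x-1\in I\}=\ker(G\to(kG/I)^\times)$. $I$ is faithful if $I^\dagger=1$, and almost faithful if $I^\dagger$ is finite. (For ideals of $k'[[H/\Delta^+]]$ the two notions coincide, since $H/\Delta^+$ has no nontrivial finite normal subgroup; hence "(almost) faithful".) Idempotents. $J(-)$ is the Jacobson radical; $J(k\Delta^+)kG$ is a two-sided ideal of $kG$, and $\overline{(-)}$ denotes images in $kG/J(k\Delta^+)kG$. An idempotent is centrally primitive if it is central and is not a sum of two nonzero orthogonal central idempotents. Each minimal prime $\mathfrak{M}$ of $kG$ corresponds to a unique $G$-orbit $X$ of centrally primitive idempotents of $\overline{k\Delta^+}$: with $f=\sum_{e\in X}e$, $\mathfrak{M}$ is the full preimage in $kG$ of $(1-f)\overline{kG}$. If $\mathfrak{M}\cap k\Delta^+$ is prime then $X=\{e\}$ with $e$ centralised by $G$, and $\mathfrak{M}\cap kH$ is a minimal prime of $kH$, $kG/\mathfrak{M}\cong e\cdot\overline{kG}$ and $kH/(\mathfrak{M}\cap kH)\cong e\cdot\overline{kH}$ naturally. Moreover $e\cdot\overline{k\Delta^+}\cong M_t(k')$ for some $t\ge1$ and some finite field extension $k'/k$; fix such an isomorphism. Untwisting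 isomorphism. Let $\delta:H\to(e\cdot\overline{k\Delta^+})^\times$ be a continuous group homomorphism with (i) $\delta(h)=e\cdot\overline{h}$ for all $h\in\Delta^+$, and (ii) $\delta(h)^{-1}\overline{h}$ centralises $e\cdot\overline{k\Delta^+}$ for all $h\in H$. The assignment $e\cdot\overline{h}\mapsto\delta(h)\otimes h\Delta^+$ ($h\in H$) extends to a ring isomorphism $\Psi:e\cdot\overline{kH}\to e\cdot\overline{k\Delta^+}\otimes_k k[[H/\Delta^+]]$, and an untwisting isomorphism $\psi$ is the composite of $\Psi$ with the identification $e\cdot\overline{k\Delta^+}\otimes_k k[[H/\Delta^+]]=e\cdot\overline{k\Delta^+}\otimes_{k'}k'[[H/\Delta^+]]=M_t(k'[[H/\Delta^+]])$; it is regarded as defined on $kH/(\mathfrak{M}\cap kH)\cong e\cdot\overline{kH}$. Crossed products. Let $R$ be a ring and $F$ a finite group. A crossed product $S=R*F$ with action $\sigma:F\to\mathrm{Aut}(R)$ and twisting $\tau:F\times F\to R^\times$ (functions of sets) is a ring containing $R$, free as an $R$-module on a basis $\{u_x:x\in F\}$ with $ru_x=u_xr^{\sigma(x)}$ and $u_xu_y=u_{xy}\tau(x,y)$. For $A_0=Z(R)^\times$, $Z^2_\sigma(F,A_0)$ is the set of functions $\alpha:F\times F\to A_0$ with $\alpha(xy,z)\alpha(x,y)^{\sigma(z)}=\alpha(x,yz)\alpha(y,z)$ for all $x,y,z$; such $\alpha$ is called a central 2-cocycle. The central 2-cocycle twist $S_\alpha$ is the crossed product of $R$ by $F$ with basis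 $\{\hat u_x:x\in F\}$, the same action $\sigma$, and twisting $(x,y)\mapsto\tau(x,y)\alpha(x,y)$. Here $S=k'[[G/\Delta^+]]$, $R=k'[[H/\Delta^+]]$, $F=G/H$, the decomposition of $S$ is standard, meaning that the basis $\{u_x\}$ is the image of a transversal of $H$ in $G$ under the natural map $G\to k'[[G/\Delta^+]]^\times$, and $\alpha\in Z^2_\sigma(G/H,Z(k'[[H/\Delta^+]])^\times)$. The conjugation action of $G/\Delta^+$ on $k'[[H/\Delta^+]]$ inside $(k'[[G/\Delta^+]])_\alpha$: an element $u_xn$ of $G/\Delta^+$ ($x\in G/H$, $n\in H/\Delta^+$) acts by conjugation $r\mapsto(\hat u_xn)^{-1}r(\hat u_xn)$. *)

theory Defs
  imports "HOL-Analysis.Analysis" "HOL-Algebra.Ideal_Product" "HOL-Algebra.QuotRing"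
    "HOL-Algebra.Embedded_Algebras"
begin

section \<open>The field of p-adic numbers\<close>

definition padic_abs :: "nat \<Rightarrow> rat \<Rightarrow> real" where
  "padic_abs p q = (if q = 0 then 0 else
     real p powi (int (multiplicity (int p) (snd (quotient_of q)))
                  - int (multiplicity (int p) (fst (quotient_of q)))))"

definition padic_Cauchy :: "nat \<Rightarrow> (nat \<Rightarrow> rat) set" where
  "padic_Cauchy p = {s. \<forall>\<epsilon>>0. \<exists>N. \<forall>m\<ge>N. \<forall>n\<ge>N. padic_abs p (s m - s n) < \<epsilon>}"

definition padic_null :: "nat \<Rightarrow> (nat \<Rightarrow> rat) set" where
  "padic_null p = {s. (\<lambda>n. padic_abs p (s n)) \<longlonglongrightarrow> 0}"

definition padic_Cauchy_ring :: "nat \<Rightarrow> (nat \<Rightarrow> rat) ring" where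
  "padic_Cauchy_ring p = \<lparr>carrier = padic_Cauchy p, mult = (\<lambda>s s' n. s n * s' n), one = (\<lambda>n. 1),
     zero = (\<lambda>n. 0), add = (\<lambda>s s' n. s n + s' n)\<rparr>"

definition Qp :: "nat \<Rightarrow> (nat \<Rightarrow> rat) set ring" where
  "Qp p = padic_Cauchy_ring p Quot padic_null p"

text \<open>The sequence of absolute values converges and its limit does not depend on the
  representative.\<close>

definition padic_norm :: "nat \<Rightarrow> (nat \<Rightarrow> rat) set \<Rightarrow> real" where
  "padic_norm p x = lim (\<lambda>n. padic_abs p ((SOME s. s \<in> x) n))"

definition padic_space :: "nat \<Rightarrow> nat \<Rightarrow> (nat \<Rightarrow> (nat \<Rightarrow> rat) set) set" where
  "padic_space p n = {..<n} \<rightarrow>\<^sub>E carrier (Qp p)"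

text \<open>\<open>Metric_space\<close> requires symmetry and nonnegativity for arguments outside the carrier too.\<close>

definition padic_dist :: "nat \<Rightarrow> (nat \<Rightarrow> rat) set \<Rightarrow> (nat \<Rightarrow> rat) set \<Rightarrow> real" where
  "padic_dist p x y = (if x \<in> carrier (Qp p) \<and> y \<in> carrier (Qp p)
     then padic_norm p (x \<ominus>\<^bsub>Qp p\<^esub> y) else 0)"

definition padic_topology :: "nat \<Rightarrow> nat \<Rightarrow> (nat \<Rightarrow> (nat \<Rightarrow> rat) set) topology" where
  "padic_topology p n = product_topology
     (\<lambda>_. Metric_space.mtopology (carrier (Qp p)) (padic_dist p)) {..<n}"

definition padic_ball ::
    "nat \<Rightarrow> nat \<Rightarrow> (nat \<Rightarrow> (nat \<Rightarrow> rat) set) \<Rightarrow> real \<Rightarrow> (nat \<Rightarrow> (nat \<Rightarrow> rat) set) set" where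
  "padic_ball p n a r = {x \<in> padic_space p n. \<forall>i<n. padic_norm p (x i \<ominus>\<^bsub>Qp p\<^esub> a i) < r}"

text \<open>Unordered convergence of a family in \<open>Qp p\<close> indexed by \<open>I\<close>.\<close>

definition padic_has_sum ::
    "nat \<Rightarrow> ('i \<Rightarrow> (nat \<Rightarrow> rat) set) \<Rightarrow> 'i set \<Rightarrow> (nat \<Rightarrow> rat) set \<Rightarrow> bool" where
  "padic_has_sum p f I s \<longleftrightarrow> s \<in> carrier (Qp p) \<and>
     (\<forall>\<epsilon>>0. \<exists>E. finite E \<and> E \<subseteq> I \<and>
        (\<forall>F. finite F \<and> E \<subseteq> F \<and> F \<subseteq> I \<longrightarrow>
             padic_norm p ((\<Oplus>\<^bsub>Qp p\<^esub>i\<in>F. f i) \<ominus>\<^bsub>Qp p\<^esub> s) < \<epsilon>))"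

text \<open>\<open>f\<close> maps \<open>V\<close> to \<open>n\<close>-space and near every point of \<open>V\<close> each of its components is given by
  a convergent power series in \<open>m\<close> variables; \<open>\<alpha>\<close> ranges over the multi-indices.\<close>

definition padic_analytic_on ::
    "nat \<Rightarrow> nat \<Rightarrow> nat \<Rightarrow> (nat \<Rightarrow> (nat \<Rightarrow> rat) set) set \<Rightarrow>
     ((nat \<Rightarrow> (nat \<Rightarrow> rat) set) \<Rightarrow> (nat \<Rightarrow> (nat \<Rightarrow> rat) set)) \<Rightarrow> bool" where
  "padic_analytic_on p m n V f \<longleftrightarrow> openin (padic_topology p m) V \<and> f ` V \<subseteq> padic_space p n \<and>
     (\<forall>a\<in>V. \<forall>i<n. \<exists>r>0. \<exists>c. (\<forall>\<alpha> \<in> {..<m} \<rightarrow>\<^sub>E UNIV. c \<alpha> \<in> carrier (Qp p)) \<and>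
        padic_ball p m a r \<subseteq> V \<and>
        (\<forall>x \<in> padic_ball p m a r.
           padic_has_sum p
             (\<lambda>\<alpha>. c \<alpha> \<otimes>\<^bsub>Qp p\<^esub> (\<Otimes>\<^bsub>Qp p\<^esub>j\<in>{..<m}. (x j \<ominus>\<^bsub>Qp p\<^esub> a j) [^]\<^bsub>Qp p\<^esub> (\<alpha> j :: nat)))
             ({..<m} \<rightarrow>\<^sub>E UNIV) (f x i)))"


section \<open>Topological groups\<close>

definition topological_group :: "'g monoid \<Rightarrow> 'g topology \<Rightarrow> bool" where
  "topological_group G T \<longleftrightarrow> group G \<and> topspace T = carrier G \<and>
     continuous_map (prod_topology T T) T (\<lambda>(x, y). x \<otimes>\<^bsub>G\<^esub> y) \<and>
     continuous_map T T (\<lambda>x. inv\<^bsub>G\<^esub> x)"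

type_synonym 'g chart = "'g set \<times> ('g \<Rightarrow> nat \<Rightarrow> (nat \<Rightarrow> rat) set) \<times> nat"

definition padic_atlas :: "nat \<Rightarrow> 'g topology \<Rightarrow> 'g chart set \<Rightarrow> bool" where
  "padic_atlas p T \<A> \<longleftrightarrow> (\<Union>(U, \<phi>, n)\<in>\<A>. U) = topspace T \<and>
     (\<forall>(U, \<phi>, n)\<in>\<A>. openin T U \<and> openin (padic_topology p n) (\<phi> ` U) \<and>
        homeomorphic_map (subtopology T U) (subtopology (padic_topology p n) (\<phi> ` U)) \<phi>) \<and>
     (\<forall>(U, \<phi>, m)\<in>\<A>. \<forall>(V, \<eta>, n)\<in>\<A>.
        padic_analytic_on p m n (\<phi> ` (U \<inter> V)) (\<lambda>x. \<eta> (inv_into U \<phi> x)))"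

text \<open>Analyticity of multiplication in the charts; points of the product are written as vectors
  \<open>z\<close> of length \<open>m + n\<close>.\<close>

definition padic_analytic_mult :: "nat \<Rightarrow> 'g monoid \<Rightarrow> 'g chart set \<Rightarrow> bool" where
  "padic_analytic_mult p G \<A> \<longleftrightarrow>
     (\<forall>(U, \<phi>, m)\<in>\<A>. \<forall>(V, \<eta>, n)\<in>\<A>. \<forall>(W, \<omega>, l)\<in>\<A>.
        let x = (\<lambda>z. inv_into U \<phi> (restrict z {..<m}));
            y = (\<lambda>z. inv_into V \<eta> (\<lambda>j\<in>{..<n}. z (m + j)))
        in padic_analytic_on p (m + n) l
             {z \<in> padic_space p (m + n). restrict z {..<m} \<in> \<phi> ` U \<and>
                (\<lambda>j\<in>{..<n}. z (m + j)) \<in> \<eta> ` V \<and> x z \<otimes>\<^bsub>G\<^esub> y z \<in> W}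
             (\<lambda>z. \<omega> (x z \<otimes>\<^bsub>G\<^esub> y z)))"

definition padic_analytic_inv :: "nat \<Rightarrow> 'g monoid \<Rightarrow> 'g chart set \<Rightarrow> bool" where
  "padic_analytic_inv p G \<A> \<longleftrightarrow>
     (\<forall>(U, \<phi>, m)\<in>\<A>. \<forall>(V, \<eta>, n)\<in>\<A>.
        padic_analytic_on p m n (\<phi> ` {g \<in> U. inv\<^bsub>G\<^esub> g \<in> V})
          (\<lambda>x. \<eta> (inv\<^bsub>G\<^esub> (inv_into U \<phi> x))))"

definition padic_analytic_group :: "nat \<Rightarrow> 'g monoid \<Rightarrow> 'g topology \<Rightarrow> bool" where
  "padic_analytic_group p G T \<longleftrightarrow> topological_group G T \<and>
     (\<exists>\<A>. padic_atlas p T \<A> \<and> padic_analytic_mult p G \<A> \<and> padic_analytic_inv p G \<A>)"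

definition open_normals :: "'g monoid \<Rightarrow> 'g topology \<Rightarrow> 'g set set" where
  "open_normals G T = {N. N \<lhd> G \<and> openin T N}"

definition profinite_group :: "'g monoid \<Rightarrow> 'g topology \<Rightarrow> bool" where
  "profinite_group G T \<longleftrightarrow> topological_group G T \<and> compact_space T \<and> Hausdorff_space T \<and>
     (\<forall>x \<in> topspace T. connected_component_of_set T x = {x})"

definition pro_p_group :: "nat \<Rightarrow> 'g monoid \<Rightarrow> 'g topology \<Rightarrow> bool" where
  "pro_p_group p G T \<longleftrightarrow> profinite_group G T \<and>
     (\<forall>N \<in> open_normals G T. finite (rcosets\<^bsub>G\<^esub> N) \<and> (\<exists>n. card (rcosets\<^bsub>G\<^esub> N) = p ^ n))"

definition quotient_topology :: "'g monoid \<Rightarrow> 'g topology \<Rightarrow> 'g set \<Rightarrow> 'g set topology" where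
  "quotient_topology G T D = topology (\<lambda>U. U \<subseteq> carrier (G Mod D) \<and> openin T (\<Union>U))"

definition finite_radical :: "'g monoid \<Rightarrow> 'g set" where
  "finite_radical G = {x \<in> carrier G. (\<exists>n>0. x [^]\<^bsub>G\<^esub> (n::nat) = \<one>\<^bsub>G\<^esub>) \<and>
     finite (rcosets\<^bsub>G\<^esub> {g \<in> carrier G. g \<otimes>\<^bsub>G\<^esub> x = x \<otimes>\<^bsub>G\<^esub> g})}"


section \<open>Completed group rings\<close>

definition group_ring :: "'a ring \<Rightarrow> 'q monoid \<Rightarrow> ('q \<Rightarrow> 'a) ring" where
  "group_ring k Q =
     \<lparr>carrier = {f \<in> carrier Q \<rightarrow>\<^sub>E carrier k. finite {q \<in> carrier Q. f q \<noteq> \<zero>\<^bsub>k\<^esub>}},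
      mult = (\<lambda>f g. \<lambda>q\<in>carrier Q.
                \<Oplus>\<^bsub>k\<^esub>a\<in>{a \<in> carrier Q. f a \<noteq> \<zero>\<^bsub>k\<^esub>}. f a \<otimes>\<^bsub>k\<^esub> g (inv\<^bsub>Q\<^esub> a \<otimes>\<^bsub>Q\<^esub> q)),
      one = (\<lambda>q\<in>carrier Q. if q = \<one>\<^bsub>Q\<^esub> then \<one>\<^bsub>k\<^esub> else \<zero>\<^bsub>k\<^esub>),
      zero = (\<lambda>q\<in>carrier Q. \<zero>\<^bsub>k\<^esub>),
      add = (\<lambda>f g. \<lambda>q\<in>carrier Q. f q \<oplus>\<^bsub>k\<^esub> g q)\<rparr>"

text \<open>The \<open>k\<close>-linear map of group rings induced by \<open>\<phi>\<close>.\<close>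

definition group_ring_map ::
    "'a ring \<Rightarrow> 'q monoid \<Rightarrow> 'r monoid \<Rightarrow> ('q \<Rightarrow> 'r) \<Rightarrow> ('q \<Rightarrow> 'a) \<Rightarrow> ('r \<Rightarrow> 'a)" where
  "group_ring_map k Q P \<phi> f =
     (\<lambda>r\<in>carrier P. \<Oplus>\<^bsub>k\<^esub>q\<in>{q \<in> carrier Q. \<phi> q = r \<and> f q \<noteq> \<zero>\<^bsub>k\<^esub>}. f q)"

text \<open>The inverse limit of the rings \<open>k[G/N]\<close>: an element is a compatible family \<open>x\<close> with
  \<open>x N\<close> in \<open>k[G/N]\<close>, and for \<open>N \<subseteq> N'\<close> the projection \<open>G/N \<rightarrow> G/N'\<close> is \<open>C \<mapsto> N' C\<close>.\<close>

definition cgr :: "'a ring \<Rightarrow> 'g monoid \<Rightarrow> 'g topology \<Rightarrow> ('g set \<Rightarrow> 'g set \<Rightarrow> 'a) ring" where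
  "cgr k G T =
     \<lparr>carrier = {x \<in> (\<Pi>\<^sub>E N\<in>open_normals G T. carrier (group_ring k (G Mod N))).
        \<forall>N\<in>open_normals G T. \<forall>N'\<in>open_normals G T. N \<subseteq> N' \<longrightarrow>
          group_ring_map k (G Mod N) (G Mod N') (\<lambda>C. N' <#>\<^bsub>G\<^esub> C) (x N) = x N'},
      mult = (\<lambda>x y. \<lambda>N\<in>open_normals G T. x N \<otimes>\<^bsub>group_ring k (G Mod N)\<^esub> y N),
      one = (\<lambda>N\<in>open_normals G T. \<one>\<^bsub>group_ring k (G Mod N)\<^esub>),
      zero = (\<lambda>N\<in>open_normals G T. \<zero>\<^bsub>group_ring k (G Mod N)\<^esub>),
      add = (\<lambda>x y. \<lambda>N\<in>open_normals G T. x N \<oplus>\<^bsub>group_ring k (G Mod N)\<^esub> y N)\<rparr>"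

definition cgr_topology ::
    "'a ring \<Rightarrow> 'g monoid \<Rightarrow> 'g topology \<Rightarrow> ('g set \<Rightarrow> 'g set \<Rightarrow> 'a) topology" where
  "cgr_topology k G T = subtopology
     (product_topology (\<lambda>N. discrete_topology (carrier (group_ring k (G Mod N)))) (open_normals G T))
     (carrier (cgr k G T))"

definition cgr_elt :: "'a ring \<Rightarrow> 'g monoid \<Rightarrow> 'g topology \<Rightarrow> 'g \<Rightarrow> 'g set \<Rightarrow> 'g set \<Rightarrow> 'a" where
  "cgr_elt k G T g = (\<lambda>N\<in>open_normals G T. \<lambda>C\<in>carrier (G Mod N).
     if g \<in> C then \<one>\<^bsub>k\<^esub> else \<zero>\<^bsub>k\<^esub>)"

definition cgr_smult :: "'a ring \<Rightarrow> 'g monoid \<Rightarrow> 'g topology \<Rightarrow> 'a \<Rightarrow>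
    ('g set \<Rightarrow> 'g set \<Rightarrow> 'a) \<Rightarrow> 'g set \<Rightarrow> 'g set \<Rightarrow> 'a" where
  "cgr_smult k G T c x =
     (\<lambda>N\<in>open_normals G T. \<lambda>C\<in>carrier (G Mod N). c \<otimes>\<^bsub>k\<^esub> x N C)"

text \<open>For a closed subgroup \<open>L\<close>, the natural embedding of \<open>k[[L]]\<close> into \<open>k[[G]]\<close>, induced by the
  inclusions \<open>L/(N \<inter> L) \<rightarrow> G/N\<close>; \<open>k[[L]]\<close> is identified with its image \<open>cgr_sub k G T L\<close>.\<close>

definition cgr_incl :: "'a ring \<Rightarrow> 'g monoid \<Rightarrow> 'g topology \<Rightarrow> 'g set \<Rightarrow>
    ('g set \<Rightarrow> 'g set \<Rightarrow> 'a) \<Rightarrow> 'g set \<Rightarrow> 'g set \<Rightarrow> 'a" where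
  "cgr_incl k G T L x = (\<lambda>N\<in>open_normals G T.
     group_ring_map k (G\<lparr>carrier := L\<rparr> Mod (N \<inter> L)) (G Mod N) (\<lambda>C. N <#>\<^bsub>G\<^esub> C) (x (N \<inter> L)))"

definition cgr_sub ::
    "'a ring \<Rightarrow> 'g monoid \<Rightarrow> 'g topology \<Rightarrow> 'g set \<Rightarrow> ('g set \<Rightarrow> 'g set \<Rightarrow> 'a) ring" where
  "cgr_sub k G T L = (cgr k G T)
     \<lparr>carrier := cgr_incl k G T L ` carrier (cgr k (G\<lparr>carrier := L\<rparr>) (subtopology T L))\<rparr>"

text \<open>\<open>I\<^sup>\<dagger>\<close> for an ideal \<open>I\<close> of \<open>k[[L]]\<close>.\<close>

definition dagger :: "'a ring \<Rightarrow> 'g monoid \<Rightarrow> 'g topology \<Rightarrow> 'g set \<Rightarrow>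
    ('g set \<Rightarrow> 'g set \<Rightarrow> 'a) set \<Rightarrow> 'g set" where
  "dagger k G T L I = {x \<in> L. cgr_elt k G T x \<ominus>\<^bsub>cgr k G T\<^esub> \<one>\<^bsub>cgr k G T\<^esub> \<in> I}"

definition faithful :: "'a ring \<Rightarrow> 'g monoid \<Rightarrow> 'g topology \<Rightarrow> 'g set \<Rightarrow>
    ('g set \<Rightarrow> 'g set \<Rightarrow> 'a) set \<Rightarrow> bool" where
  "faithful k G T L I \<longleftrightarrow> dagger k G T L I = {\<one>\<^bsub>G\<^esub>}"

definition almost_faithful :: "'a ring \<Rightarrow> 'g monoid \<Rightarrow> 'g topology \<Rightarrow> 'g set \<Rightarrow>
    ('g set \<Rightarrow> 'g set \<Rightarrow> 'a) set \<Rightarrow> bool" where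
  "almost_faithful k G T L I \<longleftrightarrow> finite (dagger k G T L I)"

definition conj_stable ::
    "'a ring \<Rightarrow> 'g monoid \<Rightarrow> 'g topology \<Rightarrow> ('g set \<Rightarrow> 'g set \<Rightarrow> 'a) set \<Rightarrow> bool" where
  "conj_stable k G T A \<longleftrightarrow> (\<forall>g\<in>carrier G.
     (\<lambda>a. cgr_elt k G T (inv\<^bsub>G\<^esub> g) \<otimes>\<^bsub>cgr k G T\<^esub> a \<otimes>\<^bsub>cgr k G T\<^esub> cgr_elt k G T g) ` A = A)"


section \<open>Noncommutative rings\<close>

text \<open>The library's \<open>primeideal\<close> requires a commutative ring.\<close>

definition prime_ideal :: "'r set \<Rightarrow> 'r ring \<Rightarrow> bool" where
  "prime_ideal P R \<longleftrightarrow> ideal P R \<and> P \<noteq> carrier R \<and>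
     (\<forall>I J. ideal I R \<and> ideal J R \<and> I \<cdot>\<^bsub>R\<^esub> J \<subseteq> P \<longrightarrow> I \<subseteq> P \<or> J \<subseteq> P)"

definition minimal_prime_ideal :: "'r set \<Rightarrow> 'r ring \<Rightarrow> bool" where
  "minimal_prime_ideal P R \<longleftrightarrow>
     prime_ideal P R \<and> (\<forall>P'. prime_ideal P' R \<and> P' \<subseteq> P \<longrightarrow> P' = P)"

definition right_ideal :: "'r set \<Rightarrow> 'r ring \<Rightarrow> bool" where
  "right_ideal I R \<longleftrightarrow> subgroup I (add_monoid R) \<and> (\<forall>a\<in>I. \<forall>x\<in>carrier R. a \<otimes>\<^bsub>R\<^esub> x \<in> I)"

definition maximal_right_ideal :: "'r set \<Rightarrow> 'r ring \<Rightarrow> bool" where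
  "maximal_right_ideal I R \<longleftrightarrow> right_ideal I R \<and> I \<noteq> carrier R \<and>
     (\<forall>I'. right_ideal I' R \<and> I \<subseteq> I' \<longrightarrow> I' = I \<or> I' = carrier R)"

definition jacobson_radical :: "'r ring \<Rightarrow> 'r set" where
  "jacobson_radical R = carrier R \<inter> \<Inter>{I. maximal_right_ideal I R}"

definition ring_center :: "'r ring \<Rightarrow> 'r set" where
  "ring_center R = {z \<in> carrier R. \<forall>r\<in>carrier R. z \<otimes>\<^bsub>R\<^esub> r = r \<otimes>\<^bsub>R\<^esub> z}"

definition central_idempotent :: "'r ring \<Rightarrow> 'r \<Rightarrow> bool" where
  "central_idempotent R e \<longleftrightarrow> e \<in> ring_center R \<and> e \<otimes>\<^bsub>R\<^esub> e = e"

definition centrally_primitive :: "'r ring \<Rightarrow> 'r \<Rightarrow> bool" where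
  "centrally_primitive R e \<longleftrightarrow> central_idempotent R e \<and> e \<noteq> \<zero>\<^bsub>R\<^esub> \<and>
     \<not> (\<exists>a b. central_idempotent R a \<and> central_idempotent R b \<and> a \<noteq> \<zero>\<^bsub>R\<^esub> \<and> b \<noteq> \<zero>\<^bsub>R\<^esub> \<and>
              a \<otimes>\<^bsub>R\<^esub> b = \<zero>\<^bsub>R\<^esub> \<and> e = a \<oplus>\<^bsub>R\<^esub> b)"

text \<open>The ring \<open>eR\<close>, with identity \<open>e\<close>, for a central idempotent \<open>e\<close>.\<close>

definition corner_ring :: "'r \<Rightarrow> 'r ring \<Rightarrow> 'r ring" where
  "corner_ring e R = R\<lparr>carrier := (\<lambda>b. e \<otimes>\<^bsub>R\<^esub> b) ` carrier R, one := e\<rparr>"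

definition mat_set :: "nat \<Rightarrow> 'r set \<Rightarrow> (nat \<times> nat \<Rightarrow> 'r) set" where
  "mat_set t B = ({..<t} \<times> {..<t}) \<rightarrow>\<^sub>E B"

definition mat_ring :: "nat \<Rightarrow> 'r ring \<Rightarrow> (nat \<times> nat \<Rightarrow> 'r) ring" where
  "mat_ring t R =
     \<lparr>carrier = mat_set t (carrier R),
      mult = (\<lambda>a b. \<lambda>(i, j)\<in>{..<t} \<times> {..<t}. \<Oplus>\<^bsub>R\<^esub>l\<in>{..<t}. a (i, l) \<otimes>\<^bsub>R\<^esub> b (l, j)),
      one = (\<lambda>(i, j)\<in>{..<t} \<times> {..<t}. if i = j then \<one>\<^bsub>R\<^esub> else \<zero>\<^bsub>R\<^esub>),
      zero = (\<lambda>_\<in>{..<t} \<times> {..<t}. \<zero>\<^bsub>R\<^esub>),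
      add = (\<lambda>a b. \<lambda>ij\<in>{..<t} \<times> {..<t}. a ij \<oplus>\<^bsub>R\<^esub> b ij)\<rparr>"

definition mat_map :: "nat \<Rightarrow> ('r \<Rightarrow> 's) \<Rightarrow> (nat \<times> nat \<Rightarrow> 'r) \<Rightarrow> nat \<times> nat \<Rightarrow> 's" where
  "mat_map t j a = (\<lambda>il\<in>{..<t} \<times> {..<t}. j (a il))"


section \<open>Crossed products\<close>

text \<open>The containment of \<open>R\<close> in \<open>S\<close> is given by an injective ring homomorphism \<open>j\<close>, and \<open>\<sigma> x r\<close>
  is the image of \<open>r\<close> under the right action of \<open>x\<close>. These relations determine \<open>S\<close> up to isomorphism
  over \<open>R\<close>.\<close>

definition crossed_product :: "'r ring \<Rightarrow> 'f monoid \<Rightarrow> ('f \<Rightarrow> 'r \<Rightarrow> 'r) \<Rightarrow> ('f \<Rightarrow> 'f \<Rightarrow> 'r) \<Rightarrow>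
    's ring \<Rightarrow> ('r \<Rightarrow> 's) \<Rightarrow> ('f \<Rightarrow> 's) \<Rightarrow> bool" where
  "crossed_product R F \<sigma> \<tau> S j u \<longleftrightarrow>
     ring R \<and> group F \<and> finite (carrier F) \<and>
     (\<forall>x\<in>carrier F. \<sigma> x \<in> ring_iso R R) \<and>
     (\<forall>x\<in>carrier F. \<forall>y\<in>carrier F. \<tau> x y \<in> Units R) \<and>
     ring S \<and> j \<in> ring_hom R S \<and> inj_on j (carrier R) \<and>
     (\<forall>x\<in>carrier F. u x \<in> carrier S) \<and>
     (\<forall>s\<in>carrier S. \<exists>!c. c \<in> carrier F \<rightarrow>\<^sub>E carrier R \<and>
        s = (\<Oplus>\<^bsub>S\<^esub>x\<in>carrier F. u x \<otimes>\<^bsub>S\<^esub> j (c x))) \<and>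
     (\<forall>x\<in>carrier F. \<forall>r\<in>carrier R. j r \<otimes>\<^bsub>S\<^esub> u x = u x \<otimes>\<^bsub>S\<^esub> j (\<sigma> x r)) \<and>
     (\<forall>x\<in>carrier F. \<forall>y\<in>carrier F. u x \<otimes>\<^bsub>S\<^esub> u y = u (x \<otimes>\<^bsub>F\<^esub> y) \<otimes>\<^bsub>S\<^esub> j (\<tau> x y))"

definition central_2_cocycle ::
    "'r ring \<Rightarrow> 'f monoid \<Rightarrow> ('f \<Rightarrow> 'r \<Rightarrow> 'r) \<Rightarrow> ('f \<Rightarrow> 'f \<Rightarrow> 'r) \<Rightarrow> bool" where
  "central_2_cocycle R F \<sigma> \<alpha> \<longleftrightarrow>
     (\<forall>x\<in>carrier F. \<forall>y\<in>carrier F. \<alpha> x y \<in> Units R \<inter> ring_center R) \<and>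
     (\<forall>x\<in>carrier F. \<forall>y\<in>carrier F. \<forall>z\<in>carrier F.
        \<alpha> (x \<otimes>\<^bsub>F\<^esub> y) z \<otimes>\<^bsub>R\<^esub> \<sigma> z (\<alpha> x y) = \<alpha> x (y \<otimes>\<^bsub>F\<^esub> z) \<otimes>\<^bsub>R\<^esub> \<alpha> y z)"

definition central_twist :: "'r ring \<Rightarrow> 'f monoid \<Rightarrow> ('f \<Rightarrow> 'r \<Rightarrow> 'r) \<Rightarrow> ('f \<Rightarrow> 'f \<Rightarrow> 'r) \<Rightarrow>
    ('f \<Rightarrow> 'f \<Rightarrow> 'r) \<Rightarrow> 's ring \<Rightarrow> ('r \<Rightarrow> 's) \<Rightarrow> ('f \<Rightarrow> 's) \<Rightarrow> bool" where
  "central_twist R F \<sigma> \<tau> \<alpha> S\<^sub>\<alpha> j u\<^sub>\<alpha> \<longleftrightarrow>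
     crossed_product R F \<sigma> (\<lambda>x y. \<tau> x y \<otimes>\<^bsub>R\<^esub> \<alpha> x y) S\<^sub>\<alpha> j u\<^sub>\<alpha>"

text \<open>Stability of a subset \<open>\<aa>\<close> of \<open>R\<close> under the maps \<open>r \<mapsto> (u\<^sub>x n)\<^sup>-\<^sup>1 r (u\<^sub>x n)\<close>, for \<open>x\<close> in \<open>F\<close> and \<open>n\<close> in a
  set \<open>B\<close> of units of \<open>R\<close>.\<close>

definition twist_conj_stable ::
    "'f monoid \<Rightarrow> 's ring \<Rightarrow> ('r \<Rightarrow> 's) \<Rightarrow> ('f \<Rightarrow> 's) \<Rightarrow> 'r set \<Rightarrow> 'r set \<Rightarrow> bool" where
  "twist_conj_stable F S j u B \<aa> \<longleftrightarrow> (\<forall>x\<in>carrier F. \<forall>n\<in>B.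
     (\<lambda>r. inv\<^bsub>S\<^esub> (u x \<otimes>\<^bsub>S\<^esub> j n) \<otimes>\<^bsub>S\<^esub> j r \<otimes>\<^bsub>S\<^esub> (u x \<otimes>\<^bsub>S\<^esub> j n)) ` \<aa> = j ` \<aa>)"


section \<open>Minimal primes and untwisting\<close>

text \<open>\<open>kG/J(k\<Delta>\<^sup>+)kG\<close>, the projection onto it, and the image in it of \<open>k[[L]]\<close>.\<close>

definition radical_ideal :: "'a ring \<Rightarrow> 'g monoid \<Rightarrow> 'g topology \<Rightarrow> ('g set \<Rightarrow> 'g set \<Rightarrow> 'a) set" where
  "radical_ideal k G T =
     jacobson_radical (cgr_sub k G T (finite_radical G)) \<cdot>\<^bsub>cgr k G T\<^esub> carrier (cgr k G T)"

definition bar_ring ::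
    "'a ring \<Rightarrow> 'g monoid \<Rightarrow> 'g topology \<Rightarrow> ('g set \<Rightarrow> 'g set \<Rightarrow> 'a) set ring" where
  "bar_ring k G T = cgr k G T Quot radical_ideal k G T"

definition bar :: "'a ring \<Rightarrow> 'g monoid \<Rightarrow> 'g topology \<Rightarrow> ('g set \<Rightarrow> 'g set \<Rightarrow> 'a) \<Rightarrow>
    ('g set \<Rightarrow> 'g set \<Rightarrow> 'a) set" where
  "bar k G T x = radical_ideal k G T +>\<^bsub>cgr k G T\<^esub> x"

definition bar_sub :: "'a ring \<Rightarrow> 'g monoid \<Rightarrow> 'g topology \<Rightarrow> 'g set \<Rightarrow>
    ('g set \<Rightarrow> 'g set \<Rightarrow> 'a) set ring" where
  "bar_sub k G T L = (bar_ring k G T)\<lparr>carrier := bar k G T ` carrier (cgr_sub k G T L)\<rparr>"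

definition idempotent_orbit :: "'a ring \<Rightarrow> 'g monoid \<Rightarrow> 'g topology \<Rightarrow>
    ('g set \<Rightarrow> 'g set \<Rightarrow> 'a) set set \<Rightarrow> bool" where
  "idempotent_orbit k G T \<X> \<longleftrightarrow>
     (\<exists>e. centrally_primitive (bar_sub k G T (finite_radical G)) e \<and>
        \<X> = (\<lambda>g. bar k G T (cgr_elt k G T (inv\<^bsub>G\<^esub> g)) \<otimes>\<^bsub>bar_ring k G T\<^esub> e
                 \<otimes>\<^bsub>bar_ring k G T\<^esub> bar k G T (cgr_elt k G T g)) ` carrier G)"

definition corresponds_to_orbit :: "'a ring \<Rightarrow> 'g monoid \<Rightarrow> 'g topology \<Rightarrow>
    ('g set \<Rightarrow> 'g set \<Rightarrow> 'a) set \<Rightarrow> ('g set \<Rightarrow> 'g set \<Rightarrow> 'a) set set \<Rightarrow> bool" where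
  "corresponds_to_orbit k G T M \<X> \<longleftrightarrow> idempotent_orbit k G T \<X> \<and>
     M = {x \<in> carrier (cgr k G T). \<exists>y\<in>carrier (bar_ring k G T).
            bar k G T x = (\<one>\<^bsub>bar_ring k G T\<^esub> \<ominus>\<^bsub>bar_ring k G T\<^esub> (\<Oplus>\<^bsub>bar_ring k G T\<^esub>e\<in>\<X>. e))
                          \<otimes>\<^bsub>bar_ring k G T\<^esub> y}"

definition finite_field_extension :: "'a ring \<Rightarrow> 'b ring \<Rightarrow> ('a \<Rightarrow> 'b) \<Rightarrow> bool" where
  "finite_field_extension k K \<iota> \<longleftrightarrow> field k \<and> field K \<and> \<iota> \<in> ring_hom k K \<and>
     ring.finite_dimension K (\<iota> ` carrier k) (carrier K)"

text \<open>\<open>\<theta>\<close> is an isomorphism of \<open>k\<close>-algebras from the image of \<open>k\<Delta>\<^sup>+\<close>, cut down by \<open>e\<close>, to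
  \<open>M\<^sub>t(K)\<close>.\<close>

definition matrix_identification :: "'a ring \<Rightarrow> 'g monoid \<Rightarrow> 'g topology \<Rightarrow>
    ('g set \<Rightarrow> 'g set \<Rightarrow> 'a) set \<Rightarrow> 'b ring \<Rightarrow> ('a \<Rightarrow> 'b) \<Rightarrow> nat \<Rightarrow>
    (('g set \<Rightarrow> 'g set \<Rightarrow> 'a) set \<Rightarrow> nat \<times> nat \<Rightarrow> 'b) \<Rightarrow> bool" where
  "matrix_identification k G T e K \<iota> t \<theta> \<longleftrightarrow>
     \<theta> \<in> ring_iso (corner_ring e (bar_sub k G T (finite_radical G))) (mat_ring t K) \<and>
     (\<forall>c\<in>carrier k.
        \<theta> (e \<otimes>\<^bsub>bar_ring k G T\<^esub> bar k G T (cgr_smult k G T c \<one>\<^bsub>cgr k G T\<^esub>))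
          = (\<lambda>(i, j)\<in>{..<t} \<times> {..<t}. if i = j then \<iota> c else \<zero>\<^bsub>K\<^esub>))"

text \<open>The group of units is finite, so it carries the discrete topology.\<close>

definition untwisting_map :: "'a ring \<Rightarrow> 'g monoid \<Rightarrow> 'g topology \<Rightarrow> 'g set \<Rightarrow>
    ('g set \<Rightarrow> 'g set \<Rightarrow> 'a) set \<Rightarrow> ('g \<Rightarrow> ('g set \<Rightarrow> 'g set \<Rightarrow> 'a) set) \<Rightarrow> bool" where
  "untwisting_map k G T H e \<delta> \<longleftrightarrow>
     (let B = corner_ring e (bar_sub k G T (finite_radical G)); E = bar_ring k G T in
        \<delta> \<in> hom (G\<lparr>carrier := H\<rparr>) (units_of B) \<and>
        continuous_map (subtopology T H) (discrete_topology (Units B)) \<delta> \<and>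
        (\<forall>h\<in>finite_radical G. \<delta> h = e \<otimes>\<^bsub>E\<^esub> bar k G T (cgr_elt k G T h)) \<and>
        (\<forall>h\<in>H. \<forall>b\<in>carrier B.
           (inv\<^bsub>B\<^esub> (\<delta> h) \<otimes>\<^bsub>E\<^esub> bar k G T (cgr_elt k G T h)) \<otimes>\<^bsub>E\<^esub> b
             = b \<otimes>\<^bsub>E\<^esub> (inv\<^bsub>B\<^esub> (\<delta> h) \<otimes>\<^bsub>E\<^esub> bar k G T (cgr_elt k G T h))))"

text \<open>Under \<open>\<theta>\<close>, the tensor \<open>b \<otimes> y\<close> in \<open>B \<otimes>\<^sub>k k[[H/\<Delta>\<^sup>+]] = M\<^sub>t(K[[H/\<Delta>\<^sup>+]])\<close> is the matrix with
  entries \<open>\<theta>(b)\<^sub>i\<^sub>j y\<close>. Linearity and continuity make \<open>\<psi>\<close> the unique extension of the assignment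
  \<open>h \<mapsto> \<delta>(h) \<otimes> h\<Delta>\<^sup>+\<close>, since the \<open>k\<close>-span of \<open>H\<close> is dense in \<open>kH\<close>. Here \<open>K[[H/\<Delta>\<^sup>+]]\<close> is viewed
  inside \<open>K[[G/\<Delta>\<^sup>+]]\<close>.\<close>

definition untwisting_iso :: "'a ring \<Rightarrow> 'g monoid \<Rightarrow> 'g topology \<Rightarrow> 'g set \<Rightarrow>
    ('g set \<Rightarrow> 'g set \<Rightarrow> 'a) set \<Rightarrow> ('g set \<Rightarrow> 'g set \<Rightarrow> 'a) set \<Rightarrow> 'b ring \<Rightarrow> ('a \<Rightarrow> 'b) \<Rightarrow> nat \<Rightarrow>
    (('g set \<Rightarrow> 'g set \<Rightarrow> 'a) set \<Rightarrow> nat \<times> nat \<Rightarrow> 'b) \<Rightarrow>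
    (('g set \<Rightarrow> 'g set \<Rightarrow> 'a) set \<Rightarrow> nat \<times> nat \<Rightarrow> 'g set set \<Rightarrow> 'g set set \<Rightarrow> 'b) \<Rightarrow> bool" where
  "untwisting_iso k G T H M e K \<iota> t \<theta> \<psi> \<longleftrightarrow>
     (let \<Delta> = finite_radical G; Q = G Mod \<Delta>; TQ = quotient_topology G T \<Delta>;
          kH = cgr_sub k G T H; I = M \<inter> carrier kH;
          R = cgr_sub K Q TQ (carrier (G\<lparr>carrier := H\<rparr> Mod \<Delta>))
      in \<psi> \<in> ring_iso (kH Quot I) (mat_ring t R) \<and>
         (\<forall>c\<in>carrier k. \<forall>x\<in>carrier kH. \<forall>i<t. \<forall>j<t.
            \<psi> (I +>\<^bsub>kH\<^esub> cgr_smult k G T c x) (i, j)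
              = cgr_smult K Q TQ (\<iota> c) (\<psi> (I +>\<^bsub>kH\<^esub> x) (i, j))) \<and>
         (\<forall>i<t. \<forall>j<t. continuous_map (subtopology (cgr_topology k G T) (carrier kH))
            (cgr_topology K Q TQ) (\<lambda>x. \<psi> (I +>\<^bsub>kH\<^esub> x) (i, j))) \<and>
         (\<exists>\<delta>. untwisting_map k G T H e \<delta> \<and>
            (\<forall>h\<in>H. \<forall>i<t. \<forall>j<t.
               \<psi> (I +>\<^bsub>kH\<^esub> cgr_elt k G T h) (i, j)
                 = cgr_smult K Q TQ (\<theta> (\<delta> h) (i, j)) (cgr_elt K Q TQ (\<Delta> #>\<^bsub>G\<^esub> h)))))"

end

theory Submission
  imports Defs
begin

text \<open>
  Write \<open>\<phi>\<close> for the map \<open>kH \<rightarrow> M\<^sub>t(R)\<close> induced by \<open>\<psi>\<close>, where \<open>R = K[[H/\<Delta>]]\<close>. It is surjective with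
  kernel \<open>M \<inter> kH\<close>, so \<open>A\<close> is the full preimage of \<open>M\<^sub>t(\<aa>)\<close>, and each of the three claims compares a
  property of \<open>A\<close> with one of \<open>\<aa>\<close> along \<open>\<phi>\<close>.

  (i) is the Morita correspondence for matrix rings: every ideal of \<open>M\<^sub>t(R)\<close> is \<open>M\<^sub>t\<close> of the ideal of
  its entries, and products of ideals correspond (\<open>prime_matrix_preimage_iff\<close>).

  (ii) For an ideal \<open>\<aa>\<close> of \<open>R\<close>, let \<open>S\<^sub>\<alpha> \<aa>\<close> be the left ideal of the twisted crossed product that it
  generates. It consists of the combinations of the basis with coefficients in \<open>\<aa>\<close>, meets \<open>R\<close> in
  \<open>\<aa>\<close>, and is two-sided if \<open>\<aa>\<close> is stable under the action \<open>\<sigma>\<close>. If \<open>\<aa>\<close> is stable, the preimage of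
  \<open>M\<^sub>t(S\<^sub>\<alpha> \<aa>)\<close> under \<open>\<psi>'\<close> is therefore an ideal of \<open>kG\<close>, and its intersection with \<open>kH\<close> is \<open>A\<close>;
  hence \<open>A\<close> is stable under \<open>G\<close>. Conversely, let \<open>A\<close> be stable. Then \<open>A kG \<subseteq> kG A\<close>, because \<open>kG\<close> is
  the sum of the \<open>g kH\<close> over coset representatives \<open>g\<close> (\<open>cgr_coset_decomposition\<close>). Applying \<open>\<psi>'\<close>,
  conjugation by the basis elements of the crossed product keeps \<open>\<aa>\<close> within \<open>S\<^sub>\<alpha> \<aa> \<inter> R = \<aa>\<close>. Nothing
  has to be known about the images of the elements of \<open>G\<close> under \<open>\<psi>'\<close>; all this is
  \<open>conj_stable_matrix_iff\<close>.

  (iii) The untwisting map \<open>\<delta>\<close> has finitely many values, and if \<open>\<delta>(h) = \<delta>(h')\<close> then \<open>\<phi>\<close> sends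
  \<open>h\<^sup>-\<^sup>1 h'\<close> to the scalar matrix \<open>h\<^sup>-\<^sup>1 h' \<Delta>\<close>. On such quotients membership in \<open>A\<^sup>\<dagger>\<close> and in \<open>\<aa>\<^sup>\<dagger>\<close>
  agree, so by the pigeonhole principle one is finite if and only if the other is. If \<open>\<aa>\<^sup>\<dagger>\<close> is
  finite, its preimage in \<open>H\<close> is a finite normal subgroup of \<open>H\<close>, hence contained in \<open>\<Delta>\<close>, and
  \<open>\<aa>\<^sup>\<dagger>\<close> is trivial (\<open>faithful_iff\<close>). Both steps use that \<open>\<Delta>\<close> is finite. This is where the analytic
  structure enters: in a chart at the identity, multiplication is addition up to a bilinear error,
  so small elements of finite order are trivial (\<open>padic_analytic_no_small_torsion\<close>), and compactness
  does the rest.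

  Elements of \<open>k[[G]]\<close> are handled as \<open>k\<close>-valued finitely additive measures on the clopen subsets of
  \<open>G\<close>. In this language \<open>k[[H]]\<close> consists of the measures supported on \<open>H\<close>, and multiplication by a
  group element is translation.
\<close>

section \<open>The norm on the p-adic numbers\<close>

text \<open>The absolute value may be read off from any fraction, reduced or not, since multiplicities of a
  prime are additive.\<close>

lemma padic_abs_fraction:
  assumes "prime p" "a \<noteq> 0" "b \<noteq> 0"
  shows "padic_abs p (of_int a / of_int b)
     = real p powi (int (multiplicity (int p) b) - int (multiplicity (int p) a))"
proof -
  define q :: rat where "q = of_int a / of_int b"
  obtain n d where nd: "quotient_of q = (n, d)" by force
  have d0: "d > 0" and q: "q = of_int n / of_int d"
    using quotient_of_denom_pos[OF nd] quotient_of_div[OF nd] by auto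
  have q0: "q \<noteq> 0" using assms by (simp add: q_def)
  then have n0: "n \<noteq> 0" using q by auto
  have "(of_int (a * d) :: rat) = of_int (n * b)"
    using q d0 assms unfolding q_def by (simp add: field_simps)
  then have "a * d = n * b" by (simp only: of_int_eq_iff)
  moreover have "prime_elem (int p)" using assms(1) by (simp add: prime_imp_prime_elem)
  ultimately have "multiplicity (int p) a + multiplicity (int p) d
      = multiplicity (int p) n + multiplicity (int p) b"
    using assms d0 n0 by (metis less_irrefl prime_elem_multiplicity_mult_distrib)
  then have "int (multiplicity (int p) d) - int (multiplicity (int p) n)
      = int (multiplicity (int p) b) - int (multiplicity (int p) a)" by linarith
  then show ?thesis using q0 nd unfolding q_def[symmetric] padic_abs_def by simp
qed

lemma rat_fraction_cases:
  fixes x :: rat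
  obtains a b where "x = of_int a / of_int b" "b \<noteq> 0"
  by (metis quotient_of_div quotient_of_denom_pos less_irrefl surj_pair)

lemma padic_abs_0 [simp]: "padic_abs p 0 = 0"
  by (simp add: padic_abs_def)

lemma padic_abs_nonneg [simp]: "padic_abs p x \<ge> 0"
  by (simp add: padic_abs_def)

lemma padic_abs_mult:
  assumes "prime p" shows "padic_abs p (x * y) = padic_abs p x * padic_abs p y"
proof (cases "x = 0 \<or> y = 0")
  case False
  obtain a b where x: "x = of_int a / of_int b" "b \<noteq> 0" by (rule rat_fraction_cases)
  obtain c d where y: "y = of_int c / of_int d" "d \<noteq> 0" by (rule rat_fraction_cases)
  have ac: "a \<noteq> 0" "c \<noteq> 0" using False x y by auto
  have xy: "x * y = of_int (a * c) / of_int (b * d)" using x y by simp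
  have "prime_elem (int p)" using assms by (simp add: prime_imp_prime_elem)
  moreover have "real p \<noteq> 0" using assms by (simp add: prime_gt_0_nat)
  ultimately show ?thesis
    unfolding xy using x y ac assms
    by (simp only: padic_abs_fraction mult_eq_0_iff prime_elem_multiplicity_mult_distrib simp_thms)
       (simp add: power_int_add[symmetric] algebra_simps)
qed auto

lemma padic_abs_minus:
  assumes "prime p" shows "padic_abs p (- x) = padic_abs p x"
proof (cases "x = 0")
  case False
  have "padic_abs p (- 1) = 1" by (simp add: padic_abs_def multiplicity_unit_right)
  then show ?thesis using padic_abs_mult[OF assms, of "- 1" x] by simp
qed auto

lemma padic_abs_add:
  assumes "prime p" shows "padic_abs p (x + y) \<le> max (padic_abs p x) (padic_abs p y)"
proof (cases "x = 0 \<or> y = 0 \<or> x + y = 0")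
  case True
  then show ?thesis by (auto simp: max_def)
next
  case False
  obtain a b where x: "x = of_int a / of_int b" "b \<noteq> 0" by (rule rat_fraction_cases)
  obtain c d where y: "y = of_int c / of_int d" "d \<noteq> 0" by (rule rat_fraction_cases)
  have x': "x = of_int (a * d) / of_int (b * d)" and y': "y = of_int (c * b) / of_int (b * d)"
    and s: "x + y = of_int (a * d + c * b) / of_int (b * d)"
    using x y by (auto simp: field_simps)
  let ?m = "multiplicity (int p)"
  have nz: "a * d \<noteq> 0" "c * b \<noteq> 0" "a * d + c * b \<noteq> 0" "b * d \<noteq> 0"
    using False x y x' y' s by (auto simp del: of_int_add of_int_mult)
  have "\<not> is_unit (int p)" using prime_gt_1_nat[OF assms] by simp
  have ge: "min (?m (a * d)) (?m (c * b)) \<le> ?m (a * d + c * b)"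
    by (intro multiplicity_geI \<open>\<not> is_unit (int p)\<close> nz(3) dvd_add)
       (auto intro: multiplicity_dvd')
  have p1: "real p \<ge> 1" using prime_gt_1_nat[OF assms] by simp
  have mono: "real p powi m \<le> real p powi n" if "m \<le> n" for m n
    using that p1 by (rule power_int_increasing)
  have "padic_abs p (x + y) \<le> padic_abs p x \<or> padic_abs p (x + y) \<le> padic_abs p y"
    using ge padic_abs_fraction[OF assms nz(1,4)] padic_abs_fraction[OF assms nz(2,4)]
      padic_abs_fraction[OF assms nz(3,4)] unfolding x'[symmetric] y'[symmetric] s[symmetric]
    by (auto intro!: mono simp: min_def split: if_splits)
  then show ?thesis by auto
qed

lemma padic_abs_diff:
  assumes "prime p" shows "padic_abs p (x - y) \<le> max (padic_abs p x) (padic_abs p y)"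
  using padic_abs_add[OF assms, of x "- y"] by (simp add: padic_abs_minus[OF assms])

lemma padic_abs_1 [simp]: "padic_abs p 1 = 1"
  by (simp add: padic_abs_def)

lemma padic_abs_prime: "prime p \<Longrightarrow> padic_abs p (of_nat p) = 1 / real p"
  using padic_abs_fraction[of p "int p" 1]
  by (simp add: prime_gt_0_nat power_int_minus field_simps multiplicity_self prime_gt_1_nat)

lemma padic_abs_other_prime:
  assumes "prime p" "prime q" "q \<noteq> p" shows "padic_abs p (of_nat q) = 1"
proof -
  have "\<not> p dvd q" using assms primes_dvd_imp_eq by blast
  then have "\<not> int p dvd int q" by simp
  then show ?thesis using padic_abs_fraction[of p "int q" 1] assms
    by (simp add: prime_gt_0_nat not_dvd_imp_multiplicity_0)
qed

lemma padic_abs_abs_diff: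
  assumes "prime p" shows "\<bar>padic_abs p x - padic_abs p y\<bar> \<le> padic_abs p (x - y)"
proof -
  have "padic_abs p x \<le> max (padic_abs p (x - y)) (padic_abs p y)"
    using padic_abs_add[OF assms, of "x - y" y] by simp
  moreover have "padic_abs p y \<le> max (padic_abs p (x - y)) (padic_abs p x)"
    using padic_abs_diff[OF assms, of x "x - y"] by (simp add: max.commute)
  moreover have "padic_abs p x \<ge> 0" "padic_abs p y \<ge> 0" "padic_abs p (x - y) \<ge> 0" by auto
  ultimately show ?thesis by linarith
qed

lemma padic_CauchyD:
  assumes "s \<in> padic_Cauchy p" "\<epsilon> > 0"
  obtains N where "\<And>m n. m \<ge> N \<Longrightarrow> n \<ge> N \<Longrightarrow> padic_abs p (s m - s n) < \<epsilon>"
  using assms unfolding padic_Cauchy_def by blast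

lemma padic_Cauchy_bounded:
  assumes "prime p" "s \<in> padic_Cauchy p"
  obtains B where "B > 0" "\<And>n. padic_abs p (s n) \<le> B"
proof -
  obtain N where N: "\<And>m n. m \<ge> N \<Longrightarrow> n \<ge> N \<Longrightarrow> padic_abs p (s m - s n) < 1"
    using padic_CauchyD[OF assms(2) zero_less_one] by blast
  define B where "B = 1 + (\<Sum>i\<le>N. padic_abs p (s i))"
  have le: "padic_abs p (s i) \<le> B - 1" if "i \<le> N" for i
    unfolding B_def using that member_le_sum[of i "{..N}" "\<lambda>i. padic_abs p (s i)"] by simp
  have "padic_abs p (s n) \<le> B" for n
  proof (cases "n \<le> N")
    case False
    then have "padic_abs p (s n) \<le> max (padic_abs p (s n - s N)) (padic_abs p (s N))"
      using padic_abs_add[OF assms(1), of "s n - s N" "s N"] by simp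
    then show ?thesis using N[of n N] le[of N] False padic_abs_nonneg[of p "s N"] by linarith
  qed (use le in force)
  moreover have "B > 0" unfolding B_def by (simp add: sum_nonneg add_pos_nonneg)
  ultimately show ?thesis using that by blast
qed

lemma padic_Cauchy_const: "(\<lambda>n. c) \<in> padic_Cauchy p"
  by (simp add: padic_Cauchy_def)

lemma padic_Cauchy_diff:
  assumes "prime p" "s \<in> padic_Cauchy p" "s' \<in> padic_Cauchy p"
  shows "(\<lambda>n. s n - s' n) \<in> padic_Cauchy p"
  unfolding padic_Cauchy_def
proof (intro CollectI allI impI)
  fix \<epsilon> :: real assume "\<epsilon> > 0"
  obtain N where N: "\<And>m n. m \<ge> N \<Longrightarrow> n \<ge> N \<Longrightarrow> padic_abs p (s m - s n) < \<epsilon>"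
    using padic_CauchyD[OF assms(2) \<open>\<epsilon> > 0\<close>] by blast
  obtain N' where N': "\<And>m n. m \<ge> N' \<Longrightarrow> n \<ge> N' \<Longrightarrow> padic_abs p (s' m - s' n) < \<epsilon>"
    using padic_CauchyD[OF assms(3) \<open>\<epsilon> > 0\<close>] by blast
  have "padic_abs p (s m - s' m - (s n - s' n)) < \<epsilon>" if "m \<ge> max N N'" "n \<ge> max N N'" for m n
    using padic_abs_diff[OF assms(1), of "s m - s n" "s' m - s' n"] N[of m n] N'[of m n] that
    by (simp add: algebra_simps)
  then show "\<exists>N. \<forall>m\<ge>N. \<forall>n\<ge>N. padic_abs p (s m - s' m - (s n - s' n)) < \<epsilon>" by blast
qed

lemma padic_Cauchy_minus:
  "prime p \<Longrightarrow> s \<in> padic_Cauchy p \<Longrightarrow> (\<lambda>n. - s n) \<in> padic_Cauchy p"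
  using padic_Cauchy_diff[OF _ padic_Cauchy_const[of 0]] by simp

lemma padic_Cauchy_add:
  "prime p \<Longrightarrow> s \<in> padic_Cauchy p \<Longrightarrow> s' \<in> padic_Cauchy p \<Longrightarrow> (\<lambda>n. s n + s' n) \<in> padic_Cauchy p"
  using padic_Cauchy_diff[of p s "\<lambda>n. - s' n"] padic_Cauchy_minus[of p s'] by simp

lemma padic_Cauchy_mult:
  assumes "prime p" "s \<in> padic_Cauchy p" "s' \<in> padic_Cauchy p"
  shows "(\<lambda>n. s n * s' n) \<in> padic_Cauchy p"
  unfolding padic_Cauchy_def
proof (intro CollectI allI impI)
  fix \<epsilon> :: real assume "\<epsilon> > 0"
  obtain B where B: "B > 0" "\<And>n. padic_abs p (s n) \<le> B" using padic_Cauchy_bounded assms by blast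
  obtain B' where B': "B' > 0" "\<And>n. padic_abs p (s' n) \<le> B'"
    using padic_Cauchy_bounded assms by blast
  obtain N where N: "\<And>m n. m \<ge> N \<Longrightarrow> n \<ge> N \<Longrightarrow> padic_abs p (s m - s n) < \<epsilon> / B'"
    using padic_CauchyD[OF assms(2)] \<open>\<epsilon> > 0\<close> B' by (metis divide_pos_pos)
  obtain N' where N': "\<And>m n. m \<ge> N' \<Longrightarrow> n \<ge> N' \<Longrightarrow> padic_abs p (s' m - s' n) < \<epsilon> / B"
    using padic_CauchyD[OF assms(3)] \<open>\<epsilon> > 0\<close> B by (metis divide_pos_pos)
  have "padic_abs p (s m * s' m - s n * s' n) < \<epsilon>" if "m \<ge> max N N'" "n \<ge> max N N'" for m n
  proof -
    have "padic_abs p (s m * (s' m - s' n)) < \<epsilon>"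
    proof -
      have "padic_abs p (s m * (s' m - s' n)) \<le> B * padic_abs p (s' m - s' n)"
        by (simp add: padic_abs_mult[OF assms(1)] B mult_right_mono)
      also have "\<dots> < \<epsilon>" using N'[of m n] that B by (simp add: field_simps)
      finally show ?thesis .
    qed
    moreover have "padic_abs p ((s m - s n) * s' n) < \<epsilon>"
    proof -
      have "padic_abs p ((s m - s n) * s' n) \<le> padic_abs p (s m - s n) * B'"
        by (simp add: padic_abs_mult[OF assms(1)] B' mult_left_mono)
      also have "\<dots> < \<epsilon>" using N[of m n] that B' by (simp add: field_simps)
      finally show ?thesis .
    qed
    ultimately show ?thesis
      using padic_abs_add[OF assms(1), of "s m * (s' m - s' n)" "(s m - s n) * s' n"]
      by (simp add: algebra_simps)
  qed
  then show "\<exists>N. \<forall>m\<ge>N. \<forall>n\<ge>N. padic_abs p (s m * s' m - s n * s' n) < \<epsilon>" by blast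
qed

lemma padic_Cauchy_cring:
  assumes "prime p" shows "cring (padic_Cauchy_ring p)"
proof (rule cringI)
  show "abelian_group (padic_Cauchy_ring p)"
  proof (rule abelian_groupI)
    fix x assume "x \<in> carrier (padic_Cauchy_ring p)"
    then show "\<exists>y\<in>carrier (padic_Cauchy_ring p).
        y \<oplus>\<^bsub>padic_Cauchy_ring p\<^esub> x = \<zero>\<^bsub>padic_Cauchy_ring p\<^esub>"
      using padic_Cauchy_minus[OF assms] unfolding padic_Cauchy_ring_def
      by (intro bexI[of _ "\<lambda>n. - x n"]) auto
  qed (auto simp: padic_Cauchy_ring_def padic_Cauchy_add assms padic_Cauchy_const algebra_simps)
  show "comm_monoid (padic_Cauchy_ring p)"
    by (rule comm_monoidI)
       (auto simp: padic_Cauchy_ring_def padic_Cauchy_mult assms padic_Cauchy_const algebra_simps)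
qed (auto simp: padic_Cauchy_ring_def algebra_simps)

lemma padic_null_Cauchy:
  assumes "prime p" "s \<in> padic_null p" shows "s \<in> padic_Cauchy p"
  unfolding padic_Cauchy_def
proof (intro CollectI allI impI)
  fix \<epsilon> :: real assume "\<epsilon> > 0"
  then obtain N where N: "\<And>n. n \<ge> N \<Longrightarrow> padic_abs p (s n) < \<epsilon>"
    using assms(2) unfolding padic_null_def by (force dest: LIMSEQ_D)
  have "padic_abs p (s m - s n) < \<epsilon>" if "m \<ge> N" "n \<ge> N" for m n
    using padic_abs_diff[OF assms(1), of "s m" "s n"] N[OF that(1)] N[OF that(2)] by linarith
  then show "\<exists>N. \<forall>m\<ge>N. \<forall>n\<ge>N. padic_abs p (s m - s n) < \<epsilon>" by blast
qed

lemma tendsto_zero_squeeze: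
  fixes f g :: "nat \<Rightarrow> real"
  assumes "g \<longlonglongrightarrow> 0" "\<And>n. 0 \<le> f n" "\<And>n. f n \<le> g n" shows "f \<longlonglongrightarrow> 0"
  by (rule tendsto_sandwich[OF _ _ tendsto_const assms(1)]) (use assms in auto)

lemma padic_null_ideal:
  assumes "prime p" shows "ideal (padic_null p) (padic_Cauchy_ring p)"
proof (rule idealI)
  interpret cring "padic_Cauchy_ring p" by (rule padic_Cauchy_cring[OF assms])
  show "ring (padic_Cauchy_ring p)" by (rule ring_axioms)
  have minus: "\<ominus>\<^bsub>padic_Cauchy_ring p\<^esub> s = (\<lambda>n. - s n)" if "s \<in> padic_Cauchy p" for s
    using that padic_Cauchy_minus[OF assms that]
    by (intro minus_equality) (auto simp: padic_Cauchy_ring_def)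
  show "subgroup (padic_null p) (add_monoid (padic_Cauchy_ring p))"
  proof (rule group.subgroupI)
    show "group (add_monoid (padic_Cauchy_ring p))" by (rule a_group)
    show "padic_null p \<subseteq> carrier (add_monoid (padic_Cauchy_ring p))"
      using padic_null_Cauchy[OF assms] by (auto simp: padic_Cauchy_ring_def)
    show "padic_null p \<noteq> {}" by (auto simp: padic_null_def intro!: exI[of _ "\<lambda>n. 0"])
    fix s assume s: "s \<in> padic_null p"
    have "inv\<^bsub>add_monoid (padic_Cauchy_ring p)\<^esub> s = (\<lambda>n. - s n)"
      using minus[OF padic_null_Cauchy[OF assms s]] by (simp add: a_inv_def)
    then show "inv\<^bsub>add_monoid (padic_Cauchy_ring p)\<^esub> s \<in> padic_null p"
      using s by (simp add: padic_null_def padic_abs_minus[OF assms])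
    fix s' assume s': "s' \<in> padic_null p"
    have "(\<lambda>n. max (padic_abs p (s n)) (padic_abs p (s' n))) \<longlonglongrightarrow> max 0 0"
      using s s' unfolding padic_null_def by (intro tendsto_max) auto
    then have "(\<lambda>n. padic_abs p (s n + s' n)) \<longlonglongrightarrow> 0"
      by (simp add: tendsto_zero_squeeze padic_abs_add[OF assms])
    then show "s \<otimes>\<^bsub>add_monoid (padic_Cauchy_ring p)\<^esub> s' \<in> padic_null p"
      by (simp add: padic_null_def padic_Cauchy_ring_def)
  qed
  fix a x assume a: "a \<in> padic_null p" and x: "x \<in> carrier (padic_Cauchy_ring p)"
  obtain B where B: "B > 0" "\<And>n. padic_abs p (x n) \<le> B"
    using padic_Cauchy_bounded[OF assms, of x] x by (auto simp: padic_Cauchy_ring_def)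
  have "(\<lambda>n. B * padic_abs p (a n)) \<longlonglongrightarrow> B * 0"
    using a unfolding padic_null_def by (intro tendsto_mult) auto
  then have "(\<lambda>n. padic_abs p (x n * a n)) \<longlonglongrightarrow> 0"
    by (rule_tac tendsto_zero_squeeze) (auto simp: padic_abs_mult[OF assms] mult_right_mono B)
  then show "x \<otimes>\<^bsub>padic_Cauchy_ring p\<^esub> a \<in> padic_null p"
      "a \<otimes>\<^bsub>padic_Cauchy_ring p\<^esub> x \<in> padic_null p"
    by (auto simp: padic_null_def padic_Cauchy_ring_def mult.commute)
qed

definition padic_class :: "nat \<Rightarrow> (nat \<Rightarrow> rat) \<Rightarrow> (nat \<Rightarrow> rat) set" where
  "padic_class p s = padic_null p +>\<^bsub>padic_Cauchy_ring p\<^esub> s"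

lemma Qp_cring: "prime p \<Longrightarrow> cring (Qp p)"
  unfolding Qp_def by (intro ideal.quotient_is_cring padic_null_ideal padic_Cauchy_cring)

lemma padic_class_hom: "prime p \<Longrightarrow> padic_class p \<in> ring_hom (padic_Cauchy_ring p) (Qp p)"
  unfolding Qp_def padic_class_def[abs_def] by (intro ideal.rcos_ring_hom padic_null_ideal)

lemma Qp_cases:
  assumes "x \<in> carrier (Qp p)"
  obtains s where "s \<in> padic_Cauchy p" "x = padic_class p s"
  using assms unfolding Qp_def FactRing_def A_RCOSETS_def' padic_class_def
  by (auto simp: padic_Cauchy_ring_def)

lemma padic_class_add:
  "prime p \<Longrightarrow> s \<in> padic_Cauchy p \<Longrightarrow> s' \<in> padic_Cauchy p \<Longrightarrow>
    padic_class p s \<oplus>\<^bsub>Qp p\<^esub> padic_class p s' = padic_class p (\<lambda>n. s n + s' n)"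
  using ring_hom_add[OF padic_class_hom, of p s s'] by (simp add: padic_Cauchy_ring_def)

lemma padic_class_mult:
  "prime p \<Longrightarrow> s \<in> padic_Cauchy p \<Longrightarrow> s' \<in> padic_Cauchy p \<Longrightarrow>
    padic_class p s \<otimes>\<^bsub>Qp p\<^esub> padic_class p s' = padic_class p (\<lambda>n. s n * s' n)"
  using ring_hom_mult[OF padic_class_hom, of p s s'] by (simp add: padic_Cauchy_ring_def)

lemma padic_class_one: "prime p \<Longrightarrow> \<one>\<^bsub>Qp p\<^esub> = padic_class p (\<lambda>n. 1)"
  using ring_hom_one[OF padic_class_hom, of p] by (simp add: padic_Cauchy_ring_def)

lemma padic_class_zero: "prime p \<Longrightarrow> \<zero>\<^bsub>Qp p\<^esub> = padic_class p (\<lambda>n. 0)"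
  using ring_hom_zero[OF padic_class_hom, of p] Qp_cring[of p] padic_Cauchy_cring[of p]
  by (simp add: padic_Cauchy_ring_def cring_def)

text \<open>The limit in the definition of the norm exists because absolute values are 1-Lipschitz.\<close>

lemma padic_norm_tendsto:
  assumes "prime p" "s \<in> padic_Cauchy p"
  shows "(\<lambda>n. padic_abs p (s n)) \<longlonglongrightarrow> padic_norm p (padic_class p s)"
proof -
  interpret C: ideal "padic_null p" "padic_Cauchy_ring p" by (rule padic_null_ideal[OF assms(1)])
  define s' where "s' = (SOME s'. s' \<in> padic_class p s)"
  have "s \<in> padic_class p s" unfolding padic_class_def using assms(2)
    by (intro C.a_rcos_self) (auto simp: padic_Cauchy_ring_def)
  then have "s' \<in> padic_class p s" unfolding s'_def by (metis someI)
  then obtain h where h: "h \<in> padic_null p" "s' = (\<lambda>n. h n + s n)"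
    unfolding padic_class_def a_r_coset_def' by (auto simp: padic_Cauchy_ring_def)
  have "Cauchy (\<lambda>n. padic_abs p (s n))"
    unfolding Cauchy_def dist_real_def
  proof (intro allI impI)
    fix \<epsilon> :: real assume "\<epsilon> > 0"
    then obtain N where N: "\<And>m n. m \<ge> N \<Longrightarrow> n \<ge> N \<Longrightarrow> padic_abs p (s m - s n) < \<epsilon>"
      using padic_CauchyD[OF assms(2)] by blast
    then have "\<bar>padic_abs p (s m) - padic_abs p (s n)\<bar> < \<epsilon>" if "m \<ge> N" "n \<ge> N" for m n
      using padic_abs_abs_diff[OF assms(1), of "s m" "s n"] N[OF that] by linarith
    then show "\<exists>N. \<forall>m\<ge>N. \<forall>n\<ge>N. \<bar>padic_abs p (s m) - padic_abs p (s n)\<bar> < \<epsilon>" by blast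
  qed
  then obtain l where l: "(\<lambda>n. padic_abs p (s n)) \<longlonglongrightarrow> l"
    using Cauchy_convergent convergent_def by blast
  have "(\<lambda>n. padic_abs p (s' n) - padic_abs p (s n)) \<longlonglongrightarrow> 0"
  proof (rule tendsto_rabs_zero_cancel, rule tendsto_zero_squeeze)
    show "(\<lambda>n. padic_abs p (h n)) \<longlonglongrightarrow> 0" using h by (simp add: padic_null_def)
    show "\<bar>padic_abs p (s' n) - padic_abs p (s n)\<bar> \<le> padic_abs p (h n)" for n
      using padic_abs_abs_diff[OF assms(1), of "s' n" "s n"] h by simp
  qed auto
  from tendsto_add[OF this l] have "(\<lambda>n. padic_abs p (s' n)) \<longlonglongrightarrow> l" by simp
  then have "padic_norm p (padic_class p s) = l"
    unfolding padic_norm_def s'_def by (rule limI)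
  then show ?thesis using l by simp
qed

lemma padic_norm_nonneg:
  assumes "prime p" "x \<in> carrier (Qp p)" shows "padic_norm p x \<ge> 0"
  by (rule Qp_cases[OF assms(2)]) (auto intro: LIMSEQ_le_const[OF padic_norm_tendsto[OF assms(1)]])

lemma padic_norm_mult:
  assumes "prime p" "x \<in> carrier (Qp p)" "y \<in> carrier (Qp p)"
  shows "padic_norm p (x \<otimes>\<^bsub>Qp p\<^esub> y) = padic_norm p x * padic_norm p y"
proof -
  obtain s where s: "s \<in> padic_Cauchy p" "x = padic_class p s" using Qp_cases assms by blast
  obtain s' where s': "s' \<in> padic_Cauchy p" "y = padic_class p s'" using Qp_cases assms by blast
  have "(\<lambda>n. padic_abs p (s n) * padic_abs p (s' n)) \<longlonglongrightarrow> padic_norm p x * padic_norm p y"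
    using s s' by (auto intro!: tendsto_mult padic_norm_tendsto[OF assms(1)])
  moreover have "(\<lambda>n. padic_abs p (s n * s' n)) \<longlonglongrightarrow> padic_norm p (x \<otimes>\<^bsub>Qp p\<^esub> y)"
    using s s' by (simp add: padic_class_mult assms padic_norm_tendsto padic_Cauchy_mult)
  ultimately show ?thesis by (auto simp: padic_abs_mult[OF assms(1)] intro: LIMSEQ_unique)
qed

lemma padic_norm_add:
  assumes "prime p" "x \<in> carrier (Qp p)" "y \<in> carrier (Qp p)"
  shows "padic_norm p (x \<oplus>\<^bsub>Qp p\<^esub> y) \<le> max (padic_norm p x) (padic_norm p y)"
proof -
  obtain s where s: "s \<in> padic_Cauchy p" "x = padic_class p s" using Qp_cases assms by blast
  obtain s' where s': "s' \<in> padic_Cauchy p" "y = padic_class p s'" using Qp_cases assms by blast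
  have "(\<lambda>n. max (padic_abs p (s n)) (padic_abs p (s' n))) \<longlonglongrightarrow> max (padic_norm p x) (padic_norm p y)"
    using s s' by (auto intro!: tendsto_max padic_norm_tendsto[OF assms(1)])
  moreover have "(\<lambda>n. padic_abs p (s n + s' n)) \<longlonglongrightarrow> padic_norm p (x \<oplus>\<^bsub>Qp p\<^esub> y)"
    using s s' by (simp add: padic_class_add assms padic_norm_tendsto padic_Cauchy_add)
  ultimately show ?thesis using padic_abs_add[OF assms(1)] by (intro LIMSEQ_le) auto
qed

lemma padic_norm_zero: "prime p \<Longrightarrow> padic_norm p \<zero>\<^bsub>Qp p\<^esub> = 0"
  using padic_norm_tendsto[OF _ padic_Cauchy_const[of 0]] by (simp add: padic_class_zero LIMSEQ_const_iff)

lemma padic_norm_eq_0: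
  assumes "prime p" "x \<in> carrier (Qp p)" "padic_norm p x = 0" shows "x = \<zero>\<^bsub>Qp p\<^esub>"
proof -
  interpret C: ideal "padic_null p" "padic_Cauchy_ring p" by (rule padic_null_ideal[OF assms(1)])
  obtain s where s: "s \<in> padic_Cauchy p" "x = padic_class p s" using Qp_cases assms by blast
  then have "s \<in> padic_null p"
    using padic_norm_tendsto[OF assms(1) s(1)] assms(3) by (simp add: padic_null_def)
  then show ?thesis using s C.a_rcos_zero unfolding padic_class_def Qp_def
    by (simp add: FactRing_def C.a_rcos_const)
qed

lemma padic_norm_of_nat:
  assumes "prime p" shows "padic_norm p ([n] \<cdot>\<^bsub>Qp p\<^esub> \<one>\<^bsub>Qp p\<^esub>) = padic_abs p (of_nat n)"
proof -
  interpret Qp: cring "Qp p" by (rule Qp_cring[OF assms])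
  have "[n] \<cdot>\<^bsub>Qp p\<^esub> \<one>\<^bsub>Qp p\<^esub> = padic_class p (\<lambda>_. of_nat n)"
  proof (induction n)
    case 0
    show ?case by (simp add: padic_class_zero assms)
  next
    case (Suc n)
    then show ?case
      by (simp add: padic_class_add assms padic_class_one padic_Cauchy_const add.commute)
  qed
  then show ?thesis using padic_norm_tendsto[OF assms padic_Cauchy_const]
    by (simp add: LIMSEQ_const_iff)
qed

text \<open>The norm of \<open>-1\<close> is a nonnegative real with square \<open>1\<close>.\<close>

lemma padic_norm_minus:
  assumes "prime p" "x \<in> carrier (Qp p)" shows "padic_norm p (\<ominus>\<^bsub>Qp p\<^esub> x) = padic_norm p x"
proof -
  interpret Qp: cring "Qp p" by (rule Qp_cring[OF assms(1)])
  have le: "padic_norm p (\<ominus>\<^bsub>Qp p\<^esub> \<one>\<^bsub>Qp p\<^esub>) = 1"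
  proof -
    have "padic_norm p (\<ominus>\<^bsub>Qp p\<^esub> \<one>\<^bsub>Qp p\<^esub>) * padic_norm p (\<ominus>\<^bsub>Qp p\<^esub> \<one>\<^bsub>Qp p\<^esub>)
        = padic_norm p \<one>\<^bsub>Qp p\<^esub>"
      by (subst padic_norm_mult[symmetric]) (auto simp: assms Qp.l_minus)
    also have "\<dots> = 1" using padic_norm_of_nat[OF assms(1), of 1] by simp
    finally have "padic_norm p (\<ominus>\<^bsub>Qp p\<^esub> \<one>\<^bsub>Qp p\<^esub>) ^ 2 = 1" by (simp add: power2_eq_square)
    then show ?thesis using padic_norm_nonneg[OF assms(1), of "\<ominus>\<^bsub>Qp p\<^esub> \<one>\<^bsub>Qp p\<^esub>"]
      by (simp add: power2_eq_1_iff)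
  qed
  have "\<ominus>\<^bsub>Qp p\<^esub> x = (\<ominus>\<^bsub>Qp p\<^esub> \<one>\<^bsub>Qp p\<^esub>) \<otimes>\<^bsub>Qp p\<^esub> x" using assms by (simp add: Qp.l_minus)
  then show ?thesis using padic_norm_mult[OF assms(1)] assms le by simp
qed

lemma padic_norm_diff:
  assumes "prime p" "x \<in> carrier (Qp p)" "y \<in> carrier (Qp p)"
  shows "padic_norm p (x \<ominus>\<^bsub>Qp p\<^esub> y) \<le> max (padic_norm p x) (padic_norm p y)"
proof -
  interpret Qp: cring "Qp p" by (rule Qp_cring[OF assms(1)])
  show ?thesis unfolding a_minus_def
    using padic_norm_add[OF assms(1,2) Qp.a_inv_closed[OF assms(3)]] padic_norm_minus assms by simp
qed

section \<open>Power series and torsion in p-adic analytic groups\<close>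

text \<open>Closed balls around zero are closed subgroups, by the ultrametric inequality.\<close>

lemma padic_has_sum_norm_le:
  assumes p: "prime p" and f: "f \<in> I \<rightarrow> carrier (Qp p)" and s: "padic_has_sum p f I s"
    and B: "\<And>i. i \<in> I \<Longrightarrow> padic_norm p (f i) \<le> B" "B \<ge> 0"
  shows "padic_norm p s \<le> B"
proof (rule field_le_epsilon)
  interpret Qp: cring "Qp p" by (rule Qp_cring[OF p])
  fix \<epsilon> :: real assume \<epsilon>: "\<epsilon> > 0"
  have sc: "s \<in> carrier (Qp p)" using s by (simp add: padic_has_sum_def)
  obtain E where E: "finite E" "E \<subseteq> I"
      "padic_norm p ((\<Oplus>\<^bsub>Qp p\<^esub>i\<in>E. f i) \<ominus>\<^bsub>Qp p\<^esub> s) < \<epsilon>"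
    using s \<epsilon> unfolding padic_has_sum_def by blast
  have fin: "padic_norm p (\<Oplus>\<^bsub>Qp p\<^esub>i\<in>F. f i) \<le> B" if "finite F" "F \<subseteq> I" for F
    using that
  proof (induction F rule: finite_induct)
    case (insert x F)
    then have "f x \<in> carrier (Qp p)" "f \<in> F \<rightarrow> carrier (Qp p)" using f by auto
    then show ?case using insert B(1)[of x] padic_norm_add[OF p, of "f x" "\<Oplus>\<^bsub>Qp p\<^esub>i\<in>F. f i"]
      by (simp add: Qp.finsum_insert)
  qed (simp add: padic_norm_zero p B)
  let ?S = "\<Oplus>\<^bsub>Qp p\<^esub>i\<in>E. f i"
  have Sc: "?S \<in> carrier (Qp p)" using f E by (intro Qp.finsum_closed) auto
  have "s = ?S \<ominus>\<^bsub>Qp p\<^esub> (?S \<ominus>\<^bsub>Qp p\<^esub> s)" using Sc sc by algebra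
  then have "padic_norm p s \<le> max (padic_norm p ?S) (padic_norm p (?S \<ominus>\<^bsub>Qp p\<^esub> s))"
    using padic_norm_diff[OF p Sc Qp.minus_closed[OF Sc sc]] by simp
  then show "padic_norm p s \<le> B + \<epsilon>" using fin[OF E(1,2)] E(3) B(2) \<epsilon> by linarith
qed

lemma padic_has_sum_diff:
  assumes p: "prime p" and f: "f \<in> I \<rightarrow> carrier (Qp p)" and g: "g \<in> I \<rightarrow> carrier (Qp p)"
    and s: "padic_has_sum p f I s" and t: "padic_has_sum p g I t"
  shows "padic_has_sum p (\<lambda>i. f i \<ominus>\<^bsub>Qp p\<^esub> g i) I (s \<ominus>\<^bsub>Qp p\<^esub> t)"
  unfolding padic_has_sum_def
proof (intro conjI allI impI)
  interpret Qp: cring "Qp p" by (rule Qp_cring[OF p])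
  have c: "s \<in> carrier (Qp p)" "t \<in> carrier (Qp p)" using s t by (auto simp: padic_has_sum_def)
  then show "s \<ominus>\<^bsub>Qp p\<^esub> t \<in> carrier (Qp p)" by simp
  fix \<epsilon> :: real assume \<epsilon>: "\<epsilon> > 0"
  obtain E where E: "finite E" "E \<subseteq> I" "\<And>F. finite F \<Longrightarrow> E \<subseteq> F \<Longrightarrow> F \<subseteq> I \<Longrightarrow>
      padic_norm p ((\<Oplus>\<^bsub>Qp p\<^esub>i\<in>F. f i) \<ominus>\<^bsub>Qp p\<^esub> s) < \<epsilon>"
    using s \<epsilon> unfolding padic_has_sum_def by meson
  obtain E' where E': "finite E'" "E' \<subseteq> I" "\<And>F. finite F \<Longrightarrow> E' \<subseteq> F \<Longrightarrow> F \<subseteq> I \<Longrightarrow>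
      padic_norm p ((\<Oplus>\<^bsub>Qp p\<^esub>i\<in>F. g i) \<ominus>\<^bsub>Qp p\<^esub> t) < \<epsilon>"
    using t \<epsilon> unfolding padic_has_sum_def by meson
  have "padic_norm p ((\<Oplus>\<^bsub>Qp p\<^esub>i\<in>F. f i \<ominus>\<^bsub>Qp p\<^esub> g i) \<ominus>\<^bsub>Qp p\<^esub> (s \<ominus>\<^bsub>Qp p\<^esub> t)) < \<epsilon>"
    if F: "finite F" "E \<union> E' \<subseteq> F" "F \<subseteq> I" for F
  proof -
    have fg: "f \<in> F \<rightarrow> carrier (Qp p)" "g \<in> F \<rightarrow> carrier (Qp p)" using f g F by auto
    let ?f = "\<Oplus>\<^bsub>Qp p\<^esub>i\<in>F. f i" and ?g = "\<Oplus>\<^bsub>Qp p\<^esub>i\<in>F. g i"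
    have fgc: "?f \<in> carrier (Qp p)" "?g \<in> carrier (Qp p)" using fg by auto
    have "(\<Oplus>\<^bsub>Qp p\<^esub>i\<in>F. f i \<ominus>\<^bsub>Qp p\<^esub> g i) = ?f \<ominus>\<^bsub>Qp p\<^esub> ?g"
      using F(1) fg
    proof (induction F rule: finite_induct)
      case (insert x F)
      then have c: "f x \<in> carrier (Qp p)" "g x \<in> carrier (Qp p)"
          "f \<in> F \<rightarrow> carrier (Qp p)" "g \<in> F \<rightarrow> carrier (Qp p)" by auto
      then have "finsum (Qp p) f F \<in> carrier (Qp p)" "finsum (Qp p) g F \<in> carrier (Qp p)" by auto
      moreover have "(\<lambda>i. f i \<ominus>\<^bsub>Qp p\<^esub> g i) \<in> F \<rightarrow> carrier (Qp p)" using c by auto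
      ultimately have "(\<Oplus>\<^bsub>Qp p\<^esub>i\<in>insert x F. f i \<ominus>\<^bsub>Qp p\<^esub> g i)
          = f x \<ominus>\<^bsub>Qp p\<^esub> g x \<oplus>\<^bsub>Qp p\<^esub> (finsum (Qp p) f F \<ominus>\<^bsub>Qp p\<^esub> finsum (Qp p) g F)"
        using insert c by (simp add: Qp.finsum_insert)
      also have "\<dots> = f x \<oplus>\<^bsub>Qp p\<^esub> finsum (Qp p) f F \<ominus>\<^bsub>Qp p\<^esub> (g x \<oplus>\<^bsub>Qp p\<^esub> finsum (Qp p) g F)"
        using c \<open>finsum (Qp p) f F \<in> _\<close> \<open>finsum (Qp p) g F \<in> _\<close> by algebra
      also have "\<dots> = finsum (Qp p) f (insert x F) \<ominus>\<^bsub>Qp p\<^esub> finsum (Qp p) g (insert x F)"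
        using insert c by (simp add: Qp.finsum_insert)
      finally show ?case .
    qed (simp add: Qp.r_neg a_minus_def)
    then have "(\<Oplus>\<^bsub>Qp p\<^esub>i\<in>F. f i \<ominus>\<^bsub>Qp p\<^esub> g i) \<ominus>\<^bsub>Qp p\<^esub> (s \<ominus>\<^bsub>Qp p\<^esub> t)
        = (?f \<ominus>\<^bsub>Qp p\<^esub> s) \<ominus>\<^bsub>Qp p\<^esub> (?g \<ominus>\<^bsub>Qp p\<^esub> t)" using fgc c by simp algebra
    then show ?thesis using padic_norm_diff[OF p, of "?f \<ominus>\<^bsub>Qp p\<^esub> s" "?g \<ominus>\<^bsub>Qp p\<^esub> t"]
      E(3)[of F] E'(3)[of F] F fgc c by force
  qed
  then show "\<exists>E. finite E \<and> E \<subseteq> I \<and> (\<forall>F. finite F \<and> E \<subseteq> F \<and> F \<subseteq> I \<longrightarrow>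
      padic_norm p ((\<Oplus>\<^bsub>Qp p\<^esub>i\<in>F. f i \<ominus>\<^bsub>Qp p\<^esub> g i) \<ominus>\<^bsub>Qp p\<^esub> (s \<ominus>\<^bsub>Qp p\<^esub> t)) < \<epsilon>)"
    using E(1,2) E'(1,2) by (intro exI[of _ "E \<union> E'"]) auto
qed

text \<open>Outside a finite set of indices a term is the difference of two partial sums near \<open>s\<close>.\<close>

lemma padic_has_sum_bounded:
  assumes p: "prime p" and f: "f \<in> I \<rightarrow> carrier (Qp p)" and s: "padic_has_sum p f I s"
  obtains B where "B \<ge> 0" "\<And>i. i \<in> I \<Longrightarrow> padic_norm p (f i) \<le> B"
proof -
  interpret Qp: cring "Qp p" by (rule Qp_cring[OF p])
  have sc: "s \<in> carrier (Qp p)" using s by (simp add: padic_has_sum_def)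
  obtain E where E: "finite E" "E \<subseteq> I" "\<And>F. finite F \<Longrightarrow> E \<subseteq> F \<Longrightarrow> F \<subseteq> I \<Longrightarrow>
      padic_norm p ((\<Oplus>\<^bsub>Qp p\<^esub>i\<in>F. f i) \<ominus>\<^bsub>Qp p\<^esub> s) < 1"
    using s zero_less_one unfolding padic_has_sum_def by meson
  define B where "B = 1 + (\<Sum>i\<in>E. padic_norm p (f i))"
  have nn: "padic_norm p (f i) \<ge> 0" if "i \<in> E" for i
    using f E that by (intro padic_norm_nonneg[OF p]) auto
  have "padic_norm p (f i) \<le> B" if i: "i \<in> I" for i
  proof (cases "i \<in> E")
    case True
    then have "padic_norm p (f i) \<le> (\<Sum>i\<in>E. padic_norm p (f i))"
      using nn E(1) by (intro member_le_sum) auto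
    then show ?thesis by (simp add: B_def)
  next
    case False
    let ?S = "\<Oplus>\<^bsub>Qp p\<^esub>i\<in>E. f i"
    have c: "?S \<in> carrier (Qp p)" "f i \<in> carrier (Qp p)" "f \<in> E \<rightarrow> carrier (Qp p)"
      using f E i by (auto intro!: Qp.finsum_closed)
    have ins: "(\<Oplus>\<^bsub>Qp p\<^esub>i\<in>insert i E. f i) = f i \<oplus>\<^bsub>Qp p\<^esub> ?S"
      using c E False by (intro Qp.finsum_insert) auto
    have "f i = ((f i \<oplus>\<^bsub>Qp p\<^esub> ?S) \<ominus>\<^bsub>Qp p\<^esub> s) \<ominus>\<^bsub>Qp p\<^esub> (?S \<ominus>\<^bsub>Qp p\<^esub> s)"
      using c sc by algebra
    then have "padic_norm p (f i) \<le> max (padic_norm p ((f i \<oplus>\<^bsub>Qp p\<^esub> ?S) \<ominus>\<^bsub>Qp p\<^esub> s))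
        (padic_norm p (?S \<ominus>\<^bsub>Qp p\<^esub> s))"
      using padic_norm_diff[OF p, of "(f i \<oplus>\<^bsub>Qp p\<^esub> ?S) \<ominus>\<^bsub>Qp p\<^esub> s" "?S \<ominus>\<^bsub>Qp p\<^esub> s"] c sc by simp
    also have "\<dots> \<le> 1" using E(3)[of E] E(3)[of "insert i E"] E(1,2) i ins
      by (simp add: subset_insertI less_imp_le)
    also have "\<dots> \<le> B" using nn by (simp add: B_def sum_nonneg)
    finally show ?thesis .
  qed
  moreover have "B \<ge> 0" using nn by (simp add: B_def sum_nonneg add_nonneg_nonneg)
  ultimately show ?thesis using that by blast
qed

lemma padic_norm_one:
  assumes "prime p" shows "padic_norm p \<one>\<^bsub>Qp p\<^esub> = 1"
proof -
  interpret Qp: cring "Qp p" by (rule Qp_cring[OF assms])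
  show ?thesis using padic_norm_of_nat[OF assms, of 1] by simp
qed

lemma padic_norm_pow:
  assumes "prime p" "x \<in> carrier (Qp p)"
  shows "padic_norm p (x [^]\<^bsub>Qp p\<^esub> (n::nat)) = padic_norm p x ^ n"
proof -
  interpret Qp: cring "Qp p" by (rule Qp_cring[OF assms(1)])
  show ?thesis by (induction n) (simp_all add: padic_norm_one padic_norm_mult assms)
qed

lemma padic_norm_prod:
  assumes "prime p" "finite J" "f \<in> J \<rightarrow> carrier (Qp p)"
  shows "padic_norm p (\<Otimes>\<^bsub>Qp p\<^esub>j\<in>J. f j) = (\<Prod>j\<in>J. padic_norm p (f j))"
proof -
  interpret Qp: cring "Qp p" by (rule Qp_cring[OF assms(1)])
  show ?thesis using assms(2,3)
  proof (induction J rule: finite_induct)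
    case (insert x F)
    then have "f x \<in> carrier (Qp p)" "f \<in> F \<rightarrow> carrier (Qp p)" by auto
    then show ?case using insert by (simp add: padic_norm_mult assms)
  qed (simp add: padic_norm_one assms)
qed

lemma padic_small_element:
  assumes "prime p" "r > 0"
  obtains x where "x \<in> carrier (Qp p)" "0 < padic_norm p x" "padic_norm p x < r"
proof -
  interpret Qp: cring "Qp p" by (rule Qp_cring[OF assms(1)])
  have p1: "real p > 1" using prime_gt_1_nat[OF assms(1)] by simp
  then obtain M where M: "(1 / real p) ^ M < r" using real_arch_pow_inv[OF assms(2), of "1 / real p"] by auto
  have "padic_norm p (([p] \<cdot>\<^bsub>Qp p\<^esub> \<one>\<^bsub>Qp p\<^esub>) [^]\<^bsub>Qp p\<^esub> M) = (1 / real p) ^ M"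
    by (simp add: padic_norm_pow assms padic_norm_of_nat padic_abs_prime)
  then show ?thesis using M p1 by (intro that[of "([p] \<cdot>\<^bsub>Qp p\<^esub> \<one>\<^bsub>Qp p\<^esub>) [^]\<^bsub>Qp p\<^esub> M"]) auto
qed

text \<open>A constant monomial cancels. In a nonconstant one every factor is at most \<open>s/\<rho> \<le> 1\<close> times the
  corresponding power of \<open>\<rho>\<close>, and one such factor suffices.\<close>

lemma padic_monomial_diff_bound:
  assumes p: "prime p" and J: "finite J" and w: "\<And>j. j \<in> J \<Longrightarrow> w j \<in> carrier (Qp p)"
    and ws: "\<And>j. j \<in> J \<Longrightarrow> padic_norm p (w j) \<le> s" and s: "0 \<le> s" "s \<le> \<rho>" "0 < \<rho>"
  shows "padic_norm p ((\<Otimes>\<^bsub>Qp p\<^esub>j\<in>J. w j [^]\<^bsub>Qp p\<^esub> (\<alpha> j :: nat)) \<ominus>\<^bsub>Qp p\<^esub>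
            (\<Otimes>\<^bsub>Qp p\<^esub>j\<in>J. \<zero>\<^bsub>Qp p\<^esub> [^]\<^bsub>Qp p\<^esub> \<alpha> j)) \<le> s / \<rho> * \<rho> ^ (\<Sum>j\<in>J. \<alpha> j)" (is "?l \<le> ?r")
proof (cases "\<forall>j\<in>J. \<alpha> j = 0")
  interpret Qp: cring "Qp p" by (rule Qp_cring[OF p])
  case True
  then have "(\<Otimes>\<^bsub>Qp p\<^esub>j\<in>J. w j [^]\<^bsub>Qp p\<^esub> \<alpha> j) = \<one>\<^bsub>Qp p\<^esub>"
      "(\<Otimes>\<^bsub>Qp p\<^esub>j\<in>J. \<zero>\<^bsub>Qp p\<^esub> [^]\<^bsub>Qp p\<^esub> \<alpha> j) = \<one>\<^bsub>Qp p\<^esub>"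
    by (auto intro!: Qp.finprod_one_eqI)
  then have "?l = 0" by (simp add: Qp.r_neg a_minus_def padic_norm_zero p)
  then show ?thesis using s by simp
next
  interpret Qp: cring "Qp p" by (rule Qp_cring[OF p])
  case False
  then obtain j where j: "j \<in> J" "\<alpha> j > 0" by auto
  have c: "(\<Otimes>\<^bsub>Qp p\<^esub>j\<in>J. w j [^]\<^bsub>Qp p\<^esub> \<alpha> j) \<in> carrier (Qp p)"
      "(\<Otimes>\<^bsub>Qp p\<^esub>j\<in>J. \<zero>\<^bsub>Qp p\<^esub> [^]\<^bsub>Qp p\<^esub> \<alpha> j) \<in> carrier (Qp p)"
    using w by (auto intro!: Qp.finprod_closed)
  have "padic_norm p (\<Otimes>\<^bsub>Qp p\<^esub>j\<in>J. \<zero>\<^bsub>Qp p\<^esub> [^]\<^bsub>Qp p\<^esub> \<alpha> j) = (\<Prod>j\<in>J. 0 ^ \<alpha> j)"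
    using J by (simp add: padic_norm_prod p padic_norm_pow padic_norm_zero)
  also have "\<dots> = 0" using J j by (intro prod_zero) auto
  finally have "(\<Otimes>\<^bsub>Qp p\<^esub>j\<in>J. \<zero>\<^bsub>Qp p\<^esub> [^]\<^bsub>Qp p\<^esub> \<alpha> j) = \<zero>\<^bsub>Qp p\<^esub>" using padic_norm_eq_0[OF p c(2)] by simp
  then have "?l = padic_norm p (\<Otimes>\<^bsub>Qp p\<^esub>j\<in>J. w j [^]\<^bsub>Qp p\<^esub> \<alpha> j)"
    using c(1) by (simp add: a_minus_def)
  also have "\<dots> = (\<Prod>j\<in>J. padic_norm p (w j) ^ \<alpha> j)"
    using J w by (simp add: padic_norm_prod p padic_norm_pow Pi_iff)
  also have "\<dots> \<le> (\<Prod>j\<in>J. s ^ \<alpha> j)"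
    using ws w by (intro prod_mono) (auto intro!: power_mono zero_le_power padic_norm_nonneg[OF p])
  also have "\<dots> = s ^ (\<Sum>j\<in>J. \<alpha> j)" by (simp add: power_sum)
  also have "\<dots> = (s / \<rho>) ^ (\<Sum>j\<in>J. \<alpha> j) * \<rho> ^ (\<Sum>j\<in>J. \<alpha> j)" using s by (simp add: power_divide)
  also have "\<dots> \<le> ?r"
  proof (intro mult_right_mono)
    have "\<alpha> j \<le> (\<Sum>j\<in>J. \<alpha> j)" using J j(1) by (intro member_le_sum) auto
    then have "1 \<le> (\<Sum>j\<in>J. \<alpha> j)" using j by linarith
    then show "(s / \<rho>) ^ (\<Sum>j\<in>J. \<alpha> j) \<le> s / \<rho>"
      using s power_decreasing[of 1 "\<Sum>j\<in>J. \<alpha> j" "s / \<rho>"] by simp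
  qed (use s in simp)
  finally show ?thesis .
qed

text \<open>Subtracting from a power series in two groups of variables its values with one group set to
  zero leaves only the mixed monomials, and these are divisible by a variable of either group.\<close>

lemma padic_mixed_difference_bound:
  fixes m n :: nat
  assumes p: "prime p" and r: "r > 0" and c: "\<And>\<alpha>. \<alpha> \<in> {..<m + n} \<rightarrow>\<^sub>E UNIV \<Longrightarrow> c \<alpha> \<in> carrier (Qp p)"
    and sum: "\<And>w. (\<And>j. j < m + n \<Longrightarrow> w j \<in> carrier (Qp p) \<and> padic_norm p (w j) < r) \<Longrightarrow>
      padic_has_sum p (\<lambda>\<alpha>. c \<alpha> \<otimes>\<^bsub>Qp p\<^esub> (\<Otimes>\<^bsub>Qp p\<^esub>j\<in>{..<m + n}. w j [^]\<^bsub>Qp p\<^esub> (\<alpha> j :: nat)))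
        ({..<m + n} \<rightarrow>\<^sub>E UNIV) (\<Phi> w)"
  shows "\<exists>C \<rho>. 0 < C \<and> 0 < \<rho> \<and> \<rho> < r \<and> (\<forall>w s s'. 0 \<le> s \<longrightarrow> s \<le> \<rho> \<longrightarrow> 0 \<le> s' \<longrightarrow> s' \<le> \<rho> \<longrightarrow>
      (\<forall>j<m + n. w j \<in> carrier (Qp p)) \<longrightarrow> (\<forall>j<m. padic_norm p (w j) \<le> s) \<longrightarrow>
      (\<forall>j<m + n. m \<le> j \<longrightarrow> padic_norm p (w j) \<le> s') \<longrightarrow>
      padic_norm p (\<Phi> w \<ominus>\<^bsub>Qp p\<^esub> \<Phi> (\<lambda>j. if j < m then \<zero>\<^bsub>Qp p\<^esub> else w j) \<ominus>\<^bsub>Qp p\<^esub>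
        (\<Phi> (\<lambda>j. if j < m then w j else \<zero>\<^bsub>Qp p\<^esub>) \<ominus>\<^bsub>Qp p\<^esub> \<Phi> (\<lambda>j. \<zero>\<^bsub>Qp p\<^esub>))) \<le> C * s * s')"
proof -
  interpret Qp: cring "Qp p" by (rule Qp_cring[OF p])
  define I :: "(nat \<Rightarrow> nat) set" where "I = {..<m + n} \<rightarrow>\<^sub>E UNIV"
  define f where "f w \<alpha> = c \<alpha> \<otimes>\<^bsub>Qp p\<^esub> (\<Otimes>\<^bsub>Qp p\<^esub>j\<in>{..<m + n}. w j [^]\<^bsub>Qp p\<^esub> (\<alpha> j :: nat))" for w \<alpha>
  have fI: "f w \<in> I \<rightarrow> carrier (Qp p)" if "\<And>j. j < m + n \<Longrightarrow> w j \<in> carrier (Qp p)" for w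
    unfolding f_def I_def using that c by (auto intro!: Qp.m_closed Qp.finprod_closed)
  have fs: "padic_has_sum p (f w) I (\<Phi> w)"
    if "\<And>j. j < m + n \<Longrightarrow> w j \<in> carrier (Qp p) \<and> padic_norm p (w j) < r" for w
    unfolding f_def I_def using sum that by blast
  obtain x where x: "x \<in> carrier (Qp p)" "0 < padic_norm p x" "padic_norm p x < r"
    by (rule padic_small_element[OF p r])
  define \<rho> where "\<rho> = padic_norm p x"
  obtain B where B: "B \<ge> 0" "\<And>\<alpha>. \<alpha> \<in> I \<Longrightarrow> padic_norm p (f (\<lambda>_. x) \<alpha>) \<le> B"
    using padic_has_sum_bounded[OF p fI fs, of "\<lambda>_. x"] x by auto
  have cB: "padic_norm p (c \<alpha>) * \<rho> ^ (\<Sum>j<m + n. \<alpha> j) \<le> B" if "\<alpha> \<in> I" for \<alpha>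
    using B(2)[OF that] c[of \<alpha>] that x
    by (simp add: f_def I_def padic_norm_mult p padic_norm_prod padic_norm_pow \<rho>_def power_sum Pi_iff)
  \<comment> \<open>Adding \<open>1\<close> keeps \<open>C\<close> positive when all coefficients vanish.\<close>
  define C where "C = (B + 1) / \<rho>\<^sup>2"
  have "padic_norm p (\<Phi> w \<ominus>\<^bsub>Qp p\<^esub> \<Phi> (\<lambda>j. if j < m then \<zero>\<^bsub>Qp p\<^esub> else w j) \<ominus>\<^bsub>Qp p\<^esub>
        (\<Phi> (\<lambda>j. if j < m then w j else \<zero>\<^bsub>Qp p\<^esub>) \<ominus>\<^bsub>Qp p\<^esub> \<Phi> (\<lambda>j. \<zero>\<^bsub>Qp p\<^esub>))) \<le> C * s * s'"
    if s: "0 \<le> s" "s \<le> \<rho>" "0 \<le> s'" "s' \<le> \<rho>" and w: "\<And>j. j < m + n \<Longrightarrow> w j \<in> carrier (Qp p)"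
      and ws: "\<And>j. j < m \<Longrightarrow> padic_norm p (w j) \<le> s"
        "\<And>j. j < m + n \<Longrightarrow> m \<le> j \<Longrightarrow> padic_norm p (w j) \<le> s'" for w s s'
  proof -
    define w1 where "w1 = (\<lambda>j. if j < m then \<zero>\<^bsub>Qp p\<^esub> else w j)"
    define w2 where "w2 = (\<lambda>j. if j < m then w j else \<zero>\<^bsub>Qp p\<^esub>)"
    define w0 where "w0 = (\<lambda>j::nat. \<zero>\<^bsub>Qp p\<^esub>)"
    have small: "padic_norm p (w j) < r" if "j < m + n" for j
      using ws[of j] s x(3) that unfolding \<rho>_def by (cases "j < m") force+
    note ok = fI[of w] fI[of w1] fI[of w2] fI[of w0]
    note sums = fs[of w] fs[of w1] fs[of w2] fs[of w0]
    have "padic_has_sum p (\<lambda>\<alpha>. (f w \<alpha> \<ominus>\<^bsub>Qp p\<^esub> f w1 \<alpha>) \<ominus>\<^bsub>Qp p\<^esub> (f w2 \<alpha> \<ominus>\<^bsub>Qp p\<^esub> f w0 \<alpha>)) I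
        ((\<Phi> w \<ominus>\<^bsub>Qp p\<^esub> \<Phi> w1) \<ominus>\<^bsub>Qp p\<^esub> (\<Phi> w2 \<ominus>\<^bsub>Qp p\<^esub> \<Phi> w0))"
      using ok sums w small r
      by (intro padic_has_sum_diff p) (auto simp: w1_def w2_def w0_def padic_norm_zero p Pi_iff)
    moreover have "padic_norm p ((f w \<alpha> \<ominus>\<^bsub>Qp p\<^esub> f w1 \<alpha>) \<ominus>\<^bsub>Qp p\<^esub> (f w2 \<alpha> \<ominus>\<^bsub>Qp p\<^esub> f w0 \<alpha>)) \<le> C * s * s'"
      if \<alpha>: "\<alpha> \<in> I" for \<alpha>
    proof -
      define M where "M J v = (\<Otimes>\<^bsub>Qp p\<^esub>j\<in>J. v j [^]\<^bsub>Qp p\<^esub> \<alpha> j)" for J v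
      have split: "f v \<alpha> = c \<alpha> \<otimes>\<^bsub>Qp p\<^esub> (M {..<m} v \<otimes>\<^bsub>Qp p\<^esub> M {m..<m + n} v)"
        if "\<And>j. j < m + n \<Longrightarrow> v j \<in> carrier (Qp p)" for v
      proof -
        have "{..<m + n} = {..<m} \<union> {m..<m + n}" by auto
        then show ?thesis unfolding f_def M_def using that
          by (simp only:) (subst Qp.finprod_Un_disjoint, auto)
      qed
      have cong: "M {..<m} w1 = M {..<m} w0" "M {..<m} w2 = M {..<m} w"
          "M {m..<m + n} w1 = M {m..<m + n} w" "M {m..<m + n} w2 = M {m..<m + n} w0"
        unfolding M_def by (rule Qp.finprod_cong'; use w in \<open>force simp: w1_def w2_def w0_def\<close>)+
      have Mc: "M {..<m} w \<in> carrier (Qp p)" "M {m..<m + n} w \<in> carrier (Qp p)"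
          "M {..<m} w0 \<in> carrier (Qp p)" "M {m..<m + n} w0 \<in> carrier (Qp p)"
        unfolding M_def using w by (auto intro!: Qp.finprod_closed simp: w0_def)
      have ca: "c \<alpha> \<in> carrier (Qp p)" using c \<alpha> by (simp add: I_def)
      let ?P = "M {..<m} w \<ominus>\<^bsub>Qp p\<^esub> M {..<m} w0" and ?Q = "M {m..<m + n} w \<ominus>\<^bsub>Qp p\<^esub> M {m..<m + n} w0"
      have "(f w \<alpha> \<ominus>\<^bsub>Qp p\<^esub> f w1 \<alpha>) \<ominus>\<^bsub>Qp p\<^esub> (f w2 \<alpha> \<ominus>\<^bsub>Qp p\<^esub> f w0 \<alpha>)
          = c \<alpha> \<otimes>\<^bsub>Qp p\<^esub> (?P \<otimes>\<^bsub>Qp p\<^esub> ?Q)"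
      proof -
        have "f w1 \<alpha> = c \<alpha> \<otimes>\<^bsub>Qp p\<^esub> (M {..<m} w0 \<otimes>\<^bsub>Qp p\<^esub> M {m..<m + n} w)"
            "f w2 \<alpha> = c \<alpha> \<otimes>\<^bsub>Qp p\<^esub> (M {..<m} w \<otimes>\<^bsub>Qp p\<^esub> M {m..<m + n} w0)"
            "f w0 \<alpha> = c \<alpha> \<otimes>\<^bsub>Qp p\<^esub> (M {..<m} w0 \<otimes>\<^bsub>Qp p\<^esub> M {m..<m + n} w0)"
            "f w \<alpha> = c \<alpha> \<otimes>\<^bsub>Qp p\<^esub> (M {..<m} w \<otimes>\<^bsub>Qp p\<^esub> M {m..<m + n} w)"
          using split[of w1] split[of w2] split[of w0] split[of w] w
          by (auto simp: cong) (auto simp: w1_def w2_def w0_def)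
        then show ?thesis using ca Mc by simp algebra
      qed
      then have "padic_norm p ((f w \<alpha> \<ominus>\<^bsub>Qp p\<^esub> f w1 \<alpha>) \<ominus>\<^bsub>Qp p\<^esub> (f w2 \<alpha> \<ominus>\<^bsub>Qp p\<^esub> f w0 \<alpha>))
          = padic_norm p (c \<alpha>) * (padic_norm p ?P * padic_norm p ?Q)"
        using ca Mc by (simp add: padic_norm_mult p)
      also have "\<dots> \<le> padic_norm p (c \<alpha>) * ((s / \<rho> * \<rho> ^ (\<Sum>j<m. \<alpha> j)) * (s' / \<rho> * \<rho> ^ (\<Sum>j=m..<m + n. \<alpha> j)))"
      proof (intro mult_left_mono mult_mono)
        show "padic_norm p ?P \<le> s / \<rho> * \<rho> ^ (\<Sum>j<m. \<alpha> j)"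
          unfolding M_def w0_def using w ws s x by (intro padic_monomial_diff_bound p) (auto simp: \<rho>_def)
        show "padic_norm p ?Q \<le> s' / \<rho> * \<rho> ^ (\<Sum>j=m..<m + n. \<alpha> j)"
          unfolding M_def w0_def using w ws s x by (intro padic_monomial_diff_bound p) (auto simp: \<rho>_def)
      qed (use s x ca Mc in \<open>auto simp: \<rho>_def intro!: padic_norm_nonneg p\<close>)
      also have "\<dots> = (padic_norm p (c \<alpha>) * \<rho> ^ (\<Sum>j<m + n. \<alpha> j)) * (s * s' / \<rho>\<^sup>2)"
      proof -
        have "(\<Sum>j<m + n. \<alpha> j) = (\<Sum>j<m. \<alpha> j) + (\<Sum>j=m..<m + n. \<alpha> j)"
          using sum.atLeastLessThan_concat[of 0 m "m + n" \<alpha>] by (simp add: lessThan_atLeast0)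
        then show ?thesis by (simp add: power_add power2_eq_square)
      qed
      also have "\<dots> \<le> B * (s * s' / \<rho>\<^sup>2)" using cB[OF \<alpha>] s by (intro mult_right_mono) auto
      also have "\<dots> \<le> (B + 1) * (s * s' / \<rho>\<^sup>2)" using s by (intro mult_right_mono) auto
      finally show ?thesis by (simp add: C_def)
    qed
    moreover have "C \<ge> 0" using B x by (simp add: C_def)
    moreover have "(\<lambda>\<alpha>. (f w \<alpha> \<ominus>\<^bsub>Qp p\<^esub> f w1 \<alpha>) \<ominus>\<^bsub>Qp p\<^esub> (f w2 \<alpha> \<ominus>\<^bsub>Qp p\<^esub> f w0 \<alpha>)) \<in> I \<rightarrow> carrier (Qp p)"
      using ok w by (auto simp: w1_def w2_def w0_def Pi_iff)
    ultimately show ?thesis using s unfolding w1_def w2_def w0_def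
      by (elim padic_has_sum_norm_le[OF p, rotated]) auto
  qed
  moreover have "C > 0" "\<rho> > 0" "\<rho> < r" using B x by (auto simp: C_def \<rho>_def)
  ultimately show ?thesis by blast
qed

lemma padic_metric: assumes "prime p" shows "Metric_space (carrier (Qp p)) (padic_dist p)"
proof -
  interpret Qp: cring "Qp p" by (rule Qp_cring[OF assms])
  show ?thesis
  proof
    fix x y
    show "0 \<le> padic_dist p x y" by (simp add: padic_dist_def padic_norm_nonneg assms)
    show "padic_dist p x y = padic_dist p y x"
    proof (cases "x \<in> carrier (Qp p) \<and> y \<in> carrier (Qp p)")
      case True
      then have "y \<ominus>\<^bsub>Qp p\<^esub> x = \<ominus>\<^bsub>Qp p\<^esub> (x \<ominus>\<^bsub>Qp p\<^esub> y)" by algebra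
      then show ?thesis using True padic_norm_minus[OF assms, of "x \<ominus>\<^bsub>Qp p\<^esub> y"]
        by (simp add: padic_dist_def)
    qed (auto simp: padic_dist_def)
    assume xy: "x \<in> carrier (Qp p)" "y \<in> carrier (Qp p)"
    show "(padic_dist p x y = 0) = (x = y)"
    proof
      assume "padic_dist p x y = 0"
      then have "x \<ominus>\<^bsub>Qp p\<^esub> y = \<zero>\<^bsub>Qp p\<^esub>"
        using xy padic_norm_eq_0[OF assms, of "x \<ominus>\<^bsub>Qp p\<^esub> y"] by (simp add: padic_dist_def)
      then show "x = y" using xy by simp
    next
      assume "x = y"
      then have "x \<ominus>\<^bsub>Qp p\<^esub> y = \<zero>\<^bsub>Qp p\<^esub>" using xy by simp
      then show "padic_dist p x y = 0" using xy padic_norm_zero[OF assms]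
        by (simp add: padic_dist_def del: Qp.r_right_minus_eq)
    qed
    fix z assume z: "z \<in> carrier (Qp p)"
    have "x \<ominus>\<^bsub>Qp p\<^esub> z = (x \<ominus>\<^bsub>Qp p\<^esub> y) \<oplus>\<^bsub>Qp p\<^esub> (y \<ominus>\<^bsub>Qp p\<^esub> z)" using xy z by algebra
    then show "padic_dist p x z \<le> padic_dist p x y + padic_dist p y z"
      using xy z padic_norm_add[OF assms, of "x \<ominus>\<^bsub>Qp p\<^esub> y" "y \<ominus>\<^bsub>Qp p\<^esub> z"]
        padic_norm_nonneg[OF assms, of "x \<ominus>\<^bsub>Qp p\<^esub> y"] padic_norm_nonneg[OF assms, of "y \<ominus>\<^bsub>Qp p\<^esub> z"]
      by (simp add: padic_dist_def)
  qed
qed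

lemma topspace_padic_topology:
  assumes "prime p" shows "topspace (padic_topology p n) = padic_space p n"
  using Metric_space.topspace_mtopology[OF padic_metric[OF assms]]
  by (simp add: padic_topology_def padic_space_def)

lemma openin_padic_ball:
  assumes p: "prime p" and a: "a \<in> padic_space p n" shows "openin (padic_topology p n) (padic_ball p n a r)"
proof -
  interpret Qp: cring "Qp p" by (rule Qp_cring[OF p])
  interpret M: Metric_space "carrier (Qp p)" "padic_dist p" by (rule padic_metric[OF p])
  have "padic_ball p n a r = (\<Pi>\<^sub>E i\<in>{..<n}. M.mball (a i) r)"
  proof (rule subset_antisym; rule subsetI)
    fix x assume x: "x \<in> padic_ball p n a r"
    then have "x i \<in> M.mball (a i) r" if "i < n" for i
      using that a M.commute[of "a i" "x i"]
      by (auto simp: padic_ball_def padic_space_def M.mball_def padic_dist_def PiE_iff)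
    then show "x \<in> (\<Pi>\<^sub>E i\<in>{..<n}. M.mball (a i) r)"
      using x by (auto simp: padic_ball_def padic_space_def PiE_iff)
  next
    fix x assume x: "x \<in> (\<Pi>\<^sub>E i\<in>{..<n}. M.mball (a i) r)"
    then have *: "x i \<in> M.mball (a i) r" if "i < n" for i using that by auto
    then have xc: "x i \<in> carrier (Qp p)" if "i < n" for i using that by (auto simp: M.mball_def)
    have "padic_norm p (x i \<ominus>\<^bsub>Qp p\<^esub> a i) < r" if "i < n" for i
      using *[OF that] M.commute[of "a i" "x i"] by (auto simp: M.mball_def padic_dist_def)
    then show "x \<in> padic_ball p n a r"
      using x xc by (auto simp: padic_ball_def padic_space_def PiE_iff)
  qed
  then show ?thesis unfolding padic_topology_def by (simp add: openin_PiE)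
qed

text \<open>In a chart at the identity the product is the sum up to a bilinear error: the product of the
  chart with itself is given by power series whose pure parts are fixed by \<open>g \<cdot> 1 = 1 \<cdot> g = g\<close>.\<close>

lemma padic_chart_at_identity:
  assumes p: "prime p" and an: "padic_analytic_group p G T"
  obtains U \<phi> n C \<rho> where "openin T U" "\<one>\<^bsub>G\<^esub> \<in> U" "inj_on \<phi> U" "\<phi> ` U \<subseteq> padic_space p n"
    "C > 0 \<and> \<rho> > 0"
    "\<And>\<epsilon>. openin T {g \<in> U. \<forall>i<n. padic_norm p (\<phi> g i \<ominus>\<^bsub>Qp p\<^esub> \<phi> \<one>\<^bsub>G\<^esub> i) < \<epsilon>}"
    "\<forall>g\<in>U. \<forall>h\<in>U. \<forall>s s'. 0 \<le> s \<longrightarrow> s \<le> \<rho> \<longrightarrow> 0 \<le> s' \<longrightarrow> s' \<le> \<rho> \<longrightarrow>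
      (\<forall>i<n. padic_norm p (\<phi> g i \<ominus>\<^bsub>Qp p\<^esub> \<phi> \<one>\<^bsub>G\<^esub> i) \<le> s) \<longrightarrow>
      (\<forall>i<n. padic_norm p (\<phi> h i \<ominus>\<^bsub>Qp p\<^esub> \<phi> \<one>\<^bsub>G\<^esub> i) \<le> s') \<longrightarrow>
      g \<otimes>\<^bsub>G\<^esub> h \<in> U \<and> (\<forall>i<n. padic_norm p ((\<phi> (g \<otimes>\<^bsub>G\<^esub> h) i \<ominus>\<^bsub>Qp p\<^esub> \<phi> h i) \<ominus>\<^bsub>Qp p\<^esub>
        (\<phi> g i \<ominus>\<^bsub>Qp p\<^esub> \<phi> \<one>\<^bsub>G\<^esub> i)) \<le> C * s * s')"
proof -
  interpret Qp: cring "Qp p" by (rule Qp_cring[OF p])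
  have tg: "topological_group G T" using an by (simp add: padic_analytic_group_def)
  interpret G: group G using tg by (simp add: topological_group_def)
  have top: "topspace T = carrier G" using tg by (simp add: topological_group_def)
  obtain \<A> where \<A>: "padic_atlas p T \<A>" "padic_analytic_mult p G \<A>"
    using an by (auto simp: padic_analytic_group_def)
  have "\<one>\<^bsub>G\<^esub> \<in> (\<Union>(U, \<phi>, n)\<in>\<A>. U)" using \<A>(1) top by (simp add: padic_atlas_def)
  then obtain U \<phi> n where ch: "(U, \<phi>, n) \<in> \<A>" and U1: "\<one>\<^bsub>G\<^esub> \<in> U" by auto
  have UT: "openin T U" and Uo: "openin (padic_topology p n) (\<phi> ` U)"
    and hom: "homeomorphic_map (subtopology T U) (subtopology (padic_topology p n) (\<phi> ` U)) \<phi>"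
    using \<A>(1) ch unfolding padic_atlas_def by auto
  have UG: "U \<subseteq> carrier G" using openin_subset[OF UT] top by simp
  have tsU: "topspace (subtopology T U) = U" using openin_subset[OF UT] by auto
  have inj: "inj_on \<phi> U" using homeomorphic_imp_injective_map[OF hom] tsU by simp
  have \<phi>U: "\<phi> ` U \<subseteq> padic_space p n" using openin_subset[OF Uo] topspace_padic_topology[OF p] by simp
  define a where "a = \<phi> \<one>\<^bsub>G\<^esub>"
  have a: "a \<in> padic_space p n" using \<phi>U U1 by (auto simp: a_def)
  have \<phi>c: "\<phi> g i \<in> carrier (Qp p)" if "g \<in> U" "i < n" for g i
    using that \<phi>U by (auto simp: padic_space_def PiE_iff)
  have open_ball: "openin T {g \<in> U. \<forall>i<n. padic_norm p (\<phi> g i \<ominus>\<^bsub>Qp p\<^esub> a i) < \<epsilon>}" for \<epsilon>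
  proof -
    have "continuous_map (subtopology T U) (padic_topology p n) \<phi>"
      using homeomorphic_imp_continuous_map[OF hom] continuous_map_in_subtopology by blast
    then have "openin (subtopology T U) {g \<in> topspace (subtopology T U). \<phi> g \<in> padic_ball p n a \<epsilon>}"
      using openin_padic_ball[OF p a] openin_continuous_map_preimage by blast
    moreover have "{g \<in> topspace (subtopology T U). \<phi> g \<in> padic_ball p n a \<epsilon>}
        = {g \<in> U. \<forall>i<n. padic_norm p (\<phi> g i \<ominus>\<^bsub>Qp p\<^esub> a i) < \<epsilon>}"
      using \<phi>U tsU by (auto simp: padic_ball_def)
    ultimately have "openin (subtopology T U) {g \<in> U. \<forall>i<n. padic_norm p (\<phi> g i \<ominus>\<^bsub>Qp p\<^esub> a i) < \<epsilon>}"
      by simp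
    then show ?thesis by (rule openin_trans_full[OF _ UT])
  qed
  \<comment> \<open>\<open>pr g h\<close> is the point with the coordinates of \<open>g\<close> followed by those of \<open>h\<close>.\<close>
  define pr where "pr g h = (\<lambda>j\<in>{..<n + n}. if j < n then \<phi> g j else \<phi> h (j - n))" for g h
  define x where "x z = inv_into U \<phi> (restrict z {..<n})" for z
  define y where "y z = inv_into U \<phi> (\<lambda>j\<in>{..<n}. z (n + j))" for z
  define V where "V = {z \<in> padic_space p (n + n). restrict z {..<n} \<in> \<phi> ` U \<and>
                (\<lambda>j\<in>{..<n}. z (n + j)) \<in> \<phi> ` U \<and> x z \<otimes>\<^bsub>G\<^esub> y z \<in> U}"
  have anV: "padic_analytic_on p (n + n) n V (\<lambda>z. \<phi> (x z \<otimes>\<^bsub>G\<^esub> y z))"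
    using \<A>(2) ch unfolding padic_analytic_mult_def Let_def V_def x_def y_def by fast
  have prs: "pr g h \<in> padic_space p (n + n)" "restrict (pr g h) {..<n} = \<phi> g"
      "(\<lambda>j\<in>{..<n}. pr g h (n + j)) = \<phi> h" "x (pr g h) = g" "y (pr g h) = h" if "g \<in> U" "h \<in> U" for g h
  proof -
    have ext: "\<phi> g \<in> extensional {..<n}" "\<phi> h \<in> extensional {..<n}"
      using that \<phi>U by (auto simp: padic_space_def PiE_iff)
    show "pr g h \<in> padic_space p (n + n)" using \<phi>c that by (auto simp: pr_def padic_space_def)
    show 1: "restrict (pr g h) {..<n} = \<phi> g"
      using ext by (intro extensionalityI[of _ "{..<n}"]) (auto simp: pr_def)
    show 2: "(\<lambda>j\<in>{..<n}. pr g h (n + j)) = \<phi> h"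
      using ext by (intro extensionalityI[of _ "{..<n}"]) (auto simp: pr_def)
    show "x (pr g h) = g" "y (pr g h) = h" unfolding x_def y_def 1 2 using inj that by auto
  qed
  have prV: "pr g h \<in> V \<longleftrightarrow> g \<otimes>\<^bsub>G\<^esub> h \<in> U" if "g \<in> U" "h \<in> U" for g h
    using prs[OF that] that by (simp add: V_def)
  define a2 where "a2 = pr \<one>\<^bsub>G\<^esub> \<one>\<^bsub>G\<^esub>"
  have a2V: "a2 \<in> V" unfolding a2_def using prV[OF U1 U1] U1 by simp
  have a2c: "a2 j \<in> carrier (Qp p)" if "j < n + n" for j
    using prs(1)[OF U1 U1] that by (auto simp: a2_def padic_space_def PiE_iff)
  define Y where "Y g i = \<phi> g i \<ominus>\<^bsub>Qp p\<^esub> a i" for g i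
  define ok where "ok i C \<rho> \<longleftrightarrow> (\<forall>g\<in>U. \<forall>h\<in>U. \<forall>s s'. 0 \<le> s \<longrightarrow> s \<le> \<rho> \<longrightarrow> 0 \<le> s' \<longrightarrow> s' \<le> \<rho> \<longrightarrow>
      (\<forall>i<n. padic_norm p (Y g i) \<le> s) \<longrightarrow> (\<forall>i<n. padic_norm p (Y h i) \<le> s') \<longrightarrow>
      g \<otimes>\<^bsub>G\<^esub> h \<in> U \<and> padic_norm p ((\<phi> (g \<otimes>\<^bsub>G\<^esub> h) i \<ominus>\<^bsub>Qp p\<^esub> \<phi> h i) \<ominus>\<^bsub>Qp p\<^esub>
        (\<phi> g i \<ominus>\<^bsub>Qp p\<^esub> a i)) \<le> C * s * s')" for i and C \<rho> :: real
  have "\<exists>C \<rho>. 0 < C \<and> 0 < \<rho> \<and> ok i C \<rho>" if i: "i < n" for i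
  proof -
    obtain r c where r: "r > 0" and c: "\<And>\<alpha>. \<alpha> \<in> {..<n + n} \<rightarrow>\<^sub>E UNIV \<Longrightarrow> c \<alpha> \<in> carrier (Qp p)"
      and ball: "padic_ball p (n + n) a2 r \<subseteq> V"
      and hs: "\<And>z. z \<in> padic_ball p (n + n) a2 r \<Longrightarrow> padic_has_sum p
             (\<lambda>\<alpha>. c \<alpha> \<otimes>\<^bsub>Qp p\<^esub> (\<Otimes>\<^bsub>Qp p\<^esub>j\<in>{..<n + n}. (z j \<ominus>\<^bsub>Qp p\<^esub> a2 j) [^]\<^bsub>Qp p\<^esub> (\<alpha> j :: nat)))
             ({..<n + n} \<rightarrow>\<^sub>E UNIV) (\<phi> (x z \<otimes>\<^bsub>G\<^esub> y z) i)"
      using anV a2V i unfolding padic_analytic_on_def by meson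
    define sh where "sh w = (\<lambda>j\<in>{..<n + n}. a2 j \<oplus>\<^bsub>Qp p\<^esub> w j)" for w
    define \<Phi> where "\<Phi> w = \<phi> (x (sh w) \<otimes>\<^bsub>G\<^esub> y (sh w)) i" for w
    have shd: "sh w j \<ominus>\<^bsub>Qp p\<^esub> a2 j = w j" if "j < n + n" "w j \<in> carrier (Qp p)" for w j
    proof -
      have "sh w j = a2 j \<oplus>\<^bsub>Qp p\<^esub> w j" using that by (simp add: sh_def)
      then show ?thesis using a2c[OF that(1)] that(2) by simp algebra
    qed
    have shb: "sh w \<in> padic_ball p (n + n) a2 r"
      if "\<And>j. j < n + n \<Longrightarrow> w j \<in> carrier (Qp p) \<and> padic_norm p (w j) < r" for w
      using that a2c shd by (auto simp: padic_ball_def padic_space_def sh_def)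
    have ex: "\<exists>C \<rho>. 0 < C \<and> 0 < \<rho> \<and> \<rho> < r \<and> (\<forall>w s s'. 0 \<le> s \<longrightarrow> s \<le> \<rho> \<longrightarrow> 0 \<le> s' \<longrightarrow> s' \<le> \<rho> \<longrightarrow>
      (\<forall>j<n + n. w j \<in> carrier (Qp p)) \<longrightarrow> (\<forall>j<n. padic_norm p (w j) \<le> s) \<longrightarrow>
      (\<forall>j<n + n. n \<le> j \<longrightarrow> padic_norm p (w j) \<le> s') \<longrightarrow>
      padic_norm p (\<Phi> w \<ominus>\<^bsub>Qp p\<^esub> \<Phi> (\<lambda>j. if j < n then \<zero>\<^bsub>Qp p\<^esub> else w j) \<ominus>\<^bsub>Qp p\<^esub>
        (\<Phi> (\<lambda>j. if j < n then w j else \<zero>\<^bsub>Qp p\<^esub>) \<ominus>\<^bsub>Qp p\<^esub> \<Phi> (\<lambda>j. \<zero>\<^bsub>Qp p\<^esub>))) \<le> C * s * s')"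
    proof (rule padic_mixed_difference_bound[OF p r])
      fix w assume w: "\<And>j. j < n + n \<Longrightarrow> w j \<in> carrier (Qp p) \<and> padic_norm p (w j) < r"
      have "(\<Otimes>\<^bsub>Qp p\<^esub>j\<in>{..<n + n}. (sh w j \<ominus>\<^bsub>Qp p\<^esub> a2 j) [^]\<^bsub>Qp p\<^esub> (\<alpha> j :: nat))
          = (\<Otimes>\<^bsub>Qp p\<^esub>j\<in>{..<n + n}. w j [^]\<^bsub>Qp p\<^esub> \<alpha> j)" for \<alpha>
        by (rule Qp.finprod_cong') (use shd w in auto)
      then show "padic_has_sum p (\<lambda>\<alpha>. c \<alpha> \<otimes>\<^bsub>Qp p\<^esub> (\<Otimes>\<^bsub>Qp p\<^esub>j\<in>{..<n + n}. w j [^]\<^bsub>Qp p\<^esub> (\<alpha> j :: nat)))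
        ({..<n + n} \<rightarrow>\<^sub>E UNIV) (\<Phi> w)"
        using hs[of "sh w"] shb[of w] w by (simp add: \<Phi>_def)
    qed (use c in auto)
    from ex obtain C \<rho> where C: "0 < C" "0 < \<rho>" "\<rho> < r" and
      est: "\<forall>w s s'. 0 \<le> s \<longrightarrow> s \<le> \<rho> \<longrightarrow> 0 \<le> s' \<longrightarrow> s' \<le> \<rho> \<longrightarrow>
      (\<forall>j<n + n. w j \<in> carrier (Qp p)) \<longrightarrow> (\<forall>j<n. padic_norm p (w j) \<le> s) \<longrightarrow>
      (\<forall>j<n + n. n \<le> j \<longrightarrow> padic_norm p (w j) \<le> s') \<longrightarrow>
      padic_norm p (\<Phi> w \<ominus>\<^bsub>Qp p\<^esub> \<Phi> (\<lambda>j. if j < n then \<zero>\<^bsub>Qp p\<^esub> else w j) \<ominus>\<^bsub>Qp p\<^esub>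
        (\<Phi> (\<lambda>j. if j < n then w j else \<zero>\<^bsub>Qp p\<^esub>) \<ominus>\<^bsub>Qp p\<^esub> \<Phi> (\<lambda>j. \<zero>\<^bsub>Qp p\<^esub>))) \<le> C * s * s'"
      by (elim exE conjE) (rule that, assumption+)
    have "ok i C \<rho>" unfolding ok_def
    proof (intro ballI allI impI)
      fix g h s s' assume g: "g \<in> U" and h: "h \<in> U" and s: "0 \<le> s" "s \<le> \<rho>" "0 \<le> s'" "s' \<le> \<rho>"
        and gs: "\<forall>i<n. padic_norm p (Y g i) \<le> s" and hs: "\<forall>i<n. padic_norm p (Y h i) \<le> s'"
      define w where "w j = (if j < n then Y g j else Y h (j - n))" for j
      have ac: "a i \<in> carrier (Qp p)" if "i < n" for i using a that by (auto simp: padic_space_def)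
      have Yc: "Y g i \<in> carrier (Qp p)" if "g \<in> U" "i < n" for g i
        using \<phi>c[OF that] ac[OF that(2)] by (simp add: Y_def)
      have wc: "w j \<in> carrier (Qp p)" if "j < n + n" for j
        using Yc g h that by (auto simp: w_def)
      have a2w: "sh v = pr g' h'" if gh: "g' \<in> U" "h' \<in> U"
        and v: "\<And>j. j < n + n \<Longrightarrow> v j = (if j < n then Y g' j else Y h' (j - n))" for v g' h'
      proof (rule extensionalityI[of _ "{..<n + n}"])
        fix j assume j: "j \<in> {..<n + n}"
        have "a i \<oplus>\<^bsub>Qp p\<^esub> Y g i = \<phi> g i" if "g \<in> U" "i < n" for g i
          using \<phi>c[OF that] ac[OF that(2)] unfolding Y_def by algebra
        then show "sh v j = pr g' h' j" using j gh v[of j]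
          by (auto simp: sh_def pr_def a2_def a_def)
      qed (auto simp: sh_def pr_def)
      have Y1: "Y \<one>\<^bsub>G\<^esub> j = \<zero>\<^bsub>Qp p\<^esub>" if "j < n" for j
        using ac[OF that] by (simp add: Y_def a_def Qp.r_neg a_minus_def)
      have "sh w = pr g h" by (rule a2w[OF g h]) (simp add: w_def)
      moreover have "sh w \<in> padic_ball p (n + n) a2 r"
      proof (rule shb)
        fix j assume j: "j < n + n"
        have "padic_norm p (w j) \<le> max s s'"
        proof (cases "j < n")
          case True
          then show ?thesis using gs by (simp add: w_def le_max_iff_disj)
        next
          case False
          then have "padic_norm p (Y h (j - n)) \<le> s'" using hs j by simp
          then show ?thesis using False by (simp add: w_def le_max_iff_disj)
        qed
        then show "w j \<in> carrier (Qp p) \<and> padic_norm p (w j) < r" using wc[OF j] s C by simp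
      qed
      ultimately have ghU: "g \<otimes>\<^bsub>G\<^esub> h \<in> U" using ball prV[OF g h] by auto
      have "\<Phi> w = \<phi> (g \<otimes>\<^bsub>G\<^esub> h) i" using prs[OF g h] \<open>sh w = pr g h\<close> by (simp add: \<Phi>_def)
      moreover have "sh (\<lambda>j. if j < n then \<zero>\<^bsub>Qp p\<^esub> else w j) = pr \<one>\<^bsub>G\<^esub> h"
        by (rule a2w[OF U1 h]) (simp add: w_def Y1)
      then have "\<Phi> (\<lambda>j. if j < n then \<zero>\<^bsub>Qp p\<^esub> else w j) = \<phi> h i"
        using prs[OF U1 h] h UG by (auto simp: \<Phi>_def)
      moreover have "sh (\<lambda>j. if j < n then w j else \<zero>\<^bsub>Qp p\<^esub>) = pr g \<one>\<^bsub>G\<^esub>"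
        by (rule a2w[OF g U1]) (simp add: w_def Y1)
      then have "\<Phi> (\<lambda>j. if j < n then w j else \<zero>\<^bsub>Qp p\<^esub>) = \<phi> g i"
        using prs[OF g U1] g UG by (auto simp: \<Phi>_def)
      moreover have "sh (\<lambda>j. \<zero>\<^bsub>Qp p\<^esub>) = pr \<one>\<^bsub>G\<^esub> \<one>\<^bsub>G\<^esub>"
        by (rule a2w[OF U1 U1]) (simp add: Y1)
      then have "\<Phi> (\<lambda>j. \<zero>\<^bsub>Qp p\<^esub>) = a i"
        using prs[OF U1 U1] by (auto simp: \<Phi>_def a_def)
      moreover have "padic_norm p (\<Phi> w \<ominus>\<^bsub>Qp p\<^esub> \<Phi> (\<lambda>j. if j < n then \<zero>\<^bsub>Qp p\<^esub> else w j) \<ominus>\<^bsub>Qp p\<^esub>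
        (\<Phi> (\<lambda>j. if j < n then w j else \<zero>\<^bsub>Qp p\<^esub>) \<ominus>\<^bsub>Qp p\<^esub> \<Phi> (\<lambda>j. \<zero>\<^bsub>Qp p\<^esub>))) \<le> C * s * s'"
        using gs hs by (intro est[rule_format] s wc) (auto simp: w_def)
      ultimately show "g \<otimes>\<^bsub>G\<^esub> h \<in> U \<and> padic_norm p ((\<phi> (g \<otimes>\<^bsub>G\<^esub> h) i \<ominus>\<^bsub>Qp p\<^esub> \<phi> h i) \<ominus>\<^bsub>Qp p\<^esub>
        (\<phi> g i \<ominus>\<^bsub>Qp p\<^esub> a i)) \<le> C * s * s'" using ghU by simp
    qed
    then show ?thesis using C by blast
  qed
  then obtain Cf \<rho>f where Cf: "\<And>i. i < n \<Longrightarrow> 0 < Cf i \<and> 0 < \<rho>f i \<and> ok i (Cf i) (\<rho>f i)" by metis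
  define C where "C = 1 + (\<Sum>i<n. Cf i)"
  define \<rho> where "\<rho> = Min (insert 1 (\<rho>f ` {..<n}))"
  have CfC: "Cf i \<le> C" if "i < n" for i
    using member_le_sum[of i "{..<n}" Cf] Cf that by (force simp: C_def less_imp_le)
  have C0: "C > 0" unfolding C_def using Cf by (intro add_pos_nonneg sum_nonneg) (auto simp: less_imp_le)
  have \<rho>0: "\<rho> > 0" unfolding \<rho>_def using Cf by (subst Min_gr_iff) auto
  have \<rho>f: "\<rho> \<le> \<rho>f i" if "i < n" for i unfolding \<rho>_def using that by (intro Min_le) auto
  show ?thesis
  proof (rule that[OF UT U1 inj \<phi>U conjI[OF C0 \<rho>0]])
    show "openin T {g \<in> U. \<forall>i<n. padic_norm p (\<phi> g i \<ominus>\<^bsub>Qp p\<^esub> \<phi> \<one>\<^bsub>G\<^esub> i) < \<epsilon>}" for \<epsilon>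
      using open_ball by (simp add: a_def)
    show "\<forall>g\<in>U. \<forall>h\<in>U. \<forall>s s'. 0 \<le> s \<longrightarrow> s \<le> \<rho> \<longrightarrow> 0 \<le> s' \<longrightarrow> s' \<le> \<rho> \<longrightarrow>
      (\<forall>i<n. padic_norm p (\<phi> g i \<ominus>\<^bsub>Qp p\<^esub> \<phi> \<one>\<^bsub>G\<^esub> i) \<le> s) \<longrightarrow>
      (\<forall>i<n. padic_norm p (\<phi> h i \<ominus>\<^bsub>Qp p\<^esub> \<phi> \<one>\<^bsub>G\<^esub> i) \<le> s') \<longrightarrow>
      g \<otimes>\<^bsub>G\<^esub> h \<in> U \<and> (\<forall>i<n. padic_norm p ((\<phi> (g \<otimes>\<^bsub>G\<^esub> h) i \<ominus>\<^bsub>Qp p\<^esub> \<phi> h i) \<ominus>\<^bsub>Qp p\<^esub>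
        (\<phi> g i \<ominus>\<^bsub>Qp p\<^esub> \<phi> \<one>\<^bsub>G\<^esub> i)) \<le> C * s * s')"
    proof (intro ballI allI impI)
    fix g h and s s' :: real
    assume gh: "g \<in> U" "h \<in> U" and s: "0 \<le> s" "s \<le> \<rho>" "0 \<le> s'" "s' \<le> \<rho>"
      and gs: "\<forall>i<n. padic_norm p (\<phi> g i \<ominus>\<^bsub>Qp p\<^esub> \<phi> \<one>\<^bsub>G\<^esub> i) \<le> s"
      and hs: "\<forall>i<n. padic_norm p (\<phi> h i \<ominus>\<^bsub>Qp p\<^esub> \<phi> \<one>\<^bsub>G\<^esub> i) \<le> s'"
    have *: "g \<otimes>\<^bsub>G\<^esub> h \<in> U \<and> padic_norm p ((\<phi> (g \<otimes>\<^bsub>G\<^esub> h) i \<ominus>\<^bsub>Qp p\<^esub> \<phi> h i) \<ominus>\<^bsub>Qp p\<^esub>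
        (\<phi> g i \<ominus>\<^bsub>Qp p\<^esub> \<phi> \<one>\<^bsub>G\<^esub> i)) \<le> C * s * s'" if "i < n" for i
    proof -
      have "g \<otimes>\<^bsub>G\<^esub> h \<in> U \<and> padic_norm p ((\<phi> (g \<otimes>\<^bsub>G\<^esub> h) i \<ominus>\<^bsub>Qp p\<^esub> \<phi> h i) \<ominus>\<^bsub>Qp p\<^esub>
          (\<phi> g i \<ominus>\<^bsub>Qp p\<^esub> \<phi> \<one>\<^bsub>G\<^esub> i)) \<le> Cf i * s * s'"
      proof -
        have "ok i (Cf i) (\<rho>f i)" using Cf[OF that] by simp
        moreover have "s \<le> \<rho>f i" "s' \<le> \<rho>f i" using s \<rho>f[OF that] by auto
        ultimately show ?thesis using gh s gs hs unfolding ok_def Y_def a_def by simp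
      qed
      moreover have "Cf i * s * s' \<le> C * s * s'"
        using CfC[OF that] s by (intro mult_right_mono) auto
      ultimately show ?thesis by linarith
    qed
    show "g \<otimes>\<^bsub>G\<^esub> h \<in> U \<and> (\<forall>i<n. padic_norm p ((\<phi> (g \<otimes>\<^bsub>G\<^esub> h) i \<ominus>\<^bsub>Qp p\<^esub> \<phi> h i) \<ominus>\<^bsub>Qp p\<^esub>
        (\<phi> g i \<ominus>\<^bsub>Qp p\<^esub> \<phi> \<one>\<^bsub>G\<^esub> i)) \<le> C * s * s')"
    proof (cases "n = 0")
      case True
      \<comment> \<open>In dimension zero the chart domain is the single point \<open>1\<close>.\<close>
      have "\<phi> x = (\<lambda>_. undefined)" if "x \<in> U" for x
        using \<phi>U that True by (simp add: padic_space_def image_subset_iff)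
      then have "\<phi> g = \<phi> \<one>\<^bsub>G\<^esub>" "\<phi> h = \<phi> \<one>\<^bsub>G\<^esub>" using gh U1 by simp_all
      then have "g = \<one>\<^bsub>G\<^esub>" "h = \<one>\<^bsub>G\<^esub>" using inj gh U1 by (auto dest: inj_onD)
      then show ?thesis using U1 True by simp
    qed (use * in auto)
    qed
  qed
qed

text \<open>An element \<open>g\<close> of order \<open>q\<close>, a prime, and of norm \<open>s > 0\<close> in the chart would give
  \<open>\<bar>q\<bar> s = \<parallel>q g - g\<^sup>q\<parallel> \<le> C s\<^sup>2\<close>, so \<open>s\<close> is bounded below because \<open>\<bar>q\<bar> \<ge> 1/p\<close>.\<close>

lemma padic_analytic_no_small_torsion:
  assumes p: "prime p" and an: "padic_analytic_group p G T"
  obtains W where "openin T W" "\<one>\<^bsub>G\<^esub> \<in> W"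
    "\<And>g N. g \<in> W \<Longrightarrow> N > 0 \<Longrightarrow> g [^]\<^bsub>G\<^esub> (N::nat) = \<one>\<^bsub>G\<^esub> \<Longrightarrow> g = \<one>\<^bsub>G\<^esub>"
proof -
  interpret Qp: cring "Qp p" by (rule Qp_cring[OF p])
  have tg: "topological_group G T" using an by (simp add: padic_analytic_group_def)
  interpret G: group G using tg by (simp add: topological_group_def)
  have top: "topspace T = carrier G" using tg by (simp add: topological_group_def)
  obtain U \<phi> n C \<rho> where U: "openin T U" "\<one>\<^bsub>G\<^esub> \<in> U" "inj_on \<phi> U" "\<phi> ` U \<subseteq> padic_space p n"
    and C: "C > 0 \<and> \<rho> > 0"
    and op: "\<And>\<epsilon>. openin T {g \<in> U. \<forall>i<n. padic_norm p (\<phi> g i \<ominus>\<^bsub>Qp p\<^esub> \<phi> \<one>\<^bsub>G\<^esub> i) < \<epsilon>}"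
    and est: "\<forall>g\<in>U. \<forall>h\<in>U. \<forall>s s'. 0 \<le> s \<longrightarrow> s \<le> \<rho> \<longrightarrow> 0 \<le> s' \<longrightarrow> s' \<le> \<rho> \<longrightarrow>
      (\<forall>i<n. padic_norm p (\<phi> g i \<ominus>\<^bsub>Qp p\<^esub> \<phi> \<one>\<^bsub>G\<^esub> i) \<le> s) \<longrightarrow>
      (\<forall>i<n. padic_norm p (\<phi> h i \<ominus>\<^bsub>Qp p\<^esub> \<phi> \<one>\<^bsub>G\<^esub> i) \<le> s') \<longrightarrow>
      g \<otimes>\<^bsub>G\<^esub> h \<in> U \<and> (\<forall>i<n. padic_norm p ((\<phi> (g \<otimes>\<^bsub>G\<^esub> h) i \<ominus>\<^bsub>Qp p\<^esub> \<phi> h i) \<ominus>\<^bsub>Qp p\<^esub>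
        (\<phi> g i \<ominus>\<^bsub>Qp p\<^esub> \<phi> \<one>\<^bsub>G\<^esub> i)) \<le> C * s * s')"
    by (rule padic_chart_at_identity[OF p an]) (rule that)
  define Y where "Y g i = \<phi> g i \<ominus>\<^bsub>Qp p\<^esub> \<phi> \<one>\<^bsub>G\<^esub> i" for g i
  define \<rho>' where "\<rho>' = min \<rho> (1 / (C * p))"
  have p1: "real p > 1" using prime_gt_1_nat[OF p] by simp
  have \<rho>': "0 < \<rho>'" "\<rho>' \<le> \<rho>" "C * \<rho>' \<le> 1 / p"
    using C p1 by (auto simp: \<rho>'_def min_def field_simps)
  define W where "W = {g \<in> U. \<forall>i<n. padic_norm p (Y g i) < \<rho>'}"
  have UG: "U \<subseteq> carrier G" using openin_subset[OF U(1)] top by simp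
  have \<phi>c: "\<phi> g i \<in> carrier (Qp p)" if "g \<in> U" "i < n" for g i
    using that U(4) by (auto simp: padic_space_def PiE_iff)
  have Yc: "Y g i \<in> carrier (Qp p)" if "g \<in> U" "i < n" for g i
    using \<phi>c that U(2) by (simp add: Y_def)
  have Y1: "Y \<one>\<^bsub>G\<^esub> i = \<zero>\<^bsub>Qp p\<^esub>" if "i < n" for i
    using \<phi>c[OF U(2) that] by (simp add: Y_def Qp.r_neg a_minus_def)
  \<comment> \<open>The inserted \<open>0\<close> makes the maximum meaningful in dimension zero.\<close>
  define Mx where "Mx g = Max (insert 0 ((\<lambda>i. padic_norm p (Y g i)) ` {..<n}))" for g
  have Mx: "0 \<le> Mx g" "i < n \<Longrightarrow> padic_norm p (Y g i) \<le> Mx g" for g i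
    unfolding Mx_def by (auto intro!: Max_ge)
  have Mx\<rho>: "Mx g < \<rho>'" if "g \<in> W" for g
    unfolding Mx_def using that \<rho>' by (subst Max_less_iff) (auto simp: W_def)
  have pow: "g [^]\<^bsub>G\<^esub> (m::nat) \<in> U \<and> (\<forall>i<n. padic_norm p (Y (g [^]\<^bsub>G\<^esub> m) i) \<le> Mx g \<and>
      padic_norm p (Y (g [^]\<^bsub>G\<^esub> m) i \<ominus>\<^bsub>Qp p\<^esub> ([m] \<cdot>\<^bsub>Qp p\<^esub> \<one>\<^bsub>Qp p\<^esub>) \<otimes>\<^bsub>Qp p\<^esub> Y g i) \<le> C * Mx g * Mx g)"
    if g: "g \<in> W" for g m
  proof (induction m)
    case 0
    have "Y g i \<in> carrier (Qp p)" if "i < n" for i using Yc g that by (auto simp: W_def)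
    then show ?case using U(2) Mx(1)[of g] Mx(2)[of _ g] C by (auto simp: Y1 padic_norm_zero p Qp.r_neg a_minus_def)
  next
    case (Suc m)
    have gU: "g \<in> U" "g \<in> carrier G" using g UG by (auto simp: W_def)
    have s: "0 \<le> Mx g" "Mx g \<le> \<rho>" using Mx(1) Mx\<rho>[OF g] \<rho>' by auto
    let ?h = "g [^]\<^bsub>G\<^esub> m"
    have e: "?h \<otimes>\<^bsub>G\<^esub> g \<in> U \<and> (\<forall>i<n. padic_norm p ((\<phi> (?h \<otimes>\<^bsub>G\<^esub> g) i \<ominus>\<^bsub>Qp p\<^esub> \<phi> g i) \<ominus>\<^bsub>Qp p\<^esub> Y ?h i)
        \<le> C * Mx g * Mx g)"
      unfolding Y_def
      by (rule est[rule_format, OF _ gU(1) s s]) (use Suc.IH Mx(2)[of _ g] in \<open>auto simp: Y_def\<close>)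
    have "padic_norm p (Y (?h \<otimes>\<^bsub>G\<^esub> g) i) \<le> Mx g \<and>
      padic_norm p (Y (?h \<otimes>\<^bsub>G\<^esub> g) i \<ominus>\<^bsub>Qp p\<^esub> ([Suc m] \<cdot>\<^bsub>Qp p\<^esub> \<one>\<^bsub>Qp p\<^esub>) \<otimes>\<^bsub>Qp p\<^esub> Y g i) \<le> C * Mx g * Mx g"
      if i: "i < n" for i
    proof -
      let ?E = "(\<phi> (?h \<otimes>\<^bsub>G\<^esub> g) i \<ominus>\<^bsub>Qp p\<^esub> \<phi> g i) \<ominus>\<^bsub>Qp p\<^esub> Y ?h i"
      let ?m = "[m] \<cdot>\<^bsub>Qp p\<^esub> \<one>\<^bsub>Qp p\<^esub>"
      have c: "\<phi> (?h \<otimes>\<^bsub>G\<^esub> g) i \<in> carrier (Qp p)" "\<phi> g i \<in> carrier (Qp p)" "\<phi> \<one>\<^bsub>G\<^esub> i \<in> carrier (Qp p)"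
          "Y ?h i \<in> carrier (Qp p)" "Y g i \<in> carrier (Qp p)" "?m \<in> carrier (Qp p)"
        using \<phi>c Yc e gU i U(2) Suc.IH by auto
      have Em: "padic_norm p ?E \<le> C * Mx g * Mx g" using e i by blast
      have "C * Mx g * Mx g \<le> 1 * Mx g"
      proof (rule mult_right_mono)
        have "C * Mx g \<le> C * \<rho>'" using Mx\<rho>[OF g] C by (intro mult_left_mono) auto
        moreover have "1 / real p \<le> 1" using p1 by simp
        ultimately show "C * Mx g \<le> 1" using \<rho>'(3) by linarith
      qed (rule s)
      then have Em': "padic_norm p ?E \<le> Mx g" using Em by simp
      have 1: "Y (?h \<otimes>\<^bsub>G\<^esub> g) i = ?E \<oplus>\<^bsub>Qp p\<^esub> (Y ?h i \<oplus>\<^bsub>Qp p\<^esub> Y g i)"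
      proof -
        have "?E \<oplus>\<^bsub>Qp p\<^esub> Y ?h i = \<phi> (?h \<otimes>\<^bsub>G\<^esub> g) i \<ominus>\<^bsub>Qp p\<^esub> \<phi> g i"
          using c by (simp add: a_minus_def Qp.a_assoc Qp.l_neg)
        then have "?E \<oplus>\<^bsub>Qp p\<^esub> (Y ?h i \<oplus>\<^bsub>Qp p\<^esub> Y g i)
            = (\<phi> (?h \<otimes>\<^bsub>G\<^esub> g) i \<ominus>\<^bsub>Qp p\<^esub> \<phi> g i) \<oplus>\<^bsub>Qp p\<^esub> Y g i"
          using c by (simp add: Qp.a_assoc[symmetric])
        also have "\<dots> = (\<phi> (?h \<otimes>\<^bsub>G\<^esub> g) i \<oplus>\<^bsub>Qp p\<^esub> (\<ominus>\<^bsub>Qp p\<^esub> \<phi> g i \<oplus>\<^bsub>Qp p\<^esub> \<phi> g i)) \<ominus>\<^bsub>Qp p\<^esub> \<phi> \<one>\<^bsub>G\<^esub> i"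
          unfolding Y_def[of g] using c by (simp only: a_minus_def Qp.a_assoc Qp.a_closed Qp.a_inv_closed)
        also have "\<dots> = Y (?h \<otimes>\<^bsub>G\<^esub> g) i" unfolding Y_def using c by (simp add: Qp.l_neg)
        finally show ?thesis by simp
      qed
      have "padic_norm p (Y ?h i \<oplus>\<^bsub>Qp p\<^esub> Y g i) \<le> Mx g"
        using padic_norm_add[OF p c(4,5)] Suc.IH Mx(2)[OF i, of g] i by fastforce
      then have A: "padic_norm p (Y (?h \<otimes>\<^bsub>G\<^esub> g) i) \<le> Mx g"
        unfolding 1 using padic_norm_add[OF p, of ?E "Y ?h i \<oplus>\<^bsub>Qp p\<^esub> Y g i"] c Em' by force
      have "Y (?h \<otimes>\<^bsub>G\<^esub> g) i \<ominus>\<^bsub>Qp p\<^esub> (?m \<oplus>\<^bsub>Qp p\<^esub> \<one>\<^bsub>Qp p\<^esub>) \<otimes>\<^bsub>Qp p\<^esub> Y g i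
          = ?E \<oplus>\<^bsub>Qp p\<^esub> (Y ?h i \<ominus>\<^bsub>Qp p\<^esub> ?m \<otimes>\<^bsub>Qp p\<^esub> Y g i)"
      proof -
        have Ec: "?E \<in> carrier (Qp p)" using c by simp
        have "(Y ?h i \<oplus>\<^bsub>Qp p\<^esub> Y g i) \<ominus>\<^bsub>Qp p\<^esub> (?m \<oplus>\<^bsub>Qp p\<^esub> \<one>\<^bsub>Qp p\<^esub>) \<otimes>\<^bsub>Qp p\<^esub> Y g i
            = Y ?h i \<oplus>\<^bsub>Qp p\<^esub> (Y g i \<ominus>\<^bsub>Qp p\<^esub> Y g i) \<ominus>\<^bsub>Qp p\<^esub> ?m \<otimes>\<^bsub>Qp p\<^esub> Y g i"
          using c(4,5,6) by (simp add: Qp.l_distr Qp.minus_add a_minus_def Qp.a_ac)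
        then have "(Y ?h i \<oplus>\<^bsub>Qp p\<^esub> Y g i) \<ominus>\<^bsub>Qp p\<^esub> (?m \<oplus>\<^bsub>Qp p\<^esub> \<one>\<^bsub>Qp p\<^esub>) \<otimes>\<^bsub>Qp p\<^esub> Y g i
            = Y ?h i \<ominus>\<^bsub>Qp p\<^esub> ?m \<otimes>\<^bsub>Qp p\<^esub> Y g i"
          using c(4,5,6) by (simp add: Qp.r_neg a_minus_def)
        then show ?thesis unfolding 1 using Ec c(4,5,6) by (simp add: a_minus_def Qp.a_assoc)
      qed
      moreover have "[Suc m] \<cdot>\<^bsub>Qp p\<^esub> \<one>\<^bsub>Qp p\<^esub> = ?m \<oplus>\<^bsub>Qp p\<^esub> \<one>\<^bsub>Qp p\<^esub>" by simp
      moreover have "padic_norm p (?E \<oplus>\<^bsub>Qp p\<^esub> (Y ?h i \<ominus>\<^bsub>Qp p\<^esub> ?m \<otimes>\<^bsub>Qp p\<^esub> Y g i)) \<le> C * Mx g * Mx g"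
        using padic_norm_add[OF p, of ?E "Y ?h i \<ominus>\<^bsub>Qp p\<^esub> ?m \<otimes>\<^bsub>Qp p\<^esub> Y g i"] c Em Suc.IH i by fastforce
      ultimately show ?thesis using A by simp
    qed
    then show ?case using e by simp
  qed
  have "g = \<one>\<^bsub>G\<^esub>" if g: "g \<in> W" and N: "N > 0" "g [^]\<^bsub>G\<^esub> (N::nat) = \<one>\<^bsub>G\<^esub>" for g N
  proof (rule ccontr)
    assume g1: "g \<noteq> \<one>\<^bsub>G\<^esub>"
    have gG: "g \<in> carrier G" using g UG by (auto simp: W_def)
    define N0 where "N0 = (LEAST N. N > 0 \<and> g [^]\<^bsub>G\<^esub> (N::nat) = \<one>\<^bsub>G\<^esub>)"
    have N0: "N0 > 0" "g [^]\<^bsub>G\<^esub> N0 = \<one>\<^bsub>G\<^esub>"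
      using LeastI[of "\<lambda>N. N > 0 \<and> g [^]\<^bsub>G\<^esub> (N::nat) = \<one>\<^bsub>G\<^esub>" N] N by (auto simp: N0_def)
    have least: "\<not> (k > 0 \<and> g [^]\<^bsub>G\<^esub> k = \<one>\<^bsub>G\<^esub>)" if "k < N0" for k
      using not_less_Least[of k] that unfolding N0_def by auto
    have "N0 \<noteq> 1" using N0 g1 gG by auto
    then obtain q where q: "prime q" "q dvd N0" using prime_factor_nat by blast
    then obtain k where k: "N0 = q * k" by (auto elim: dvdE)
    have k0: "0 < k" "k < N0" using N0(1) k prime_gt_1_nat[OF q(1)] by auto
    let ?g = "g [^]\<^bsub>G\<^esub> k"
    have g'1: "?g \<noteq> \<one>\<^bsub>G\<^esub>" using least[OF k0(2)] k0(1) by auto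
    have g'q: "?g [^]\<^bsub>G\<^esub> q = \<one>\<^bsub>G\<^esub>" using N0(2) gG k by (simp add: G.nat_pow_pow mult.commute)
    have g'W: "?g \<in> W" using pow[OF g, of k] Mx\<rho>[OF g] by (force simp: W_def)
    then have g'U: "?g \<in> U" by (simp add: W_def)
    have "\<exists>i<n. \<phi> ?g i \<noteq> \<phi> \<one>\<^bsub>G\<^esub> i"
    proof (rule ccontr)
      assume "\<not> ?thesis"
      then have "\<phi> ?g = \<phi> \<one>\<^bsub>G\<^esub>" using g'U U(2,4)
        by (intro extensionalityI[of _ "{..<n}"]) (auto simp: padic_space_def PiE_iff)
      then show False using U(2,3) g'U g'1 by (auto dest: inj_onD)
    qed
    then obtain i0 where i0: "i0 < n" "\<phi> ?g i0 \<noteq> \<phi> \<one>\<^bsub>G\<^esub> i0" by auto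
    have "Y ?g i0 \<noteq> \<zero>\<^bsub>Qp p\<^esub>" unfolding Y_def using i0 \<phi>c g'U U(2) Qp.r_right_minus_eq by auto
    then have "padic_norm p (Y ?g i0) > 0"
      using padic_norm_eq_0[OF p Yc[OF g'U i0(1)]] padic_norm_nonneg[OF p Yc[OF g'U i0(1)]]
      by (auto simp: less_le)
    then have s0: "Mx ?g > 0" using Mx(2)[OF i0(1), of ?g] by linarith
    have "Mx ?g \<in> insert 0 ((\<lambda>i. padic_norm p (Y ?g i)) ` {..<n})"
      unfolding Mx_def by (rule Max_in) auto
    then obtain i where i: "i < n" "padic_norm p (Y ?g i) = Mx ?g" using s0 by auto
    have Yi: "Y ?g i \<in> carrier (Qp p)" by (rule Yc[OF g'U i(1)])
    have "padic_norm p (Y \<one>\<^bsub>G\<^esub> i \<ominus>\<^bsub>Qp p\<^esub> ([q] \<cdot>\<^bsub>Qp p\<^esub> \<one>\<^bsub>Qp p\<^esub>) \<otimes>\<^bsub>Qp p\<^esub> Y ?g i) \<le> C * Mx ?g * Mx ?g"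
      using pow[OF g'W, of q] i(1) g'q by simp
    moreover have "padic_norm p (Y \<one>\<^bsub>G\<^esub> i \<ominus>\<^bsub>Qp p\<^esub> ([q] \<cdot>\<^bsub>Qp p\<^esub> \<one>\<^bsub>Qp p\<^esub>) \<otimes>\<^bsub>Qp p\<^esub> Y ?g i)
        = padic_abs p (of_nat q) * Mx ?g"
      using Yi i by (simp add: Y1 a_minus_def padic_norm_minus p padic_norm_mult padic_norm_of_nat)
    ultimately have "padic_abs p (of_nat q) \<le> C * Mx ?g" using s0 by simp
    also have "\<dots> < C * \<rho>'" using Mx\<rho>[OF g'W] C by simp
    also have "\<dots> \<le> 1 / p" by (rule \<rho>'(3))
    also have "\<dots> \<le> padic_abs p (of_nat q)"
      using padic_abs_prime[OF p] padic_abs_other_prime[OF p q(1)] p1 by (cases "q = p") auto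
    finally show False by simp
  qed
  moreover have "openin T W" using op by (simp add: W_def Y_def)
  moreover have "\<one>\<^bsub>G\<^esub> \<in> W" using U(2) Y1 \<rho>' by (auto simp: W_def padic_norm_zero p)
  ultimately show ?thesis using that by blast
qed

text \<open>By continuity of \<open>(y, z) \<mapsto> y\<^sup>-\<^sup>1 z\<close> the group is covered by open sets that meet \<open>D\<close> in at
  most one point.\<close>

lemma compact_group_finite_if_quotients_isolated:
  assumes tg: "topological_group G T" and cpt: "compact_space T"
    and W: "openin T W" "\<one>\<^bsub>G\<^esub> \<in> W"
    and D: "D \<subseteq> carrier G" "\<And>d e. d \<in> D \<Longrightarrow> e \<in> D \<Longrightarrow> inv\<^bsub>G\<^esub> d \<otimes>\<^bsub>G\<^esub> e \<in> W \<Longrightarrow> d = e"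
  shows "finite D"
proof -
  interpret G: group G using tg by (simp add: topological_group_def)
  have top: "topspace T = carrier G" using tg by (simp add: topological_group_def)
  have mc: "continuous_map (prod_topology T T) T (\<lambda>(x, y). x \<otimes>\<^bsub>G\<^esub> y)"
    and ic: "continuous_map T T (\<lambda>x. inv\<^bsub>G\<^esub> x)" using tg by (auto simp: topological_group_def)
  have "continuous_map (prod_topology T T) (prod_topology T T) (\<lambda>z. (inv\<^bsub>G\<^esub> (fst z), snd z))"
    using continuous_map_compose[OF continuous_map_fst ic] continuous_map_snd
    by (intro continuous_map_pairedI) (auto simp: o_def)
  from continuous_map_compose[OF this mc]
  have dc: "continuous_map (prod_topology T T) T (\<lambda>z. inv\<^bsub>G\<^esub> (fst z) \<otimes>\<^bsub>G\<^esub> snd z)"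
    by (simp add: o_def)
  define P where "P = {z \<in> topspace (prod_topology T T). inv\<^bsub>G\<^esub> (fst z) \<otimes>\<^bsub>G\<^esub> snd z \<in> W}"
  have Po: "openin (prod_topology T T) P" unfolding P_def
    by (rule openin_continuous_map_preimage[OF dc W(1)])
  have "\<exists>O'. openin T O' \<and> x \<in> O' \<and> O' \<times> O' \<subseteq> P" if x: "x \<in> carrier G" for x
  proof -
    have "(x, x) \<in> P" using x W(2) top by (simp add: P_def)
    then obtain A B where "openin T A" "openin T B" "x \<in> A" "x \<in> B" "A \<times> B \<subseteq> P"
      using Po[unfolded openin_prod_topology_alt, rule_format, OF \<open>(x, x) \<in> P\<close>] by blast
    then show ?thesis by (intro exI[of _ "A \<inter> B"]) auto
  qed
  then obtain N where N: "\<And>x. x \<in> carrier G \<Longrightarrow> openin T (N x) \<and> x \<in> N x \<and> N x \<times> N x \<subseteq> P" by metis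
  have "(\<forall>U\<in>N ` carrier G. openin T U) \<and> topspace T \<subseteq> \<Union>(N ` carrier G)" using N top by auto
  from cpt[unfolded compact_space_alt, THEN spec, THEN mp, OF this]
  obtain F where F: "finite F" "F \<subseteq> N ` carrier G" "topspace T \<subseteq> \<Union>F" by auto
  have one: "finite (X \<inter> D)" if X: "X \<in> F" for X
  proof -
    have "d = e" if "d \<in> X \<inter> D" "e \<in> X \<inter> D" for d e
    proof (rule D(2))
      obtain x where "x \<in> carrier G" "X = N x" using X F(2) by blast
      then have "(d, e) \<in> P" using N[of x] that by blast
      then show "inv\<^bsub>G\<^esub> d \<otimes>\<^bsub>G\<^esub> e \<in> W" by (simp add: P_def)
    qed (use that in auto)
    then show ?thesis by (metis finite.emptyI finite.insertI finite_subset insertI1 subsetI)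
  qed
  have "D \<subseteq> (\<Union>X\<in>F. X \<inter> D)" using D(1) F(3) top by auto
  then show ?thesis using F(1) one by (meson finite_UN_I finite_subset)
qed

section \<open>Completed group rings\<close>

lemma (in normal) rcosets_cases:
  assumes "C \<in> rcosets H" obtains x where "x \<in> carrier G" "C = H #> x"
  using assms by (auto simp: RCOSETS_def)

lemma (in normal) rcosets_eq_iff:
  assumes "x \<in> carrier G" "y \<in> carrier G" shows "H #> x = H #> y \<longleftrightarrow> x \<in> H #> y"
  using assms repr_independence[OF _ assms(2) is_subgroup] rcos_self[OF assms(1) is_subgroup] by blast

lemma (in normal) rcosets_memD:
  assumes "C \<in> rcosets H" "x \<in> C" shows "x \<in> carrier G" "C = H #> x"
proof -
  obtain y where y: "y \<in> carrier G" "C = H #> y" using assms(1) by (rule rcosets_cases)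
  then show x: "x \<in> carrier G" using assms(2) r_coset_subset_G[OF subset] by blast
  show "C = H #> x" using rcosets_eq_iff[OF x y(1)] y assms(2) by simp
qed

lemma (in normal) rcoset_mem: "x \<in> carrier G \<Longrightarrow> x \<in> H #> x"
  using rcos_self is_subgroup by blast

lemma (in normal) rcoset_in: "x \<in> carrier G \<Longrightarrow> H #> x \<in> rcosets H"
  by (auto simp: RCOSETS_def)

lemma (in normal) rcosets_disj:
  assumes "C \<in> rcosets H" "D \<in> rcosets H" "x \<in> C" "x \<in> D" shows "C = D"
  using rcosets_memD assms by metis

lemma (in group) rcoset_mono: "N \<subseteq> N' \<Longrightarrow> N #> x \<subseteq> N' #> x"
  by (auto simp: r_coset_def)

lemma (in group) set_mult_rcoset:
  assumes N: "subgroup N G" and N': "subgroup N' G" and "N \<subseteq> N'" and x: "x \<in> carrier G"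
  shows "N' <#> (N #> x) = N' #> x"
proof -
  have "N' <#> (N #> x) = (N' <#> N) #> x"
    using assms by (simp add: setmult_rcos_assoc subgroup.subset)
  also have "N' <#> N = N'"
  proof
    show "N' <#> N \<subseteq> N'" using N' \<open>N \<subseteq> N'\<close> by (auto simp: set_mult_def subgroup.m_closed)
    show "N' \<subseteq> N' <#> N" unfolding set_mult_def using subgroup.one_closed[OF N] subgroup.subset[OF N']
      by force
  qed
  finally show ?thesis .
qed

lemma (in group) coarser_rcoset_iff:
  assumes N: "N \<lhd> G" and N': "N' \<lhd> G" and "N \<subseteq> N'" and C: "C \<in> rcosets N" and D: "D \<in> rcosets N'"
  shows "N' <#> C = D \<longleftrightarrow> C \<subseteq> D"
proof -
  interpret N: normal N G by (rule N)
  interpret N': normal N' G by (rule N')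
  obtain x where x: "x \<in> carrier G" "C = N #> x" by (rule N.rcosets_cases[OF C])
  have "N' <#> C = N' #> x" using x set_mult_rcoset[OF N.is_subgroup N'.is_subgroup assms(3)] by simp
  moreover have "N' #> x = D \<longleftrightarrow> x \<in> D" using N'.rcosets_memD[OF D] N'.rcoset_mem[OF x(1)] by metis
  moreover have "x \<in> D \<longleftrightarrow> C \<subseteq> D"
  proof
    assume "x \<in> D"
    then have "D = N' #> x" using N'.rcosets_memD[OF D] by blast
    then show "C \<subseteq> D" using x rcoset_mono[OF assms(3)] by simp
  qed (use x N.rcoset_mem in auto)
  ultimately show ?thesis by simp
qed

lemma group_ring_simps:
  "carrier (group_ring k Q) = {f \<in> carrier Q \<rightarrow>\<^sub>E carrier k. finite {q \<in> carrier Q. f q \<noteq> \<zero>\<^bsub>k\<^esub>}}"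
  "f \<otimes>\<^bsub>group_ring k Q\<^esub> g = (\<lambda>q\<in>carrier Q.
                \<Oplus>\<^bsub>k\<^esub>a\<in>{a \<in> carrier Q. f a \<noteq> \<zero>\<^bsub>k\<^esub>}. f a \<otimes>\<^bsub>k\<^esub> g (inv\<^bsub>Q\<^esub> a \<otimes>\<^bsub>Q\<^esub> q))"
  "\<one>\<^bsub>group_ring k Q\<^esub> = (\<lambda>q\<in>carrier Q. if q = \<one>\<^bsub>Q\<^esub> then \<one>\<^bsub>k\<^esub> else \<zero>\<^bsub>k\<^esub>)"
  "\<zero>\<^bsub>group_ring k Q\<^esub> = (\<lambda>q\<in>carrier Q. \<zero>\<^bsub>k\<^esub>)"
  "f \<oplus>\<^bsub>group_ring k Q\<^esub> g = (\<lambda>q\<in>carrier Q. f q \<oplus>\<^bsub>k\<^esub> g q)"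
  by (simp_all add: group_ring_def)

lemma cgr_simps:
  "x \<otimes>\<^bsub>cgr k G T\<^esub> y = (\<lambda>N\<in>open_normals G T. x N \<otimes>\<^bsub>group_ring k (G Mod N)\<^esub> y N)"
  "\<one>\<^bsub>cgr k G T\<^esub> = (\<lambda>N\<in>open_normals G T. \<one>\<^bsub>group_ring k (G Mod N)\<^esub>)"
  "\<zero>\<^bsub>cgr k G T\<^esub> = (\<lambda>N\<in>open_normals G T. \<zero>\<^bsub>group_ring k (G Mod N)\<^esub>)"
  "x \<oplus>\<^bsub>cgr k G T\<^esub> y = (\<lambda>N\<in>open_normals G T. x N \<oplus>\<^bsub>group_ring k (G Mod N)\<^esub> y N)"
  by (simp_all add: cgr_def)

lemma carrier_Mod: "carrier (G Mod N) = rcosets\<^bsub>G\<^esub> N" "\<one>\<^bsub>G Mod N\<^esub> = N" "C \<otimes>\<^bsub>G Mod N\<^esub> D = C <#>\<^bsub>G\<^esub> D"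
  by (simp_all add: FactGroup_def)

lemma open_normalsD: "N \<in> open_normals G T \<Longrightarrow> N \<lhd> G" "N \<in> open_normals G T \<Longrightarrow> openin T N"
  by (simp_all add: open_normals_def)

lemma cgr_value:
  assumes "z \<in> carrier (cgr k G T)" "N \<in> open_normals G T"
  shows "z N \<in> (rcosets\<^bsub>G\<^esub> N) \<rightarrow>\<^sub>E carrier k" "finite {C \<in> rcosets\<^bsub>G\<^esub> N. z N C \<noteq> \<zero>\<^bsub>k\<^esub>}"
  using assms by (auto simp: cgr_def group_ring_simps carrier_Mod PiE_iff)

lemma cgr_eqI:
  assumes x: "x \<in> carrier (cgr k G T)" and y: "y \<in> carrier (cgr k G T)"
    and eq: "\<And>N C. N \<in> open_normals G T \<Longrightarrow> C \<in> rcosets\<^bsub>G\<^esub> N \<Longrightarrow> x N C = y N C"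
  shows "x = y"
proof (rule extensionalityI[of _ "open_normals G T"])
  show "x \<in> extensional (open_normals G T)" "y \<in> extensional (open_normals G T)"
    using x y by (auto simp: cgr_def PiE_iff)
  fix N assume N: "N \<in> open_normals G T"
  show "x N = y N"
    by (rule extensionalityI[of _ "rcosets\<^bsub>G\<^esub> N"])
       (use eq N cgr_value[OF x N] cgr_value[OF y N] in \<open>auto simp: PiE_iff\<close>)
qed

locale field_and_group = K: field k + group G for k :: "'a ring" and G :: "'g monoid" (structure)
begin

lemma Mod_inv:
  assumes "N \<lhd> G" "x \<in> carrier G" shows "inv\<^bsub>G Mod N\<^esub> (N #> x) = N #> inv x"
proof -
  interpret N: normal N G by (rule assms(1))
  have "inv\<^bsub>G Mod N\<^esub> (N #> x) = set_inv (N #> x)"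
    by (rule N.inv_FactGroup) (simp add: carrier_Mod N.rcoset_in assms)
  then show ?thesis using N.rcos_inv[OF assms(2)] by simp
qed

lemma group_ring_map_Mod:
  assumes N: "N \<lhd> G" and N': "N' \<lhd> G" and "N \<subseteq> N'"
  shows "group_ring_map k (G Mod N) (G Mod N') (\<lambda>C. N' <#> C) f
    = (\<lambda>D\<in>rcosets N'. \<Oplus>\<^bsub>k\<^esub>C\<in>{C \<in> rcosets N. C \<subseteq> D \<and> f C \<noteq> \<zero>\<^bsub>k\<^esub>}. f C)"
  unfolding group_ring_map_def carrier_Mod
proof (rule restrict_ext)
  fix D assume D: "D \<in> rcosets N'"
  have "{C \<in> rcosets N. N' <#> C = D \<and> f C \<noteq> \<zero>\<^bsub>k\<^esub>} = {C \<in> rcosets N. C \<subseteq> D \<and> f C \<noteq> \<zero>\<^bsub>k\<^esub>}"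
    using coarser_rcoset_iff[OF assms _ D] by auto
  then show "(\<Oplus>\<^bsub>k\<^esub>C\<in>{C \<in> rcosets N. N' <#> C = D \<and> f C \<noteq> \<zero>\<^bsub>k\<^esub>}. f C)
      = (\<Oplus>\<^bsub>k\<^esub>C\<in>{C \<in> rcosets N. C \<subseteq> D \<and> f C \<noteq> \<zero>\<^bsub>k\<^esub>}. f C)" by simp
qed

lemma cgr_carrier_iff:
  "z \<in> carrier (cgr k G T) \<longleftrightarrow>
     z \<in> (\<Pi>\<^sub>E N\<in>open_normals G T. (rcosets N) \<rightarrow>\<^sub>E carrier k) \<and>
     (\<forall>N\<in>open_normals G T. finite {C \<in> rcosets N. z N C \<noteq> \<zero>\<^bsub>k\<^esub>}) \<and>
     (\<forall>N\<in>open_normals G T. \<forall>N'\<in>open_normals G T. N \<subseteq> N' \<longrightarrow> (\<forall>D\<in>rcosets N'.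
        (\<Oplus>\<^bsub>k\<^esub>C\<in>{C \<in> rcosets N. C \<subseteq> D \<and> z N C \<noteq> \<zero>\<^bsub>k\<^esub>}. z N C) = z N' D))"
  (is "_ \<longleftrightarrow> ?R1 \<and> ?R2 \<and> ?R3")
proof -
  have eq: "group_ring_map k (G Mod N) (G Mod N') (\<lambda>C. N' <#> C) (z N) = z N' \<longleftrightarrow>
      (\<forall>D\<in>rcosets N'. (\<Oplus>\<^bsub>k\<^esub>C\<in>{C \<in> rcosets N. C \<subseteq> D \<and> z N C \<noteq> \<zero>\<^bsub>k\<^esub>}. z N C) = z N' D)"
    if "?R1" "N \<in> open_normals G T" "N' \<in> open_normals G T" "N \<subseteq> N'" for N N'
  proof -
    have "z N' \<in> extensional (rcosets N')" using that by (auto simp: PiE_iff)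
    then show ?thesis
      using group_ring_map_Mod[OF open_normalsD(1)[OF that(2)] open_normalsD(1)[OF that(3)] that(4), of "z N"]
      by (auto simp: fun_eq_iff restrict_def extensional_def)
  qed
  have R1: "?R1 \<and> ?R2 \<longleftrightarrow> z \<in> (\<Pi>\<^sub>E N\<in>open_normals G T. carrier (group_ring k (G Mod N)))"
    by (auto simp: PiE_iff group_ring_simps carrier_Mod)
  show ?thesis
  proof
    assume z: "z \<in> carrier (cgr k G T)"
    then have 1: "?R1 \<and> ?R2" unfolding R1 by (simp add: cgr_def)
    then show "?R1 \<and> ?R2 \<and> ?R3" using z eq by (auto simp: cgr_def)
  next
    assume a: "?R1 \<and> ?R2 \<and> ?R3"
    then have "z \<in> (\<Pi>\<^sub>E N\<in>open_normals G T. carrier (group_ring k (G Mod N)))" using R1 by blast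
    then show "z \<in> carrier (cgr k G T)" using a eq by (simp add: cgr_def)
  qed
qed

lemma cgr_elt_value:
  "N \<in> open_normals G T \<Longrightarrow> C \<in> rcosets N \<Longrightarrow> cgr_elt k G T g N C = (if g \<in> C then \<one>\<^bsub>k\<^esub> else \<zero>\<^bsub>k\<^esub>)"
  by (simp add: cgr_elt_def carrier_Mod)

lemma cgr_elt_support:
  assumes g: "g \<in> carrier G" and N: "N \<in> open_normals G T"
  shows "{C \<in> rcosets N. cgr_elt k G T g N C \<noteq> \<zero>\<^bsub>k\<^esub>} = {N #> g}"
proof -
  interpret N: normal N G by (rule open_normalsD(1)[OF N])
  have "C \<in> rcosets N \<and> cgr_elt k G T g N C \<noteq> \<zero>\<^bsub>k\<^esub> \<longleftrightarrow> C \<in> rcosets N \<and> g \<in> C" for C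
    using N by (cases "g \<in> C") (auto simp: cgr_elt_value)
  moreover have "C \<in> rcosets N \<and> g \<in> C \<longleftrightarrow> C = N #> g" for C
    using N.rcosets_memD(2) N.rcoset_mem[OF g] N.rcoset_in[OF g] by blast
  ultimately show ?thesis by simp
qed

lemma cgr_elt_closed:
  assumes g: "g \<in> carrier G" shows "cgr_elt k G T g \<in> carrier (cgr k G T)"
  unfolding cgr_carrier_iff
proof (intro conjI ballI impI)
  show "cgr_elt k G T g \<in> (\<Pi>\<^sub>E N\<in>open_normals G T. (rcosets N) \<rightarrow>\<^sub>E carrier k)"
    by (auto simp: cgr_elt_def carrier_Mod)
  fix N assume N: "N \<in> open_normals G T"
  interpret N: normal N G by (rule open_normalsD(1)[OF N])
  note single = cgr_elt_support[OF g N]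
  then show "finite {C \<in> rcosets N. cgr_elt k G T g N C \<noteq> \<zero>\<^bsub>k\<^esub>}" by simp
  fix N' D assume N': "N' \<in> open_normals G T" "N \<subseteq> N'" and D: "D \<in> rcosets N'"
  interpret N': normal N' G by (rule open_normalsD(1)[OF N'(1)])
  have "N #> g \<subseteq> D \<longleftrightarrow> g \<in> D"
    using N'.rcosets_memD(2)[OF D, of g] N.rcoset_mem[OF g] rcoset_mono[OF N'(2), of g] by blast
  then have "{C \<in> rcosets N. C \<subseteq> D \<and> cgr_elt k G T g N C \<noteq> \<zero>\<^bsub>k\<^esub>} = (if g \<in> D then {N #> g} else {})"
    using single by auto
  then show "(\<Oplus>\<^bsub>k\<^esub>C\<in>{C \<in> rcosets N. C \<subseteq> D \<and> cgr_elt k G T g N C \<noteq> \<zero>\<^bsub>k\<^esub>}. cgr_elt k G T g N C)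
      = cgr_elt k G T g N' D"
    using N.rcoset_mem[OF g] N.rcoset_in[OF g] N N'(1) D by (simp add: cgr_elt_value K.finsum_insert)
qed

text \<open>Modulo \<open>N\<close> a group element has a single nonzero coefficient, at its own coset; so the
  convolution sums below have one term, and multiplication by a group element is translation.\<close>

lemma cgr_elt_mult_value:
  assumes g: "g \<in> carrier G" and x: "x \<in> carrier G" and z: "z \<in> carrier (cgr k G T)"
    and N: "N \<in> open_normals G T"
  shows "(cgr_elt k G T g \<otimes>\<^bsub>cgr k G T\<^esub> z) N (N #> x) = z N (N #> (inv g \<otimes> x))"
proof -
  interpret N: normal N G by (rule open_normalsD(1)[OF N])
  have zc: "z N C \<in> carrier k" if "C \<in> rcosets N" for C using cgr_value[OF z N] that by auto
  note single = cgr_elt_support[OF g N]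
  have "(cgr_elt k G T g \<otimes>\<^bsub>cgr k G T\<^esub> z) N (N #> x)
      = \<one>\<^bsub>k\<^esub> \<otimes>\<^bsub>k\<^esub> z N (inv\<^bsub>G Mod N\<^esub> (N #> g) <#> (N #> x))"
    using N.rcoset_in[OF x] N g N.rcoset_in[OF g] N.rcoset_mem[OF g] zc
    by (simp add: cgr_simps group_ring_simps carrier_Mod single cgr_elt_value Mod_inv[OF N.normal_axioms]
        N.rcos_sum x N.rcoset_in K.finsum_insert)
  then show ?thesis using zc g x N.rcoset_in
    by (simp add: Mod_inv[OF N.normal_axioms] N.rcos_sum)
qed

lemma cgr_mult_elt_value:
  assumes g: "g \<in> carrier G" and x: "x \<in> carrier G" and z: "z \<in> carrier (cgr k G T)"
    and N: "N \<in> open_normals G T"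
  shows "(z \<otimes>\<^bsub>cgr k G T\<^esub> cgr_elt k G T g) N (N #> x) = z N (N #> (x \<otimes> inv g))"
proof -
  interpret N: normal N G by (rule open_normalsD(1)[OF N])
  have zc: "z N C \<in> carrier k" if "C \<in> rcosets N" for C using cgr_value[OF z N] that by auto
  let ?S = "{C \<in> rcosets N. z N C \<noteq> \<zero>\<^bsub>k\<^esub>}" and ?X = "N #> (x \<otimes> inv g)"
  have fin: "finite ?S" by (rule cgr_value(2)[OF z N])
  have X: "?X \<in> rcosets N" using N.rcoset_in g x by simp
  have elt: "cgr_elt k G T g N (inv\<^bsub>G Mod N\<^esub> C <#> (N #> x)) = (if C = ?X then \<one>\<^bsub>k\<^esub> else \<zero>\<^bsub>k\<^esub>)"
    if C: "C \<in> rcosets N" for C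
  proof -
    obtain c where c: "c \<in> carrier G" "C = N #> c" by (rule N.rcosets_cases[OF C])
    have e: "inv\<^bsub>G Mod N\<^esub> C <#> (N #> x) = N #> (inv c \<otimes> x)"
      using c x by (simp add: Mod_inv[OF N.normal_axioms] N.rcos_sum)
    have "g \<in> N #> (inv c \<otimes> x) \<longleftrightarrow> N #> g = N #> (inv c \<otimes> x)"
      using N.rcosets_eq_iff g c x by simp
    also have "\<dots> \<longleftrightarrow> C = ?X"
    proof
      assume h: "N #> g = N #> (inv c \<otimes> x)"
      have "?X = (N #> x) <#> (N #> inv g)" using g x by (simp add: N.rcos_sum)
      also have "N #> inv g = inv\<^bsub>G Mod N\<^esub> (N #> g)" using g Mod_inv[OF N.normal_axioms] by simp
      also have "\<dots> = N #> inv (inv c \<otimes> x)" unfolding h using c x Mod_inv[OF N.normal_axioms] by simp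
      also have "(N #> x) <#> \<dots> = N #> (x \<otimes> inv (inv c \<otimes> x))" using c x by (simp add: N.rcos_sum)
      also have "x \<otimes> inv (inv c \<otimes> x) = c" using c x
        by (simp add: inv_mult_group m_assoc[symmetric])
      finally show "C = ?X" using c by simp
    next
      assume h: "C = ?X"
      have "N #> (inv c \<otimes> x) = inv\<^bsub>G Mod N\<^esub> C <#> (N #> x)" using e by simp
      also have "\<dots> = (N #> inv (x \<otimes> inv g)) <#> (N #> x)" unfolding h using g x Mod_inv[OF N.normal_axioms] by simp
      also have "\<dots> = N #> (inv (x \<otimes> inv g) \<otimes> x)" using g x by (simp add: N.rcos_sum)
      also have "inv (x \<otimes> inv g) \<otimes> x = g" using g x by (simp add: inv_mult_group m_assoc)
      finally show "N #> g = N #> (inv c \<otimes> x)" by simp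
    qed
    finally show ?thesis unfolding e using N.rcoset_in N c x by (simp add: cgr_elt_value)
  qed
  have "(z \<otimes>\<^bsub>cgr k G T\<^esub> cgr_elt k G T g) N (N #> x)
      = (\<Oplus>\<^bsub>k\<^esub>C\<in>?S. z N C \<otimes>\<^bsub>k\<^esub> cgr_elt k G T g N (inv\<^bsub>G Mod N\<^esub> C <#> (N #> x)))"
    using N.rcoset_in[OF x] N by (simp add: cgr_simps group_ring_simps carrier_Mod)
  also have "\<dots> = (\<Oplus>\<^bsub>k\<^esub>C\<in>?S. if ?X = C then z N C else \<zero>\<^bsub>k\<^esub>)"
    by (rule K.finsum_cong') (use elt zc in auto)
  also have "\<dots> = z N ?X"
  proof (cases "?X \<in> ?S")
    case True
    then show ?thesis using fin zc by (intro K.add.finprod_singleton) auto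
  next
    case False
    then have "(\<Oplus>\<^bsub>k\<^esub>C\<in>?S. if ?X = C then z N C else \<zero>\<^bsub>k\<^esub>) = (\<Oplus>\<^bsub>k\<^esub>C\<in>?S. \<zero>\<^bsub>k\<^esub>)"
      by (intro K.finsum_cong') auto
    then show ?thesis using False X by auto
  qed
  finally show ?thesis .
qed

lemma cgr_elt_one: "cgr_elt k G T \<one> = \<one>\<^bsub>cgr k G T\<^esub>"
proof -
  have "\<one> \<in> C \<longleftrightarrow> C = N" if "N \<in> open_normals G T" "C \<in> rcosets N" for N C
  proof -
    interpret N: normal N G by (rule open_normalsD(1)[OF that(1)])
    have "C = N" if "\<one> \<in> C"
      using N.rcosets_memD(2)[OF \<open>C \<in> rcosets N\<close> that] coset_mult_one[OF N.subset] by simp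
    then show ?thesis using N.one_closed by metis
  qed
  then show ?thesis
    unfolding cgr_elt_def cgr_simps group_ring_simps carrier_Mod
    by (intro restrict_ext) (simp add: carrier_Mod)
qed

lemma cgr_elt_mult:
  assumes g: "g \<in> carrier G" and h: "h \<in> carrier G" and R: "ring (cgr k G T)"
  shows "cgr_elt k G T g \<otimes>\<^bsub>cgr k G T\<^esub> cgr_elt k G T h = cgr_elt k G T (g \<otimes> h)"
proof (rule cgr_eqI)
  interpret R: ring "cgr k G T" by (rule R)
  show "cgr_elt k G T g \<otimes>\<^bsub>cgr k G T\<^esub> cgr_elt k G T h \<in> carrier (cgr k G T)"
    using g h cgr_elt_closed by simp
  show "cgr_elt k G T (g \<otimes> h) \<in> carrier (cgr k G T)" using g h cgr_elt_closed by simp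
  fix N C assume N: "N \<in> open_normals G T" and C: "C \<in> rcosets N"
  interpret N: normal N G by (rule open_normalsD(1)[OF N])
  obtain x where x: "x \<in> carrier G" "C = N #> x" by (rule N.rcosets_cases[OF C])
  have "h \<in> N #> (inv g \<otimes> x) \<longleftrightarrow> g \<otimes> h \<in> N #> x"
  proof -
    have "h \<in> N #> (inv g \<otimes> x) \<longleftrightarrow> N #> h = (N #> inv g) <#> (N #> x)"
      using N.rcosets_eq_iff[of h "inv g \<otimes> x"] g h x by (simp add: N.rcos_sum)
    also have "\<dots> \<longleftrightarrow> (N #> g) <#> (N #> h) = N #> x"
    proof
      assume "N #> h = (N #> inv g) <#> (N #> x)"
      then have "(N #> g) <#> (N #> h) = (N #> g) <#> (N #> (inv g \<otimes> x))" using g x by (simp add: N.rcos_sum)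
      then show "(N #> g) <#> (N #> h) = N #> x" using g x by (simp add: N.rcos_sum m_assoc[symmetric])
    next
      assume "(N #> g) <#> (N #> h) = N #> x"
      then have "(N #> inv g) <#> (N #> x) = (N #> inv g) <#> (N #> (g \<otimes> h))" using g h by (simp add: N.rcos_sum)
      then show "N #> h = (N #> inv g) <#> (N #> x)" using g h by (simp add: N.rcos_sum m_assoc[symmetric])
    qed
    also have "\<dots> \<longleftrightarrow> g \<otimes> h \<in> N #> x" using N.rcosets_eq_iff[of "g \<otimes> h" x] g h x by (simp add: N.rcos_sum)
    finally show ?thesis .
  qed
  then show "(cgr_elt k G T g \<otimes>\<^bsub>cgr k G T\<^esub> cgr_elt k G T h) N C = cgr_elt k G T (g \<otimes> h) N C"
    using cgr_elt_mult_value[OF g x(1) cgr_elt_closed[OF h] N] x g h N N.rcoset_in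
    by (simp add: cgr_elt_value)
qed

end

text \<open>An element of \<open>k[[G]]\<close> is a finitely additive \<open>k\<close>-valued measure on the clopen subsets of
  \<open>G\<close>; this is the measure of a union \<open>D\<close> of cosets of \<open>N\<close>.\<close>

definition cgr_mass :: "'a ring \<Rightarrow> 'g monoid \<Rightarrow> ('g set \<Rightarrow> 'g set \<Rightarrow> 'a) \<Rightarrow> 'g set \<Rightarrow> 'g set \<Rightarrow> 'a" where
  "cgr_mass k G z N D = (\<Oplus>\<^bsub>k\<^esub>C\<in>{C \<in> rcosets\<^bsub>G\<^esub> N. C \<subseteq> D}. z N C)"

definition coset_union :: "('g, 'm) monoid_scheme \<Rightarrow> 'g set \<Rightarrow> 'g set \<Rightarrow> bool" where
  "coset_union G N D \<longleftrightarrow> D \<subseteq> carrier G \<and> (\<forall>x\<in>D. N #>\<^bsub>G\<^esub> x \<subseteq> D)"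

lemma (in group) coset_union_coset:
  assumes "N \<lhd> G" "N' \<lhd> G" "N \<subseteq> N'" "C \<in> rcosets N'" shows "coset_union G N C"
proof -
  interpret N': normal N' G by (rule assms(2))
  show ?thesis unfolding coset_union_def
    using N'.rcosets_memD[OF assms(4)] rcoset_mono[OF assms(3)] by blast
qed

lemma (in group) coset_union_Union:
  assumes N: "N \<lhd> G" and D: "coset_union G N D" shows "\<Union>{C \<in> rcosets N. C \<subseteq> D} = D"
proof -
  interpret N: normal N G by (rule N)
  have "x \<in> \<Union>{C \<in> rcosets N. C \<subseteq> D}" if "x \<in> D" for x
    using that D N.rcoset_mem[of x] N.rcoset_in[of x] by (auto simp: coset_union_def)
  then show ?thesis by auto
qed

locale compact_group_ring = field_and_group k G
  for k :: "'a ring" and G :: "'g monoid" (structure) +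
  fixes T :: "'g topology"
  assumes top_group: "topological_group G T" and compact: "compact_space T"
begin

lemma topspace_eq: "topspace T = carrier G"
  using top_group by (simp add: topological_group_def)

lemma continuous_translation:
  assumes "a \<in> carrier G"
  shows "continuous_map T T (\<lambda>x. x \<otimes> a)" "continuous_map T T (\<lambda>x. a \<otimes> x)"
proof -
  have mc: "continuous_map (prod_topology T T) T (\<lambda>(x, y). x \<otimes> y)"
    using top_group by (simp add: topological_group_def)
  have "continuous_map T (prod_topology T T) (\<lambda>x. (x, a))" "continuous_map T (prod_topology T T) (\<lambda>x. (a, x))"
    using assms topspace_eq by (auto intro!: continuous_map_pairedI)
  from this[THEN continuous_map_compose, OF mc]
  show "continuous_map T T (\<lambda>x. x \<otimes> a)" "continuous_map T T (\<lambda>x. a \<otimes> x)" by (auto simp: o_def)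
qed

lemma openin_translation_preimage:
  assumes "a \<in> carrier G" "openin T N"
  shows "openin T {x \<in> carrier G. x \<otimes> a \<in> N}" "openin T {x \<in> carrier G. a \<otimes> x \<in> N}"
  using continuous_translation[OF assms(1), THEN openin_continuous_map_preimage, OF assms(2)]
  by (simp_all add: topspace_eq)

lemma finite_rcosets:
  assumes N: "N \<in> open_normals G T" shows "finite (rcosets N)"
proof -
  interpret N: normal N G by (rule open_normalsD(1)[OF N])
  have "openin T C" if C: "C \<in> rcosets N" for C
  proof -
    obtain x where x: "x \<in> carrier G" "C = N #> x" by (rule N.rcosets_cases[OF C])
    have "C = {y \<in> carrier G. y \<otimes> inv x \<in> N}"
      using x N.subset by (auto simp: r_coset_def m_assoc intro!: bexI[of _ "_ \<otimes> inv x"])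
    then show ?thesis using openin_translation_preimage(1)[of "inv x" N] open_normalsD(2)[OF N] x by simp
  qed
  moreover have "topspace T \<subseteq> \<Union>(rcosets N)" using topspace_eq rcosets_part_G[OF N.is_subgroup] by simp
  ultimately obtain F where F: "finite F" "F \<subseteq> rcosets N" "topspace T \<subseteq> \<Union>F"
    using compact unfolding compact_space_alt by meson
  have "C \<in> F" if C: "C \<in> rcosets N" for C
  proof -
    obtain x where x: "x \<in> carrier G" "C = N #> x" by (rule N.rcosets_cases[OF C])
    then obtain D where D: "D \<in> F" "x \<in> D" using F(3) topspace_eq by auto
    then have "C = D" using N.rcosets_disj[of C D x] C F(2) x N.rcoset_mem by blast
    then show ?thesis using D by simp
  qed
  then show ?thesis using F(1) by (metis finite_subset subsetI)
qed

lemma open_normals_Int: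
  assumes "N \<in> open_normals G T" "N' \<in> open_normals G T" shows "N \<inter> N' \<in> open_normals G T"
  using assms by (auto simp: open_normals_def intro: normal_subgroup_intersect)

lemma cgr_value_closed:
  "z \<in> carrier (cgr k G T) \<Longrightarrow> N \<in> open_normals G T \<Longrightarrow> C \<in> rcosets N \<Longrightarrow> z N C \<in> carrier k"
  using cgr_value(1)[of z k G T N] by auto

lemma finsum_support:
  assumes "finite A" "f \<in> A \<rightarrow> carrier k"
  shows "(\<Oplus>\<^bsub>k\<^esub>x\<in>{x \<in> A. f x \<noteq> \<zero>\<^bsub>k\<^esub>}. f x) = (\<Oplus>\<^bsub>k\<^esub>x\<in>A. f x)"
  using assms by (intro K.add.finprod_mono_neutral_cong_left) auto

lemma cgr_mass_coset:
  assumes z: "z \<in> carrier (cgr k G T)" and N: "N \<in> open_normals G T" "N' \<in> open_normals G T" "N \<subseteq> N'"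
    and D: "D \<in> rcosets N'"
  shows "cgr_mass k G z N D = z N' D"
proof -
  have "z N' D = (\<Oplus>\<^bsub>k\<^esub>C\<in>{C \<in> {C \<in> rcosets N. C \<subseteq> D}. z N C \<noteq> \<zero>\<^bsub>k\<^esub>}. z N C)"
    using z N D unfolding cgr_carrier_iff by (simp add: conj_assoc)
  also have "\<dots> = cgr_mass k G z N D" unfolding cgr_mass_def
    using finite_rcosets[OF N(1)] cgr_value_closed[OF z N(1)] by (intro finsum_support) auto
  finally show ?thesis by simp
qed

text \<open>As the quotients are finite, an element of the inverse limit is a family of functions on cosets
  whose values are consistent with their masses.\<close>

lemma cgr_carrierI:
  assumes "z \<in> extensional (open_normals G T)"
    and "\<And>N. N \<in> open_normals G T \<Longrightarrow> z N \<in> (rcosets N) \<rightarrow>\<^sub>E carrier k"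
    and "\<And>N N' D. N \<in> open_normals G T \<Longrightarrow> N' \<in> open_normals G T \<Longrightarrow> N \<subseteq> N' \<Longrightarrow> D \<in> rcosets N' \<Longrightarrow>
      cgr_mass k G z N D = z N' D"
  shows "z \<in> carrier (cgr k G T)"
  unfolding cgr_carrier_iff
proof (intro conjI ballI impI)
  show "z \<in> (\<Pi>\<^sub>E N\<in>open_normals G T. (rcosets N) \<rightarrow>\<^sub>E carrier k)" using assms by (auto simp: PiE_iff)
  fix N assume N: "N \<in> open_normals G T"
  show "finite {C \<in> rcosets N. z N C \<noteq> \<zero>\<^bsub>k\<^esub>}" using finite_rcosets[OF N] by simp
  fix N' D assume *: "N' \<in> open_normals G T" "N \<subseteq> N'" "D \<in> rcosets N'"
  have "(\<Oplus>\<^bsub>k\<^esub>C\<in>{C \<in> {C \<in> rcosets N. C \<subseteq> D}. z N C \<noteq> \<zero>\<^bsub>k\<^esub>}. z N C) = cgr_mass k G z N D"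
    unfolding cgr_mass_def using finite_rcosets[OF N] assms(2)[OF N] by (intro finsum_support) auto
  then show "(\<Oplus>\<^bsub>k\<^esub>C\<in>{C \<in> rcosets N. C \<subseteq> D \<and> z N C \<noteq> \<zero>\<^bsub>k\<^esub>}. z N C) = z N' D"
    using assms(3)[OF N *] by (simp add: conj_assoc)
qed

lemma cgr_mass_closed:
  assumes "z \<in> carrier (cgr k G T)" "N \<in> open_normals G T" shows "cgr_mass k G z N D \<in> carrier k"
  unfolding cgr_mass_def using cgr_value_closed[OF assms] by (intro K.finsum_closed) auto

lemma coset_union_Int: "coset_union G N C \<Longrightarrow> coset_union G N D \<Longrightarrow> coset_union G N (C \<inter> D)"
  by (auto simp: coset_union_def)

lemma cgr_mass_UN:
  assumes z: "z \<in> carrier (cgr k G T)" and N: "N \<in> open_normals G T"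
    and fin: "finite I" and cu: "\<And>i. i \<in> I \<Longrightarrow> coset_union G N (D i)"
    and disj: "\<And>i j. i \<in> I \<Longrightarrow> j \<in> I \<Longrightarrow> i \<noteq> j \<Longrightarrow> D i \<inter> D j = {}"
  shows "cgr_mass k G z N (\<Union>i\<in>I. D i) = (\<Oplus>\<^bsub>k\<^esub>i\<in>I. cgr_mass k G z N (D i))"
proof -
  interpret N: normal N G by (rule open_normalsD(1)[OF N])
  have "{C \<in> rcosets N. C \<subseteq> (\<Union>i\<in>I. D i)} = (\<Union>i\<in>I. {C \<in> rcosets N. C \<subseteq> D i})"
  proof (rule subset_antisym; rule subsetI)
    fix C assume C: "C \<in> {C \<in> rcosets N. C \<subseteq> (\<Union>i\<in>I. D i)}"
    obtain x where x: "x \<in> carrier G" "C = N #> x" using C by (auto elim: N.rcosets_cases)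
    then have "x \<in> (\<Union>i\<in>I. D i)" using C N.rcoset_mem by blast
    then obtain i where "i \<in> I" "x \<in> D i" by blast
    then have "C \<subseteq> D i" using cu[of i] x by (auto simp: coset_union_def)
    then show "C \<in> (\<Union>i\<in>I. {C \<in> rcosets N. C \<subseteq> D i})" using C \<open>i \<in> I\<close> by blast
  qed auto
  moreover have "(\<Oplus>\<^bsub>k\<^esub>C\<in>(\<Union>i\<in>I. {C \<in> rcosets N. C \<subseteq> D i}). z N C) = (\<Oplus>\<^bsub>k\<^esub>i\<in>I. cgr_mass k G z N (D i))"
    unfolding cgr_mass_def
  proof (rule K.add.finprod_UN_disjoint)
    show "pairwise (\<lambda>i j. disjnt {C \<in> rcosets N. C \<subseteq> D i} {C \<in> rcosets N. C \<subseteq> D j}) I"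
    proof (rule pairwiseI)
      fix i j assume ij: "i \<in> I" "j \<in> I" "i \<noteq> j"
      have False if C: "C \<in> rcosets N" "C \<subseteq> D i" "C \<subseteq> D j" for C
      proof -
        obtain x where x: "x \<in> carrier G" "C = N #> x" using C by (auto elim: N.rcosets_cases)
        then have "x \<in> D i \<inter> D j" using C N.rcoset_mem by blast
        then show False using disj[OF ij] by simp
      qed
      then show "disjnt {C \<in> rcosets N. C \<subseteq> D i} {C \<in> rcosets N. C \<subseteq> D j}" by (auto simp: disjnt_def)
    qed
  qed (use fin finite_rcosets[OF N] cgr_value_closed[OF z N] in auto)
  ultimately show ?thesis by (simp add: cgr_mass_def)
qed

lemma cgr_mass_empty:
  assumes "N \<in> open_normals G T" shows "cgr_mass k G z N {} = \<zero>\<^bsub>k\<^esub>"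
proof -
  interpret N: normal N G by (rule open_normalsD(1)[OF assms])
  have none: "{C \<in> rcosets N. C \<subseteq> {}} = {}" using N.rcoset_mem by (auto elim!: N.rcosets_cases)
  show ?thesis unfolding cgr_mass_def none by simp
qed

text \<open>Passing to a smaller subgroup splits every coset into cosets of total equal mass; hence the mass
  does not depend on the subgroup used to compute it.\<close>

lemma cgr_mass_refine:
  assumes z: "z \<in> carrier (cgr k G T)" and N: "N \<in> open_normals G T" "N' \<in> open_normals G T" "N \<subseteq> N'"
    and D: "coset_union G N' D"
  shows "cgr_mass k G z N D = cgr_mass k G z N' D"
proof -
  interpret N': normal N' G by (rule open_normalsD(1)[OF N(2)])
  let ?I = "{C \<in> rcosets N'. C \<subseteq> D}"
  have "cgr_mass k G z N (\<Union>C\<in>?I. C) = (\<Oplus>\<^bsub>k\<^esub>C\<in>?I. cgr_mass k G z N C)"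
  proof (rule cgr_mass_UN[OF z N(1)])
    show "finite ?I" using finite_rcosets[OF N(2)] by simp
    show "coset_union G N C" if "C \<in> ?I" for C
      using that coset_union_coset[OF N(1,2)[THEN open_normalsD(1)] N(3)] by auto
    show "C \<inter> C' = {}" if "C \<in> ?I" "C' \<in> ?I" "C \<noteq> C'" for C C'
      using that N'.rcosets_disj by blast
  qed
  also have "\<dots> = cgr_mass k G z N' D" unfolding cgr_mass_def[of _ _ _ N']
    by (rule K.finsum_cong') (use cgr_mass_coset[OF z N] cgr_value_closed[OF z N(2)] in auto)
  finally show ?thesis using coset_union_Union[OF N'.normal_axioms D] by simp
qed

lemma cgr_mass_independent:
  assumes z: "z \<in> carrier (cgr k G T)" and N: "N \<in> open_normals G T" "N' \<in> open_normals G T"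
    and D: "coset_union G N D" "coset_union G N' D"
  shows "cgr_mass k G z N D = cgr_mass k G z N' D"
  using cgr_mass_refine[OF z open_normals_Int[OF N] N(1) _ D(1)]
    cgr_mass_refine[OF z open_normals_Int[OF N] N(2) _ D(2)] by simp

end

lemma restricted_rcosets: "rcosets\<^bsub>G\<lparr>carrier := L\<rparr>\<^esub> M = {M #>\<^bsub>G\<^esub> h |h. h \<in> L}"
  by (auto simp: RCOSETS_def r_coset_def)

context field_and_group
begin

lemma open_normals_restrict:
  assumes "subgroup L G" "N \<in> open_normals G T"
  shows "N \<inter> L \<in> open_normals (G\<lparr>carrier := L\<rparr>) (subtopology T L)"
  using assms normal_Int_subgroup[OF assms(1)] unfolding open_normals_def
  by (auto simp: openin_subtopology_Int)

lemma rcoset_Int_subgroup: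
  assumes L: "subgroup L G" and N: "N \<subseteq> carrier G" and h: "h \<in> L"
  shows "(N #> h) \<inter> L = (N \<inter> L) #> h"
proof (rule subset_antisym; rule subsetI)
  interpret L: subgroup L G by (rule L)
  fix y assume "y \<in> (N #> h) \<inter> L"
  then obtain n where n: "n \<in> N" "y = n \<otimes> h" "n \<otimes> h \<in> L" by (auto simp: r_coset_def)
  have "n = (n \<otimes> h) \<otimes> inv h" using h n N by (simp add: m_assoc subset_iff)
  then have "n \<in> L" using n(3) h L.m_closed L.m_inv_closed by metis
  then show "y \<in> (N \<inter> L) #> h" using n by (auto simp: r_coset_def)
qed (use h L in \<open>auto simp: r_coset_def subgroup.m_closed\<close>)

text \<open>The map \<open>L/(N \<inter> L) \<rightarrow> G/N\<close> is injective: the only possible preimage of a coset is its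
  intersection with \<open>L\<close>. So the sums that define the embedding of \<open>k[[L]]\<close> have at most one term.\<close>

lemma coset_Int_subgroup_iff:
  assumes L: "subgroup L G" and N: "N \<lhd> G" and C: "C \<in> rcosets N"
  shows "q \<in> rcosets\<^bsub>G\<lparr>carrier := L\<rparr>\<^esub> (N \<inter> L) \<and> N <#> q = C \<longleftrightarrow> C \<inter> L \<noteq> {} \<and> q = C \<inter> L"
proof -
  interpret L: subgroup L G by (rule L)
  interpret N: normal N G by (rule N)
  have NL: "subgroup (N \<inter> L) G" by (rule subgroups_Inter_pair[OF N.is_subgroup L])
  have mult: "N <#> ((N \<inter> L) #> h) = N #> h" if "h \<in> L" for h
    using set_mult_rcoset[OF NL N.is_subgroup _ L.mem_carrier[OF that]] by simp
  have Int: "(N #> h) \<inter> L = (N \<inter> L) #> h" if "h \<in> L" for h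
    by (rule rcoset_Int_subgroup[OF L N.subset that])
  show ?thesis
  proof
    assume "q \<in> rcosets\<^bsub>G\<lparr>carrier := L\<rparr>\<^esub> (N \<inter> L) \<and> N <#> q = C"
    then obtain h where h: "h \<in> L" "q = (N \<inter> L) #> h" "N <#> q = C" by (auto simp: restricted_rcosets)
    then have "C = N #> h" using mult by simp
    then show "C \<inter> L \<noteq> {} \<and> q = C \<inter> L" using Int h N.rcoset_mem[of h] by auto
  next
    assume q: "C \<inter> L \<noteq> {} \<and> q = C \<inter> L"
    then obtain h where h: "h \<in> C" "h \<in> L" by auto
    then have "C = N #> h" using N.rcosets_memD(2)[OF C] by blast
    then show "q \<in> rcosets\<^bsub>G\<lparr>carrier := L\<rparr>\<^esub> (N \<inter> L) \<and> N <#> q = C"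
      using q h mult Int by (auto simp: restricted_rcosets)
  qed
qed

lemma cgr_incl_value:
  assumes L: "subgroup L G" and N: "N \<in> open_normals G T" and C: "C \<in> rcosets N"
    and x: "x (N \<inter> L) \<in> (rcosets\<^bsub>G\<lparr>carrier := L\<rparr>\<^esub> (N \<inter> L)) \<rightarrow> carrier k"
  shows "cgr_incl k G T L x N C = (if C \<inter> L = {} then \<zero>\<^bsub>k\<^esub> else x (N \<inter> L) (C \<inter> L))"
proof -
  note iff = coset_Int_subgroup_iff[OF L open_normalsD(1)[OF N] C]
  have "cgr_incl k G T L x N C
      = (\<Oplus>\<^bsub>k\<^esub>q\<in>{q. (q \<in> rcosets\<^bsub>G\<lparr>carrier := L\<rparr>\<^esub> (N \<inter> L) \<and> N <#> q = C) \<and> x (N \<inter> L) q \<noteq> \<zero>\<^bsub>k\<^esub>}. x (N \<inter> L) q)"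
    using N C by (simp add: cgr_incl_def group_ring_map_def carrier_Mod conj_assoc)
  also have "\<dots> = (if C \<inter> L = {} then \<zero>\<^bsub>k\<^esub> else x (N \<inter> L) (C \<inter> L))"
  proof (cases "C \<inter> L = {} \<or> x (N \<inter> L) (C \<inter> L) = \<zero>\<^bsub>k\<^esub>")
    case True
    then have none: "{q. (q \<in> rcosets\<^bsub>G\<lparr>carrier := L\<rparr>\<^esub> (N \<inter> L) \<and> N <#> q = C) \<and> x (N \<inter> L) q \<noteq> \<zero>\<^bsub>k\<^esub>} = {}"
      unfolding iff by auto
    show ?thesis unfolding none using True by auto
  next
    case False
    then have single: "{q. (q \<in> rcosets\<^bsub>G\<lparr>carrier := L\<rparr>\<^esub> (N \<inter> L) \<and> N <#> q = C) \<and> x (N \<inter> L) q \<noteq> \<zero>\<^bsub>k\<^esub>} = {C \<inter> L}"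
      unfolding iff by auto
    have "C \<inter> L \<in> rcosets\<^bsub>G\<lparr>carrier := L\<rparr>\<^esub> (N \<inter> L)" using iff[of "C \<inter> L"] False by blast
    then have "x (N \<inter> L) (C \<inter> L) \<in> carrier k" using x by blast
    then show ?thesis unfolding single using False by simp
  qed
  finally show ?thesis .
qed

lemma cgr_incl_extensional:
  "cgr_incl k G T L x \<in> extensional (open_normals G T)"
  "N \<in> open_normals G T \<Longrightarrow> cgr_incl k G T L x N \<in> extensional (rcosets N)"
  by (simp_all add: cgr_incl_def group_ring_map_def carrier_Mod)

lemma cgr_elt_in_cgr_sub:
  assumes L: "subgroup L G" and h: "h \<in> L"
  shows "cgr_elt k G T h \<in> carrier (cgr_sub k G T L)"
proof -
  let ?L = "G\<lparr>carrier := L\<rparr>" and ?TL = "subtopology T L"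
  interpret L: group ?L by (rule subgroup.subgroup_is_group[OF L group_axioms])
  interpret KL: field_and_group k ?L by unfold_locales
  have c: "cgr_elt k ?L ?TL h \<in> carrier (cgr k ?L ?TL)" using h KL.cgr_elt_closed by simp
  have "cgr_elt k G T h = cgr_incl k G T L (cgr_elt k ?L ?TL h)"
  proof (rule extensionalityI[of _ "open_normals G T"])
    fix N assume N: "N \<in> open_normals G T"
    show "cgr_elt k G T h N = cgr_incl k G T L (cgr_elt k ?L ?TL h) N"
    proof (rule extensionalityI[of _ "rcosets N"])
      fix C assume C: "C \<in> rcosets N"
      have NL: "N \<inter> L \<in> open_normals ?L ?TL" by (rule open_normals_restrict[OF L N])
      have "cgr_elt k ?L ?TL h (N \<inter> L) \<in> (rcosets\<^bsub>?L\<^esub> (N \<inter> L)) \<rightarrow> carrier k"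
        using cgr_value(1)[OF c NL] by auto
      moreover have "C \<inter> L \<noteq> {} \<Longrightarrow> C \<inter> L \<in> rcosets\<^bsub>?L\<^esub> (N \<inter> L)"
        using coset_Int_subgroup_iff[OF L open_normalsD(1)[OF N] C, of "C \<inter> L"] by blast
      ultimately show "cgr_elt k G T h N C = cgr_incl k G T L (cgr_elt k ?L ?TL h) N C"
        using h KL.cgr_elt_value[OF NL] by (auto simp: cgr_incl_value[OF L N C] cgr_elt_value[OF N C])
    qed (use N cgr_incl_extensional in \<open>auto simp: cgr_elt_def carrier_Mod\<close>)
  qed (use cgr_incl_extensional in \<open>auto simp: cgr_elt_def\<close>)
  then show ?thesis using c by (simp add: cgr_sub_def)
qed

end

text \<open>An open normal subgroup of \<open>H\<close> contains an open normal subgroup of \<open>G\<close>: it has finitely many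
  conjugates because \<open>H\<close> has finite index.\<close>

lemma (in compact_group_ring) open_normal_core:
  assumes H: "H \<lhd> G" "openin T H" and M: "M \<in> open_normals (G\<lparr>carrier := H\<rparr>) (subtopology T H)"
  obtains N where "N \<in> open_normals G T" "N \<subseteq> M"
proof -
  interpret H: normal H G by (rule H(1))
  have MH: "M \<lhd> G\<lparr>carrier := H\<rparr>" and Mo: "openin T M"
    using M H(2) by (auto simp: open_normals_def intro: openin_trans_full)
  have Ms: "subgroup M G"
    using incl_subgroup[OF H.is_subgroup normal_imp_subgroup[OF MH]] .
  interpret M: subgroup M G by (rule Ms)
  have MsH: "M \<subseteq> H" using normal_imp_subgroup[OF MH] subgroup.subset by fastforce
  have MinvH: "h \<otimes> m \<otimes> inv h \<in> M" if "h \<in> H" "m \<in> M" for h m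
    using normal.inv_op_closed2[OF MH, of h m] that
      m_inv_consistent[OF H.is_subgroup that(1)] by simp
  \<comment> \<open>\<open>cj g\<close> is the conjugate \<open>g\<^sup>-\<^sup>1 M g\<close>.\<close>
  define cj where "cj g = {x \<in> carrier G. g \<otimes> x \<otimes> inv g \<in> M}" for g
  have cjo: "openin T (cj g)" if g: "g \<in> carrier G" for g
  proof -
    have "cj g = {x \<in> carrier G. g \<otimes> x \<in> {y \<in> carrier G. y \<otimes> inv g \<in> M}}"
      using g by (auto simp: cj_def)
    then show ?thesis
      using openin_translation_preimage(2)[OF g openin_translation_preimage(1)[OF inv_closed[OF g] Mo]]
      by simp
  qed
  have cjH: "cj (h \<otimes> g) = cj g" if h: "h \<in> H" and g: "g \<in> carrier G" for h g
  proof -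
    have hG: "h \<in> carrier G" using h by simp
    have "h \<otimes> g \<otimes> x \<otimes> inv (h \<otimes> g) \<in> M \<longleftrightarrow> g \<otimes> x \<otimes> inv g \<in> M" if x: "x \<in> carrier G" for x
    proof -
      let ?y = "g \<otimes> x \<otimes> inv g"
      have e: "h \<otimes> g \<otimes> x \<otimes> inv (h \<otimes> g) = h \<otimes> ?y \<otimes> inv h"
        using hG g x by (simp add: inv_mult_group m_assoc)
      have yG: "?y \<in> carrier G" using g x by simp
      have "inv h \<otimes> (h \<otimes> ?y \<otimes> inv h) = ?y \<otimes> inv h"
        using hG yG by (metis inv_closed m_assoc m_closed l_inv l_one)
      moreover have "?y \<otimes> inv h \<otimes> inv (inv h) = ?y"
        using hG yG by (metis inv_closed m_assoc r_inv r_one)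
      ultimately have "?y = inv h \<otimes> (h \<otimes> ?y \<otimes> inv h) \<otimes> inv (inv h)" by simp
      then show ?thesis unfolding e using MinvH[of h ?y] MinvH[of "inv h" "h \<otimes> ?y \<otimes> inv h"] h H.m_inv_closed
        by metis
    qed
    then show ?thesis by (auto simp: cj_def)
  qed
  have fin: "finite (cj ` carrier G)"
  proof -
    have "H \<in> open_normals G T" using H by (simp add: open_normals_def)
    then have "finite (rcosets H)" by (rule finite_rcosets)
    moreover have "cj ` carrier G \<subseteq> (\<lambda>C. cj (SOME g. g \<in> C)) ` (rcosets H)"
    proof
      fix X assume "X \<in> cj ` carrier G"
      then obtain g where g: "g \<in> carrier G" "X = cj g" by auto
      let ?s = "SOME s. s \<in> H #> g"
      have "?s \<in> H #> g" using H.rcoset_mem[OF g(1)] by (metis someI)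
      then obtain h where "h \<in> H" "?s = h \<otimes> g" unfolding r_coset_def by blast
      then have "X = cj ?s" using cjH g by simp
      then show "X \<in> (\<lambda>C. cj (SOME g. g \<in> C)) ` (rcosets H)" using H.rcoset_in[OF g(1)] by blast
    qed
    ultimately show ?thesis by (meson finite_surj)
  qed
  define N where "N = (\<Inter>g\<in>carrier G. cj g)"
  have No: "openin T N" unfolding N_def
    by (rule openin_Inter) (use fin cjo in auto)
  have cjs: "subgroup (cj g) G" if g: "g \<in> carrier G" for g
  proof (rule subgroupI)
    show "cj g \<subseteq> carrier G" by (auto simp: cj_def)
    have "\<one> \<in> cj g" using g by (simp add: cj_def)
    then show "cj g \<noteq> {}" by auto
    fix a assume a: "a \<in> cj g"
    have "g \<otimes> inv a \<otimes> inv g = inv (g \<otimes> a \<otimes> inv g)"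
      using a g by (simp add: cj_def inv_mult_group m_assoc)
    then show "inv a \<in> cj g" using a g by (simp add: cj_def)
    fix b assume b: "b \<in> cj g"
    have "g \<otimes> (a \<otimes> b) \<otimes> inv g = (g \<otimes> a \<otimes> inv g) \<otimes> (g \<otimes> b \<otimes> inv g)"
    proof -
      have "inv g \<otimes> (g \<otimes> (b \<otimes> inv g)) = b \<otimes> inv g"
        using b g by (simp add: cj_def m_assoc[symmetric])
      then show ?thesis using a b g by (simp add: cj_def m_assoc)
    qed
    then show "a \<otimes> b \<in> cj g" using a b g by (simp add: cj_def)
  qed
  have "subgroup N G" unfolding N_def
    by (rule subgroups_Inter) (use cjs in auto)
  moreover have "g \<otimes> n \<otimes> inv g \<in> N" if g: "g \<in> carrier G" and n: "n \<in> N" for g n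
  proof -
    have nG: "n \<in> carrier G" using n by (auto simp: N_def cj_def)
    have "g \<otimes> n \<otimes> inv g \<in> cj x" if x: "x \<in> carrier G" for x
    proof -
      have "x \<otimes> (g \<otimes> n \<otimes> inv g) \<otimes> inv x = (x \<otimes> g) \<otimes> n \<otimes> inv (x \<otimes> g)"
        using nG g x by (simp add: inv_mult_group m_assoc)
      moreover have "n \<in> cj (x \<otimes> g)" using n x g by (simp add: N_def)
      ultimately show ?thesis using nG g x by (simp add: cj_def)
    qed
    then show ?thesis by (simp add: N_def)
  qed
  ultimately have "N \<lhd> G" using normal_inv_iff by blast
  moreover have "N \<subseteq> M"
  proof
    fix n assume "n \<in> N"
    then have "n \<in> cj \<one>" by (simp add: N_def)
    then show "n \<in> M" by (auto simp: cj_def)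
  qed
  ultimately show ?thesis using that No by (simp add: open_normals_def)
qed

context compact_group_ring
begin

text \<open>Compatibility of the image at \<open>N \<subseteq> N'\<close> is compatibility at \<open>N \<inter> H \<subseteq> N' \<inter> H\<close>, transported
  along the bijection \<open>C \<mapsto> C \<inter> H\<close> from the cosets of \<open>N\<close> that meet \<open>H\<close>.\<close>

lemma cgr_incl_closed:
  assumes H: "H \<lhd> G" and x: "x \<in> carrier (cgr k (G\<lparr>carrier := H\<rparr>) (subtopology T H))"
  shows "cgr_incl k G T H x \<in> carrier (cgr k G T)"
proof (rule cgr_carrierI)
  let ?H = "G\<lparr>carrier := H\<rparr>" and ?TH = "subtopology T H"
  interpret H: normal H G by (rule H)
  interpret HG: group ?H by (rule subgroup.subgroup_is_group[OF H.is_subgroup group_axioms])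
  interpret KH: field_and_group k ?H by unfold_locales
  show "cgr_incl k G T H x \<in> extensional (open_normals G T)" by (rule cgr_incl_extensional)
  have xv: "x (N \<inter> H) \<in> (rcosets\<^bsub>?H\<^esub> (N \<inter> H)) \<rightarrow> carrier k" if "N \<in> open_normals G T" for N
    using cgr_value(1)[OF x open_normals_restrict[OF H.is_subgroup that]] by auto
  have incl: "cgr_incl k G T H x N C = (if C \<inter> H = {} then \<zero>\<^bsub>k\<^esub> else x (N \<inter> H) (C \<inter> H))"
    if "N \<in> open_normals G T" "C \<in> rcosets N" for N C
    by (rule cgr_incl_value[where x = x, OF H.is_subgroup that xv[OF that(1)]])
  have Int: "C \<inter> H \<in> rcosets\<^bsub>?H\<^esub> (N \<inter> H)"
    if "N \<in> open_normals G T" "C \<in> rcosets N" "C \<inter> H \<noteq> {}" for N C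
    using coset_Int_subgroup_iff[OF H.is_subgroup open_normalsD(1)[OF that(1)] that(2)] that(3) by blast
  show val: "cgr_incl k G T H x N \<in> (rcosets N) \<rightarrow>\<^sub>E carrier k" if N: "N \<in> open_normals G T" for N
  proof (rule PiE_I)
    fix C assume C: "C \<in> rcosets N"
    show "cgr_incl k G T H x N C \<in> carrier k"
    proof (cases "C \<inter> H = {}")
      case False
      then show ?thesis using incl[OF N C] Int[OF N C] xv[OF N] by auto
    qed (simp add: incl[OF N C])
  qed (use cgr_incl_extensional(2)[OF N] in \<open>auto simp: extensional_def\<close>)
  fix N N' D assume N: "N \<in> open_normals G T" "N' \<in> open_normals G T" "N \<subseteq> N'" and D: "D \<in> rcosets N'"
  interpret N: normal N G by (rule open_normalsD(1)[OF N(1)])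
  interpret N': normal N' G by (rule open_normalsD(1)[OF N(2)])
  let ?A = "{C \<in> rcosets N. C \<subseteq> D}" and ?B = "{E \<in> rcosets\<^bsub>?H\<^esub> (N \<inter> H). E \<subseteq> D \<inter> H}"
  let ?AH = "{C \<in> ?A. C \<inter> H \<noteq> {}}"
  have finA: "finite ?A" using finite_rcosets[OF N(1)] by simp
  have "cgr_mass k G (cgr_incl k G T H x) N D = (\<Oplus>\<^bsub>k\<^esub>C\<in>?AH. x (N \<inter> H) (C \<inter> H))"
    unfolding cgr_mass_def
    using finA val[OF N(1)] incl[OF N(1)] xv[OF N(1)] Int[OF N(1)]
    by (intro K.add.finprod_mono_neutral_cong_right) auto
  also have "\<dots> = (\<Oplus>\<^bsub>k\<^esub>E\<in>(\<lambda>C. C \<inter> H) ` ?AH. x (N \<inter> H) E)"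
  proof (rule K.finsum_reindex[symmetric])
    show "x (N \<inter> H) \<in> (\<lambda>C. C \<inter> H) ` ?AH \<rightarrow> carrier k" using xv[OF N(1)] Int[OF N(1)] by auto
    show "inj_on (\<lambda>C. C \<inter> H) ?AH"
    proof (rule inj_onI)
      fix C C' assume "C \<in> ?AH" "C' \<in> ?AH" "C \<inter> H = C' \<inter> H"
      then show "C = C'" using N.rcosets_disj[of C C'] by blast
    qed
  qed
  also have B_eq: "(\<lambda>C. C \<inter> H) ` ?AH = ?B"
  proof (rule subset_antisym; rule subsetI)
    fix E assume E: "E \<in> ?B"
    then obtain h where h: "h \<in> H" "E = (N \<inter> H) #> h" by (auto simp: restricted_rcosets)
    then have Eh: "E = (N #> h) \<inter> H" using rcoset_Int_subgroup[OF H.is_subgroup N.subset] by simp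
    have hE: "h \<in> E" using Eh h N.rcoset_mem[of h] by simp
    then have "h \<in> D" using E by blast
    from N'.rcosets_memD(2)[OF D this] have "N #> h \<subseteq> D" using rcoset_mono[OF N(3), of h] by simp
    moreover have "N #> h \<in> rcosets N" using N.rcoset_in h(1) by simp
    ultimately have "N #> h \<in> ?AH" using Eh hE by auto
    then show "E \<in> (\<lambda>C. C \<inter> H) ` ?AH" using Eh by (rule image_eqI[rotated])
  next
    fix E assume "E \<in> (\<lambda>C. C \<inter> H) ` ?AH"
    then obtain C where C: "C \<in> rcosets N" "C \<subseteq> D" "C \<inter> H \<noteq> {}" "E = C \<inter> H" by blast
    then show "E \<in> ?B" using Int[OF N(1) C(1,3)] by auto
  qed
  also have "(\<Oplus>\<^bsub>k\<^esub>E\<in>?B. x (N \<inter> H) E) = cgr_incl k G T H x N' D"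
  proof (cases "D \<inter> H = {}")
    case True
    have "E \<notin> ?B" for E
    proof
      assume E: "E \<in> ?B"
      then obtain h where h: "h \<in> H" "E = (N \<inter> H) #> h" by (auto simp: restricted_rcosets)
      then have "h \<in> (N #> h) \<inter> H" using N.rcoset_mem[of h] by simp
      then show False using E True h rcoset_Int_subgroup[OF H.is_subgroup N.subset h(1)] by blast
    qed
    then have none: "?B = {}" by blast
    show ?thesis unfolding none using True incl[OF N(2) D] by simp
  next
    case False
    have "finite ?AH" using finA by (rule rev_finite_subset) blast
    then have fin: "finite ?B" by (rule finite_subset[OF equalityD2[OF B_eq] finite_imageI])
    have "x (N' \<inter> H) (D \<inter> H)
        = (\<Oplus>\<^bsub>k\<^esub>E\<in>{E \<in> rcosets\<^bsub>?H\<^esub> (N \<inter> H). E \<subseteq> D \<inter> H \<and> x (N \<inter> H) E \<noteq> \<zero>\<^bsub>k\<^esub>}. x (N \<inter> H) E)"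
      by (rule KH.cgr_carrier_iff[THEN iffD1, OF x, THEN conjunct2, THEN conjunct2, rule_format,
            OF open_normals_restrict[OF H.is_subgroup N(1)] open_normals_restrict[OF H.is_subgroup N(2)]
              Int_mono[OF N(3) order_refl] Int[OF N(2) D False], symmetric])
    also have "\<dots> = (\<Oplus>\<^bsub>k\<^esub>E\<in>{E \<in> ?B. x (N \<inter> H) E \<noteq> \<zero>\<^bsub>k\<^esub>}. x (N \<inter> H) E)" by (simp add: conj_assoc)
    also have "\<dots> = (\<Oplus>\<^bsub>k\<^esub>E\<in>?B. x (N \<inter> H) E)"
      using fin xv[OF N(1)] by (intro finsum_support) auto
    finally show ?thesis using False incl[OF N(2) D] by simp
  qed
  finally show "cgr_mass k G (cgr_incl k G T H x) N D = cgr_incl k G T H x N' D" .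
qed

text \<open>A measure \<open>z\<close> supported on \<open>H\<close> comes from the measure on \<open>H\<close> that gives \<open>D\<close> the mass of \<open>D\<close>
  under \<open>z\<close>, computed with an open normal subgroup of \<open>G\<close> fine enough for \<open>D\<close>.\<close>

lemma cgr_supported_in_image:
  assumes H: "H \<lhd> G" "openin T H" and z: "z \<in> carrier (cgr k G T)"
    and supp: "\<And>N C. N \<in> open_normals G T \<Longrightarrow> C \<in> rcosets N \<Longrightarrow> C \<inter> H = {} \<Longrightarrow> z N C = \<zero>\<^bsub>k\<^esub>"
  shows "z \<in> carrier (cgr_sub k G T H)"
proof -
  let ?H = "G\<lparr>carrier := H\<rparr>" and ?TH = "subtopology T H"
  interpret H: normal H G by (rule H)
  interpret HG: group ?H by (rule subgroup.subgroup_is_group[OF H.is_subgroup group_axioms])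
  interpret KH: field_and_group k ?H by unfold_locales
  have "\<forall>M\<in>open_normals ?H ?TH. \<exists>N. N \<in> open_normals G T \<and> N \<subseteq> M"
  proof
    fix M assume "M \<in> open_normals ?H ?TH"
    then show "\<exists>N. N \<in> open_normals G T \<and> N \<subseteq> M" using open_normal_core[OF H] by blast
  qed
  from bchoice[OF this] obtain core
    where core: "\<And>M. M \<in> open_normals ?H ?TH \<Longrightarrow> core M \<in> open_normals G T \<and> core M \<subseteq> M" by blast
  define y where "y = (\<lambda>M\<in>open_normals ?H ?TH. \<lambda>D\<in>rcosets\<^bsub>?H\<^esub> M. cgr_mass k G z (core M) D)"
  have cu: "coset_union G N D" if N: "N \<in> open_normals G T" "N \<subseteq> M" and M: "M \<in> open_normals ?H ?TH"
    and D: "D \<in> rcosets\<^bsub>?H\<^esub> M" for N M D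
  proof -
    interpret M: normal M ?H by (rule open_normalsD(1)[OF M])
    have MG: "M \<subseteq> carrier G" using M.subset H.subset by auto
    obtain h where h: "h \<in> H" "D = M #> h" using D by (auto simp: restricted_rcosets)
    have "N #> x \<subseteq> D" if x: "x \<in> D" for x
    proof
      obtain m where m: "m \<in> M" "x = m \<otimes> h" using x h by (auto simp: r_coset_def)
      fix y assume "y \<in> N #> x"
      then obtain n where n: "n \<in> N" "y = n \<otimes> x" by (auto simp: r_coset_def)
      then have "y = (n \<otimes> m) \<otimes> h" using m h MG N(2) by (simp add: m_assoc subset_iff)
      moreover have "n \<otimes> m \<in> M" using M.m_closed m n N(2) by auto
      ultimately show "y \<in> D" using h by (auto simp: r_coset_def)
    qed
    moreover have "D \<subseteq> carrier G" unfolding h(2) by (rule r_coset_subset_G[OF MG]) (use h in auto)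
    ultimately show ?thesis by (simp add: coset_union_def)
  qed
  have yv: "y M D = cgr_mass k G z N D"
    if "N \<in> open_normals G T" "N \<subseteq> M" "M \<in> open_normals ?H ?TH" "D \<in> rcosets\<^bsub>?H\<^esub> M" for N M D
    using that core[OF that(3)] cgr_mass_independent[OF z, of "core M" N D] cu by (auto simp: y_def)
  have finH: "finite (rcosets\<^bsub>?H\<^esub> M)" if M: "M \<in> open_normals ?H ?TH" for M
  proof -
    interpret M: normal M ?H by (rule open_normalsD(1)[OF M])
    interpret N: normal "core M" G using core[OF M] open_normalsD(1) by blast
    have Ms: "subgroup M G" using incl_subgroup[OF H.is_subgroup M.is_subgroup] .
    have "rcosets\<^bsub>?H\<^esub> M \<subseteq> (\<lambda>C. M <#> C) ` (rcosets (core M))"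
    proof
      fix D assume "D \<in> rcosets\<^bsub>?H\<^esub> M"
      then obtain h where h: "h \<in> H" "D = M #> h" by (auto simp: restricted_rcosets)
      then have "D = M <#> (core M #> h)"
        using set_mult_rcoset[OF N.is_subgroup Ms] core[OF M] by simp
      moreover have "core M #> h \<in> rcosets (core M)" using N.rcoset_in h by simp
      ultimately show "D \<in> (\<lambda>C. M <#> C) ` (rcosets (core M))" by (rule image_eqI)
    qed
    then show ?thesis using core[OF M] finite_rcosets finite_surj by blast
  qed
  have yc: "y \<in> carrier (cgr k ?H ?TH)" unfolding KH.cgr_carrier_iff
  proof (intro conjI ballI impI)
    show "y \<in> (\<Pi>\<^sub>E M\<in>open_normals ?H ?TH. (rcosets\<^bsub>?H\<^esub> M) \<rightarrow>\<^sub>E carrier k)"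
      using core cgr_mass_closed[OF z] by (auto simp: y_def)
    fix M assume M: "M \<in> open_normals ?H ?TH"
    show "finite {D \<in> rcosets\<^bsub>?H\<^esub> M. y M D \<noteq> \<zero>\<^bsub>k\<^esub>}" using finH[OF M] by simp
    fix M' D' assume M': "M' \<in> open_normals ?H ?TH" "M \<subseteq> M'" and D': "D' \<in> rcosets\<^bsub>?H\<^esub> M'"
    interpret M: normal M ?H by (rule open_normalsD(1)[OF M])
    let ?N = "core M" and ?B = "{D \<in> rcosets\<^bsub>?H\<^esub> M. D \<subseteq> D'}"
    have N: "?N \<in> open_normals G T" "?N \<subseteq> M" "?N \<subseteq> M'" using core[OF M] M' by auto
    have "(\<Oplus>\<^bsub>k\<^esub>D\<in>{D \<in> ?B. y M D \<noteq> \<zero>\<^bsub>k\<^esub>}. y M D) = (\<Oplus>\<^bsub>k\<^esub>D\<in>?B. y M D)"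
      using finH[OF M] yv[OF N(1,2) M] cgr_mass_closed[OF z N(1)] by (intro finsum_support) auto
    also have "\<dots> = (\<Oplus>\<^bsub>k\<^esub>D\<in>?B. cgr_mass k G z ?N D)"
      using yv[OF N(1,2) M] cgr_mass_closed[OF z N(1)] by (intro K.finsum_cong') auto
    also have "\<dots> = cgr_mass k G z ?N (\<Union>D\<in>?B. D)"
    proof (rule cgr_mass_UN[OF z N(1), symmetric])
      show "finite ?B" using finH[OF M] by simp
      show "coset_union G ?N D" if "D \<in> ?B" for D using cu[OF N(1,2) M] that by simp
      show "D \<inter> E = {}" if "D \<in> ?B" "E \<in> ?B" "D \<noteq> E" for D E using that M.rcosets_disj[of D E] by auto
    qed
    also have "(\<Union>D\<in>?B. D) = D'"
    proof -
      have "coset_union ?H M D'"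
        by (rule HG.coset_union_coset[OF open_normalsD(1)[OF M] open_normalsD(1)[OF M'(1)] M'(2) D'])
      then show ?thesis using HG.coset_union_Union[OF open_normalsD(1)[OF M]] by simp
    qed
    also have "cgr_mass k G z ?N D' = y M' D'" using yv[OF N(1,3) M'(1) D'] by simp
    finally show "(\<Oplus>\<^bsub>k\<^esub>D\<in>{D \<in> rcosets\<^bsub>?H\<^esub> M. D \<subseteq> D' \<and> y M D \<noteq> \<zero>\<^bsub>k\<^esub>}. y M D) = y M' D'"
      by (simp add: conj_assoc)
  qed
  have "z = cgr_incl k G T H y"
  proof (rule cgr_eqI[OF z cgr_incl_closed[OF H(1) yc]])
    fix N C assume N: "N \<in> open_normals G T" and C: "C \<in> rcosets N"
    interpret N: normal N G by (rule open_normalsD(1)[OF N])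
    have NH: "N \<inter> H \<in> open_normals ?H ?TH" by (rule open_normals_restrict[OF H.is_subgroup N])
    have incl: "cgr_incl k G T H y N C = (if C \<inter> H = {} then \<zero>\<^bsub>k\<^esub> else y (N \<inter> H) (C \<inter> H))"
      using cgr_value(1)[OF yc NH] by (intro cgr_incl_value[OF H.is_subgroup N C]) auto
    show "z N C = cgr_incl k G T H y N C"
    proof (cases "C \<inter> H = {}")
      case True
      then show ?thesis using incl supp[OF N C] by simp
    next
      case False
      let ?N = "core (N \<inter> H)"
      have N1: "?N \<in> open_normals G T" "?N \<subseteq> N \<inter> H" using core[OF NH] by auto
      interpret N1: normal ?N G by (rule open_normalsD(1)[OF N1(1)])
      have CH: "C \<inter> H \<in> rcosets\<^bsub>?H\<^esub> (N \<inter> H)"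
        using coset_Int_subgroup_iff[OF H.is_subgroup N.normal_axioms C] False by blast
      have "C' \<inter> H = {}" if C': "C' \<in> rcosets ?N" "C' \<subseteq> C" "\<not> C' \<subseteq> C \<inter> H" for C'
      proof (rule ccontr)
        assume "C' \<inter> H \<noteq> {}"
        then obtain h where h: "h \<in> C'" "h \<in> H" by auto
        then have "C' = ?N #> h" using N1.rcosets_memD(2)[OF C'(1)] by blast
        then have "C' \<subseteq> H" using h N1(2) by (auto simp: r_coset_def)
        then show False using C' by blast
      qed
      then have "cgr_mass k G z ?N (C \<inter> H) = cgr_mass k G z ?N C"
        unfolding cgr_mass_def using finite_rcosets[OF N1(1)] supp[OF N1(1)] cgr_value_closed[OF z N1(1)]
        by (intro K.add.finprod_mono_neutral_cong_left) auto
      also have "\<dots> = z N C" using cgr_mass_coset[OF z N1(1) N _ C] N1(2) by simp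
      finally show ?thesis using incl False yv[OF N1 NH CH] by simp
    qed
  qed
  then show ?thesis using yc by (simp add: cgr_sub_def)
qed

lemma cgr_sub_carrier_iff:
  assumes H: "H \<lhd> G" "openin T H"
  shows "z \<in> carrier (cgr_sub k G T H) \<longleftrightarrow> z \<in> carrier (cgr k G T) \<and>
    (\<forall>N\<in>open_normals G T. \<forall>C\<in>rcosets N. C \<inter> H = {} \<longrightarrow> z N C = \<zero>\<^bsub>k\<^esub>)"
proof
  interpret H: normal H G by (rule H)
  assume "z \<in> carrier (cgr_sub k G T H)"
  then obtain x where x: "x \<in> carrier (cgr k (G\<lparr>carrier := H\<rparr>) (subtopology T H))" "z = cgr_incl k G T H x"
    by (auto simp: cgr_sub_def)
  have "z N C = \<zero>\<^bsub>k\<^esub>" if N: "N \<in> open_normals G T" and C: "C \<in> rcosets N" "C \<inter> H = {}" for N C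
  proof -
    have "x (N \<inter> H) \<in> (rcosets\<^bsub>G\<lparr>carrier := H\<rparr>\<^esub> (N \<inter> H)) \<rightarrow> carrier k"
      using cgr_value(1)[OF x(1) open_normals_restrict[OF H.is_subgroup N]] by auto
    then show ?thesis using cgr_incl_value[OF H.is_subgroup N C(1)] C(2) x(2) by simp
  qed
  then show "z \<in> carrier (cgr k G T) \<and>
      (\<forall>N\<in>open_normals G T. \<forall>C\<in>rcosets N. C \<inter> H = {} \<longrightarrow> z N C = \<zero>\<^bsub>k\<^esub>)"
    using cgr_incl_closed[OF H(1) x(1)] x(2) by blast
qed (use cgr_supported_in_image[OF H] in blast)

lemma cgr_finsum_value:
  assumes R: "ring (cgr k G T)" and "finite X" "f \<in> X \<rightarrow> carrier (cgr k G T)"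
    and N: "N \<in> open_normals G T" and C: "C \<in> rcosets N"
  shows "(\<Oplus>\<^bsub>cgr k G T\<^esub>x\<in>X. f x) N C = (\<Oplus>\<^bsub>k\<^esub>x\<in>X. f x N C)"
  using assms(2,3)
proof (induction X rule: finite_induct)
  interpret R: ring "cgr k G T" by (rule R)
  case empty
  then show ?case using N C by (simp add: cgr_simps group_ring_simps carrier_Mod)
next
  interpret R: ring "cgr k G T" by (rule R)
  case (insert x X)
  then have "f x \<in> carrier (cgr k G T)" "f \<in> X \<rightarrow> carrier (cgr k G T)" by auto
  moreover from this have "f x N C \<in> carrier k" "(\<lambda>x. f x N C) \<in> X \<rightarrow> carrier k"
    using cgr_value_closed[OF _ N C] by auto
  ultimately show ?case using insert N C
    by (simp add: R.finsum_insert K.finsum_insert cgr_simps(4) group_ring_simps(5) carrier_Mod)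
qed

text \<open>Restricting the measure \<open>z\<close> to the cosets of \<open>H\<close> writes it as a sum of translates of measures
  supported on \<open>H\<close>.\<close>

lemma cgr_coset_decomposition:
  assumes H: "H \<lhd> G" "openin T H" and R: "ring (cgr k G T)" and z: "z \<in> carrier (cgr k G T)"
    and s: "\<And>X. X \<in> rcosets H \<Longrightarrow> s X \<in> X"
  obtains y where "\<And>X. X \<in> rcosets H \<Longrightarrow> y X \<in> carrier (cgr_sub k G T H)"
    "z = (\<Oplus>\<^bsub>cgr k G T\<^esub>X\<in>rcosets H. cgr_elt k G T (s X) \<otimes>\<^bsub>cgr k G T\<^esub> y X)"
proof -
  interpret R: ring "cgr k G T" by (rule R)
  interpret H: normal H G by (rule H)
  have Hon: "H \<in> open_normals G T" using H by (simp add: open_normals_def)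
  \<comment> \<open>\<open>r X\<close> is the restriction of the measure \<open>z\<close> to the coset \<open>X\<close>.\<close>
  define r where "r X = (\<lambda>N\<in>open_normals G T. \<lambda>C\<in>rcosets N. cgr_mass k G z (N \<inter> H) (C \<inter> X))" for X
  have NH: "N \<inter> H \<in> open_normals G T" if "N \<in> open_normals G T" for N
    using open_normals_Int[OF that Hon] .
  have cu: "coset_union G M (C \<inter> X)"
    if "M \<in> open_normals G T" "N \<in> open_normals G T" "M \<subseteq> N \<inter> H" "C \<in> rcosets N" "X \<in> rcosets H"
    for M N C X
    using that coset_union_coset[of M N C] coset_union_coset[of M H X] H open_normalsD(1)
    by (intro coset_union_Int) auto
  have rv: "r X N C = cgr_mass k G z M (C \<inter> X)"
    if "M \<in> open_normals G T" "N \<in> open_normals G T" "M \<subseteq> N \<inter> H" "C \<in> rcosets N" "X \<in> rcosets H"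
    for M N C X
    using that cgr_mass_refine[OF z that(1) NH[OF that(2)] that(3), of "C \<inter> X"] cu[OF NH[OF that(2)] that(2)]
    by (simp add: r_def)
  have rc: "r X \<in> carrier (cgr k G T)" if X: "X \<in> rcosets H" for X
  proof (rule cgr_carrierI)
    show "r X \<in> extensional (open_normals G T)" by (simp add: r_def)
    show "r X N \<in> (rcosets N) \<rightarrow>\<^sub>E carrier k" if "N \<in> open_normals G T" for N
      using cgr_mass_closed[OF z NH[OF that]] that by (simp add: r_def)
    fix N N' D assume N: "N \<in> open_normals G T" "N' \<in> open_normals G T" "N \<subseteq> N'" and D: "D \<in> rcosets N'"
    interpret N: normal N G by (rule open_normalsD(1)[OF N(1)])
    let ?A = "{C \<in> rcosets N. C \<subseteq> D}"
    have "cgr_mass k G (r X) N D = (\<Oplus>\<^bsub>k\<^esub>C\<in>?A. cgr_mass k G z (N \<inter> H) (C \<inter> X))"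
      unfolding cgr_mass_def[of k G "r X"]
      using N(1) cgr_mass_closed[OF z NH[OF N(1)]] by (intro K.finsum_cong') (auto simp: r_def)
    also have "\<dots> = cgr_mass k G z (N \<inter> H) (\<Union>C\<in>?A. C \<inter> X)"
    proof (rule cgr_mass_UN[OF z NH[OF N(1)], symmetric])
      show "finite ?A" using finite_rcosets[OF N(1)] by simp
      show "coset_union G (N \<inter> H) (C \<inter> X)" if "C \<in> ?A" for C
        using cu[OF NH[OF N(1)] N(1) _ _ X] that by simp
      show "(C \<inter> X) \<inter> (C' \<inter> X) = {}" if "C \<in> ?A" "C' \<in> ?A" "C \<noteq> C'" for C C'
        using that N.rcosets_disj by blast
    qed
    also have "(\<Union>C\<in>?A. C \<inter> X) = \<Union>?A \<inter> X" by auto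
    also have "\<Union>?A = D"
      using coset_union_Union[OF N.normal_axioms]
        coset_union_coset[OF N.normal_axioms open_normalsD(1)[OF N(2)] N(3) D] by simp
    also have "cgr_mass k G z (N \<inter> H) (D \<inter> X) = r X N' D"
      by (subst rv[OF NH[OF N(1)] N(2) _ D X]) (use N(3) in auto)
    finally show "cgr_mass k G (r X) N D = r X N' D" .
  qed
  have sG: "s X \<in> carrier G" if "X \<in> rcosets H" for X using H.rcosets_memD(1)[OF that s[OF that]] .
  define y where "y X = cgr_elt k G T (inv (s X)) \<otimes>\<^bsub>cgr k G T\<^esub> r X" for X
  have yH: "y X \<in> carrier (cgr_sub k G T H)" if X: "X \<in> rcosets H" for X
  proof (rule cgr_supported_in_image[OF H])
    show "y X \<in> carrier (cgr k G T)" using rc[OF X] sG[OF X] cgr_elt_closed by (simp add: y_def)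
    fix N C assume N: "N \<in> open_normals G T" and C: "C \<in> rcosets N" "C \<inter> H = {}"
    interpret N: normal N G by (rule open_normalsD(1)[OF N])
    obtain x where x: "x \<in> carrier G" "C = N #> x" by (rule N.rcosets_cases[OF C(1)])
    have "(N #> (s X \<otimes> x)) \<inter> X = {}"
    proof (rule ccontr)
      assume "(N #> (s X \<otimes> x)) \<inter> X \<noteq> {}"
      then obtain n where n: "n \<in> N" "n \<otimes> (s X \<otimes> x) \<in> X" by (auto simp: r_coset_def)
      have nG: "n \<in> carrier G" using n N.subset by auto
      have "X = s X <# H" using H.rcosets_memD(2)[OF X s[OF X]] H.coset_eq sG[OF X] by simp
      then obtain h where h: "h \<in> H" "n \<otimes> (s X \<otimes> x) = s X \<otimes> h" using n(2) by (auto simp: l_coset_def)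
      have "(inv (s X) \<otimes> n \<otimes> s X) \<otimes> x = inv (s X) \<otimes> (n \<otimes> (s X \<otimes> x))"
        using nG sG[OF X] x by (simp add: m_assoc)
      also have "\<dots> = h" unfolding h(2) using sG[OF X] h by (simp add: m_assoc[symmetric])
      finally have "h \<in> N #> x"
        using N.inv_op_closed1[OF sG[OF X] n(1)] unfolding r_coset_def by blast
      then show False using C x h by blast
    qed
    then have "r X N (N #> (s X \<otimes> x)) = \<zero>\<^bsub>k\<^esub>"
      using cgr_mass_empty[OF NH[OF N]] N N.rcoset_in x sG[OF X] by (simp add: r_def)
    then show "y X N C = \<zero>\<^bsub>k\<^esub>" unfolding y_def x(2)
      using cgr_elt_mult_value[OF _ x(1) rc[OF X] N, of "inv (s X)"] sG[OF X] by simp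
  qed
  have ry: "cgr_elt k G T (s X) \<otimes>\<^bsub>cgr k G T\<^esub> y X = r X" if X: "X \<in> rcosets H" for X
    using rc[OF X] sG[OF X] cgr_elt_closed unfolding y_def
    by (simp add: R.m_assoc[symmetric] cgr_elt_mult R cgr_elt_one)
  have "z = (\<Oplus>\<^bsub>cgr k G T\<^esub>X\<in>rcosets H. r X)"
  proof (rule cgr_eqI[OF z])
    show "(\<Oplus>\<^bsub>cgr k G T\<^esub>X\<in>rcosets H. r X) \<in> carrier (cgr k G T)" using rc by (intro R.finsum_closed) auto
    fix N C assume N: "N \<in> open_normals G T" and C: "C \<in> rcosets N"
    interpret N: normal N G by (rule open_normalsD(1)[OF N])
    have "(\<Oplus>\<^bsub>cgr k G T\<^esub>X\<in>rcosets H. r X) N C = (\<Oplus>\<^bsub>k\<^esub>X\<in>rcosets H. r X N C)"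
      using rc by (intro cgr_finsum_value[OF R finite_rcosets[OF Hon] _ N C]) auto
    also have "\<dots> = (\<Oplus>\<^bsub>k\<^esub>X\<in>rcosets H. cgr_mass k G z (N \<inter> H) (C \<inter> X))"
      using cgr_mass_closed[OF z NH[OF N]] rv[OF NH[OF N] N _ C] by (intro K.finsum_cong') auto
    also have "\<dots> = cgr_mass k G z (N \<inter> H) (\<Union>X\<in>rcosets H. C \<inter> X)"
    proof (rule cgr_mass_UN[OF z NH[OF N] finite_rcosets[OF Hon], symmetric])
      show "coset_union G (N \<inter> H) (C \<inter> X)" if "X \<in> rcosets H" for X using cu[OF NH[OF N] N _ C that] by simp
      show "C \<inter> X \<inter> (C \<inter> X') = {}" if "X \<in> rcosets H" "X' \<in> rcosets H" "X \<noteq> X'" for X X'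
        using that H.rcosets_disj[of X X'] by auto
    qed
    also have "(\<Union>X\<in>rcosets H. C \<inter> X) = C"
      using rcosets_part_G[OF H.is_subgroup] N.rcosets_memD(1)[OF C] by blast
    also have "cgr_mass k G z (N \<inter> H) C = z N C" by (rule cgr_mass_coset[OF z NH[OF N] N _ C]) simp
    finally show "z N C = (\<Oplus>\<^bsub>cgr k G T\<^esub>X\<in>rcosets H. r X) N C" by simp
  qed
  also have "\<dots> = (\<Oplus>\<^bsub>cgr k G T\<^esub>X\<in>rcosets H. cgr_elt k G T (s X) \<otimes>\<^bsub>cgr k G T\<^esub> y X)"
    using rc ry by (intro R.finsum_cong') auto
  finally show ?thesis using that yH by blast
qed

lemma cgr_sub_conj_closed:
  assumes H: "H \<lhd> G" "openin T H" and R: "ring (cgr k G T)" and z: "z \<in> carrier (cgr_sub k G T H)"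
    and g: "g \<in> carrier G"
  shows "cgr_elt k G T (inv g) \<otimes>\<^bsub>cgr k G T\<^esub> z \<otimes>\<^bsub>cgr k G T\<^esub> cgr_elt k G T g \<in> carrier (cgr_sub k G T H)"
proof (rule cgr_supported_in_image[OF H])
  interpret R: ring "cgr k G T" by (rule R)
  interpret H: normal H G by (rule H)
  have zc: "z \<in> carrier (cgr k G T)"
    and supp: "\<And>N C. N \<in> open_normals G T \<Longrightarrow> C \<in> rcosets N \<Longrightarrow> C \<inter> H = {} \<Longrightarrow> z N C = \<zero>\<^bsub>k\<^esub>"
    using z cgr_sub_carrier_iff[OF H] by auto
  show "cgr_elt k G T (inv g) \<otimes>\<^bsub>cgr k G T\<^esub> z \<otimes>\<^bsub>cgr k G T\<^esub> cgr_elt k G T g \<in> carrier (cgr k G T)"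
    using zc g cgr_elt_closed by simp
  fix N C assume N: "N \<in> open_normals G T" and C: "C \<in> rcosets N" "C \<inter> H = {}"
  interpret N: normal N G by (rule open_normalsD(1)[OF N])
  obtain x where x: "x \<in> carrier G" "C = N #> x" by (rule N.rcosets_cases[OF C(1)])
  have "(N #> (g \<otimes> (x \<otimes> inv g))) \<inter> H = {}"
  proof (rule ccontr)
    assume "(N #> (g \<otimes> (x \<otimes> inv g))) \<inter> H \<noteq> {}"
    then obtain n where n: "n \<in> N" "n \<otimes> (g \<otimes> (x \<otimes> inv g)) \<in> H" by (auto simp: r_coset_def)
    have nG: "n \<in> carrier G" using n N.subset by auto
    have "inv g \<otimes> (n \<otimes> (g \<otimes> (x \<otimes> inv g))) \<otimes> g = (inv g \<otimes> n \<otimes> g) \<otimes> x"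
      using nG g x by (simp add: m_assoc)
    moreover have "inv g \<otimes> (n \<otimes> (g \<otimes> (x \<otimes> inv g))) \<otimes> g \<in> H" by (rule H.inv_op_closed1[OF g n(2)])
    ultimately have "(inv g \<otimes> n \<otimes> g) \<otimes> x \<in> C \<inter> H"
      using N.inv_op_closed1[OF g n(1)] x(2) unfolding r_coset_def by auto
    then show False using C by simp
  qed
  then have "z N (N #> (g \<otimes> (x \<otimes> inv g))) = \<zero>\<^bsub>k\<^esub>" using g x by (intro supp[OF N]) (simp_all add: N.rcoset_in)
  then show "(cgr_elt k G T (inv g) \<otimes>\<^bsub>cgr k G T\<^esub> z \<otimes>\<^bsub>cgr k G T\<^esub> cgr_elt k G T g) N C = \<zero>\<^bsub>k\<^esub>"
    unfolding x(2) using g x zc cgr_elt_closed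
    by (simp add: cgr_mult_elt_value N cgr_elt_mult_value)
qed

end

section \<open>Ideals of matrix rings\<close>

lemma (in ideal) finsum_in_ideal:
  "finite A \<Longrightarrow> (\<And>x. x \<in> A \<Longrightarrow> f x \<in> I) \<Longrightarrow> (\<Oplus>x\<in>A. f x) \<in> I"
proof (induction A rule: finite_induct)
  case (insert x A)
  have "f \<in> insert x A \<rightarrow> carrier R" using insert.prems a_subset by blast
  then show ?case using insert by (simp add: finsum_insert a_closed)
qed simp

lemma ideal_prod_subset_iff:
  assumes "ideal P R" shows "I \<cdot>\<^bsub>R\<^esub> J \<subseteq> P \<longleftrightarrow> (\<forall>a\<in>I. \<forall>b\<in>J. a \<otimes>\<^bsub>R\<^esub> b \<in> P)"
proof
  interpret ideal P R by (rule assms)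
  assume a: "\<forall>a\<in>I. \<forall>b\<in>J. a \<otimes>\<^bsub>R\<^esub> b \<in> P"
  show "I \<cdot>\<^bsub>R\<^esub> J \<subseteq> P"
  proof
    fix s assume "s \<in> I \<cdot>\<^bsub>R\<^esub> J"
    then show "s \<in> P" by (induction rule: ideal_prod.induct) (use a in auto)
  qed
qed (auto intro: ideal_prod.prod)

text \<open>The matrix \<open>r e\<^sub>i\<^sub>j\<close>. Multiplication by such matrices on both sides isolates an entry.\<close>

definition mat_single :: "nat \<Rightarrow> 'r ring \<Rightarrow> nat \<Rightarrow> nat \<Rightarrow> 'r \<Rightarrow> nat \<times> nat \<Rightarrow> 'r" where
  "mat_single t R i j r = (\<lambda>(a, b)\<in>{..<t} \<times> {..<t}. if a = i \<and> b = j then r else \<zero>\<^bsub>R\<^esub>)"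

lemma mat_ring_simps:
  "carrier (mat_ring t R) = mat_set t (carrier R)"
  "i < t \<Longrightarrow> j < t \<Longrightarrow> (a \<otimes>\<^bsub>mat_ring t R\<^esub> b) (i, j) = (\<Oplus>\<^bsub>R\<^esub>l\<in>{..<t}. a (i, l) \<otimes>\<^bsub>R\<^esub> b (l, j))"
  "i < t \<Longrightarrow> j < t \<Longrightarrow> (a \<oplus>\<^bsub>mat_ring t R\<^esub> b) (i, j) = a (i, j) \<oplus>\<^bsub>R\<^esub> b (i, j)"
  "i < t \<Longrightarrow> j < t \<Longrightarrow> \<one>\<^bsub>mat_ring t R\<^esub> (i, j) = (if i = j then \<one>\<^bsub>R\<^esub> else \<zero>\<^bsub>R\<^esub>)"
  by (simp_all add: mat_ring_def)

lemma mat_set_iff: "a \<in> mat_set t B \<longleftrightarrow> a \<in> extensional ({..<t} \<times> {..<t}) \<and> (\<forall>i<t. \<forall>j<t. a (i, j) \<in> B)"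
  by (auto simp: mat_set_def PiE_iff)

lemma mat_set_eqI:
  "a \<in> mat_set t B \<Longrightarrow> b \<in> mat_set t C \<Longrightarrow> (\<And>i j. i < t \<Longrightarrow> j < t \<Longrightarrow> a (i, j) = b (i, j)) \<Longrightarrow> a = b"
  by (rule extensionalityI[of _ "{..<t} \<times> {..<t}"]) (auto simp: mat_set_iff)

lemma mat_single_entry:
  "a < t \<Longrightarrow> b < t \<Longrightarrow> mat_single t R i j r (a, b) = (if a = i \<and> b = j then r else \<zero>\<^bsub>R\<^esub>)"
  by (simp add: mat_single_def)

lemma mat_single_closed: "r \<in> B \<Longrightarrow> \<zero>\<^bsub>R\<^esub> \<in> B \<Longrightarrow> mat_single t R i j r \<in> mat_set t B"
  by (auto simp: mat_single_def mat_set_iff)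

text \<open>Matrix rings are defined over records without additional fields; the locale fixes this type.\<close>

locale plain_ring = ring R for R :: "'r ring" (structure)

lemma (in plain_ring) mat_single_mult:
  assumes "i < t" "l < t" "r \<in> carrier R" "a \<in> mat_set t (carrier R)" "u < t" "v < t"
  shows "(mat_single t R i l r \<otimes>\<^bsub>mat_ring t R\<^esub> a) (u, v) = (if u = i then r \<otimes> a (l, v) else \<zero>)"
proof -
  have ac: "a (m, v) \<in> carrier R" if "m < t" for m using assms that by (auto simp: mat_set_iff)
  have "(mat_single t R i l r \<otimes>\<^bsub>mat_ring t R\<^esub> a) (u, v)
      = (\<Oplus>m\<in>{..<t}. if l = m then (if u = i then r else \<zero>) \<otimes> a (m, v) else \<zero>)"
    unfolding mat_ring_simps(2)[OF assms(5,6)]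
    by (rule finsum_cong') (use assms ac in \<open>auto simp: mat_single_entry\<close>)
  also have "\<dots> = (if u = i then r else \<zero>) \<otimes> a (l, v)"
    using assms ac by (intro add.finprod_singleton) auto
  finally show ?thesis using assms ac by simp
qed

lemma (in plain_ring) mat_mult_single:
  assumes "l < t" "j < t" "r \<in> carrier R" "a \<in> mat_set t (carrier R)" "u < t" "v < t"
  shows "(a \<otimes>\<^bsub>mat_ring t R\<^esub> mat_single t R l j r) (u, v) = (if v = j then a (u, l) \<otimes> r else \<zero>)"
proof -
  have ac: "a (u, m) \<in> carrier R" if "m < t" for m using assms that by (auto simp: mat_set_iff)
  have "(a \<otimes>\<^bsub>mat_ring t R\<^esub> mat_single t R l j r) (u, v)
      = (\<Oplus>m\<in>{..<t}. if l = m then a (u, m) \<otimes> (if v = j then r else \<zero>) else \<zero>)"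
    unfolding mat_ring_simps(2)[OF assms(5,6)]
    by (rule finsum_cong') (use assms ac in \<open>auto simp: mat_single_entry\<close>)
  also have "\<dots> = a (u, l) \<otimes> (if v = j then r else \<zero>)"
    using assms ac by (intro add.finprod_singleton) auto
  finally show ?thesis using assms ac by simp
qed

lemma (in plain_ring) mat_mult_closed:
  "a \<in> mat_set t (carrier R) \<Longrightarrow> b \<in> mat_set t (carrier R) \<Longrightarrow>
    a \<otimes>\<^bsub>mat_ring t R\<^esub> b \<in> mat_set t (carrier R)"
  by (auto simp: mat_ring_def mat_set_iff intro!: finsum_closed)

lemma (in plain_ring) mat_single_mult_single:
  assumes "i < t" "l < t" "m < t" "j < t" "r \<in> carrier R" "s \<in> carrier R" "a \<in> mat_set t (carrier R)"
  shows "mat_single t R i l r \<otimes>\<^bsub>mat_ring t R\<^esub> a \<otimes>\<^bsub>mat_ring t R\<^esub> mat_single t R m j s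
    = mat_single t R i j (r \<otimes> a (l, m) \<otimes> s)"
proof -
  have s: "mat_single t R i l r \<in> mat_set t (carrier R)" "mat_single t R m j s \<in> mat_set t (carrier R)"
    using assms by (auto intro: mat_single_closed)
  have alm: "a (l, m) \<in> carrier R" using assms by (auto simp: mat_set_iff)
  have c: "mat_single t R i l r \<otimes>\<^bsub>mat_ring t R\<^esub> a \<in> mat_set t (carrier R)" using mat_mult_closed s assms by blast
  show ?thesis
  proof (rule mat_set_eqI)
    show "mat_single t R i l r \<otimes>\<^bsub>mat_ring t R\<^esub> a \<otimes>\<^bsub>mat_ring t R\<^esub> mat_single t R m j s \<in> mat_set t (carrier R)"
      using mat_mult_closed c s by blast
    show "mat_single t R i j (r \<otimes> a (l, m) \<otimes> s) \<in> mat_set t (carrier R)"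
      using assms alm by (intro mat_single_closed) auto
  qed (use assms alm c in \<open>auto simp: mat_mult_single mat_single_mult mat_single_entry\<close>)
qed

locale matrix_hom = A: ring A + R: plain_ring R for A :: "'a ring" and R :: "'r ring" +
  fixes t :: nat and \<phi> :: "'a \<Rightarrow> nat \<times> nat \<Rightarrow> 'r"
  assumes hom: "\<phi> \<in> ring_hom A (mat_ring t R)"
begin

lemma hom_closed: "x \<in> carrier A \<Longrightarrow> \<phi> x \<in> mat_set t (carrier R)"
  using ring_hom_closed[OF hom] by (simp add: mat_ring_simps)

lemma hom_entry: "x \<in> carrier A \<Longrightarrow> i < t \<Longrightarrow> j < t \<Longrightarrow> \<phi> x (i, j) \<in> carrier R"
  using hom_closed by (auto simp: mat_set_iff)

lemma hom_mult: "x \<in> carrier A \<Longrightarrow> y \<in> carrier A \<Longrightarrow> \<phi> (x \<otimes>\<^bsub>A\<^esub> y) = \<phi> x \<otimes>\<^bsub>mat_ring t R\<^esub> \<phi> y"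
  by (rule ring_hom_mult[OF hom])

lemma hom_add:
  "x \<in> carrier A \<Longrightarrow> y \<in> carrier A \<Longrightarrow> i < t \<Longrightarrow> j < t \<Longrightarrow> \<phi> (x \<oplus>\<^bsub>A\<^esub> y) (i, j) = \<phi> x (i, j) \<oplus>\<^bsub>R\<^esub> \<phi> y (i, j)"
  by (simp add: ring_hom_add[OF hom] mat_ring_simps)

lemma hom_zero: assumes "i < t" "j < t" shows "\<phi> \<zero>\<^bsub>A\<^esub> (i, j) = \<zero>\<^bsub>R\<^esub>"
  using hom_add[of "\<zero>\<^bsub>A\<^esub>" "\<zero>\<^bsub>A\<^esub>" i j] hom_entry[of "\<zero>\<^bsub>A\<^esub>" i j] assms by simp

lemma hom_minus:
  assumes "x \<in> carrier A" "i < t" "j < t" shows "\<phi> (\<ominus>\<^bsub>A\<^esub> x) (i, j) = \<ominus>\<^bsub>R\<^esub> \<phi> x (i, j)"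
proof -
  have "\<phi> (\<ominus>\<^bsub>A\<^esub> x) (i, j) \<oplus>\<^bsub>R\<^esub> \<phi> x (i, j) = \<phi> (\<ominus>\<^bsub>A\<^esub> x \<oplus>\<^bsub>A\<^esub> x) (i, j)"
    using assms by (subst hom_add) auto
  also have "\<dots> = \<zero>\<^bsub>R\<^esub>" using assms hom_zero by (simp add: A.l_neg)
  finally show ?thesis using R.minus_equality assms hom_entry by (metis A.a_inv_closed)
qed

lemma hom_diff:
  assumes "x \<in> carrier A" "y \<in> carrier A" "i < t" "j < t"
  shows "\<phi> (x \<ominus>\<^bsub>A\<^esub> y) (i, j) = \<phi> x (i, j) \<ominus>\<^bsub>R\<^esub> \<phi> y (i, j)"
  using assms by (simp add: a_minus_def hom_add hom_minus)

lemma hom_finsum: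
  assumes "finite X" "f \<in> X \<rightarrow> carrier A" "i < t" "j < t"
  shows "\<phi> (\<Oplus>\<^bsub>A\<^esub>x\<in>X. f x) (i, j) = (\<Oplus>\<^bsub>R\<^esub>x\<in>X. \<phi> (f x) (i, j))"
  using assms(1,2)
proof (induction X rule: finite_induct)
  case (insert x X)
  then have "f x \<in> carrier A" "f \<in> X \<rightarrow> carrier A" by auto
  then show ?case using insert assms(3,4) hom_entry
    by (simp add: A.finsum_insert R.finsum_insert hom_add Pi_iff)
qed (simp add: hom_zero assms)

text \<open>The two closure conditions that make the matrices over a two-sided ideal an ideal, kept apart
  for later use with one-sided ideals.\<close>

lemma hom_left_mult_in:
  assumes "x \<in> carrier A" "y \<in> carrier A" "\<phi> y \<in> mat_set t B" "additive_subgroup B R"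
    "\<And>r b. r \<in> carrier R \<Longrightarrow> b \<in> B \<Longrightarrow> r \<otimes>\<^bsub>R\<^esub> b \<in> B"
  shows "\<phi> (x \<otimes>\<^bsub>A\<^esub> y) \<in> mat_set t B"
proof -
  interpret B: additive_subgroup B R by (rule assms(4))
  have "(\<Oplus>\<^bsub>R\<^esub>l\<in>L. \<phi> x (i, l) \<otimes>\<^bsub>R\<^esub> \<phi> y (l, j)) \<in> B" if "finite L" "L \<subseteq> {..<t}" "i < t" "j < t" for i j L
    using that(1,2)
  proof (induction L rule: finite_induct)
    case (insert l L)
    have "\<phi> x (i, m) \<otimes>\<^bsub>R\<^esub> \<phi> y (m, j) \<in> B" if "m < t" for m
      using assms(5) hom_entry[OF assms(1)] assms(3) that \<open>i < t\<close> \<open>j < t\<close> by (auto simp: mat_set_iff)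
    moreover have "B \<subseteq> carrier R" by (rule B.a_subset)
    ultimately show ?case using insert by (subst R.finsum_insert) (auto intro!: B.a_closed)
  qed simp
  then show ?thesis using hom_closed[of "x \<otimes>\<^bsub>A\<^esub> y"] assms(1,2)
    by (auto simp: mat_set_iff hom_mult mat_ring_simps)
qed

lemma hom_right_mult_in:
  assumes "x \<in> carrier A" "y \<in> carrier A" "\<phi> x \<in> mat_set t B" "additive_subgroup B R"
    "\<And>r b. r \<in> carrier R \<Longrightarrow> b \<in> B \<Longrightarrow> b \<otimes>\<^bsub>R\<^esub> r \<in> B"
  shows "\<phi> (x \<otimes>\<^bsub>A\<^esub> y) \<in> mat_set t B"
proof -
  interpret B: additive_subgroup B R by (rule assms(4))
  have "(\<Oplus>\<^bsub>R\<^esub>l\<in>L. \<phi> x (i, l) \<otimes>\<^bsub>R\<^esub> \<phi> y (l, j)) \<in> B" if "finite L" "L \<subseteq> {..<t}" "i < t" "j < t" for i j L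
    using that(1,2)
  proof (induction L rule: finite_induct)
    case (insert l L)
    have "\<phi> x (i, m) \<otimes>\<^bsub>R\<^esub> \<phi> y (m, j) \<in> B" if "m < t" for m
      using assms(5) hom_entry[OF assms(2)] assms(3) that \<open>i < t\<close> \<open>j < t\<close> by (auto simp: mat_set_iff)
    moreover have "B \<subseteq> carrier R" by (rule B.a_subset)
    ultimately show ?case using insert by (subst R.finsum_insert) (auto intro!: B.a_closed)
  qed simp
  then show ?thesis using hom_closed[of "x \<otimes>\<^bsub>A\<^esub> y"] assms(1,2)
    by (auto simp: mat_set_iff hom_mult mat_ring_simps)
qed

lemma matrix_preimage_ideal:
  assumes "ideal B R" shows "ideal {x \<in> carrier A. \<phi> x \<in> mat_set t B} A" (is "ideal ?I A")
proof (rule idealI)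
  interpret B: ideal B R by (rule assms)
  show "ring A" by (rule A.ring_axioms)
  have ext: "\<phi> x \<in> extensional ({..<t} \<times> {..<t})" if "x \<in> carrier A" for x
    using hom_closed[OF that] by (simp add: mat_set_iff)
  show "subgroup ?I (add_monoid A)"
  proof (rule group.subgroupI)
    show "group (add_monoid A)" by (rule A.a_group)
    show "?I \<subseteq> carrier (add_monoid A)" by auto
    have "\<zero>\<^bsub>A\<^esub> \<in> ?I" using ext by (auto simp: mat_set_iff hom_zero)
    then show "?I \<noteq> {}" by blast
    fix x assume x: "x \<in> ?I"
    then have "\<ominus>\<^bsub>A\<^esub> x \<in> ?I" using ext by (auto simp: mat_set_iff hom_minus)
    then show "inv\<^bsub>add_monoid A\<^esub> x \<in> ?I" by (simp add: a_inv_def)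
    fix y assume y: "y \<in> ?I"
    show "x \<otimes>\<^bsub>add_monoid A\<^esub> y \<in> ?I" using x y ext by (auto simp: mat_set_iff hom_add)
  qed
  fix a x assume "a \<in> ?I" "x \<in> carrier A"
  then show "x \<otimes>\<^bsub>A\<^esub> a \<in> ?I" "a \<otimes>\<^bsub>A\<^esub> x \<in> ?I"
    using hom_left_mult_in[of x a B] hom_right_mult_in[of a x B] B.additive_subgroup_axioms
      B.I_l_closed B.I_r_closed by auto
qed

text \<open>Over a ring with identity every ideal of the matrix ring consists of the matrices over the
  ideal of its entries, so primeness passes between a ring and its matrix ring.\<close>

lemma prime_matrix_preimage_iff:
  assumes surj: "\<phi> ` carrier A = mat_set t (carrier R)" and t: "t \<ge> 1" and I: "ideal I R"
  shows "prime_ideal {x \<in> carrier A. \<phi> x \<in> mat_set t I} A \<longleftrightarrow> prime_ideal I R"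
proof -
  interpret I: ideal I R by (rule I)
  define pre where "pre B = {x \<in> carrier A. \<phi> x \<in> mat_set t B}" for B
  have pre: "ideal (pre B) A" if "ideal B R" for B
    unfolding pre_def by (rule matrix_preimage_ideal[OF that])
  have t0: "0 < t" using t by simp
  have pre_mono: "B \<subseteq> C" if B: "ideal B R" and "pre B \<subseteq> pre C" for B C
  proof
    interpret B: ideal B R by (rule B)
    fix b assume b: "b \<in> B"
    have "mat_single t R 0 0 b \<in> mat_set t B" using b by (simp add: mat_single_closed)
    moreover have "mat_single t R 0 0 b \<in> mat_set t (carrier R)" using b by (simp add: mat_single_closed)
    then obtain x where "x \<in> carrier A" "\<phi> x = mat_single t R 0 0 b" using surj by (metis imageE)
    ultimately have "mat_single t R 0 0 b \<in> mat_set t C" using that(2) by (auto simp: pre_def)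
    then show "b \<in> C" using t0 mat_single_entry[of 0 t 0 R 0 0 b] by (metis mat_set_iff)
  qed
  have mono: "pre B \<subseteq> pre C" if "B \<subseteq> C" for B C using that by (auto simp: pre_def mat_set_iff)
  have pre_carrier: "pre (carrier R) = carrier A" using hom_closed by (auto simp: pre_def)
  have "prime_ideal (pre I) A \<longleftrightarrow> prime_ideal I R"
  proof
    assume P: "prime_ideal (pre I) A"
    show "prime_ideal I R" unfolding prime_ideal_def
    proof (intro conjI allI impI I)
      show "I \<noteq> carrier R" using P pre_carrier by (auto simp: prime_ideal_def)
      fix B C assume BC: "ideal B R \<and> ideal C R \<and> B \<cdot>\<^bsub>R\<^esub> C \<subseteq> I"
      interpret C: ideal C R using BC by simp
      interpret B: ideal B R using BC by simp
      have bc: "b \<otimes>\<^bsub>R\<^esub> c \<in> I" if "b \<in> B" "c \<in> C" for b c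
        using BC that ideal_prod_subset_iff[OF I] by blast
      have "x \<otimes>\<^bsub>A\<^esub> y \<in> pre I" if x: "x \<in> pre B" and y: "y \<in> pre C" for x y
      proof -
        have c: "x \<in> carrier A" "y \<in> carrier A" using x y by (auto simp: pre_def)
        have "(\<Oplus>\<^bsub>R\<^esub>l\<in>{..<t}. \<phi> x (i, l) \<otimes>\<^bsub>R\<^esub> \<phi> y (l, j)) \<in> I" if "i < t" "j < t" for i j
          using x y that by (intro I.finsum_in_ideal bc) (auto simp: pre_def mat_set_iff)
        then show ?thesis using hom_closed[of "x \<otimes>\<^bsub>A\<^esub> y"] c
          by (auto simp: pre_def mat_set_iff hom_mult mat_ring_simps)
      qed
      then have "pre B \<cdot>\<^bsub>A\<^esub> pre C \<subseteq> pre I" using ideal_prod_subset_iff[OF pre[OF I]] by blast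
      then have "pre B \<subseteq> pre I \<or> pre C \<subseteq> pre I"
        using P pre BC by (auto simp: prime_ideal_def)
      then show "B \<subseteq> I \<or> C \<subseteq> I" using pre_mono BC by blast
    qed
  next
    assume P: "prime_ideal I R"
    show "prime_ideal (pre I) A" unfolding prime_ideal_def
    proof (intro conjI allI impI pre[OF I])
      show "pre I \<noteq> carrier A"
      proof
        assume "pre I = carrier A"
        then have "carrier R \<subseteq> I" using pre_mono[OF R.oneideal] pre_carrier by simp
        then show False using P I.a_subset by (auto simp: prime_ideal_def)
      qed
      fix B C assume BC: "ideal B A \<and> ideal C A \<and> B \<cdot>\<^bsub>A\<^esub> C \<subseteq> pre I"
      \<comment> \<open>The ideal of entries, read off at the position \<open>(0, 0)\<close>.\<close>
      define E where "E B = {r \<in> carrier R. \<exists>x\<in>B. \<phi> x = mat_single t R 0 0 r}" for B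
      have Ent: "\<phi> x (i, j) \<in> E B" if B: "ideal B A" and x: "x \<in> B" and ij: "i < t" "j < t" for B x i j
      proof -
        interpret B: ideal B A by (rule B)
        have xA: "x \<in> carrier A" using x B.a_subset by blast
        obtain y where y: "y \<in> carrier A" "\<phi> y = mat_single t R 0 i \<one>\<^bsub>R\<^esub>"
          using surj mat_single_closed[of "\<one>\<^bsub>R\<^esub>" "carrier R" R t 0 i] by (metis R.one_closed R.zero_closed imageE)
        obtain z where z: "z \<in> carrier A" "\<phi> z = mat_single t R j 0 \<one>\<^bsub>R\<^esub>"
          using surj mat_single_closed[of "\<one>\<^bsub>R\<^esub>" "carrier R" R t j 0] by (metis R.one_closed R.zero_closed imageE)
        have "\<phi> (y \<otimes>\<^bsub>A\<^esub> x \<otimes>\<^bsub>A\<^esub> z) = mat_single t R 0 0 (\<phi> x (i, j))"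
          using y z xA ij t0 hom_entry[OF xA ij] hom_closed[OF xA]
          by (simp add: hom_mult R.mat_single_mult_single)
        moreover have "y \<otimes>\<^bsub>A\<^esub> x \<otimes>\<^bsub>A\<^esub> z \<in> B" using x y z by (simp add: B.I_l_closed B.I_r_closed)
        ultimately show ?thesis using hom_entry[OF xA ij] by (auto simp: E_def)
      qed
      have Eid: "ideal (E B) R" if B: "ideal B A" for B
      proof (rule idealI)
        interpret B: ideal B A by (rule B)
        have BA: "x \<in> carrier A" if "x \<in> B" for x using that B.a_subset by blast
        have e00: "\<phi> x (0, 0) = r" if "\<phi> x = mat_single t R 0 0 r" for x r
          using that t0 by (simp add: mat_single_entry)
        have EI: "r \<in> E B" if "x \<in> B" "\<phi> x (0, 0) = r" for x r
          using Ent[OF B that(1) t0 t0] that(2) by simp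
        show "ring R" by (rule R.ring_axioms)
        show "subgroup (E B) (add_monoid R)"
        proof (rule group.subgroupI)
          show "group (add_monoid R)" by (rule R.a_group)
          show "E B \<subseteq> carrier (add_monoid R)" by (auto simp: E_def)
          show "E B \<noteq> {}" using EI[of "\<zero>\<^bsub>A\<^esub>"] by auto
          fix r assume r: "r \<in> E B"
          then obtain x where x: "x \<in> B" "\<phi> x (0, 0) = r" using e00 by (auto simp: E_def)
          have "\<ominus>\<^bsub>R\<^esub> r \<in> E B" using EI[of "\<ominus>\<^bsub>A\<^esub> x"] x BA t0 hom_minus[of x 0 0] by simp
          then show "inv\<^bsub>add_monoid R\<^esub> r \<in> E B" by (simp add: a_inv_def)
          fix s assume s: "s \<in> E B"
          then obtain y where y: "y \<in> B" "\<phi> y (0, 0) = s" using e00 by (auto simp: E_def)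
          show "r \<otimes>\<^bsub>add_monoid R\<^esub> s \<in> E B"
            using EI[of "x \<oplus>\<^bsub>A\<^esub> y"] x y BA t0 hom_add[of x y 0 0] by simp
        qed
        fix r s assume r: "r \<in> E B" and s: "s \<in> carrier R"
        obtain x where x: "x \<in> B" "\<phi> x (0, 0) = r" using e00 r by (auto simp: E_def)
        obtain y where y: "y \<in> carrier A" "\<phi> y = mat_single t R 0 0 s"
          using surj mat_single_closed[of s "carrier R" R t 0 0] s by (metis R.zero_closed imageE)
        have "\<phi> (y \<otimes>\<^bsub>A\<^esub> x) (0, 0) = s \<otimes>\<^bsub>R\<^esub> r"
          using x y BA t0 s hom_closed by (simp add: hom_mult R.mat_single_mult)
        then show "s \<otimes>\<^bsub>R\<^esub> r \<in> E B" using EI[of "y \<otimes>\<^bsub>A\<^esub> x"] x y B.I_l_closed by simp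
        have "\<phi> (x \<otimes>\<^bsub>A\<^esub> y) (0, 0) = r \<otimes>\<^bsub>R\<^esub> s"
          using x y BA t0 s hom_closed by (simp add: hom_mult R.mat_mult_single)
        then show "r \<otimes>\<^bsub>R\<^esub> s \<in> E B" using EI[of "x \<otimes>\<^bsub>A\<^esub> y"] x y B.I_r_closed by simp
      qed
      have sub: "B \<subseteq> pre I" if B: "ideal B A" and EI: "E B \<subseteq> I" for B
      proof
        interpret B: ideal B A by (rule B)
        fix x assume x: "x \<in> B"
        then have "x \<in> carrier A" using B.a_subset by blast
        then show "x \<in> pre I" using Ent[OF B x] EI hom_closed[of x] by (auto simp: pre_def mat_set_iff)
      qed
      have "b \<otimes>\<^bsub>R\<^esub> c \<in> I" if b: "b \<in> E B" and c: "c \<in> E C" for b c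
      proof -
        interpret B: ideal B A using BC by simp
        interpret C: ideal C A using BC by simp
        obtain x where x: "x \<in> B" "\<phi> x = mat_single t R 0 0 b" using b by (auto simp: E_def)
        obtain y where y: "y \<in> C" "\<phi> y = mat_single t R 0 0 c" using c by (auto simp: E_def)
        have bc: "b \<in> carrier R" "c \<in> carrier R" using b c by (auto simp: E_def)
        have xy: "x \<in> carrier A" "y \<in> carrier A" using x y B.a_subset C.a_subset by auto
        have "x \<otimes>\<^bsub>A\<^esub> y \<in> pre I" using BC ideal_prod.prod[OF x(1) y(1), of A] by (meson subsetD)
        then have "\<phi> (x \<otimes>\<^bsub>A\<^esub> y) (0, 0) \<in> I" using t0 by (auto simp: pre_def mat_set_iff)
        moreover have "\<phi> (x \<otimes>\<^bsub>A\<^esub> y) (0, 0) = b \<otimes>\<^bsub>R\<^esub> c"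
          using x y bc xy t0 hom_closed[OF xy(2)]
          by (simp add: hom_mult R.mat_single_mult mat_single_entry mat_single_closed)
        ultimately show ?thesis by simp
      qed
      then have "E B \<cdot>\<^bsub>R\<^esub> E C \<subseteq> I" using ideal_prod_subset_iff[OF I] by blast
      then have "E B \<subseteq> I \<or> E C \<subseteq> I" using P Eid BC by (auto simp: prime_ideal_def)
      then show "B \<subseteq> pre I \<or> C \<subseteq> pre I" using sub BC by blast
    qed
  qed
  then show ?thesis by (simp add: pre_def)
qed

end

section \<open>Crossed products\<close>

locale crossed_product_ring =
  fixes R :: "'r ring" and F :: "'f monoid" and \<sigma> \<tau> and S :: "'s ring" and j u
  assumes cp: "crossed_product R F \<sigma> \<tau> S j u"
begin

sublocale R: ring R using cp by (simp add: crossed_product_def)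
sublocale S: ring S using cp by (simp add: crossed_product_def)
sublocale F: group F using cp by (simp add: crossed_product_def)

lemma finite_F: "finite (carrier F)" using cp by (simp add: crossed_product_def)

lemma \<sigma>_iso: "x \<in> carrier F \<Longrightarrow> \<sigma> x \<in> ring_iso R R" using cp by (simp add: crossed_product_def)

lemma \<tau>_unit: "x \<in> carrier F \<Longrightarrow> y \<in> carrier F \<Longrightarrow> \<tau> x y \<in> Units R"
  using cp by (simp add: crossed_product_def)

lemma j_hom: "j \<in> ring_hom R S" and j_inj: "inj_on j (carrier R)"
  using cp by (simp_all add: crossed_product_def)

lemma u_closed [simp]: "x \<in> carrier F \<Longrightarrow> u x \<in> carrier S" using cp by (simp add: crossed_product_def)

lemma coeff_ex1:
  "s \<in> carrier S \<Longrightarrow> \<exists>!c. c \<in> carrier F \<rightarrow>\<^sub>E carrier R \<and> s = (\<Oplus>\<^bsub>S\<^esub>x\<in>carrier F. u x \<otimes>\<^bsub>S\<^esub> j (c x))"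
  using cp unfolding crossed_product_def by blast

lemma ju: "x \<in> carrier F \<Longrightarrow> r \<in> carrier R \<Longrightarrow> j r \<otimes>\<^bsub>S\<^esub> u x = u x \<otimes>\<^bsub>S\<^esub> j (\<sigma> x r)"
  using cp by (simp add: crossed_product_def)

lemma uu: "x \<in> carrier F \<Longrightarrow> y \<in> carrier F \<Longrightarrow> u x \<otimes>\<^bsub>S\<^esub> u y = u (x \<otimes>\<^bsub>F\<^esub> y) \<otimes>\<^bsub>S\<^esub> j (\<tau> x y)"
  using cp by (simp add: crossed_product_def)

lemma j_closed [simp]: "r \<in> carrier R \<Longrightarrow> j r \<in> carrier S" by (rule ring_hom_closed[OF j_hom])

lemma j_mult: "r \<in> carrier R \<Longrightarrow> s \<in> carrier R \<Longrightarrow> j (r \<otimes>\<^bsub>R\<^esub> s) = j r \<otimes>\<^bsub>S\<^esub> j s"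
  by (rule ring_hom_mult[OF j_hom])

lemma j_add: "r \<in> carrier R \<Longrightarrow> s \<in> carrier R \<Longrightarrow> j (r \<oplus>\<^bsub>R\<^esub> s) = j r \<oplus>\<^bsub>S\<^esub> j s"
  by (rule ring_hom_add[OF j_hom])

lemma j_one: "j \<one>\<^bsub>R\<^esub> = \<one>\<^bsub>S\<^esub>" by (rule ring_hom_one[OF j_hom])

lemma j_zero: "j \<zero>\<^bsub>R\<^esub> = \<zero>\<^bsub>S\<^esub>"
  by (rule ring_hom_zero[OF j_hom R.ring_axioms S.ring_axioms])

lemma \<sigma>_closed [simp]: "x \<in> carrier F \<Longrightarrow> r \<in> carrier R \<Longrightarrow> \<sigma> x r \<in> carrier R"
  by (rule ring_iso_memE(1)[OF \<sigma>_iso])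

lemma \<sigma>_surj: assumes "x \<in> carrier F" "r \<in> carrier R" obtains r' where "r' \<in> carrier R" "\<sigma> x r' = r"
proof -
  have "r \<in> \<sigma> x ` carrier R" using \<sigma>_iso[OF assms(1)] assms(2) by (simp add: ring_iso_def bij_betw_def)
  then show ?thesis using that by blast
qed

lemma \<tau>_closed [simp]: "x \<in> carrier F \<Longrightarrow> y \<in> carrier F \<Longrightarrow> \<tau> x y \<in> carrier R"
  using \<tau>_unit R.Units_closed by blast

lemma coeff_term_closed [simp]:
  "c \<in> carrier F \<rightarrow> carrier R \<Longrightarrow> x \<in> carrier F \<Longrightarrow> u x \<otimes>\<^bsub>S\<^esub> j (c x) \<in> carrier S"
  by (simp add: Pi_iff)

definition comb :: "('f \<Rightarrow> 'r) \<Rightarrow> 's" where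
  "comb c = (\<Oplus>\<^bsub>S\<^esub>x\<in>carrier F. u x \<otimes>\<^bsub>S\<^esub> j (c x))"

lemma comb_closed: "c \<in> carrier F \<rightarrow> carrier R \<Longrightarrow> comb c \<in> carrier S"
  unfolding comb_def by (rule S.finsum_closed) auto

lemma comb_cong: "c \<in> carrier F \<rightarrow> carrier R \<Longrightarrow> (\<And>x. x \<in> carrier F \<Longrightarrow> d x = c x) \<Longrightarrow> comb d = comb c"
  unfolding comb_def by (rule S.finsum_cong') auto

lemma comb_inject:
  assumes "c \<in> carrier F \<rightarrow> carrier R" "d \<in> carrier F \<rightarrow> carrier R" "comb c = comb d" "x \<in> carrier F"
  shows "c x = d x"
proof -
  have e: "restrict c (carrier F) \<in> carrier F \<rightarrow>\<^sub>E carrier R" "comb c = comb (restrict c (carrier F))"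
      "restrict d (carrier F) \<in> carrier F \<rightarrow>\<^sub>E carrier R" "comb d = comb (restrict d (carrier F))"
    using assms(1,2) comb_cong[OF assms(1), of "restrict c (carrier F)"]
      comb_cong[OF assms(2), of "restrict d (carrier F)"] by auto
  obtain c\<^sub>0 where "\<And>c'. c' \<in> carrier F \<rightarrow>\<^sub>E carrier R \<Longrightarrow> comb c = comb c' \<Longrightarrow> c' = c\<^sub>0"
    using coeff_ex1[OF comb_closed[OF assms(1)], folded comb_def] by (elim ex1E) blast
  from this[OF e(1,2)] this[OF e(3)] have "restrict c (carrier F) = restrict d (carrier F)"
    using e(4) assms(3) by simp
  from fun_cong[OF this, of x] show ?thesis using assms(4) by simp
qed

lemma combE:
  assumes "s \<in> carrier S" obtains c where "c \<in> carrier F \<rightarrow> carrier R" "s = comb c"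
proof -
  obtain c where "c \<in> carrier F \<rightarrow>\<^sub>E carrier R" "s = comb c"
    using ex1_implies_ex[OF coeff_ex1[OF assms], folded comb_def] by blast
  then show ?thesis using that by (auto simp: PiE_iff)
qed

lemma comb_single:
  assumes x: "x \<in> carrier F" and r: "r \<in> carrier R"
  shows "comb (\<lambda>y. if x = y then r else \<zero>\<^bsub>R\<^esub>) = u x \<otimes>\<^bsub>S\<^esub> j r"
proof -
  have "comb (\<lambda>y. if x = y then r else \<zero>\<^bsub>R\<^esub>) = (\<Oplus>\<^bsub>S\<^esub>y\<in>carrier F. if x = y then u y \<otimes>\<^bsub>S\<^esub> j r else \<zero>\<^bsub>S\<^esub>)"
    unfolding comb_def by (rule S.finsum_cong') (use r in \<open>auto simp: j_zero\<close>)
  also have "\<dots> = u x \<otimes>\<^bsub>S\<^esub> j r"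
    using x r finite_F by (intro S.add.finprod_singleton) auto
  finally show ?thesis .
qed

lemma comb_add:
  assumes "c \<in> carrier F \<rightarrow> carrier R" "d \<in> carrier F \<rightarrow> carrier R"
  shows "comb c \<oplus>\<^bsub>S\<^esub> comb d = comb (\<lambda>x. c x \<oplus>\<^bsub>R\<^esub> d x)"
proof -
  have "comb (\<lambda>x. c x \<oplus>\<^bsub>R\<^esub> d x) = (\<Oplus>\<^bsub>S\<^esub>x\<in>carrier F. u x \<otimes>\<^bsub>S\<^esub> j (c x) \<oplus>\<^bsub>S\<^esub> u x \<otimes>\<^bsub>S\<^esub> j (d x))"
    unfolding comb_def by (rule S.finsum_cong') (use assms in \<open>auto simp: j_add S.r_distr Pi_iff\<close>)
  also have "\<dots> = comb c \<oplus>\<^bsub>S\<^esub> comb d" unfolding comb_def using assms by (intro S.finsum_addf) auto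
  finally show ?thesis by simp
qed

text \<open>Left and right multiplication by a basis element permute the coordinates up to the twisting
  and the action.\<close>

lemma u_comb:
  assumes y: "y \<in> carrier F" and c: "c \<in> carrier F \<rightarrow> carrier R"
  shows "u y \<otimes>\<^bsub>S\<^esub> comb c = comb (\<lambda>z. \<tau> y (inv\<^bsub>F\<^esub> y \<otimes>\<^bsub>F\<^esub> z) \<otimes>\<^bsub>R\<^esub> c (inv\<^bsub>F\<^esub> y \<otimes>\<^bsub>F\<^esub> z))" (is "_ = comb ?d")
proof -
  have "u y \<otimes>\<^bsub>S\<^esub> comb c = (\<Oplus>\<^bsub>S\<^esub>x\<in>carrier F. u y \<otimes>\<^bsub>S\<^esub> (u x \<otimes>\<^bsub>S\<^esub> j (c x)))"
    unfolding comb_def using c y finite_F by (intro S.finsum_rdistr) auto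
  also have "\<dots> = (\<Oplus>\<^bsub>S\<^esub>x\<in>carrier F. u (y \<otimes>\<^bsub>F\<^esub> x) \<otimes>\<^bsub>S\<^esub> j (?d (y \<otimes>\<^bsub>F\<^esub> x)))"
  proof (rule S.finsum_cong')
    fix x assume x: "x \<in> carrier F"
    have cx: "c x \<in> carrier R" using c x by auto
    have "inv\<^bsub>F\<^esub> y \<otimes>\<^bsub>F\<^esub> (y \<otimes>\<^bsub>F\<^esub> x) = x" using x y by (simp add: F.m_assoc[symmetric])
    then show "u y \<otimes>\<^bsub>S\<^esub> (u x \<otimes>\<^bsub>S\<^esub> j (c x)) = u (y \<otimes>\<^bsub>F\<^esub> x) \<otimes>\<^bsub>S\<^esub> j (?d (y \<otimes>\<^bsub>F\<^esub> x))"
      using x y cx by (simp add: S.m_assoc[symmetric] uu j_mult)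
  qed (use Pi_mem[OF c] c y in auto)
  also have "\<dots> = (\<Oplus>\<^bsub>S\<^esub>z\<in>(\<lambda>x. y \<otimes>\<^bsub>F\<^esub> x) ` carrier F. u z \<otimes>\<^bsub>S\<^esub> j (?d z))"
    using c y by (intro S.finsum_reindex[symmetric]) (auto simp: inj_on_def Pi_iff)
  also have "(\<lambda>x. y \<otimes>\<^bsub>F\<^esub> x) ` carrier F = carrier F"
    using F.surj_const_mult[OF y] .
  finally show ?thesis by (simp add: comb_def)
qed

lemma comb_u:
  assumes y: "y \<in> carrier F" and c: "c \<in> carrier F \<rightarrow> carrier R"
  shows "comb c \<otimes>\<^bsub>S\<^esub> u y = comb (\<lambda>z. \<tau> (z \<otimes>\<^bsub>F\<^esub> inv\<^bsub>F\<^esub> y) y \<otimes>\<^bsub>R\<^esub> \<sigma> y (c (z \<otimes>\<^bsub>F\<^esub> inv\<^bsub>F\<^esub> y)))" (is "_ = comb ?d")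
proof -
  have "comb c \<otimes>\<^bsub>S\<^esub> u y = (\<Oplus>\<^bsub>S\<^esub>x\<in>carrier F. (u x \<otimes>\<^bsub>S\<^esub> j (c x)) \<otimes>\<^bsub>S\<^esub> u y)"
    unfolding comb_def using c y finite_F by (intro S.finsum_ldistr) auto
  also have "\<dots> = (\<Oplus>\<^bsub>S\<^esub>x\<in>carrier F. u (x \<otimes>\<^bsub>F\<^esub> y) \<otimes>\<^bsub>S\<^esub> j (?d (x \<otimes>\<^bsub>F\<^esub> y)))"
  proof (rule S.finsum_cong')
    fix x assume x: "x \<in> carrier F"
    have cx: "c x \<in> carrier R" using c x by auto
    have "x \<otimes>\<^bsub>F\<^esub> y \<otimes>\<^bsub>F\<^esub> inv\<^bsub>F\<^esub> y = x" using x y by (simp add: F.m_assoc)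
    moreover have "(u x \<otimes>\<^bsub>S\<^esub> j (c x)) \<otimes>\<^bsub>S\<^esub> u y = (u x \<otimes>\<^bsub>S\<^esub> u y) \<otimes>\<^bsub>S\<^esub> j (\<sigma> y (c x))"
      using x y cx by (simp add: S.m_assoc ju)
    ultimately show "(u x \<otimes>\<^bsub>S\<^esub> j (c x)) \<otimes>\<^bsub>S\<^esub> u y = u (x \<otimes>\<^bsub>F\<^esub> y) \<otimes>\<^bsub>S\<^esub> j (?d (x \<otimes>\<^bsub>F\<^esub> y))"
      using x y cx by (simp add: uu j_mult S.m_assoc)
  qed (use Pi_mem[OF c] c y in auto)
  also have "\<dots> = (\<Oplus>\<^bsub>S\<^esub>z\<in>(\<lambda>x. x \<otimes>\<^bsub>F\<^esub> y) ` carrier F. u z \<otimes>\<^bsub>S\<^esub> j (?d z))"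
    using c y by (intro S.finsum_reindex[symmetric]) (auto simp: inj_on_def Pi_iff)
  also have "(\<lambda>x. x \<otimes>\<^bsub>F\<^esub> y) ` carrier F = carrier F"
    using F.surj_const_mult[OF y] y by (auto simp: image_iff) (metis F.inv_solve_right F.m_closed F.inv_closed)
  finally show ?thesis by (simp add: comb_def)
qed

lemma j_comb:
  assumes r: "r \<in> carrier R" and c: "c \<in> carrier F \<rightarrow> carrier R"
  shows "j r \<otimes>\<^bsub>S\<^esub> comb c = comb (\<lambda>x. \<sigma> x r \<otimes>\<^bsub>R\<^esub> c x)"
proof -
  have "j r \<otimes>\<^bsub>S\<^esub> comb c = (\<Oplus>\<^bsub>S\<^esub>x\<in>carrier F. j r \<otimes>\<^bsub>S\<^esub> (u x \<otimes>\<^bsub>S\<^esub> j (c x)))"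
    unfolding comb_def using c r finite_F by (intro S.finsum_rdistr) auto
  also have "\<dots> = comb (\<lambda>x. \<sigma> x r \<otimes>\<^bsub>R\<^esub> c x)" unfolding comb_def
  proof (rule S.finsum_cong')
    fix x assume x: "x \<in> carrier F"
    have cx: "c x \<in> carrier R" using c x by auto
    show "j r \<otimes>\<^bsub>S\<^esub> (u x \<otimes>\<^bsub>S\<^esub> j (c x)) = u x \<otimes>\<^bsub>S\<^esub> j (\<sigma> x r \<otimes>\<^bsub>R\<^esub> c x)"
      using x cx r by (simp add: S.m_assoc[symmetric] ju) (simp add: S.m_assoc j_mult)
  qed (use Pi_mem[OF c] c r in auto)
  finally show ?thesis .
qed

lemma comb_j:
  assumes r: "r \<in> carrier R" and c: "c \<in> carrier F \<rightarrow> carrier R"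
  shows "comb c \<otimes>\<^bsub>S\<^esub> j r = comb (\<lambda>x. c x \<otimes>\<^bsub>R\<^esub> r)"
proof -
  have "comb c \<otimes>\<^bsub>S\<^esub> j r = (\<Oplus>\<^bsub>S\<^esub>x\<in>carrier F. (u x \<otimes>\<^bsub>S\<^esub> j (c x)) \<otimes>\<^bsub>S\<^esub> j r)"
    unfolding comb_def using c r finite_F by (intro S.finsum_ldistr) auto
  also have "\<dots> = comb (\<lambda>x. c x \<otimes>\<^bsub>R\<^esub> r)" unfolding comb_def
    by (rule S.finsum_cong') (use c r in \<open>auto simp: S.m_assoc j_mult Pi_iff\<close>)
  finally show ?thesis .
qed

text \<open>The basis need not contain the identity. By the two preceding computations the equations
  \<open>u y s = 1\<close> and \<open>s u y = 1\<close> can be solved coordinate by coordinate, dividing by the values of the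
  twisting, which are units.\<close>

lemma u_Units: assumes y: "y \<in> carrier F" shows "u y \<in> Units S"
proof -
  obtain d where d: "d \<in> carrier F \<rightarrow> carrier R" "\<one>\<^bsub>S\<^esub> = comb d" by (rule combE[OF S.one_closed])
  have itau: "inv\<^bsub>R\<^esub> (\<tau> x z) \<in> carrier R" if "x \<in> carrier F" "z \<in> carrier F" for x z
    using \<tau>_unit[OF that] by (rule R.Units_inv_closed)
  have cancel: "\<tau> x z \<otimes>\<^bsub>R\<^esub> (inv\<^bsub>R\<^esub> (\<tau> x z) \<otimes>\<^bsub>R\<^esub> r) = r" if "x \<in> carrier F" "z \<in> carrier F" "r \<in> carrier R" for x z r
    using \<tau>_unit[OF that(1,2)] itau[OF that(1,2)] that by (simp add: R.m_assoc[symmetric])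
  have dc: "d x \<in> carrier R" if "x \<in> carrier F" for x using d that by auto
  define c where "c x = inv\<^bsub>R\<^esub> (\<tau> y x) \<otimes>\<^bsub>R\<^esub> d (y \<otimes>\<^bsub>F\<^esub> x)" for x
  have c: "c \<in> carrier F \<rightarrow> carrier R" using itau dc y by (auto simp: c_def)
  have "u y \<otimes>\<^bsub>S\<^esub> comb c = comb d" unfolding u_comb[OF y c]
  proof (rule comb_cong[OF d(1)])
    fix z assume z: "z \<in> carrier F"
    then have "y \<otimes>\<^bsub>F\<^esub> (inv\<^bsub>F\<^esub> y \<otimes>\<^bsub>F\<^esub> z) = z" using y by (simp add: F.m_assoc[symmetric])
    then show "\<tau> y (inv\<^bsub>F\<^esub> y \<otimes>\<^bsub>F\<^esub> z) \<otimes>\<^bsub>R\<^esub> c (inv\<^bsub>F\<^esub> y \<otimes>\<^bsub>F\<^esub> z) = d z"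
      using y z dc[OF z] cancel by (simp add: c_def)
  qed
  then have right: "u y \<otimes>\<^bsub>S\<^esub> comb c = \<one>\<^bsub>S\<^esub>" using d by simp
  have "\<exists>c'. \<forall>x\<in>carrier F. c' x \<in> carrier R \<and> \<sigma> y (c' x) = inv\<^bsub>R\<^esub> (\<tau> x y) \<otimes>\<^bsub>R\<^esub> d (x \<otimes>\<^bsub>F\<^esub> y)"
  proof (intro bchoice ballI)
    fix x assume x: "x \<in> carrier F"
    have "inv\<^bsub>R\<^esub> (\<tau> x y) \<otimes>\<^bsub>R\<^esub> d (x \<otimes>\<^bsub>F\<^esub> y) \<in> carrier R" using itau dc x y by simp
    then show "\<exists>r. r \<in> carrier R \<and> \<sigma> y r = inv\<^bsub>R\<^esub> (\<tau> x y) \<otimes>\<^bsub>R\<^esub> d (x \<otimes>\<^bsub>F\<^esub> y)"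
      using \<sigma>_surj[OF y] by metis
  qed
  then obtain c' where c': "\<And>x. x \<in> carrier F \<Longrightarrow> c' x \<in> carrier R"
      "\<And>x. x \<in> carrier F \<Longrightarrow> \<sigma> y (c' x) = inv\<^bsub>R\<^esub> (\<tau> x y) \<otimes>\<^bsub>R\<^esub> d (x \<otimes>\<^bsub>F\<^esub> y)" by blast
  have c'': "c' \<in> carrier F \<rightarrow> carrier R" using c' by auto
  have "comb c' \<otimes>\<^bsub>S\<^esub> u y = comb d" unfolding comb_u[OF y c'']
  proof (rule comb_cong[OF d(1)])
    fix z assume z: "z \<in> carrier F"
    then have "z \<otimes>\<^bsub>F\<^esub> inv\<^bsub>F\<^esub> y \<otimes>\<^bsub>F\<^esub> y = z" using y by (simp add: F.m_assoc)
    then show "\<tau> (z \<otimes>\<^bsub>F\<^esub> inv\<^bsub>F\<^esub> y) y \<otimes>\<^bsub>R\<^esub> \<sigma> y (c' (z \<otimes>\<^bsub>F\<^esub> inv\<^bsub>F\<^esub> y)) = d z"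
      using y z dc[OF z] cancel by (simp add: c')
  qed
  then have left: "comb c' \<otimes>\<^bsub>S\<^esub> u y = \<one>\<^bsub>S\<^esub>" using d by simp
  have "comb c' = comb c"
    using left right comb_closed[OF c] comb_closed[OF c''] y by (metis S.l_one S.m_assoc S.r_one u_closed)
  then show ?thesis using left right comb_closed[OF c] y by (auto simp: Units_def)
qed

text \<open>Cancel one factor in \<open>u 1 u 1 = u 1 \<tau>(1, 1)\<close>.\<close>

lemma u_one: "u \<one>\<^bsub>F\<^esub> = j (\<tau> \<one>\<^bsub>F\<^esub> \<one>\<^bsub>F\<^esub>)"
proof -
  let ?e = "\<one>\<^bsub>F\<^esub>"
  have e: "?e \<in> carrier F" by simp
  have t: "\<tau> ?e ?e \<in> carrier R" by simp
  have "u ?e \<otimes>\<^bsub>S\<^esub> u ?e = u ?e \<otimes>\<^bsub>S\<^esub> j (\<tau> ?e ?e)" using uu[OF e e] by simp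
  then show ?thesis using S.Units_l_cancel[OF u_Units[OF e] u_closed[OF e] j_closed[OF t]] by simp
qed

lemma j_as_comb:
  assumes "r \<in> carrier R"
  shows "j r = u \<one>\<^bsub>F\<^esub> \<otimes>\<^bsub>S\<^esub> j (inv\<^bsub>R\<^esub> (\<tau> \<one>\<^bsub>F\<^esub> \<one>\<^bsub>F\<^esub>) \<otimes>\<^bsub>R\<^esub> r)"
proof -
  have t: "\<tau> \<one>\<^bsub>F\<^esub> \<one>\<^bsub>F\<^esub> \<in> Units R" by (simp add: \<tau>_unit)
  then have "\<tau> \<one>\<^bsub>F\<^esub> \<one>\<^bsub>F\<^esub> \<otimes>\<^bsub>R\<^esub> (inv\<^bsub>R\<^esub> (\<tau> \<one>\<^bsub>F\<^esub> \<one>\<^bsub>F\<^esub>) \<otimes>\<^bsub>R\<^esub> r) = r"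
    using assms by (simp add: R.m_assoc[symmetric])
  then show ?thesis using t assms by (simp add: u_one j_mult[symmetric])
qed

text \<open>The left ideal \<open>S I\<close>, described by coordinates.\<close>

definition ideal_span :: "'r set \<Rightarrow> 's set" where
  "ideal_span I = {comb c |c. c \<in> carrier F \<rightarrow> I}"

context
  fixes I assumes I: "ideal I R"
begin

interpretation I: ideal I R by (rule I)

lemma span_coeff_closed: "c \<in> carrier F \<rightarrow> I \<Longrightarrow> c \<in> carrier F \<rightarrow> carrier R"
  using I.a_subset by blast

lemma ideal_span_subgroup: "additive_subgroup (ideal_span I) S"
proof (intro additive_subgroup.intro group.subgroupI)
  show "group (add_monoid S)" by (rule S.a_group)
  show "ideal_span I \<subseteq> carrier (add_monoid S)"
    using comb_closed span_coeff_closed by (auto simp: ideal_span_def)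
  have "(\<lambda>_. \<zero>\<^bsub>R\<^esub>) \<in> carrier F \<rightarrow> I" by auto
  then show "ideal_span I \<noteq> {}" unfolding ideal_span_def by blast
  have add: "a \<oplus>\<^bsub>S\<^esub> b \<in> ideal_span I" if ab: "a \<in> ideal_span I" "b \<in> ideal_span I" for a b
  proof -
    obtain c d where cd: "c \<in> carrier F \<rightarrow> I" "d \<in> carrier F \<rightarrow> I" "a = comb c" "b = comb d"
      using ab by (auto simp: ideal_span_def)
    then have "a \<oplus>\<^bsub>S\<^esub> b = comb (\<lambda>x. c x \<oplus>\<^bsub>R\<^esub> d x)" using comb_add span_coeff_closed by simp
    moreover have "(\<lambda>x. c x \<oplus>\<^bsub>R\<^esub> d x) \<in> carrier F \<rightarrow> I" using cd I.a_closed by auto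
    ultimately show ?thesis by (auto simp: ideal_span_def)
  qed
  then show "a \<otimes>\<^bsub>add_monoid S\<^esub> b \<in> ideal_span I" if "a \<in> ideal_span I" "b \<in> ideal_span I" for a b
    using that by simp
  fix a assume "a \<in> ideal_span I"
  then obtain c where c: "c \<in> carrier F \<rightarrow> I" "a = comb c" by (auto simp: ideal_span_def)
  have cR: "c \<in> carrier F \<rightarrow> carrier R" using span_coeff_closed c by blast
  have m: "(\<lambda>x. \<ominus>\<^bsub>R\<^esub> c x) \<in> carrier F \<rightarrow> I" using c by auto
  have "comb (\<lambda>x. \<ominus>\<^bsub>R\<^esub> c x) \<oplus>\<^bsub>S\<^esub> a = comb (\<lambda>x. \<ominus>\<^bsub>R\<^esub> c x \<oplus>\<^bsub>R\<^esub> c x)"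
    using comb_add[OF span_coeff_closed[OF m] cR] c by simp
  also have "\<dots> = comb (\<lambda>y. if \<one>\<^bsub>F\<^esub> = y then \<zero>\<^bsub>R\<^esub> else \<zero>\<^bsub>R\<^esub>)"
    by (rule comb_cong) (use cR in \<open>auto simp: R.l_neg Pi_iff\<close>)
  also have "\<dots> = \<zero>\<^bsub>S\<^esub>" by (subst comb_single) (auto simp: j_zero)
  finally have "\<ominus>\<^bsub>S\<^esub> a = comb (\<lambda>x. \<ominus>\<^bsub>R\<^esub> c x)"
    using S.minus_equality comb_closed cR c span_coeff_closed[OF m] by metis
  then show "inv\<^bsub>add_monoid S\<^esub> a \<in> ideal_span I" using m unfolding ideal_span_def a_inv_def by auto
qed

lemma ideal_span_left:
  assumes s: "s \<in> carrier S" and b: "b \<in> ideal_span I" shows "s \<otimes>\<^bsub>S\<^esub> b \<in> ideal_span I"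
proof -
  interpret sp: additive_subgroup "ideal_span I" S by (rule ideal_span_subgroup)
  obtain c where c: "c \<in> carrier F \<rightarrow> I" "b = comb c" using b by (auto simp: ideal_span_def)
  have bS: "b \<in> carrier S" using comb_closed span_coeff_closed c by simp
  obtain d where d: "d \<in> carrier F \<rightarrow> carrier R" "s = comb d" by (rule combE[OF s])
  have tm: "u x \<otimes>\<^bsub>S\<^esub> j r \<otimes>\<^bsub>S\<^esub> b \<in> ideal_span I" if x: "x \<in> carrier F" and r: "r \<in> carrier R" for x r
  proof -
    have c': "(\<lambda>z. \<sigma> z r \<otimes>\<^bsub>R\<^esub> c z) \<in> carrier F \<rightarrow> I" using Pi_mem[OF c(1)] r I.I_l_closed by auto
    have "u x \<otimes>\<^bsub>S\<^esub> j r \<otimes>\<^bsub>S\<^esub> b = u x \<otimes>\<^bsub>S\<^esub> comb (\<lambda>z. \<sigma> z r \<otimes>\<^bsub>R\<^esub> c z)"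
      using x r bS j_comb[OF r span_coeff_closed[OF c(1)]] c(2) by (simp add: S.m_assoc)
    also have "\<dots> = comb (\<lambda>z. \<tau> x (inv\<^bsub>F\<^esub> x \<otimes>\<^bsub>F\<^esub> z) \<otimes>\<^bsub>R\<^esub>
        (\<sigma> (inv\<^bsub>F\<^esub> x \<otimes>\<^bsub>F\<^esub> z) r \<otimes>\<^bsub>R\<^esub> c (inv\<^bsub>F\<^esub> x \<otimes>\<^bsub>F\<^esub> z)))"
      by (rule u_comb[OF x span_coeff_closed[OF c']])
    also have "\<dots> \<in> ideal_span I"
    proof -
      have "(\<lambda>z. \<tau> x (inv\<^bsub>F\<^esub> x \<otimes>\<^bsub>F\<^esub> z) \<otimes>\<^bsub>R\<^esub>
          (\<sigma> (inv\<^bsub>F\<^esub> x \<otimes>\<^bsub>F\<^esub> z) r \<otimes>\<^bsub>R\<^esub> c (inv\<^bsub>F\<^esub> x \<otimes>\<^bsub>F\<^esub> z))) \<in> carrier F \<rightarrow> I"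
      proof (rule Pi_I)
        fix z assume "z \<in> carrier F"
        then have m: "inv\<^bsub>F\<^esub> x \<otimes>\<^bsub>F\<^esub> z \<in> carrier F" using x by simp
        show "\<tau> x (inv\<^bsub>F\<^esub> x \<otimes>\<^bsub>F\<^esub> z) \<otimes>\<^bsub>R\<^esub> (\<sigma> (inv\<^bsub>F\<^esub> x \<otimes>\<^bsub>F\<^esub> z) r \<otimes>\<^bsub>R\<^esub> c (inv\<^bsub>F\<^esub> x \<otimes>\<^bsub>F\<^esub> z)) \<in> I"
          by (rule I.I_l_closed[OF Pi_mem[OF c' m] \<tau>_closed[OF x m]])
      qed
      then show ?thesis unfolding ideal_span_def by blast
    qed
    finally show ?thesis .
  qed
  have "s \<otimes>\<^bsub>S\<^esub> b = (\<Oplus>\<^bsub>S\<^esub>x\<in>carrier F. u x \<otimes>\<^bsub>S\<^esub> j (d x) \<otimes>\<^bsub>S\<^esub> b)"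
    unfolding d(2) comb_def using d finite_F bS by (intro S.finsum_ldistr) auto
  moreover have "(\<Oplus>\<^bsub>S\<^esub>x\<in>X. u x \<otimes>\<^bsub>S\<^esub> j (d x) \<otimes>\<^bsub>S\<^esub> b) \<in> ideal_span I" if "finite X" "X \<subseteq> carrier F" for X
    using that
  proof (induction X rule: finite_induct)
    case (insert x X)
    have m: "u y \<otimes>\<^bsub>S\<^esub> j (d y) \<otimes>\<^bsub>S\<^esub> b \<in> ideal_span I" if "y \<in> carrier F" for y
      using tm[OF that, of "d y"] d that by auto
    have "ideal_span I \<subseteq> carrier S" by (rule sp.a_subset)
    then show ?case using insert m by (subst S.finsum_insert) (auto intro!: sp.a_closed)
  qed simp
  ultimately show ?thesis using finite_F by simp
qed

lemma ideal_span_right_coeff: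
  assumes r: "r \<in> carrier R" and b: "b \<in> ideal_span I" shows "b \<otimes>\<^bsub>S\<^esub> j r \<in> ideal_span I"
proof -
  obtain c where c: "c \<in> carrier F \<rightarrow> I" "b = comb c" using b by (auto simp: ideal_span_def)
  then have "b \<otimes>\<^bsub>S\<^esub> j r = comb (\<lambda>x. c x \<otimes>\<^bsub>R\<^esub> r)" using comb_j[OF r span_coeff_closed] by simp
  moreover have "(\<lambda>x. c x \<otimes>\<^bsub>R\<^esub> r) \<in> carrier F \<rightarrow> I" using c r I.I_r_closed by auto
  ultimately show ?thesis by (auto simp: ideal_span_def)
qed

lemma ideal_span_right:
  assumes st: "\<And>x. x \<in> carrier F \<Longrightarrow> \<sigma> x ` I \<subseteq> I" and s: "s \<in> carrier S" and b: "b \<in> ideal_span I"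
  shows "b \<otimes>\<^bsub>S\<^esub> s \<in> ideal_span I"
proof -
  interpret sp: additive_subgroup "ideal_span I" S by (rule ideal_span_subgroup)
  obtain c where c: "c \<in> carrier F \<rightarrow> I" "b = comb c" using b by (auto simp: ideal_span_def)
  have bS: "b \<in> carrier S" using comb_closed span_coeff_closed c by simp
  obtain d where d: "d \<in> carrier F \<rightarrow> carrier R" "s = comb d" by (rule combE[OF s])
  have tm: "b \<otimes>\<^bsub>S\<^esub> (u x \<otimes>\<^bsub>S\<^esub> j r) \<in> ideal_span I" if x: "x \<in> carrier F" and r: "r \<in> carrier R" for x r
  proof -
    have "b \<otimes>\<^bsub>S\<^esub> u x = comb (\<lambda>z. \<tau> (z \<otimes>\<^bsub>F\<^esub> inv\<^bsub>F\<^esub> x) x \<otimes>\<^bsub>R\<^esub> \<sigma> x (c (z \<otimes>\<^bsub>F\<^esub> inv\<^bsub>F\<^esub> x)))"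
      unfolding c(2) by (rule comb_u[OF x span_coeff_closed[OF c(1)]])
    also have "\<dots> \<in> ideal_span I"
    proof -
      have "(\<lambda>z. \<tau> (z \<otimes>\<^bsub>F\<^esub> inv\<^bsub>F\<^esub> x) x \<otimes>\<^bsub>R\<^esub> \<sigma> x (c (z \<otimes>\<^bsub>F\<^esub> inv\<^bsub>F\<^esub> x))) \<in> carrier F \<rightarrow> I"
        using c(1) x st[OF x] by (intro Pi_I I.I_l_closed) auto
      then show ?thesis by (auto simp: ideal_span_def)
    qed
    finally have "b \<otimes>\<^bsub>S\<^esub> u x \<in> ideal_span I" .
    then have "b \<otimes>\<^bsub>S\<^esub> u x \<otimes>\<^bsub>S\<^esub> j r \<in> ideal_span I" by (rule ideal_span_right_coeff[OF r])
    then show ?thesis using bS x r by (simp add: S.m_assoc)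
  qed
  have "b \<otimes>\<^bsub>S\<^esub> s = (\<Oplus>\<^bsub>S\<^esub>x\<in>carrier F. b \<otimes>\<^bsub>S\<^esub> (u x \<otimes>\<^bsub>S\<^esub> j (d x)))"
    unfolding d(2) comb_def using d finite_F bS by (intro S.finsum_rdistr) auto
  moreover have "(\<Oplus>\<^bsub>S\<^esub>x\<in>X. b \<otimes>\<^bsub>S\<^esub> (u x \<otimes>\<^bsub>S\<^esub> j (d x))) \<in> ideal_span I" if "finite X" "X \<subseteq> carrier F" for X
    using that
  proof (induction X rule: finite_induct)
    case (insert x X)
    have m: "b \<otimes>\<^bsub>S\<^esub> (u y \<otimes>\<^bsub>S\<^esub> j (d y)) \<in> ideal_span I" if "y \<in> carrier F" for y
      using tm[OF that, of "d y"] d that by auto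
    have "ideal_span I \<subseteq> carrier S" by (rule sp.a_subset)
    then show ?case using insert m by (subst S.finsum_insert) (auto intro!: sp.a_closed)
  qed simp
  ultimately show ?thesis using finite_F by simp
qed

text \<open>The only coordinate of an element of \<open>R\<close> is a unit multiple of it, and coordinates are unique.\<close>

lemma j_in_ideal_span_iff:
  assumes r: "r \<in> carrier R" shows "j r \<in> ideal_span I \<longleftrightarrow> r \<in> I"
proof
  let ?v = "inv\<^bsub>R\<^esub> (\<tau> \<one>\<^bsub>F\<^esub> \<one>\<^bsub>F\<^esub>)" and ?e = "\<one>\<^bsub>F\<^esub>"
  have t: "\<tau> ?e ?e \<in> Units R" by (simp add: \<tau>_unit)
  then have v: "?v \<in> carrier R" by simp
  define d where "d y = (if ?e = y then ?v \<otimes>\<^bsub>R\<^esub> r else \<zero>\<^bsub>R\<^esub>)" for y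
  have jd: "j r = comb d" unfolding d_def using comb_single[of ?e "?v \<otimes>\<^bsub>R\<^esub> r"] j_as_comb[OF r] v r by simp
  have dR: "d \<in> carrier F \<rightarrow> carrier R" using v r by (auto simp: d_def)
  {
    assume "r \<in> I"
    then have "d \<in> carrier F \<rightarrow> I" using v I.I_l_closed by (auto simp: d_def)
    then show "j r \<in> ideal_span I" unfolding jd ideal_span_def by blast
  next
    assume "j r \<in> ideal_span I"
    then obtain c where c: "c \<in> carrier F \<rightarrow> I" "j r = comb c" by (auto simp: ideal_span_def)
    have "c ?e = d ?e" by (rule comb_inject[OF span_coeff_closed[OF c(1)] dR]) (use c jd in auto)
    then have "?v \<otimes>\<^bsub>R\<^esub> r \<in> I" using Pi_mem[OF c(1) F.one_closed] by (simp add: d_def)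
    then have "\<tau> ?e ?e \<otimes>\<^bsub>R\<^esub> (?v \<otimes>\<^bsub>R\<^esub> r) \<in> I" using I.I_l_closed by simp
    then show "r \<in> I" using t v r by (simp add: R.m_assoc[symmetric])
  }
qed

end

lemma u_inv_j_u:
  assumes "x \<in> carrier F" "r \<in> carrier R" shows "inv\<^bsub>S\<^esub> (u x) \<otimes>\<^bsub>S\<^esub> j r \<otimes>\<^bsub>S\<^esub> u x = j (\<sigma> x r)"
  using assms u_Units[OF assms(1)] by (simp add: S.m_assoc ju) (simp add: S.m_assoc[symmetric])

text \<open>Conjugation by a unit of \<open>R\<close> preserves the ideals of \<open>R\<close>, so only the action \<open>\<sigma>\<close> matters.\<close>

lemma twist_conj_stable_iff:
  assumes I: "ideal I R" and B: "B \<subseteq> Units R" "B \<noteq> {}"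
  shows "twist_conj_stable F S j u B I \<longleftrightarrow> (\<forall>x\<in>carrier F. \<sigma> x ` I = I)"
proof -
  interpret I: ideal I R by (rule I)
  have conj: "inv\<^bsub>S\<^esub> (u x \<otimes>\<^bsub>S\<^esub> j n) \<otimes>\<^bsub>S\<^esub> j r \<otimes>\<^bsub>S\<^esub> (u x \<otimes>\<^bsub>S\<^esub> j n)
      = j (inv\<^bsub>R\<^esub> n \<otimes>\<^bsub>R\<^esub> \<sigma> x r \<otimes>\<^bsub>R\<^esub> n)"
    if x: "x \<in> carrier F" and n: "n \<in> Units R" and r: "r \<in> carrier R" for x n r
  proof -
    have nR: "n \<in> carrier R" "inv\<^bsub>R\<^esub> n \<in> carrier R" using n by auto
    have jn: "j n \<in> Units S" "inv\<^bsub>S\<^esub> (j n) = j (inv\<^bsub>R\<^esub> n)"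
    proof -
      have e: "j n \<otimes>\<^bsub>S\<^esub> j (inv\<^bsub>R\<^esub> n) = \<one>\<^bsub>S\<^esub>" "j (inv\<^bsub>R\<^esub> n) \<otimes>\<^bsub>S\<^esub> j n = \<one>\<^bsub>S\<^esub>"
        using n nR by (simp_all add: j_mult[symmetric] j_one)
      show "j n \<in> Units S" using e nR by (auto simp: Units_def)
      show "inv\<^bsub>S\<^esub> (j n) = j (inv\<^bsub>R\<^esub> n)" using e nR by (intro S.inv_unique'[symmetric]) auto
    qed
    have ux: "u x \<in> Units S" by (rule u_Units[OF x])
    have "inv\<^bsub>S\<^esub> (u x \<otimes>\<^bsub>S\<^esub> j n) = inv\<^bsub>S\<^esub> (j n) \<otimes>\<^bsub>S\<^esub> inv\<^bsub>S\<^esub> (u x)"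
    proof (rule S.inv_unique'[symmetric])
      have c: "u x \<in> carrier S" "j n \<in> carrier S" "inv\<^bsub>S\<^esub> (j n) \<in> carrier S" "inv\<^bsub>S\<^esub> (u x) \<in> carrier S"
        using ux jn nR x by auto
      have "u x \<otimes>\<^bsub>S\<^esub> j n \<otimes>\<^bsub>S\<^esub> (inv\<^bsub>S\<^esub> (j n) \<otimes>\<^bsub>S\<^esub> inv\<^bsub>S\<^esub> (u x)) = u x \<otimes>\<^bsub>S\<^esub> (j n \<otimes>\<^bsub>S\<^esub> inv\<^bsub>S\<^esub> (j n)) \<otimes>\<^bsub>S\<^esub> inv\<^bsub>S\<^esub> (u x)"
        using c by (simp only: S.m_assoc S.m_closed)
      then show "u x \<otimes>\<^bsub>S\<^esub> j n \<otimes>\<^bsub>S\<^esub> (inv\<^bsub>S\<^esub> (j n) \<otimes>\<^bsub>S\<^esub> inv\<^bsub>S\<^esub> (u x)) = \<one>\<^bsub>S\<^esub>"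
        using c(1) ux jn(1) by (simp add: S.Units_r_inv)
      have "inv\<^bsub>S\<^esub> (j n) \<otimes>\<^bsub>S\<^esub> inv\<^bsub>S\<^esub> (u x) \<otimes>\<^bsub>S\<^esub> (u x \<otimes>\<^bsub>S\<^esub> j n) = inv\<^bsub>S\<^esub> (j n) \<otimes>\<^bsub>S\<^esub> (inv\<^bsub>S\<^esub> (u x) \<otimes>\<^bsub>S\<^esub> u x) \<otimes>\<^bsub>S\<^esub> j n"
        using c by (simp only: S.m_assoc S.m_closed)
      then show "inv\<^bsub>S\<^esub> (j n) \<otimes>\<^bsub>S\<^esub> inv\<^bsub>S\<^esub> (u x) \<otimes>\<^bsub>S\<^esub> (u x \<otimes>\<^bsub>S\<^esub> j n) = \<one>\<^bsub>S\<^esub>"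
        using c(3) ux jn(1) by (simp add: S.Units_l_inv)
    qed (use ux jn nR x in auto)
    then have "inv\<^bsub>S\<^esub> (u x \<otimes>\<^bsub>S\<^esub> j n) \<otimes>\<^bsub>S\<^esub> j r \<otimes>\<^bsub>S\<^esub> (u x \<otimes>\<^bsub>S\<^esub> j n)
        = j (inv\<^bsub>R\<^esub> n) \<otimes>\<^bsub>S\<^esub> (inv\<^bsub>S\<^esub> (u x) \<otimes>\<^bsub>S\<^esub> j r \<otimes>\<^bsub>S\<^esub> u x) \<otimes>\<^bsub>S\<^esub> j n"
      using ux x r nR jn by (simp add: S.m_assoc)
    then show ?thesis using u_inv_j_u[OF x r] x r nR by (simp add: j_mult)
  qed
  have one: "(\<lambda>r. inv\<^bsub>S\<^esub> (u x \<otimes>\<^bsub>S\<^esub> j n) \<otimes>\<^bsub>S\<^esub> j r \<otimes>\<^bsub>S\<^esub> (u x \<otimes>\<^bsub>S\<^esub> j n)) ` I = j ` I \<longleftrightarrow> \<sigma> x ` I = I"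
    if x: "x \<in> carrier F" and n: "n \<in> Units R" for x n
  proof -
    have nR: "n \<in> carrier R" "inv\<^bsub>R\<^esub> n \<in> carrier R" using n by auto
    let ?c = "\<lambda>r. inv\<^bsub>R\<^esub> n \<otimes>\<^bsub>R\<^esub> r \<otimes>\<^bsub>R\<^esub> n"
    have IR: "I \<subseteq> carrier R" by (rule I.a_subset)
    have cI: "?c ` I = I"
    proof (rule subset_antisym; rule subsetI)
      fix r assume r: "r \<in> I"
      have rR: "r \<in> carrier R" using r IR by blast
      have "r = ?c (n \<otimes>\<^bsub>R\<^esub> r \<otimes>\<^bsub>R\<^esub> inv\<^bsub>R\<^esub> n)"
      proof -
        have "?c (n \<otimes>\<^bsub>R\<^esub> r \<otimes>\<^bsub>R\<^esub> inv\<^bsub>R\<^esub> n) = (inv\<^bsub>R\<^esub> n \<otimes>\<^bsub>R\<^esub> n) \<otimes>\<^bsub>R\<^esub> r \<otimes>\<^bsub>R\<^esub> (inv\<^bsub>R\<^esub> n \<otimes>\<^bsub>R\<^esub> n)"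
          using nR rR by (simp only: R.m_assoc R.m_closed)
        then show ?thesis using n rR by (simp add: R.Units_l_inv)
      qed
      moreover have "n \<otimes>\<^bsub>R\<^esub> r \<otimes>\<^bsub>R\<^esub> inv\<^bsub>R\<^esub> n \<in> I" using r nR I.I_l_closed I.I_r_closed by simp
      ultimately show "r \<in> ?c ` I" by blast
    qed (use nR I.I_l_closed I.I_r_closed in auto)
    have c_inj: "inj_on ?c (carrier R)"
    proof (rule inj_onI)
      fix r s assume rs: "r \<in> carrier R" "s \<in> carrier R" "?c r = ?c s"
      have "n \<otimes>\<^bsub>R\<^esub> ?c r \<otimes>\<^bsub>R\<^esub> inv\<^bsub>R\<^esub> n = r" if "r \<in> carrier R" for r
      proof -
        have "n \<otimes>\<^bsub>R\<^esub> ?c r \<otimes>\<^bsub>R\<^esub> inv\<^bsub>R\<^esub> n = (n \<otimes>\<^bsub>R\<^esub> inv\<^bsub>R\<^esub> n) \<otimes>\<^bsub>R\<^esub> r \<otimes>\<^bsub>R\<^esub> (n \<otimes>\<^bsub>R\<^esub> inv\<^bsub>R\<^esub> n)"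
          using nR that by (simp only: R.m_assoc R.m_closed)
        then show ?thesis using n that by (simp add: R.Units_r_inv)
      qed
      then show "r = s" using rs by metis
    qed
    have \<sigma>I: "\<sigma> x ` I \<subseteq> carrier R" using IR x by auto
    have "(\<lambda>r. inv\<^bsub>S\<^esub> (u x \<otimes>\<^bsub>S\<^esub> j n) \<otimes>\<^bsub>S\<^esub> j r \<otimes>\<^bsub>S\<^esub> (u x \<otimes>\<^bsub>S\<^esub> j n)) ` I = j ` (?c ` (\<sigma> x ` I))"
      unfolding image_image using conj[OF x n] IR by (intro image_cong) auto
    moreover have "j ` (?c ` (\<sigma> x ` I)) = j ` I \<longleftrightarrow> ?c ` (\<sigma> x ` I) = I"
      using \<sigma>I nR IR by (intro inj_on_image_eq_iff[OF j_inj]) auto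
    moreover have "?c ` (\<sigma> x ` I) = I \<longleftrightarrow> \<sigma> x ` I = I"
    proof -
      have "?c ` (\<sigma> x ` I) = ?c ` I \<longleftrightarrow> \<sigma> x ` I = I"
        by (rule inj_on_image_eq_iff[OF c_inj \<sigma>I IR])
      then show ?thesis unfolding cI .
    qed
    ultimately show ?thesis by simp
  qed
  show ?thesis
  proof
    assume "twist_conj_stable F S j u B I"
    then show "\<forall>x\<in>carrier F. \<sigma> x ` I = I"
      unfolding twist_conj_stable_def using one B by (meson ex_in_conv subsetD)
  next
    assume "\<forall>x\<in>carrier F. \<sigma> x ` I = I"
    then show "twist_conj_stable F S j u B I" unfolding twist_conj_stable_def using one B by blast
  qed
qed

end

section \<open>Subrings and quotients\<close>

text \<open>Additive inverses are defined by a choice from the carrier, so they have to be compared.\<close>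

lemma subring_minus:
  fixes R :: "'r ring"
  assumes R: "ring R" and C: "ring (R\<lparr>carrier := C\<rparr>)" "C \<subseteq> carrier R" and x: "x \<in> C" "y \<in> C"
  shows "x \<ominus>\<^bsub>R\<lparr>carrier := C\<rparr>\<^esub> y = x \<ominus>\<^bsub>R\<^esub> y"
proof -
  interpret R: ring R by (rule R)
  interpret C: ring "R\<lparr>carrier := C\<rparr>" by (rule C)
  have c: "\<ominus>\<^bsub>R\<lparr>carrier := C\<rparr>\<^esub> y \<in> C" using C.a_inv_closed[of y] x by simp
  moreover have "\<ominus>\<^bsub>R\<lparr>carrier := C\<rparr>\<^esub> y \<oplus>\<^bsub>R\<^esub> y = \<zero>\<^bsub>R\<^esub>" using C.l_neg[of y] x by simp
  ultimately have "\<ominus>\<^bsub>R\<^esub> y = \<ominus>\<^bsub>R\<lparr>carrier := C\<rparr>\<^esub> y" using C(2) x by (intro R.minus_equality) auto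
  then show ?thesis by (simp add: a_minus_def)
qed

lemma ideal_Int_subring:
  fixes R :: "'r ring"
  assumes I: "ideal I R" and C: "ring (R\<lparr>carrier := C\<rparr>)" "C \<subseteq> carrier R"
  shows "ideal (I \<inter> C) (R\<lparr>carrier := C\<rparr>)"
proof (rule idealI)
  interpret I: ideal I R by (rule I)
  interpret C: ring "R\<lparr>carrier := C\<rparr>" by (rule C)
  show "ring (R\<lparr>carrier := C\<rparr>)" by (rule C)
  show "subgroup (I \<inter> C) (add_monoid (R\<lparr>carrier := C\<rparr>))"
  proof (rule group.subgroupI)
    show "group (add_monoid (R\<lparr>carrier := C\<rparr>))" by (rule C.a_group)
    have "\<zero>\<^bsub>R\<^esub> \<in> C" using C.zero_closed by simp
    then show "I \<inter> C \<noteq> {}" using additive_subgroup.zero_closed[OF I.is_additive_subgroup] by blast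
    fix x assume x: "x \<in> I \<inter> C"
    have "\<ominus>\<^bsub>R\<lparr>carrier := C\<rparr>\<^esub> x = \<ominus>\<^bsub>R\<^esub> x"
    proof (rule I.minus_equality[symmetric])
      show "\<ominus>\<^bsub>R\<lparr>carrier := C\<rparr>\<^esub> x \<oplus>\<^bsub>R\<^esub> x = \<zero>\<^bsub>R\<^esub>" using C.l_neg[of x] x by simp
      show "x \<in> carrier R" "\<ominus>\<^bsub>R\<lparr>carrier := C\<rparr>\<^esub> x \<in> carrier R" using x C(2) C.a_inv_closed[of x] by auto
    qed
    then have "\<ominus>\<^bsub>R\<lparr>carrier := C\<rparr>\<^esub> x \<in> I \<inter> C" using x C.a_inv_closed[of x] by auto
    then show "inv\<^bsub>add_monoid (R\<lparr>carrier := C\<rparr>)\<^esub> x \<in> I \<inter> C" by (simp add: a_inv_def)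
    fix y assume y: "y \<in> I \<inter> C"
    show "x \<otimes>\<^bsub>add_monoid (R\<lparr>carrier := C\<rparr>)\<^esub> y \<in> I \<inter> C" using x y C.a_closed[of x y] I.a_closed by simp
  qed auto
  fix a x assume "a \<in> I \<inter> C" "x \<in> carrier (R\<lparr>carrier := C\<rparr>)"
  then show "x \<otimes>\<^bsub>R\<lparr>carrier := C\<rparr>\<^esub> a \<in> I \<inter> C" "a \<otimes>\<^bsub>R\<lparr>carrier := C\<rparr>\<^esub> x \<in> I \<inter> C"
    using C.m_closed[of x a] C.m_closed[of a x] I.I_l_closed I.I_r_closed C(2) by auto
qed

lemma quotient_iso_hom:
  assumes I: "ideal I A" and \<psi>: "\<psi> \<in> ring_iso (A Quot I) B"
  shows "(\<lambda>x. \<psi> (I +>\<^bsub>A\<^esub> x)) \<in> ring_hom A B"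
    and "(\<lambda>x. \<psi> (I +>\<^bsub>A\<^esub> x)) ` carrier A = carrier B"
    and "\<And>x y. x \<in> carrier A \<Longrightarrow> y \<in> carrier A \<Longrightarrow> \<psi> (I +>\<^bsub>A\<^esub> x) = \<psi> (I +>\<^bsub>A\<^esub> y) \<Longrightarrow> x \<ominus>\<^bsub>A\<^esub> y \<in> I"
proof -
  interpret I: ideal I A by (rule I)
  have \<psi>h: "\<psi> \<in> ring_hom (A Quot I) B" and bij: "bij_betw \<psi> (carrier (A Quot I)) (carrier B)"
    using \<psi> by (auto simp: ring_iso_def)
  have car: "carrier (A Quot I) = (\<lambda>x. I +>\<^bsub>A\<^esub> x) ` carrier A"
    by (auto simp: FactRing_def A_RCOSETS_def')
  show "(\<lambda>x. \<psi> (I +>\<^bsub>A\<^esub> x)) \<in> ring_hom A B"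
    using ring_hom_trans[OF I.rcos_ring_hom \<psi>h] by (simp add: o_def)
  show "(\<lambda>x. \<psi> (I +>\<^bsub>A\<^esub> x)) ` carrier A = carrier B"
    using bij unfolding bij_betw_def car by (simp add: image_image)
  fix x y assume xy: "x \<in> carrier A" "y \<in> carrier A" "\<psi> (I +>\<^bsub>A\<^esub> x) = \<psi> (I +>\<^bsub>A\<^esub> y)"
  then have "I +>\<^bsub>A\<^esub> x = I +>\<^bsub>A\<^esub> y" using bij unfolding bij_betw_def car by (auto dest: inj_onD)
  then show "x \<ominus>\<^bsub>A\<^esub> y \<in> I" using I.quotient_eq_iff_same_a_r_cos[OF I xy(1,2)] by simp
qed

section \<open>Stability under conjugation\<close>

text \<open>The ideal \<open>M\<^sub>t(I S)\<close> of the crossed product connects the two notions of stability without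
  comparing the elements \<open>e g\<close> with the basis \<open>u\<close>. If \<open>A\<close> is stable under the \<open>e g\<close> then \<open>A B\<close> is
  contained in \<open>B A\<close>, as \<open>B\<close> is generated by the \<open>e g\<close> over \<open>C\<close>; so conjugating matrices over \<open>I\<close>
  by \<open>u x\<close> stays within matrices over the left ideal \<open>S I\<close>, which meets \<open>R\<close> in \<open>I\<close>. Conversely, if
  \<open>I\<close> is stable then \<open>S I\<close> is a two-sided ideal, and \<open>A\<close> is the part of its preimage in \<open>C\<close>.\<close>

lemma conj_stable_matrix_iff:
  fixes B :: "'b ring" and S :: "'s ring" and e e' :: "'x \<Rightarrow> 'b" and s :: "'i \<Rightarrow> 'x"
  assumes "crossed_product_ring R F \<sigma> \<tau> S j u"
    and "matrix_hom B S t \<phi>'" and "matrix_hom (B\<lparr>carrier := C\<rparr>) R t \<phi>"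
    and CB: "C \<subseteq> carrier B" and t: "t \<ge> 1"
    and surj: "\<phi> ` C = mat_set t (carrier R)" "\<phi>' ` carrier B = mat_set t (carrier S)"
    and ext: "\<And>x. x \<in> C \<Longrightarrow> \<phi>' x = mat_map t j (\<phi> x)"
    and I: "ideal I R" and A: "A = {x \<in> C. \<phi> x \<in> mat_set t I}"
    and e: "\<And>g. g \<in> X \<Longrightarrow> e g \<in> carrier B \<and> e' g \<in> carrier B \<and> e g \<otimes>\<^bsub>B\<^esub> e' g = \<one>\<^bsub>B\<^esub>"
    and inv: "\<And>g. g \<in> X \<Longrightarrow> \<exists>h\<in>X. e h = e' g \<and> e' h = e g"
    and conj: "\<And>g z. g \<in> X \<Longrightarrow> z \<in> C \<Longrightarrow> e' g \<otimes>\<^bsub>B\<^esub> z \<otimes>\<^bsub>B\<^esub> e g \<in> C"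
    and J: "finite J" "s \<in> J \<rightarrow> X"
    and gen: "\<And>z. z \<in> carrier B \<Longrightarrow> \<exists>y. y \<in> J \<rightarrow> C \<and> z = (\<Oplus>\<^bsub>B\<^esub>i\<in>J. e (s i) \<otimes>\<^bsub>B\<^esub> y i)"
  shows "(\<forall>g\<in>X. (\<lambda>a. e' g \<otimes>\<^bsub>B\<^esub> a \<otimes>\<^bsub>B\<^esub> e g) ` A = A) \<longleftrightarrow> (\<forall>x\<in>carrier F. \<sigma> x ` I = I)"
proof -
  interpret cp: crossed_product_ring R F \<sigma> \<tau> S j u by (rule assms(1))
  interpret B: matrix_hom B S t \<phi>' by (rule assms(2))
  interpret C: matrix_hom "B\<lparr>carrier := C\<rparr>" R t \<phi> by (rule assms(3))
  interpret I: ideal I R by (rule I)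
  interpret N: additive_subgroup "cp.ideal_span I" S by (rule cp.ideal_span_subgroup[OF I])
  let ?N = "cp.ideal_span I"
  have A_ideal: "ideal A (B\<lparr>carrier := C\<rparr>)" using C.matrix_preimage_ideal[OF I] A by simp
  interpret A: ideal A "B\<lparr>carrier := C\<rparr>" by (rule A_ideal)
  have AC: "A \<subseteq> C" using A by auto
  have AB: "a \<in> carrier B" if "a \<in> A" for a using that AC CB by auto
  have eB: "e g \<in> carrier B" "e' g \<in> carrier B" "e g \<otimes>\<^bsub>B\<^esub> e' g = \<one>\<^bsub>B\<^esub>" "e' g \<otimes>\<^bsub>B\<^esub> e g = \<one>\<^bsub>B\<^esub>" if g: "g \<in> X" for g
  proof -
    show "e g \<in> carrier B" "e' g \<in> carrier B" "e g \<otimes>\<^bsub>B\<^esub> e' g = \<one>\<^bsub>B\<^esub>" using e[OF g] by auto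
    obtain h where "h \<in> X" "e h = e' g" "e' h = e g" using inv[OF g] by auto
    then show "e' g \<otimes>\<^bsub>B\<^esub> e g = \<one>\<^bsub>B\<^esub>" using e[of h] by simp
  qed
  have A_iff: "x \<in> A \<longleftrightarrow> \<phi>' x \<in> mat_set t ?N" if x: "x \<in> C" for x
  proof -
    have xc: "\<phi> x (i, l) \<in> carrier R" if "i < t" "l < t" for i l using C.hom_entry x that by simp
    have "\<phi> x \<in> extensional ({..<t} \<times> {..<t})" using C.hom_closed[of x] x by (simp add: mat_set_iff)
    then show ?thesis using x xc unfolding A ext[OF x]
      by (auto simp: mat_set_iff mat_map_def cp.j_in_ideal_span_iff[OF I])
  qed
  have t0: "0 < t" using t by simp
  show ?thesis
  proof
    assume st: "\<forall>g\<in>X. (\<lambda>a. e' g \<otimes>\<^bsub>B\<^esub> a \<otimes>\<^bsub>B\<^esub> e g) ` A = A"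
    have key: "\<phi>' (z' \<otimes>\<^bsub>B\<^esub> a \<otimes>\<^bsub>B\<^esub> z) \<in> mat_set t ?N"
      if z: "z \<in> carrier B" "z' \<in> carrier B" and a: "a \<in> A" for z z' a
    proof -
      obtain y where y: "y \<in> J \<rightarrow> C" "z = (\<Oplus>\<^bsub>B\<^esub>i\<in>J. e (s i) \<otimes>\<^bsub>B\<^esub> y i)" using gen[OF z(1)] by auto
      have aB: "a \<in> carrier B" using AB a by simp
      have sX: "s i \<in> X" if "i \<in> J" for i using J that by auto
      have yC: "y i \<in> C" "y i \<in> carrier B" if "i \<in> J" for i using y CB that by auto
      define a' where "a' i = e' (s i) \<otimes>\<^bsub>B\<^esub> a \<otimes>\<^bsub>B\<^esub> e (s i) \<otimes>\<^bsub>B\<^esub> y i" for i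
      have a': "a' i \<in> A" if i: "i \<in> J" for i
      proof -
        have "e' (s i) \<otimes>\<^bsub>B\<^esub> a \<otimes>\<^bsub>B\<^esub> e (s i) \<in> A" using st sX[OF i] a by blast
        then show ?thesis using A.I_r_closed yC[OF i] by (simp add: a'_def)
      qed
      have ae: "a \<otimes>\<^bsub>B\<^esub> (e (s i) \<otimes>\<^bsub>B\<^esub> y i) = e (s i) \<otimes>\<^bsub>B\<^esub> a' i" if i: "i \<in> J" for i
      proof -
        note c = eB[OF sX[OF i]] yC(2)[OF i] aB
        have "e (s i) \<otimes>\<^bsub>B\<^esub> a' i = (e (s i) \<otimes>\<^bsub>B\<^esub> e' (s i)) \<otimes>\<^bsub>B\<^esub> a \<otimes>\<^bsub>B\<^esub> (e (s i) \<otimes>\<^bsub>B\<^esub> y i)"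
          unfolding a'_def using c(1,2,5,6) by (simp only: B.A.m_assoc B.A.m_closed)
        then show ?thesis using c by simp
      qed
      have "z' \<otimes>\<^bsub>B\<^esub> a \<otimes>\<^bsub>B\<^esub> z = z' \<otimes>\<^bsub>B\<^esub> (a \<otimes>\<^bsub>B\<^esub> z)" using z aB by (simp add: B.A.m_assoc)
      also have "a \<otimes>\<^bsub>B\<^esub> z = (\<Oplus>\<^bsub>B\<^esub>i\<in>J. a \<otimes>\<^bsub>B\<^esub> (e (s i) \<otimes>\<^bsub>B\<^esub> y i))"
        unfolding y(2) using J(1) aB eB(1)[OF sX] yC by (intro B.A.finsum_rdistr) auto
      also have "\<dots> = (\<Oplus>\<^bsub>B\<^esub>i\<in>J. e (s i) \<otimes>\<^bsub>B\<^esub> a' i)"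
        using ae AB a' eB(1)[OF sX] by (intro B.A.finsum_cong') auto
      also have "z' \<otimes>\<^bsub>B\<^esub> \<dots> = (\<Oplus>\<^bsub>B\<^esub>i\<in>J. z' \<otimes>\<^bsub>B\<^esub> (e (s i) \<otimes>\<^bsub>B\<^esub> a' i))"
        using J(1) z AB a' eB(1)[OF sX] by (intro B.A.finsum_rdistr) auto
      also have "\<dots> = (\<Oplus>\<^bsub>B\<^esub>i\<in>J. (z' \<otimes>\<^bsub>B\<^esub> e (s i)) \<otimes>\<^bsub>B\<^esub> a' i)"
        using z AB a' eB(1)[OF sX] by (intro B.A.finsum_cong') (auto simp: B.A.m_assoc)
      finally have eq: "z' \<otimes>\<^bsub>B\<^esub> a \<otimes>\<^bsub>B\<^esub> z = (\<Oplus>\<^bsub>B\<^esub>i\<in>J. (z' \<otimes>\<^bsub>B\<^esub> e (s i)) \<otimes>\<^bsub>B\<^esub> a' i)" .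
      have tm: "(z' \<otimes>\<^bsub>B\<^esub> e (s i)) \<otimes>\<^bsub>B\<^esub> a' i \<in> carrier B"
          "\<phi>' ((z' \<otimes>\<^bsub>B\<^esub> e (s i)) \<otimes>\<^bsub>B\<^esub> a' i) \<in> mat_set t ?N" if i: "i \<in> J" for i
      proof -
        show "(z' \<otimes>\<^bsub>B\<^esub> e (s i)) \<otimes>\<^bsub>B\<^esub> a' i \<in> carrier B" using z AB a' eB(1)[OF sX] i by simp
        show "\<phi>' ((z' \<otimes>\<^bsub>B\<^esub> e (s i)) \<otimes>\<^bsub>B\<^esub> a' i) \<in> mat_set t ?N"
          using z AB a'[OF i] eB(1)[OF sX[OF i]] A_iff[of "a' i"] AC
          by (intro B.hom_left_mult_in N.additive_subgroup_axioms cp.ideal_span_left[OF I]) auto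
      qed
      have "\<phi>' (z' \<otimes>\<^bsub>B\<^esub> a \<otimes>\<^bsub>B\<^esub> z) (k, l) \<in> ?N" if kl: "k < t" "l < t" for k l
      proof -
        have "(\<Oplus>\<^bsub>S\<^esub>i\<in>J. \<phi>' ((z' \<otimes>\<^bsub>B\<^esub> e (s i)) \<otimes>\<^bsub>B\<^esub> a' i) (k, l)) \<in> ?N"
        proof -
          have m: "\<phi>' ((z' \<otimes>\<^bsub>B\<^esub> e (s i)) \<otimes>\<^bsub>B\<^esub> a' i) (k, l) \<in> ?N" if "i \<in> J" for i
            using tm(2)[OF that] kl by (auto simp: mat_set_iff)
          have "(\<Oplus>\<^bsub>S\<^esub>i\<in>J'. \<phi>' ((z' \<otimes>\<^bsub>B\<^esub> e (s i)) \<otimes>\<^bsub>B\<^esub> a' i) (k, l)) \<in> ?N" if "finite J'" "J' \<subseteq> J" for J'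
            using that
          proof (induction J' rule: finite_induct)
            case (insert x J')
            have "?N \<subseteq> carrier S" by (rule N.a_subset)
            then show ?case using insert m
              by (subst cp.S.finsum_insert) (auto intro!: N.a_closed)
          qed simp
          then show ?thesis using J(1) by simp
        qed
        then show ?thesis unfolding eq using tm(1) J(1) kl by (subst B.hom_finsum) auto
      qed
      then show ?thesis using B.hom_closed[of "z' \<otimes>\<^bsub>B\<^esub> a \<otimes>\<^bsub>B\<^esub> z"] z aB by (auto simp: mat_set_iff)
    qed
    \<comment> \<open>Taking \<open>v\<close> and \<open>w\<close> to be \<open>u x\<close> and its inverse, in either order, gives both inclusions.\<close>
    have entry: "v \<otimes>\<^bsub>S\<^esub> j b \<otimes>\<^bsub>S\<^esub> w \<in> ?N"
      if b: "b \<in> I" and vw: "v \<in> carrier S" "w \<in> carrier S" for b v w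
    proof -
      have bR: "b \<in> carrier R" using b I.a_subset by blast
      have "mat_single t R 0 0 b \<in> mat_set t (carrier R)" using bR by (simp add: mat_single_closed)
      then obtain a where a: "a \<in> C" "\<phi> a = mat_single t R 0 0 b" using surj(1) by (metis imageE)
      have aA: "a \<in> A" unfolding A using a b by (simp add: mat_single_closed)
      have "mat_single t S 0 0 v \<in> mat_set t (carrier S)" "mat_single t S 0 0 w \<in> mat_set t (carrier S)"
        using vw by (simp_all add: mat_single_closed)
      then have "mat_single t S 0 0 v \<in> \<phi>' ` carrier B" "mat_single t S 0 0 w \<in> \<phi>' ` carrier B"
        unfolding surj(2) .
      then obtain z' z where z': "z' \<in> carrier B" "\<phi>' z' = mat_single t S 0 0 v"
          and z: "z \<in> carrier B" "\<phi>' z = mat_single t S 0 0 w" by (auto elim!: imageE)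
      have "\<phi>' (z' \<otimes>\<^bsub>B\<^esub> a \<otimes>\<^bsub>B\<^esub> z) = mat_single t S 0 0 (v \<otimes>\<^bsub>S\<^esub> \<phi>' a (0, 0) \<otimes>\<^bsub>S\<^esub> w)"
        using z z' AB[OF aA] t0 vw B.hom_closed[OF AB[OF aA]]
        by (simp add: B.hom_mult B.R.mat_single_mult_single)
      moreover have "\<phi>' a (0, 0) = j b" using ext[OF a(1)] a(2) t0 by (simp add: mat_map_def mat_single_entry)
      ultimately have "mat_single t S 0 0 (v \<otimes>\<^bsub>S\<^esub> j b \<otimes>\<^bsub>S\<^esub> w) (0, 0) \<in> ?N"
        using key[OF z(1) z'(1) aA] t0 by (simp add: mat_set_iff)
      then show ?thesis using t0 by (simp add: mat_single_entry)
    qed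
    show "\<forall>x\<in>carrier F. \<sigma> x ` I = I"
    proof (intro ballI subset_antisym subsetI)
      fix x b assume x: "x \<in> carrier F"
      have ux: "u x \<in> Units S" "u x \<in> carrier S" "inv\<^bsub>S\<^esub> (u x) \<in> carrier S"
        using cp.u_Units[OF x] by auto
      {
        assume "b \<in> \<sigma> x ` I"
        then obtain b' where b': "b' \<in> I" "b = \<sigma> x b'" by auto
        have b'R: "b' \<in> carrier R" using b' I.a_subset by blast
        have "j b \<in> ?N" using entry[OF b'(1) ux(3,2)] cp.u_inv_j_u[OF x b'R] b' by simp
        then show "b \<in> I" using cp.j_in_ideal_span_iff[OF I] b' b'R x by simp
      next
        assume b: "b \<in> I"
        have bR: "b \<in> carrier R" using b I.a_subset by blast
        obtain b' where b': "b' \<in> carrier R" "\<sigma> x b' = b" using cp.\<sigma>_surj[OF x bR] by blast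
        have "u x \<otimes>\<^bsub>S\<^esub> j b \<otimes>\<^bsub>S\<^esub> inv\<^bsub>S\<^esub> (u x) = j b' \<otimes>\<^bsub>S\<^esub> u x \<otimes>\<^bsub>S\<^esub> inv\<^bsub>S\<^esub> (u x)"
          using cp.ju[OF x b'(1)] b' by simp
        also have "\<dots> = j b'" using ux b' by (simp add: cp.S.m_assoc)
        finally have "j b' \<in> ?N" using entry[OF b ux(2,3)] by simp
        then have "b' \<in> I" using cp.j_in_ideal_span_iff[OF I b'(1)] by simp
        then show "b \<in> \<sigma> x ` I" using b' by blast
      }
    qed
  next
    assume st: "\<forall>x\<in>carrier F. \<sigma> x ` I = I"
    have cl: "e' g \<otimes>\<^bsub>B\<^esub> a \<otimes>\<^bsub>B\<^esub> e g \<in> A" if g: "g \<in> X" and a: "a \<in> A" for g a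
    proof -
      have left: "\<phi>' (e' g \<otimes>\<^bsub>B\<^esub> a) \<in> mat_set t ?N"
        using eB[OF g] AB[OF a] A_iff[of a] a AC
        by (intro B.hom_left_mult_in N.additive_subgroup_axioms cp.ideal_span_left[OF I]) auto
      have "\<phi>' (e' g \<otimes>\<^bsub>B\<^esub> a \<otimes>\<^bsub>B\<^esub> e g) \<in> mat_set t ?N"
        by (rule B.hom_right_mult_in[OF _ _ left N.additive_subgroup_axioms cp.ideal_span_right[OF I]])
           (use eB[OF g] AB[OF a] st in auto)
      then show ?thesis using A_iff conj[OF g, of a] a AC by blast
    qed
    show "\<forall>g\<in>X. (\<lambda>a. e' g \<otimes>\<^bsub>B\<^esub> a \<otimes>\<^bsub>B\<^esub> e g) ` A = A"
    proof (intro ballI subset_antisym subsetI)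
      fix g a assume g: "g \<in> X" and a: "a \<in> A"
      obtain h where h: "h \<in> X" "e h = e' g" "e' h = e g" using inv[OF g] by auto
      have "e g \<otimes>\<^bsub>B\<^esub> a \<otimes>\<^bsub>B\<^esub> e' g \<in> A" using cl[OF h(1) a] h by simp
      moreover have "e' g \<otimes>\<^bsub>B\<^esub> (e g \<otimes>\<^bsub>B\<^esub> a \<otimes>\<^bsub>B\<^esub> e' g) \<otimes>\<^bsub>B\<^esub> e g = a"
      proof -
        have "e' g \<otimes>\<^bsub>B\<^esub> (e g \<otimes>\<^bsub>B\<^esub> a \<otimes>\<^bsub>B\<^esub> e' g) \<otimes>\<^bsub>B\<^esub> e g
            = (e' g \<otimes>\<^bsub>B\<^esub> e g) \<otimes>\<^bsub>B\<^esub> a \<otimes>\<^bsub>B\<^esub> (e' g \<otimes>\<^bsub>B\<^esub> e g)"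
          using eB(1,2)[OF g] AB[OF a] by (simp only: B.A.m_assoc B.A.m_closed)
        then show ?thesis using eB[OF g] AB[OF a] by simp
      qed
      ultimately show "a \<in> (\<lambda>a. e' g \<otimes>\<^bsub>B\<^esub> a \<otimes>\<^bsub>B\<^esub> e g) ` A" by force
    qed (use cl in auto)
  qed
qed

section \<open>The finite radical\<close>

lemma finite_image_factor:
  assumes "finite (g ` A)" and "\<And>x y. x \<in> A \<Longrightarrow> y \<in> A \<Longrightarrow> g x = g y \<Longrightarrow> f x = f y"
  shows "finite (f ` A)"
proof -
  have "f ` A \<subseteq> (\<lambda>v. f (inv_into A g v)) ` (g ` A)"
  proof
    fix y assume "y \<in> f ` A"
    then obtain x where x: "x \<in> A" "y = f x" by auto
    have "inv_into A g (g x) \<in> A" "g (inv_into A g (g x)) = g x"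
      using x(1) by (auto intro: inv_into_into f_inv_into_f)
    then have "y = f (inv_into A g (g x))" using assms(2) x by metis
    then show "y \<in> (\<lambda>v. f (inv_into A g v)) ` (g ` A)" using x(1) by blast
  qed
  then show ?thesis using assms(1) finite_surj by blast
qed

text \<open>The orbit-stabiliser correspondence for conjugation. It replaces the finite index of a
  centraliser by the finiteness of a conjugacy class, which is easier to transport.\<close>

lemma (in group) centralizer_coset_iff:
  assumes x: "x \<in> carrier G" and g: "g \<in> carrier G" and h: "h \<in> carrier G"
  defines "C \<equiv> {c \<in> carrier G. c \<otimes> x = x \<otimes> c}"
  shows "C #> g = C #> h \<longleftrightarrow> inv g \<otimes> x \<otimes> g = inv h \<otimes> x \<otimes> h"
proof -
  have C: "subgroup C G"
  proof (rule subgroupI)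
    show "C \<subseteq> carrier G" "C \<noteq> {}" using x by (auto simp: C_def)
    fix a assume a: "a \<in> C"
    then have ac: "a \<in> carrier G" "a \<otimes> x = x \<otimes> a" by (auto simp: C_def)
    have "inv a \<otimes> x = inv a \<otimes> (x \<otimes> a) \<otimes> inv a" using ac(1) x by (simp add: m_assoc)
    also have "\<dots> = x \<otimes> inv a" unfolding ac(2)[symmetric] using ac(1) x by (simp add: m_assoc[symmetric])
    finally show "inv a \<in> C" using ac(1) by (simp add: C_def)
    fix b assume b: "b \<in> C"
    then have bc: "b \<in> carrier G" "b \<otimes> x = x \<otimes> b" by (auto simp: C_def)
    have "a \<otimes> b \<otimes> x = a \<otimes> (x \<otimes> b)" unfolding bc(2)[symmetric] using ac(1) bc(1) x by (simp add: m_assoc)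
    also have "\<dots> = a \<otimes> x \<otimes> b" using ac(1) bc(1) x by (simp add: m_assoc)
    also have "\<dots> = x \<otimes> (a \<otimes> b)" unfolding ac(2) using ac(1) bc(1) x by (simp add: m_assoc)
    finally show "a \<otimes> b \<in> C" using ac bc by (simp add: C_def)
  qed
  have "C #> g = C #> h \<longleftrightarrow> g \<otimes> inv h \<in> C"
  proof
    assume "C #> g = C #> h"
    then have "g \<in> C #> h" using rcos_self[OF g C] by simp
    then obtain c where c: "c \<in> C" "g = c \<otimes> h" by (auto simp: r_coset_def)
    then have "g \<otimes> inv h = c" using h by (simp add: C_def m_assoc)
    then show "g \<otimes> inv h \<in> C" using c by simp
  next
    assume "g \<otimes> inv h \<in> C"
    moreover have "g = (g \<otimes> inv h) \<otimes> h" using g h by (simp add: m_assoc)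
    ultimately have "g \<in> C #> h" unfolding r_coset_def by blast
    then show "C #> g = C #> h" using repr_independence[OF _ h C] by simp
  qed
  also have "\<dots> \<longleftrightarrow> inv g \<otimes> x \<otimes> g = inv h \<otimes> x \<otimes> h"
  proof -
    have "g \<otimes> inv h \<in> C \<longleftrightarrow> (g \<otimes> inv h) \<otimes> x = x \<otimes> (g \<otimes> inv h)" using g h by (simp add: C_def)
    also have "\<dots> \<longleftrightarrow> g \<otimes> (inv h \<otimes> x \<otimes> h) = g \<otimes> (inv g \<otimes> x \<otimes> g)"
    proof -
      have "g \<otimes> (inv h \<otimes> x \<otimes> h) = ((g \<otimes> inv h) \<otimes> x) \<otimes> h" using g h x by (simp add: m_assoc)
      moreover have "g \<otimes> (inv g \<otimes> x \<otimes> g) = (x \<otimes> (g \<otimes> inv h)) \<otimes> h"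
      proof -
        have "g \<otimes> (inv g \<otimes> x \<otimes> g) = x \<otimes> g" using g x by (simp add: m_assoc[symmetric])
        then show ?thesis using g h x by (simp add: m_assoc)
      qed
      ultimately show ?thesis using g h x by simp
    qed
    also have "\<dots> \<longleftrightarrow> inv g \<otimes> x \<otimes> g = inv h \<otimes> x \<otimes> h" using g h x by auto
    finally show ?thesis .
  qed
  finally show ?thesis .
qed

locale plain_group = group G for G :: "'g monoid" (structure)

lemma (in plain_group) finite_radical_iff:
  "x \<in> finite_radical G \<longleftrightarrow> x \<in> carrier G \<and> (\<exists>n>0. x [^] (n::nat) = \<one>) \<and>
     finite ((\<lambda>g. inv g \<otimes> x \<otimes> g) ` carrier G)"
proof -
  have "finite (rcosets {g \<in> carrier G. g \<otimes> x = x \<otimes> g}) \<longleftrightarrow> finite ((\<lambda>g. inv g \<otimes> x \<otimes> g) ` carrier G)"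
    if x: "x \<in> carrier G"
  proof -
    let ?C = "{g \<in> carrier G. g \<otimes> x = x \<otimes> g}"
    have "rcosets ?C = (\<lambda>g. ?C #> g) ` carrier G" by (auto simp: RCOSETS_def)
    moreover have "finite ((\<lambda>g. ?C #> g) ` carrier G) \<longleftrightarrow> finite ((\<lambda>g. inv g \<otimes> x \<otimes> g) ` carrier G)"
    proof
      assume "finite ((\<lambda>g. ?C #> g) ` carrier G)"
      then show "finite ((\<lambda>g. inv g \<otimes> x \<otimes> g) ` carrier G)"
        by (rule finite_image_factor) (simp only: centralizer_coset_iff[OF x])
    next
      assume "finite ((\<lambda>g. inv g \<otimes> x \<otimes> g) ` carrier G)"
      then show "finite ((\<lambda>g. ?C #> g) ` carrier G)"
        by (rule finite_image_factor) (simp only: centralizer_coset_iff[OF x])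
    qed
    ultimately show ?thesis by simp
  qed
  then show ?thesis by (auto simp: finite_radical_def)
qed

lemma (in group) pow_conj:
  assumes "x \<in> carrier G" "g \<in> carrier G"
  shows "(g \<otimes> x \<otimes> inv g) [^] (n::nat) = g \<otimes> (x [^] n) \<otimes> inv g"
proof (induction n)
  case (Suc n)
  have "inv g \<otimes> (g \<otimes> (x \<otimes> inv g)) = x \<otimes> inv g" using assms by (simp add: m_assoc[symmetric])
  then show ?case using Suc assms by (simp add: m_assoc)
qed (use assms in simp)

text \<open>Inverses and conjugates have the same order and a class of the same size. That products have
  finite order is Dietzmann's lemma; here it is taken as a hypothesis, to be supplied by the group
  structure on the cosets.\<close>

lemma (in plain_group) finite_radical_normal:
  assumes mult: "\<And>x y. x \<in> finite_radical G \<Longrightarrow> y \<in> finite_radical G \<Longrightarrow> x \<otimes> y \<in> finite_radical G"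
  shows "finite_radical G \<lhd> G"
proof -
  have sub: "finite_radical G \<subseteq> carrier G" by (auto simp: finite_radical_def)
  have "subgroup (finite_radical G) G"
  proof (rule subgroupI[OF sub _ _ mult])
    have "(\<lambda>g. inv g \<otimes> \<one> \<otimes> g) ` carrier G \<subseteq> {\<one>}" by auto
    then have "\<one> \<in> finite_radical G" unfolding finite_radical_iff
      using finite_subset by (auto intro!: exI[of _ 1])
    then show "finite_radical G \<noteq> {}" by blast
    fix x assume x: "x \<in> finite_radical G"
    then have xc: "x \<in> carrier G" using sub by auto
    obtain n :: nat where n: "n > 0" "x [^] n = \<one>" using x by (auto simp: finite_radical_iff)
    have "finite ((\<lambda>g. inv g \<otimes> inv x \<otimes> g) ` carrier G)"
    proof (rule finite_surj)
      show "finite ((\<lambda>g. inv g \<otimes> x \<otimes> g) ` carrier G)" using x by (simp add: finite_radical_iff)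
      show "(\<lambda>g. inv g \<otimes> inv x \<otimes> g) ` carrier G \<subseteq> (\<lambda>y. inv y) ` (\<lambda>g. inv g \<otimes> x \<otimes> g) ` carrier G"
        unfolding image_image using xc
        by (intro subsetI) (auto simp: inv_mult_group m_assoc image_iff)
    qed
    then show "inv x \<in> finite_radical G" using n xc nat_pow_inv[of x n] by (auto simp: finite_radical_iff)
  qed
  moreover have "g \<otimes> x \<otimes> inv g \<in> finite_radical G" if g: "g \<in> carrier G" and x: "x \<in> finite_radical G" for g x
  proof -
    have xc: "x \<in> carrier G" using x sub by auto
    obtain n :: nat where n: "n > 0" "x [^] n = \<one>" using x by (auto simp: finite_radical_iff)
    have "(\<lambda>h. inv h \<otimes> (g \<otimes> x \<otimes> inv g) \<otimes> h) ` carrier G \<subseteq> (\<lambda>g. inv g \<otimes> x \<otimes> g) ` carrier G"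
    proof
      fix y assume "y \<in> (\<lambda>h. inv h \<otimes> (g \<otimes> x \<otimes> inv g) \<otimes> h) ` carrier G"
      then obtain h where h: "h \<in> carrier G" "y = inv h \<otimes> (g \<otimes> x \<otimes> inv g) \<otimes> h" by auto
      then have "y = inv (inv g \<otimes> h) \<otimes> x \<otimes> (inv g \<otimes> h)" using g xc by (simp add: inv_mult_group m_assoc)
      then show "y \<in> (\<lambda>g. inv g \<otimes> x \<otimes> g) ` carrier G" using g h by blast
    qed
    then have "finite ((\<lambda>h. inv h \<otimes> (g \<otimes> x \<otimes> inv g) \<otimes> h) ` carrier G)"
      using x finite_subset unfolding finite_radical_iff by blast
    moreover have "(g \<otimes> x \<otimes> inv g) [^] n = \<one>" using n g xc by (simp add: pow_conj)
    ultimately show ?thesis unfolding finite_radical_iff using n(1) g xc by auto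
  qed
  ultimately show ?thesis by (simp add: normal_inv_iff)
qed

text \<open>A finite normal subgroup of a normal subgroup \<open>H\<close> of finite index lies in the finite radical
  of the whole group: each of its elements has finitely many conjugates under \<open>H\<close>, hence under the
  group.\<close>

lemma (in plain_group) finite_normal_in_radical:
  assumes H: "H \<lhd> G" "finite (rcosets H)" and N: "finite N" "N \<subseteq> H"
    and mult: "\<And>x y. x \<in> N \<Longrightarrow> y \<in> N \<Longrightarrow> x \<otimes> y \<in> N"
    and conj: "\<And>h x. h \<in> H \<Longrightarrow> x \<in> N \<Longrightarrow> inv h \<otimes> x \<otimes> h \<in> N"
  shows "N \<subseteq> finite_radical G"
proof
  interpret H: normal H G by (rule H)
  fix x assume x: "x \<in> N"
  have xc: "x \<in> carrier G" using x N H.subset by auto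
  have pw: "x [^] Suc n \<in> N" for n
    by (induction n) (use x xc mult in auto)
  have "finite (range (\<lambda>n. x [^] Suc n))" using N(1) pw by (meson finite_subset image_subsetI)
  then have "\<not> inj (\<lambda>n. x [^] Suc n)" using finite_imageD infinite_UNIV_nat by blast
  then obtain a' b' where ab': "x [^] Suc a' = x [^] Suc b'" "a' \<noteq> b'" by (auto simp: inj_on_def)
  then obtain a b :: nat where ab: "a < b" "x [^] a = x [^] b"
    by (metis Suc_less_eq linorder_neqE_nat)
  have "x [^] a \<otimes> x [^] (b - a) = x [^] (a + (b - a))" by (rule nat_pow_mult[OF xc])
  also have "\<dots> = x [^] a \<otimes> \<one>" using ab xc by simp
  finally have "x [^] a \<otimes> x [^] (b - a) = x [^] a \<otimes> \<one>" .
  then have "x [^] (b - a) = \<one>" using Units_l_cancel[of "x [^] a" "x [^] (b - a)" \<one>] xc by (simp add: Units_eq del: r_one)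
  then have tors: "\<exists>n>0. x [^] (n::nat) = \<one>" using ab(1) by (intro exI[of _ "b - a"]) simp
  have "(\<lambda>g. inv g \<otimes> x \<otimes> g) ` carrier G
      \<subseteq> (\<lambda>(m, X). inv (SOME s. s \<in> X) \<otimes> m \<otimes> (SOME s. s \<in> X)) ` (N \<times> (rcosets H))"
  proof
    fix y assume "y \<in> (\<lambda>g. inv g \<otimes> x \<otimes> g) ` carrier G"
    then obtain g where g: "g \<in> carrier G" "y = inv g \<otimes> x \<otimes> g" by auto
    define s where "s = (SOME s. s \<in> H #> g)"
    have sX: "s \<in> H #> g" unfolding s_def using H.rcoset_mem[OF g(1)] by (rule someI_ex[OF exI])
    then have sc: "s \<in> carrier G" using H.rcosets_memD(1)[OF H.rcoset_in[OF g(1)]] by blast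
    have "g \<in> H #> s" using H.rcosets_memD(2)[OF H.rcoset_in[OF g(1)] sX] H.rcoset_mem[OF g(1)] by simp
    then obtain h where h: "h \<in> H" "g = h \<otimes> s" by (auto simp: r_coset_def)
    have hc: "h \<in> carrier G" using h by simp
    have "y = inv s \<otimes> (inv h \<otimes> x \<otimes> h) \<otimes> s" using g h hc sc xc by (simp add: inv_mult_group m_assoc)
    moreover have "(inv h \<otimes> x \<otimes> h, H #> g) \<in> N \<times> (rcosets H)"
      using conj[OF h(1) x] H.rcoset_in[OF g(1)] by simp
    ultimately show "y \<in> (\<lambda>(m, X). inv (SOME s. s \<in> X) \<otimes> m \<otimes> (SOME s. s \<in> X)) ` (N \<times> (rcosets H))"
      unfolding s_def by (intro image_eqI[of _ _ "(inv h \<otimes> x \<otimes> h, H #> g)"]) auto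
  qed
  then have "finite ((\<lambda>g. inv g \<otimes> x \<otimes> g) ` carrier G)" 
    by (rule finite_surj[rotated]) (use N(1) H(2) in simp)
  then show "x \<in> finite_radical G" using xc tors by (simp add: finite_radical_iff)
qed

text \<open>Quotients of elements of the finite radical have finite order, so they are trivial if they are
  small.\<close>

lemma finite_radical_finite:
  assumes p: "prime p" and an: "padic_analytic_group p G T" and cpt: "compact_space T"
    and sub: "subgroup (finite_radical G) G"
  shows "finite (finite_radical G)"
proof -
  have tg: "topological_group G T" using an by (simp add: padic_analytic_group_def)
  obtain W where W: "openin T W" "\<one>\<^bsub>G\<^esub> \<in> W"
    "\<And>g N. g \<in> W \<Longrightarrow> N > 0 \<Longrightarrow> g [^]\<^bsub>G\<^esub> (N::nat) = \<one>\<^bsub>G\<^esub> \<Longrightarrow> g = \<one>\<^bsub>G\<^esub>"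
    using padic_analytic_no_small_torsion[OF p an] by blast
  interpret G: group G using tg by (simp add: topological_group_def)
  interpret \<Delta>: subgroup "finite_radical G" G by (rule sub)
  show ?thesis
  proof (rule compact_group_finite_if_quotients_isolated[OF tg cpt W(1,2) \<Delta>.subset])
    fix d e assume de: "d \<in> finite_radical G" "e \<in> finite_radical G" "inv\<^bsub>G\<^esub> d \<otimes>\<^bsub>G\<^esub> e \<in> W"
    then have "inv\<^bsub>G\<^esub> d \<otimes>\<^bsub>G\<^esub> e \<in> finite_radical G" by simp
    then obtain n :: nat where "n > 0" "(inv\<^bsub>G\<^esub> d \<otimes>\<^bsub>G\<^esub> e) [^]\<^bsub>G\<^esub> n = \<one>\<^bsub>G\<^esub>"
      unfolding finite_radical_def by blast
    then have one: "inv\<^bsub>G\<^esub> d \<otimes>\<^bsub>G\<^esub> e = \<one>\<^bsub>G\<^esub>" using W(3) de(3) by blast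
    have c: "d \<in> carrier G" "e \<in> carrier G" using de by auto
    have "d = d \<otimes>\<^bsub>G\<^esub> (inv\<^bsub>G\<^esub> d \<otimes>\<^bsub>G\<^esub> e)" using one c by simp
    also have "\<dots> = e" using c by (simp add: G.m_assoc[symmetric])
    finally show "d = e" .
  qed
qed

section \<open>Faithfulness\<close>

lemma finite_dimension_finite_carrier:
  assumes "ring.finite_dimension R K E" "ring R" "finite K" shows "finite E"
proof -
  interpret ring R by (rule assms(2))
  obtain n where "dimension n K E" using assms(1) by (auto simp: finite_dimension_def)
  then show ?thesis using assms(3)
  proof (induction rule: dimension.induct)
    case (Suc_dim v E n K)
    have "K #>\<^bsub>R\<^esub> v = (\<lambda>h. h \<otimes>\<^bsub>R\<^esub> v) ` K" by (auto simp: r_coset_def)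
    then have "line_extension K v E = (\<lambda>(a, b). a \<oplus>\<^bsub>R\<^esub> b) ` (((\<lambda>h. h \<otimes>\<^bsub>R\<^esub> v) ` K) \<times> E)"
      by (auto simp: line_extension_def set_add_def' image_iff)
    then show ?case using Suc_dim by simp
  qed simp
qed

text \<open>This is the kernel of the homomorphism from \<open>L\<close> to the units of the quotient by \<open>I\<close>.\<close>

lemma dagger_normal:
  assumes L: "group L" and R: "ring R" and I: "ideal I R"
    and E: "\<And>x. x \<in> carrier L \<Longrightarrow> E x \<in> carrier R"
      "\<And>x y. x \<in> carrier L \<Longrightarrow> y \<in> carrier L \<Longrightarrow> E (x \<otimes>\<^bsub>L\<^esub> y) = E x \<otimes>\<^bsub>R\<^esub> E y" "E \<one>\<^bsub>L\<^esub> = \<one>\<^bsub>R\<^esub>"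
  shows "{x \<in> carrier L. E x \<ominus>\<^bsub>R\<^esub> \<one>\<^bsub>R\<^esub> \<in> I} \<lhd> L" (is "?D \<lhd> L")
proof -
  interpret L: group L by (rule L)
  interpret I: ideal I R by (rule I)
  have "subgroup ?D L"
  proof (rule L.subgroupI)
    have "\<one>\<^bsub>L\<^esub> \<in> ?D" using E(3) by (simp add: I.r_neg a_minus_def)
    then show "?D \<noteq> {}" by blast
    fix x assume x: "x \<in> ?D"
    then have Ex: "E x \<in> carrier R" "E (inv\<^bsub>L\<^esub> x) \<in> carrier R" using E by auto
    have inv: "E (inv\<^bsub>L\<^esub> x) \<otimes>\<^bsub>R\<^esub> E x = \<one>\<^bsub>R\<^esub>" using x E(2)[of "inv\<^bsub>L\<^esub> x" x] E(3) by simp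
    have "E (inv\<^bsub>L\<^esub> x) \<ominus>\<^bsub>R\<^esub> \<one>\<^bsub>R\<^esub> = \<ominus>\<^bsub>R\<^esub> (E (inv\<^bsub>L\<^esub> x) \<otimes>\<^bsub>R\<^esub> (E x \<ominus>\<^bsub>R\<^esub> \<one>\<^bsub>R\<^esub>))"
      using Ex inv by (simp add: a_minus_def I.r_distr I.r_minus I.minus_add I.a_comm)
    then show "inv\<^bsub>L\<^esub> x \<in> ?D" using x Ex I.I_l_closed by simp
    fix y assume y: "y \<in> ?D"
    then have Ey: "E y \<in> carrier R" using E by auto
    have "E (x \<otimes>\<^bsub>L\<^esub> y) \<ominus>\<^bsub>R\<^esub> \<one>\<^bsub>R\<^esub> = E x \<otimes>\<^bsub>R\<^esub> (E y \<ominus>\<^bsub>R\<^esub> \<one>\<^bsub>R\<^esub>) \<oplus>\<^bsub>R\<^esub> (E x \<ominus>\<^bsub>R\<^esub> \<one>\<^bsub>R\<^esub>)"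
    proof -
      have "E (x \<otimes>\<^bsub>L\<^esub> y) = E x \<otimes>\<^bsub>R\<^esub> E y" using x y E(2) by simp
      moreover have "E x \<otimes>\<^bsub>R\<^esub> (E y \<ominus>\<^bsub>R\<^esub> \<one>\<^bsub>R\<^esub>) \<oplus>\<^bsub>R\<^esub> (E x \<ominus>\<^bsub>R\<^esub> \<one>\<^bsub>R\<^esub>)
          = E x \<otimes>\<^bsub>R\<^esub> E y \<oplus>\<^bsub>R\<^esub> (\<ominus>\<^bsub>R\<^esub> E x \<oplus>\<^bsub>R\<^esub> E x) \<ominus>\<^bsub>R\<^esub> \<one>\<^bsub>R\<^esub>"
        using Ex(1) Ey by (simp add: a_minus_def I.r_distr I.r_minus I.a_assoc del: I.l_neg)
      ultimately show ?thesis using Ex(1) Ey by (simp add: I.l_neg)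
    qed
    then show "x \<otimes>\<^bsub>L\<^esub> y \<in> ?D" using x y Ex I.I_l_closed I.a_closed by simp
  qed auto
  moreover have "g \<otimes>\<^bsub>L\<^esub> x \<otimes>\<^bsub>L\<^esub> inv\<^bsub>L\<^esub> g \<in> ?D" if g: "g \<in> carrier L" and x: "x \<in> ?D" for g x
  proof -
    have c: "E g \<in> carrier R" "E (inv\<^bsub>L\<^esub> g) \<in> carrier R" "E x \<in> carrier R" using g x E by auto
    have inv: "E g \<otimes>\<^bsub>R\<^esub> E (inv\<^bsub>L\<^esub> g) = \<one>\<^bsub>R\<^esub>" using g E(2)[of g "inv\<^bsub>L\<^esub> g"] E(3) by simp
    have "E (g \<otimes>\<^bsub>L\<^esub> x \<otimes>\<^bsub>L\<^esub> inv\<^bsub>L\<^esub> g) = E g \<otimes>\<^bsub>R\<^esub> E x \<otimes>\<^bsub>R\<^esub> E (inv\<^bsub>L\<^esub> g)" using g x E(2) by simp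
    moreover have "E g \<otimes>\<^bsub>R\<^esub> (E x \<ominus>\<^bsub>R\<^esub> \<one>\<^bsub>R\<^esub>) \<otimes>\<^bsub>R\<^esub> E (inv\<^bsub>L\<^esub> g)
        = E g \<otimes>\<^bsub>R\<^esub> E x \<otimes>\<^bsub>R\<^esub> E (inv\<^bsub>L\<^esub> g) \<ominus>\<^bsub>R\<^esub> \<one>\<^bsub>R\<^esub>"
      using c inv by (simp add: a_minus_def I.r_distr I.l_distr I.r_minus I.l_minus)
    moreover have "E g \<otimes>\<^bsub>R\<^esub> (E x \<ominus>\<^bsub>R\<^esub> \<one>\<^bsub>R\<^esub>) \<otimes>\<^bsub>R\<^esub> E (inv\<^bsub>L\<^esub> g) \<in> I"
      using x c I.I_l_closed I.I_r_closed by simp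
    ultimately show ?thesis using g x by simp
  qed
  ultimately show ?thesis by (simp add: L.normal_inv_iff)
qed

lemma (in field_and_group) cgr_smult_elt_mult:
  assumes R: "ring (cgr k G T)" and a: "a \<in> carrier G" and b: "b \<in> carrier G"
    and c: "cgr_smult k G T c (cgr_elt k G T a) \<in> carrier (cgr k G T)"
      "cgr_smult k G T c (cgr_elt k G T (a \<otimes> b)) \<in> carrier (cgr k G T)"
  shows "cgr_smult k G T c (cgr_elt k G T a) \<otimes>\<^bsub>cgr k G T\<^esub> cgr_elt k G T b = cgr_smult k G T c (cgr_elt k G T (a \<otimes> b))"
proof (rule cgr_eqI[OF _ c(2)])
  interpret R: ring "cgr k G T" by (rule R)
  show "cgr_smult k G T c (cgr_elt k G T a) \<otimes>\<^bsub>cgr k G T\<^esub> cgr_elt k G T b \<in> carrier (cgr k G T)"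
    using c(1) cgr_elt_closed[OF b] by simp
  fix N C assume N: "N \<in> open_normals G T" and C: "C \<in> rcosets N"
  interpret N: normal N G by (rule open_normalsD(1)[OF N])
  obtain x where x: "x \<in> carrier G" "C = N #> x" by (rule N.rcosets_cases[OF C])
  have X: "N #> (x \<otimes> inv b) \<in> rcosets N" using N.rcoset_in x b by simp
  have "cgr_elt k G T a N (N #> (x \<otimes> inv b)) = (cgr_elt k G T a \<otimes>\<^bsub>cgr k G T\<^esub> cgr_elt k G T b) N C"
    unfolding x(2) by (rule cgr_mult_elt_value[OF b x(1) cgr_elt_closed[OF a] N, symmetric])
  also have "\<dots> = cgr_elt k G T (a \<otimes> b) N C" by (simp add: cgr_elt_mult a b R)
  finally show "(cgr_smult k G T c (cgr_elt k G T a) \<otimes>\<^bsub>cgr k G T\<^esub> cgr_elt k G T b) N C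
      = cgr_smult k G T c (cgr_elt k G T (a \<otimes> b)) N C"
    using cgr_mult_elt_value[OF b x(1) c(1) N] x(2) X C N by (simp add: cgr_smult_def carrier_Mod)
qed

text \<open>Comparison of two homomorphisms \<open>E\<close>, \<open>E'\<close> from a group \<open>H\<close> to rings, which agree modulo the
  ideals on the quotients \<open>h\<^sup>-\<^sup>1 h'\<close> of elements with the same invariant \<open>c\<close>. As \<open>c\<close> takes finitely
  many values, the kernels are finite together; and the kernel of \<open>E'\<close>, if finite, is trivial modulo
  the finite radical.\<close>

lemma (in plain_group) faithful_iff:
  fixes A :: "'r ring" and R :: "'s ring"
  assumes H: "H \<lhd> G" "finite (rcosets H)" and D: "finite_radical G \<lhd> G" "finite (finite_radical G)"
      "finite_radical G \<subseteq> H"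
    and I: "ideal I A" and E: "\<And>x. x \<in> H \<Longrightarrow> E x \<in> carrier A"
      "\<And>x y. x \<in> H \<Longrightarrow> y \<in> H \<Longrightarrow> E (x \<otimes> y) = E x \<otimes>\<^bsub>A\<^esub> E y" "E \<one> = \<one>\<^bsub>A\<^esub>"
    and J: "ideal J R" and E': "\<And>X. X \<in> HQ \<Longrightarrow> E' X \<in> carrier R"
      "\<And>X Y. X \<in> HQ \<Longrightarrow> Y \<in> HQ \<Longrightarrow> E' (X <#> Y) = E' X \<otimes>\<^bsub>R\<^esub> E' Y" "E' (finite_radical G) = \<one>\<^bsub>R\<^esub>"
    and HQ: "HQ = {finite_radical G #> h |h. h \<in> H}"
    and c: "finite (c ` H)"
    and key: "\<And>h h'. h \<in> H \<Longrightarrow> h' \<in> H \<Longrightarrow> c h = c h' \<Longrightarrow>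
      E (inv h \<otimes> h') \<ominus>\<^bsub>A\<^esub> \<one>\<^bsub>A\<^esub> \<in> I \<longleftrightarrow> E' (finite_radical G #> (inv h \<otimes> h')) \<ominus>\<^bsub>R\<^esub> \<one>\<^bsub>R\<^esub> \<in> J"
  defines "K \<equiv> {x \<in> H. E x \<ominus>\<^bsub>A\<^esub> \<one>\<^bsub>A\<^esub> \<in> I}" and "L \<equiv> {X \<in> HQ. E' X \<ominus>\<^bsub>R\<^esub> \<one>\<^bsub>R\<^esub> \<in> J}"
  shows "(finite K \<longleftrightarrow> L = {finite_radical G}) \<and> (finite K \<longleftrightarrow> finite L)"
proof -
  interpret H: normal H G by (rule H)
  interpret D: normal "finite_radical G" G by (rule D)
  let ?\<Delta> = "finite_radical G" and ?H = "G\<lparr>carrier := H\<rparr>"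
  have grpH: "group ?H" by (rule subgroup.subgroup_is_group[OF H.is_subgroup group_axioms])
  have ringA: "ring A" and ringR: "ring R" using I J by (auto simp: ideal_def)
  define L' where "L' = {x \<in> H. E' (?\<Delta> #> x) \<ominus>\<^bsub>R\<^esub> \<one>\<^bsub>R\<^esub> \<in> J}"
  have "{x \<in> carrier ?H. E x \<ominus>\<^bsub>A\<^esub> \<one>\<^bsub>A\<^esub> \<in> I} \<lhd> ?H"
    by (rule dagger_normal[OF grpH ringA I]) (use E in auto)
  then have Kn: "K \<lhd> ?H" by (simp add: K_def)
  have "{x \<in> carrier ?H. E' (?\<Delta> #> x) \<ominus>\<^bsub>R\<^esub> \<one>\<^bsub>R\<^esub> \<in> J} \<lhd> ?H"
  proof (rule dagger_normal[OF grpH ringR J])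
    show "E' (?\<Delta> #> x) \<in> carrier R" if "x \<in> carrier ?H" for x using that E'(1) HQ by auto
    show "E' (?\<Delta> #> (x \<otimes>\<^bsub>?H\<^esub> y)) = E' (?\<Delta> #> x) \<otimes>\<^bsub>R\<^esub> E' (?\<Delta> #> y)"
      if "x \<in> carrier ?H" "y \<in> carrier ?H" for x y
    proof -
      have "E' ((?\<Delta> #> x) <#> (?\<Delta> #> y)) = E' (?\<Delta> #> x) \<otimes>\<^bsub>R\<^esub> E' (?\<Delta> #> y)"
        using that HQ by (intro E'(2)) auto
      then show ?thesis using that by (simp add: D.rcos_sum)
    qed
    show "E' (?\<Delta> #> \<one>\<^bsub>?H\<^esub>) = \<one>\<^bsub>R\<^esub>" using E'(3) coset_mult_one[OF D.subset] by simp
  qed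
  then have L'n: "L' \<lhd> ?H" by (simp add: L'_def)
  have quot: "inv x \<otimes> y \<in> N" if N: "N \<lhd> ?H" and xy: "x \<in> N" "y \<in> N" for N x y
  proof -
    interpret N: normal N ?H by (rule N)
    have xH: "x \<in> H" using xy(1) N.subset by auto
    have "inv\<^bsub>?H\<^esub> x \<otimes>\<^bsub>?H\<^esub> y \<in> N" using xy subgroup.m_closed[OF N.is_subgroup] subgroup.m_inv_closed[OF N.is_subgroup] by simp
    then show ?thesis using m_inv_consistent[OF H.is_subgroup xH] by simp
  qed
  have finite_trans: "finite N" if N: "N \<lhd> ?H" and N': "finite N'"
    and sub: "\<And>h h'. h \<in> H \<Longrightarrow> h' \<in> H \<Longrightarrow> c h = c h' \<Longrightarrow> inv h \<otimes> h' \<in> N \<Longrightarrow> inv h \<otimes> h' \<in> N'" for N N'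
  proof (rule ccontr)
    assume inf: "infinite N"
    interpret N: normal N ?H by (rule N)
    have NH: "N \<subseteq> H" using N.subset by simp
    have "finite (c ` N)" using finite_subset[OF image_mono[OF NH] c] .
    then obtain h where h: "h \<in> N" "infinite {h' \<in> N. c h' = c h}" using pigeonhole_infinite[OF inf] by blast
    have hG: "h \<in> carrier G" using h NH by auto
    have "inj_on (\<lambda>h'. inv h \<otimes> h') {h' \<in> N. c h' = c h}"
    proof (rule inj_onI)
      fix x y assume xy: "x \<in> {h' \<in> N. c h' = c h}" "y \<in> {h' \<in> N. c h' = c h}" "inv h \<otimes> x = inv h \<otimes> y"
      have "x \<in> carrier G" "y \<in> carrier G" using xy(1,2) NH H.subset by blast+
      then show "x = y" using xy(3) hG by simp
    qed
    moreover have "(\<lambda>h'. inv h \<otimes> h') ` {h' \<in> N. c h' = c h} \<subseteq> N'"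
    proof
      fix z assume "z \<in> (\<lambda>h'. inv h \<otimes> h') ` {h' \<in> N. c h' = c h}"
      then obtain h' where h': "h' \<in> N" "c h' = c h" "z = inv h \<otimes> h'" by auto
      show "z \<in> N'" unfolding h'(3) using sub[of h h'] quot[OF N h(1) h'(1)] h(1) h' NH by auto
    qed
    ultimately have "finite {h' \<in> N. c h' = c h}" using N' finite_imageD finite_subset by blast
    then show False using h by simp
  qed
  have KL': "inv h \<otimes> h' \<in> K \<longleftrightarrow> inv h \<otimes> h' \<in> L'" if "h \<in> H" "h' \<in> H" "c h = c h'" for h h'
    using key[OF that] that by (auto simp: K_def L'_def)
  have 1: "finite K \<longleftrightarrow> finite L'"
    using finite_trans[OF Kn, of L'] finite_trans[OF L'n, of K] KL' by blast
  have L_eq: "L = (\<lambda>x. ?\<Delta> #> x) ` L'" by (auto simp: L_def L'_def HQ)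
  have 2: "finite L' \<longleftrightarrow> finite L"
  proof
    assume "finite L"
    moreover have "finite X" if XL: "X \<in> L" for X
    proof -
      obtain x where "X = ?\<Delta> #> x" using XL unfolding L_def HQ by blast
      then have "X = (\<lambda>d. d \<otimes> x) ` ?\<Delta>" by (auto simp: r_coset_def)
      then show ?thesis using D(2) by simp
    qed
    moreover have "L' \<subseteq> \<Union>L"
    proof
      fix x assume x: "x \<in> L'"
      then have "x \<in> ?\<Delta> #> x" using D.rcoset_mem[of x] by (auto simp: L'_def)
      then show "x \<in> \<Union>L" using x unfolding L_eq by blast
    qed
    ultimately show "finite L'" by (meson finite_Union finite_subset)
  qed (simp add: L_eq)
  have 3: "L = {?\<Delta>}" if fin: "finite L'"
  proof -
    interpret L': normal L' ?H by (rule L'n)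
    have "L' \<subseteq> ?\<Delta>"
    proof (rule finite_normal_in_radical[OF H fin])
      show "L' \<subseteq> H" by (auto simp: L'_def)
      show "x \<otimes> y \<in> L'" if "x \<in> L'" "y \<in> L'" for x y using subgroup.m_closed[OF L'.is_subgroup that] by simp
      show "inv h \<otimes> x \<otimes> h \<in> L'" if "h \<in> H" "x \<in> L'" for h x
        using L'.inv_op_closed1[of h x] that m_inv_consistent[OF H.is_subgroup that(1)] by simp
    qed
    moreover have "\<one> \<in> L'" using subgroup.one_closed[OF L'.is_subgroup] by simp
    moreover have "?\<Delta> #> x = ?\<Delta>" if "x \<in> ?\<Delta>" for x using D.rcos_const[OF group_axioms that] .
    ultimately show ?thesis unfolding L_eq using D.rcos_const[OF group_axioms D.one_closed] by blast
  qed
  show ?thesis using 1 2 3 by auto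
qed

section \<open>The untwisting correspondence of ideals\<close>

theorem theoremC:
  fixes p t :: nat
    and k :: "'a ring" and K :: "'b ring" and \<iota> :: "'a \<Rightarrow> 'b"
    and G :: "'g monoid" and T :: "'g topology" and H \<Delta> :: "'g set"
    and kG kH k\<Delta> :: "('g set \<Rightarrow> 'g set \<Rightarrow> 'a) ring"
    and Q :: "'g set monoid" and TQ :: "'g set topology" and HQ :: "'g set set"
    and S R :: "('g set set \<Rightarrow> 'g set set \<Rightarrow> 'b) ring"
    and S\<^sub>\<alpha> :: "'w ring"
    and M A :: "('g set \<Rightarrow> 'g set \<Rightarrow> 'a) set"
    and \<aa> :: "('g set set \<Rightarrow> 'g set set \<Rightarrow> 'b) set"
  assumes "prime p" and "field k" and "finite (carrier k)" and "[p] \<cdot>\<^bsub>k\<^esub> \<one>\<^bsub>k\<^esub> = \<zero>\<^bsub>k\<^esub>"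
    and "padic_analytic_group p G T" and "compact_space T"
    and \<Delta>: "\<Delta> = finite_radical G"
    and kG: "kG = cgr k G T" and kH: "kH = cgr_sub k G T H" and k\<Delta>: "k\<Delta> = cgr_sub k G T \<Delta>"
    and Q: "Q = G Mod \<Delta>" and TQ: "TQ = quotient_topology G T \<Delta>"
    and HQ: "HQ = carrier (G\<lparr>carrier := H\<rparr> Mod \<Delta>)"
    and S: "S = cgr K Q TQ" and R: "R = cgr_sub K Q TQ HQ"
    and "H \<lhd> G" and "openin T H" and "\<Delta> \<subseteq> H"
    and "pro_p_group p (Q\<lparr>carrier := HQ\<rparr>) (subtopology TQ HQ)"
    and "minimal_prime_ideal M kG" and "prime_ideal (M \<inter> carrier k\<Delta>) k\<Delta>"
    and "corresponds_to_orbit k G T M {e}"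
    and "t \<ge> 1" and "finite_field_extension k K \<iota>" and "matrix_identification k G T e K \<iota> t \<theta>"
    and "untwisting_iso k G T H M e K \<iota> t \<theta> \<psi>"
    and "\<forall>x\<in>carrier (G Mod H). s x \<in> x"
    and "\<forall>x\<in>carrier (G Mod H). u x = cgr_elt K Q TQ (\<Delta> #>\<^bsub>G\<^esub> s x)"
    and "crossed_product R (G Mod H) \<sigma> \<tau> S (\<lambda>r. r) u"
    and "central_2_cocycle R (G Mod H) \<sigma> \<alpha>"
    and "central_twist R (G Mod H) \<sigma> \<tau> \<alpha> S\<^sub>\<alpha> j u\<^sub>\<alpha>"
    and "\<psi>' \<in> ring_iso (kG Quot M) (mat_ring t S\<^sub>\<alpha>)"
    and "\<forall>x\<in>carrier kH.
           \<psi>' (M +>\<^bsub>kG\<^esub> x) = mat_map t j (\<psi> ((M \<inter> carrier kH) +>\<^bsub>kH\<^esub> x))"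
    and "ideal A kH" and "M \<inter> carrier kH \<subseteq> A"
    and "ideal \<aa> R"
    and "(\<lambda>x. \<psi> ((M \<inter> carrier kH) +>\<^bsub>kH\<^esub> x)) ` A = mat_set t \<aa>"
  shows "(prime_ideal A kH \<longleftrightarrow> prime_ideal \<aa> R) \<and>
    (conj_stable k G T A \<longleftrightarrow>
       twist_conj_stable (G Mod H) S\<^sub>\<alpha> j u\<^sub>\<alpha> (cgr_elt K Q TQ ` HQ) \<aa>) \<and>
    (almost_faithful k G T H A \<longleftrightarrow> faithful K Q TQ HQ \<aa>) \<and>
    (almost_faithful k G T H A \<longleftrightarrow> almost_faithful K Q TQ HQ \<aa>)"
proof -
  have tg: "topological_group G T" using assms(5) by (simp add: padic_analytic_group_def)
  have grpG: "group G" using tg by (simp add: topological_group_def)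
  have fieldK: "field K" and finK: "finite (carrier K)"
  proof -
    show "field K" using assms(24) by (simp add: finite_field_extension_def)
    then have "ring K" by (simp add: field_def domain_def cring_def)
    then show "finite (carrier K)"
      using finite_dimension_finite_carrier[of K "\<iota> ` carrier k" "carrier K"] assms(3,24)
      by (simp add: finite_field_extension_def)
  qed
  interpret PG: plain_group G using grpG by (simp add: plain_group_def)
  interpret cg: compact_group_ring k G T
    using assms(2,6) tg grpG
    by (simp add: compact_group_ring_def compact_group_ring_axioms_def field_and_group_def)
  interpret H: normal H G by (rule assms(16))
  have HQ': "HQ = {\<Delta> #>\<^bsub>G\<^esub> h |h. h \<in> H}" unfolding HQ carrier_Mod restricted_rcosets ..

  \<comment> \<open>That the cosets of \<open>\<Delta>\<close> form a group contains the closure of \<open>\<Delta>\<close> under multiplication.\<close>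
  have grpHQ: "group (Q\<lparr>carrier := HQ\<rparr>)"
    using assms(19) by (simp add: pro_p_group_def profinite_group_def topological_group_def)
  have \<Delta>N: "\<Delta> \<lhd> G"
    unfolding \<Delta>
  proof (rule PG.finite_radical_normal)
    fix x y assume "x \<in> finite_radical G" "y \<in> finite_radical G"
    then have "x \<otimes>\<^bsub>G\<^esub> y \<in> \<Delta> <#>\<^bsub>G\<^esub> \<Delta>" by (auto simp: \<Delta> set_mult_def)
    moreover have "\<Delta> <#>\<^bsub>G\<^esub> \<Delta> = \<Delta>"
      using monoid.l_one[OF group.is_monoid[OF grpHQ] monoid.one_closed[OF group.is_monoid[OF grpHQ]]]
      by (simp add: Q carrier_Mod)
    ultimately show "x \<otimes>\<^bsub>G\<^esub> y \<in> finite_radical G" by (simp add: \<Delta>)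
  qed
  interpret \<Delta>: normal \<Delta> G by (rule \<Delta>N)
  have \<Delta>fin: "finite \<Delta>"
    using finite_radical_finite[OF assms(1,5,6)] \<Delta>.is_subgroup by (simp add: \<Delta>)
  have grpQ: "group Q" unfolding Q by (rule \<Delta>.factorgroup_is_group)
  interpret KQ: field_and_group K Q using fieldK grpQ by (simp add: field_and_group_def)
  have HQsub: "subgroup HQ Q"
  proof (rule KQ.subgroupI)
    show "HQ \<subseteq> carrier Q" by (auto simp: HQ' Q carrier_Mod \<Delta>.rcoset_in)
    have "\<Delta> #>\<^bsub>G\<^esub> \<one>\<^bsub>G\<^esub> \<in> HQ" unfolding HQ' using H.one_closed by blast
    then show "HQ \<noteq> {}" by blast
    fix X assume "X \<in> HQ"
    then obtain h where h: "h \<in> H" "X = \<Delta> #>\<^bsub>G\<^esub> h" by (auto simp: HQ')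
    have "inv\<^bsub>Q\<^esub> X = \<Delta> #>\<^bsub>G\<^esub> inv\<^bsub>G\<^esub> h" unfolding h(2) Q using h(1) by (intro cg.Mod_inv \<Delta>N) auto
    then show "inv\<^bsub>Q\<^esub> X \<in> HQ" using h by (auto simp: HQ')
    fix Y assume "Y \<in> HQ"
    then obtain h' where h': "h' \<in> H" "Y = \<Delta> #>\<^bsub>G\<^esub> h'" by (auto simp: HQ')
    have "X \<otimes>\<^bsub>Q\<^esub> Y = \<Delta> #>\<^bsub>G\<^esub> (h \<otimes>\<^bsub>G\<^esub> h')" unfolding h h' Q carrier_Mod using h h' by (intro \<Delta>.rcos_sum) auto
    then show "X \<otimes>\<^bsub>Q\<^esub> Y \<in> HQ" using h h' by (auto simp: HQ')
  qed

  have cpS: "crossed_product_ring R (G Mod H) \<sigma> \<tau> S (\<lambda>r. r) u"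
    using assms(29) by (simp add: crossed_product_ring_def)
  have ringS: "ring S" and ringR: "ring R" and RS: "carrier R \<subseteq> carrier S"
    using assms(29) ring_hom_closed[of "\<lambda>r. r" R S] by (auto simp: crossed_product_def)
  interpret tw: crossed_product_ring R "G Mod H" \<sigma> "\<lambda>x y. \<tau> x y \<otimes>\<^bsub>R\<^esub> \<alpha> x y" S\<^sub>\<alpha> j u\<^sub>\<alpha>
    using assms(31) by (simp add: crossed_product_ring_def central_twist_def)
  have finGH: "finite (rcosets\<^bsub>G\<^esub> H)" using tw.finite_F by (simp add: carrier_Mod)
  have idealM: "ideal M kG" using assms(20) by (simp add: minimal_prime_ideal_def prime_ideal_def)
  then have ringG: "ring kG" by (simp add: ideal_def)
  have ringH: "ring kH" using assms(34) by (simp add: ideal_def)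
  define C where "C = carrier kH"
  have kHC: "kH = kG\<lparr>carrier := C\<rparr>" by (simp add: C_def kH kG cgr_sub_def)
  have CG: "C \<subseteq> carrier kG" using cg.cgr_sub_carrier_iff[OF assms(16,17)] by (auto simp: C_def kH kG)
  have RSc: "R = S\<lparr>carrier := carrier R\<rparr>" by (simp add: R S cgr_sub_def)
  define I where "I = M \<inter> carrier kH"
  have idealI: "ideal I kH" unfolding I_def
    using ideal_Int_subring[OF idealM ringH[unfolded kHC] CG] by (simp add: kHC)
  note unt = assms(26)[unfolded untwisting_iso_def Let_def, folded \<Delta>, folded Q TQ HQ, folded R kH, folded I_def]
  have \<psi>: "\<psi> \<in> ring_iso (kH Quot I) (mat_ring t R)" using unt by blast
  define \<phi> where "\<phi> x = \<psi> (I +>\<^bsub>kH\<^esub> x)" for x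
  define \<phi>' where "\<phi>' x = \<psi>' (M +>\<^bsub>kG\<^esub> x)" for x
  have \<phi>hom: "\<phi> \<in> ring_hom kH (mat_ring t R)" and \<phi>surj: "\<phi> ` carrier kH = mat_set t (carrier R)"
    and \<phi>ker: "\<And>x y. x \<in> carrier kH \<Longrightarrow> y \<in> carrier kH \<Longrightarrow> \<phi> x = \<phi> y \<Longrightarrow> x \<ominus>\<^bsub>kH\<^esub> y \<in> I"
    using quotient_iso_hom[OF idealI \<psi>] unfolding \<phi>_def[abs_def] mat_ring_simps(1) by auto
  have \<phi>'hom: "\<phi>' \<in> ring_hom kG (mat_ring t S\<^sub>\<alpha>)" and \<phi>'surj: "\<phi>' ` carrier kG = mat_set t (carrier S\<^sub>\<alpha>)"
    using quotient_iso_hom[OF idealM assms(32)] unfolding \<phi>'_def[abs_def] mat_ring_simps(1) by auto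
  have ext: "\<phi>' x = mat_map t j (\<phi> x)" if "x \<in> C" for x
    using assms(33) that by (simp add: \<phi>_def \<phi>'_def I_def C_def)
  interpret mh: matrix_hom kH R t \<phi>
    using ringH ringR \<phi>hom by (simp add: matrix_hom_def matrix_hom_axioms_def plain_ring_def)
  have mG: "matrix_hom kG S\<^sub>\<alpha> t \<phi>'"
    using ringG tw.S.ring_axioms \<phi>'hom by (simp add: matrix_hom_def matrix_hom_axioms_def plain_ring_def)
  interpret Ai: ideal A kH by (rule assms(34))
  interpret ai: ideal \<aa> R by (rule assms(36))
  \<comment> \<open>\<open>A\<close> contains the kernel of \<open>\<phi>\<close>, hence is the full preimage of its image.\<close>
  have A_eq: "A = {x \<in> carrier kH. \<phi> x \<in> mat_set t \<aa>}"
  proof (rule subset_antisym; rule subsetI)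
    fix x assume x: "x \<in> A"
    then have "\<phi> x \<in> mat_set t \<aa>" using assms(37) by (auto simp: \<phi>_def I_def)
    then show "x \<in> {x \<in> carrier kH. \<phi> x \<in> mat_set t \<aa>}" using x Ai.a_subset by blast
  next
    fix x assume x: "x \<in> {x \<in> carrier kH. \<phi> x \<in> mat_set t \<aa>}"
    then have "\<phi> x \<in> \<phi> ` A" using assms(37) by (simp add: \<phi>_def[abs_def] I_def)
    then obtain a where a: "a \<in> A" "\<phi> x = \<phi> a" by auto
    have aH: "a \<in> carrier kH" using a Ai.a_subset by blast
    have "x \<ominus>\<^bsub>kH\<^esub> a \<in> A" using \<phi>ker[OF _ aH a(2)] x assms(35) by (auto simp: I_def)
    then have "(x \<ominus>\<^bsub>kH\<^esub> a) \<oplus>\<^bsub>kH\<^esub> a \<in> A" using a by (intro Ai.a_closed)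
    moreover have "(x \<ominus>\<^bsub>kH\<^esub> a) \<oplus>\<^bsub>kH\<^esub> a = x"
      using x aH mh.A.minus_closed by (simp add: a_minus_def mh.A.a_assoc mh.A.l_neg)
    ultimately show "x \<in> A" by simp
  qed

  have i: "prime_ideal A kH \<longleftrightarrow> prime_ideal \<aa> R"
    unfolding A_eq by (rule mh.prime_matrix_preimage_iff[OF \<phi>surj assms(23,36)])

  let ?E = "cgr_elt k G T" and ?E' = "cgr_elt K Q TQ"
  have E: "?E g \<in> carrier kG" if "g \<in> carrier G" for g using cg.cgr_elt_closed[OF that] by (simp add: kG)
  have Emult: "?E g \<otimes>\<^bsub>kG\<^esub> ?E h = ?E (g \<otimes>\<^bsub>G\<^esub> h)" if "g \<in> carrier G" "h \<in> carrier G" for g h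
    using cg.cgr_elt_mult[OF that] ringG by (simp add: kG)
  have Eone: "?E \<one>\<^bsub>G\<^esub> = \<one>\<^bsub>kG\<^esub>" by (simp add: kG cg.cgr_elt_one)
  have EH: "?E h \<in> C" if "h \<in> H" for h
    using cg.cgr_elt_in_cgr_sub[OF H.is_subgroup that] by (simp add: C_def kH)
  have E'R: "?E' X \<in> carrier R" if "X \<in> HQ" for X
    using KQ.cgr_elt_in_cgr_sub[OF HQsub that] by (simp add: R)
  have HQQ: "HQ \<subseteq> carrier Q" by (rule subgroup.subset[OF HQsub])
  have E'mult: "?E' X \<otimes>\<^bsub>R\<^esub> ?E' Y = ?E' (X \<otimes>\<^bsub>Q\<^esub> Y)" if "X \<in> HQ" "Y \<in> HQ" for X Y
  proof -
    have "?E' X \<otimes>\<^bsub>S\<^esub> ?E' Y = ?E' (X \<otimes>\<^bsub>Q\<^esub> Y)"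
      using KQ.cgr_elt_mult[of X Y TQ] that HQQ ringS by (auto simp: S)
    then show ?thesis by (subst RSc) simp
  qed
  have E'one: "?E' \<one>\<^bsub>Q\<^esub> = \<one>\<^bsub>R\<^esub>" by (subst RSc) (simp add: S KQ.cgr_elt_one)

  have ii: "conj_stable k G T A \<longleftrightarrow>
       twist_conj_stable (G Mod H) S\<^sub>\<alpha> j u\<^sub>\<alpha> (?E' ` HQ) \<aa>"
  proof -
    have units: "?E' ` HQ \<subseteq> Units R"
    proof
      fix r assume "r \<in> ?E' ` HQ"
      then obtain X where X: "X \<in> HQ" "r = ?E' X" by auto
      have iX: "inv\<^bsub>Q\<^esub> X \<in> HQ" using subgroup.m_inv_closed[OF HQsub X(1)] .
      have "X \<in> carrier Q" using X HQQ by auto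
      then have "?E' X \<otimes>\<^bsub>R\<^esub> ?E' (inv\<^bsub>Q\<^esub> X) = \<one>\<^bsub>R\<^esub>" "?E' (inv\<^bsub>Q\<^esub> X) \<otimes>\<^bsub>R\<^esub> ?E' X = \<one>\<^bsub>R\<^esub>"
        using E'mult[OF X(1) iX] E'mult[OF iX X(1)] E'one by simp_all
      then show "r \<in> Units R" unfolding X(2) using E'R[OF X(1)] E'R[OF iX] by (auto simp: Units_def)
    qed
    have "HQ \<noteq> {}" using subgroup.one_closed[OF HQsub] by auto
    then have tw_iff: "twist_conj_stable (G Mod H) S\<^sub>\<alpha> j u\<^sub>\<alpha> (?E' ` HQ) \<aa> \<longleftrightarrow> (\<forall>x\<in>carrier (G Mod H). \<sigma> x ` \<aa> = \<aa>)"
      by (intro tw.twist_conj_stable_iff[OF assms(36) units]) simp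
    have "(\<forall>g\<in>carrier G. (\<lambda>a. ?E (inv\<^bsub>G\<^esub> g) \<otimes>\<^bsub>kG\<^esub> a \<otimes>\<^bsub>kG\<^esub> ?E g) ` A = A) \<longleftrightarrow>
        (\<forall>x\<in>carrier (G Mod H). \<sigma> x ` \<aa> = \<aa>)"
    proof (rule conj_stable_matrix_iff[where C = C and t = t and \<phi> = \<phi> and \<phi>' = \<phi>' and S = S\<^sub>\<alpha> and R = R
          and F = "G Mod H" and J = "rcosets\<^bsub>G\<^esub> H" and s = s])
      show "crossed_product_ring R (G Mod H) \<sigma> (\<lambda>x y. \<tau> x y \<otimes>\<^bsub>R\<^esub> \<alpha> x y) S\<^sub>\<alpha> j u\<^sub>\<alpha>"
        by (rule tw.crossed_product_ring_axioms)
      show "matrix_hom kG S\<^sub>\<alpha> t \<phi>'" by (rule mG)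
      show "matrix_hom (kG\<lparr>carrier := C\<rparr>) R t \<phi>" using mh.matrix_hom_axioms by (simp add: kHC)
      show "\<phi> ` C = mat_set t (carrier R)" using \<phi>surj by (simp add: C_def)
      show "A = {x \<in> C. \<phi> x \<in> mat_set t \<aa>}" unfolding C_def by (rule A_eq)
      show "?E g \<in> carrier kG \<and> ?E (inv\<^bsub>G\<^esub> g) \<in> carrier kG \<and> ?E g \<otimes>\<^bsub>kG\<^esub> ?E (inv\<^bsub>G\<^esub> g) = \<one>\<^bsub>kG\<^esub>"
        if "g \<in> carrier G" for g using that E Emult Eone by simp
      show "\<exists>h\<in>carrier G. ?E h = ?E (inv\<^bsub>G\<^esub> g) \<and> ?E (inv\<^bsub>G\<^esub> h) = ?E g" if "g \<in> carrier G" for g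
        using that by (intro bexI[of _ "inv\<^bsub>G\<^esub> g"]) auto
      show "?E (inv\<^bsub>G\<^esub> g) \<otimes>\<^bsub>kG\<^esub> z \<otimes>\<^bsub>kG\<^esub> ?E g \<in> C" if "g \<in> carrier G" "z \<in> C" for g z
        using cg.cgr_sub_conj_closed[OF assms(16,17), of z g] that ringG by (simp add: C_def kH kG)
      show "finite (rcosets\<^bsub>G\<^esub> H)" by (rule finGH)
      have sX: "s X \<in> X" if "X \<in> rcosets\<^bsub>G\<^esub> H" for X using assms(27) that by (simp add: carrier_Mod)
      then show "s \<in> (rcosets\<^bsub>G\<^esub> H) \<rightarrow> carrier G" using H.rcosets_memD(1) by blast
      show "\<exists>y. y \<in> (rcosets\<^bsub>G\<^esub> H) \<rightarrow> C \<and> z = (\<Oplus>\<^bsub>kG\<^esub>X\<in>rcosets\<^bsub>G\<^esub> H. ?E (s X) \<otimes>\<^bsub>kG\<^esub> y X)"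
        if z: "z \<in> carrier kG" for z
      proof -
        obtain y where "\<And>X. X \<in> rcosets\<^bsub>G\<^esub> H \<Longrightarrow> y X \<in> carrier (cgr_sub k G T H)"
          "z = (\<Oplus>\<^bsub>cgr k G T\<^esub>X\<in>rcosets\<^bsub>G\<^esub> H. ?E (s X) \<otimes>\<^bsub>cgr k G T\<^esub> y X)"
          using cg.cgr_coset_decomposition[OF assms(16,17) ringG[unfolded kG] z[unfolded kG], of s] sX by blast
        then show ?thesis by (auto simp: kG C_def kH)
      qed
    qed (use CG assms(23,36) \<phi>'surj ext in auto)
    then show ?thesis unfolding tw_iff conj_stable_def by (simp add: kG)
  qed

  from unt[THEN conjunct2, THEN conjunct2, THEN conjunct2]
  obtain \<delta> where \<delta>: "untwisting_map k G T H e \<delta>"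
    and \<delta>\<psi>: "\<forall>h\<in>H. \<forall>i<t. \<forall>l<t.
      \<psi> (I +>\<^bsub>kH\<^esub> ?E h) (i, l) = cgr_smult K Q TQ (\<theta> (\<delta> h) (i, l)) (?E' (\<Delta> #>\<^bsub>G\<^esub> h))"
    by (elim exE conjE) (rule that)
  have \<delta>\<phi>: "\<phi> (?E h) (i, l) = cgr_smult K Q TQ (\<theta> (\<delta> h) (i, l)) (?E' (\<Delta> #>\<^bsub>G\<^esub> h))"
    if "h \<in> H" "i < t" "l < t" for h i l
    using \<delta>\<psi> that by (simp add: \<phi>_def)
  have finc: "finite ((\<lambda>h. \<theta> (\<delta> h)) ` H)"
  proof (rule finite_subset)
    let ?B = "corner_ring e (bar_sub k G T (finite_radical G))"
    have "\<theta> \<in> ring_hom ?B (mat_ring t K)" using assms(25) by (simp add: matrix_identification_def ring_iso_def)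
    then have "\<theta> (\<delta> h) \<in> mat_set t (carrier K)" if "h \<in> H" for h
    proof -
      have "\<delta> \<in> hom (G\<lparr>carrier := H\<rparr>) (units_of ?B)" using \<delta> by (simp add: untwisting_map_def Let_def)
      then have "\<delta> \<in> H \<rightarrow> carrier (units_of ?B)" by (simp add: hom_def)
      then have "\<delta> h \<in> carrier (units_of ?B)" using that by (rule Pi_mem)
      then have "\<delta> h \<in> carrier ?B" by (simp add: units_of_def Units_def)
      then show ?thesis using ring_hom_closed[OF \<open>\<theta> \<in> _\<close>] by (simp add: mat_ring_simps)
    qed
    then show "(\<lambda>h. \<theta> (\<delta> h)) ` H \<subseteq> mat_set t (carrier K)" by auto
    show "finite (mat_set t (carrier K))" unfolding mat_set_def using finK by (intro finite_PiE) auto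
  qed
  have key: "?E (inv\<^bsub>G\<^esub> h \<otimes>\<^bsub>G\<^esub> h') \<ominus>\<^bsub>kH\<^esub> \<one>\<^bsub>kH\<^esub> \<in> A \<longleftrightarrow>
      ?E' (\<Delta> #>\<^bsub>G\<^esub> (inv\<^bsub>G\<^esub> h \<otimes>\<^bsub>G\<^esub> h')) \<ominus>\<^bsub>R\<^esub> \<one>\<^bsub>R\<^esub> \<in> \<aa>"
    if h: "h \<in> H" "h' \<in> H" and c: "\<theta> (\<delta> h) = \<theta> (\<delta> h')" for h h'
  proof -
    define g where "g = inv\<^bsub>G\<^esub> h \<otimes>\<^bsub>G\<^esub> h'"
    define r where "r = ?E' (\<Delta> #>\<^bsub>G\<^esub> g)"
    have hG: "h \<in> carrier G" "h' \<in> carrier G" using h by auto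
    have g: "g \<in> H" "g \<in> carrier G" using h hG by (auto simp: g_def)
    have h'g: "h' = h \<otimes>\<^bsub>G\<^esub> g" using hG by (simp add: g_def PG.m_assoc[symmetric])
    have rR: "r \<in> carrier R" unfolding r_def using g by (intro E'R) (auto simp: HQ')
    have EhC: "?E x \<in> carrier kH" if "x \<in> H" for x using EH[OF that] by (simp add: C_def)
    \<comment> \<open>\<open>\<delta>(h') = \<delta>(h)\<close> makes \<open>\<phi>(h')\<close> and \<open>\<phi>(h)\<close> differ by the scalar matrix of \<open>g\<Delta>\<close>.\<close>
    have step: "\<phi> (?E h') (i, l) = \<phi> (?E h) (i, l) \<otimes>\<^bsub>R\<^esub> r" if il: "i < t" "l < t" for i l
    proof -
      let ?c = "\<theta> (\<delta> h) (i, l)"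
      have cos: "\<Delta> #>\<^bsub>G\<^esub> h' = (\<Delta> #>\<^bsub>G\<^esub> h) \<otimes>\<^bsub>Q\<^esub> (\<Delta> #>\<^bsub>G\<^esub> g)"
        using hG g by (simp add: h'g Q carrier_Mod \<Delta>.rcos_sum)
      have e1: "\<phi> (?E h) (i, l) = cgr_smult K Q TQ ?c (?E' (\<Delta> #>\<^bsub>G\<^esub> h))" by (rule \<delta>\<phi>[OF h(1) il])
      have e2: "\<phi> (?E h') (i, l) = cgr_smult K Q TQ ?c (?E' ((\<Delta> #>\<^bsub>G\<^esub> h) \<otimes>\<^bsub>Q\<^esub> (\<Delta> #>\<^bsub>G\<^esub> g)))"
        using \<delta>\<phi>[OF h(2) il] c cos by simp
      have "\<phi> (?E h) (i, l) \<in> carrier S" "\<phi> (?E h') (i, l) \<in> carrier S"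
        using mh.hom_entry[OF EhC il] h RS by auto
      then have "\<phi> (?E h) (i, l) \<otimes>\<^bsub>S\<^esub> r = \<phi> (?E h') (i, l)" unfolding e1 e2 r_def S
        using hG g ringS by (intro KQ.cgr_smult_elt_mult) (auto simp: S Q carrier_Mod \<Delta>.rcoset_in)
      then show ?thesis by (subst RSc) simp
    qed
    have \<phi>g: "\<phi> (?E g) (i, l) = (if i = l then r else \<zero>\<^bsub>R\<^esub>)" if il: "i < t" "l < t" for i l
    proof -
      have ih: "inv\<^bsub>G\<^esub> h \<in> H" using h by simp
      have c1: "\<phi> (?E (inv\<^bsub>G\<^esub> h)) (i, m) \<in> carrier R" "\<phi> (?E h) (m, l) \<in> carrier R" if "m < t" for m
        using mh.hom_entry EhC ih h il that by auto
      have Eg: "?E g = ?E (inv\<^bsub>G\<^esub> h) \<otimes>\<^bsub>kH\<^esub> ?E h'" "?E (inv\<^bsub>G\<^esub> h) \<otimes>\<^bsub>kH\<^esub> ?E h = \<one>\<^bsub>kH\<^esub>"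
        using Emult hG Eone by (simp_all add: g_def kHC)
      have "\<phi> (?E g) (i, l) = (\<Oplus>\<^bsub>R\<^esub>m\<in>{..<t}. \<phi> (?E (inv\<^bsub>G\<^esub> h)) (i, m) \<otimes>\<^bsub>R\<^esub> \<phi> (?E h') (m, l))"
        unfolding Eg(1) using il EhC ih h by (simp add: mh.hom_mult mat_ring_simps)
      also have "\<dots> = (\<Oplus>\<^bsub>R\<^esub>m\<in>{..<t}. (\<phi> (?E (inv\<^bsub>G\<^esub> h)) (i, m) \<otimes>\<^bsub>R\<^esub> \<phi> (?E h) (m, l)) \<otimes>\<^bsub>R\<^esub> r)"
        using c1 rR il step by (intro tw.R.finsum_cong') (auto simp: tw.R.m_assoc)
      also have "\<dots> = (\<Oplus>\<^bsub>R\<^esub>m\<in>{..<t}. \<phi> (?E (inv\<^bsub>G\<^esub> h)) (i, m) \<otimes>\<^bsub>R\<^esub> \<phi> (?E h) (m, l)) \<otimes>\<^bsub>R\<^esub> r"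
        using c1 rR by (intro tw.R.finsum_ldistr[symmetric]) auto
      also have "(\<Oplus>\<^bsub>R\<^esub>m\<in>{..<t}. \<phi> (?E (inv\<^bsub>G\<^esub> h)) (i, m) \<otimes>\<^bsub>R\<^esub> \<phi> (?E h) (m, l)) = \<phi> \<one>\<^bsub>kH\<^esub> (i, l)"
        unfolding Eg(2)[symmetric] using il EhC ih h by (simp add: mh.hom_mult mat_ring_simps)
      also have "\<dots> = (if i = l then \<one>\<^bsub>R\<^esub> else \<zero>\<^bsub>R\<^esub>)"
        using ring_hom_one[OF \<phi>hom] il by (simp add: mat_ring_simps)
      finally show ?thesis using rR by (simp split: if_splits)
    qed
    have one: "\<phi> \<one>\<^bsub>kH\<^esub> (i, l) = (if i = l then \<one>\<^bsub>R\<^esub> else \<zero>\<^bsub>R\<^esub>)" if "i < t" "l < t" for i l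
      using ring_hom_one[OF \<phi>hom] that by (simp add: mat_ring_simps)
    have oneH: "\<one>\<^bsub>kH\<^esub> \<in> carrier kH" using ringH by (simp add: ring.ring_simprules)
    have diff: "?E g \<ominus>\<^bsub>kH\<^esub> \<one>\<^bsub>kH\<^esub> \<in> carrier kH"
      using EhC[OF g(1)] oneH by (simp add: ring.ring_simprules[OF ringH])
    have ent: "\<phi> (?E g \<ominus>\<^bsub>kH\<^esub> \<one>\<^bsub>kH\<^esub>) (i, l) = (if i = l then r \<ominus>\<^bsub>R\<^esub> \<one>\<^bsub>R\<^esub> else \<zero>\<^bsub>R\<^esub>)"
      if il: "i < t" "l < t" for i l
      using mh.hom_diff[OF EhC[OF g(1)] oneH il] \<phi>g[OF il] one[OF il]
      by (auto simp: a_minus_def)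
    have "?E g \<ominus>\<^bsub>kH\<^esub> \<one>\<^bsub>kH\<^esub> \<in> A \<longleftrightarrow> (\<forall>i<t. \<forall>l<t. \<phi> (?E g \<ominus>\<^bsub>kH\<^esub> \<one>\<^bsub>kH\<^esub>) (i, l) \<in> \<aa>)"
      unfolding A_eq using diff mh.hom_closed[OF diff] by (simp add: mat_set_iff)
    also have "\<dots> \<longleftrightarrow> r \<ominus>\<^bsub>R\<^esub> \<one>\<^bsub>R\<^esub> \<in> \<aa>"
    proof
      assume "\<forall>i<t. \<forall>l<t. \<phi> (?E g \<ominus>\<^bsub>kH\<^esub> \<one>\<^bsub>kH\<^esub>) (i, l) \<in> \<aa>"
      then have "\<phi> (?E g \<ominus>\<^bsub>kH\<^esub> \<one>\<^bsub>kH\<^esub>) (0, 0) \<in> \<aa>" using assms(23) by auto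
      then show "r \<ominus>\<^bsub>R\<^esub> \<one>\<^bsub>R\<^esub> \<in> \<aa>" using ent[of 0 0] assms(23) by simp
    next
      assume "r \<ominus>\<^bsub>R\<^esub> \<one>\<^bsub>R\<^esub> \<in> \<aa>"
      then show "\<forall>i<t. \<forall>l<t. \<phi> (?E g \<ominus>\<^bsub>kH\<^esub> \<one>\<^bsub>kH\<^esub>) (i, l) \<in> \<aa>"
        using ent additive_subgroup.zero_closed[OF ai.is_additive_subgroup] by simp
    qed
    finally show ?thesis by (simp add: g_def r_def)
  qed
  have dagA: "dagger k G T H A = {x \<in> H. ?E x \<ominus>\<^bsub>kH\<^esub> \<one>\<^bsub>kH\<^esub> \<in> A}"
  proof -
    have "\<one>\<^bsub>kG\<^esub> \<in> C" using EH[OF H.one_closed] Eone by simp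
    then have "?E x \<ominus>\<^bsub>kH\<^esub> \<one>\<^bsub>kH\<^esub> = ?E x \<ominus>\<^bsub>kG\<^esub> \<one>\<^bsub>kG\<^esub>" if "x \<in> H" for x
      using subring_minus[OF ringG ringH[unfolded kHC] CG EH[OF that]] by (simp add: kHC)
    then show ?thesis by (auto simp: dagger_def kG)
  qed
  have daga: "dagger K Q TQ HQ \<aa> = {X \<in> HQ. ?E' X \<ominus>\<^bsub>R\<^esub> \<one>\<^bsub>R\<^esub> \<in> \<aa>}"
  proof -
    have ringR': "ring (S\<lparr>carrier := carrier R\<rparr>)" using ringR RSc by simp
    have oneR: "\<one>\<^bsub>S\<^esub> \<in> carrier R" using E'R[OF subgroup.one_closed[OF HQsub]] by (simp add: S KQ.cgr_elt_one)
    have "?E' X \<ominus>\<^bsub>R\<^esub> \<one>\<^bsub>R\<^esub> = ?E' X \<ominus>\<^bsub>S\<^esub> \<one>\<^bsub>S\<^esub>" if "X \<in> HQ" for X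
    proof -
      have "?E' X \<ominus>\<^bsub>S\<lparr>carrier := carrier R\<rparr>\<^esub> \<one>\<^bsub>S\<^esub> = ?E' X \<ominus>\<^bsub>S\<^esub> \<one>\<^bsub>S\<^esub>"
        by (rule subring_minus[OF ringS ringR' RS E'R[OF that] oneR])
      moreover have "\<one>\<^bsub>R\<^esub> = \<one>\<^bsub>S\<^esub>" by (subst RSc) simp
      ultimately show ?thesis using RSc by simp
    qed
    then show ?thesis by (auto simp: dagger_def S)
  qed
  have Qone: "\<one>\<^bsub>Q\<^esub> = \<Delta>" by (simp add: Q carrier_Mod)
  have "(finite {x \<in> H. ?E x \<ominus>\<^bsub>kH\<^esub> \<one>\<^bsub>kH\<^esub> \<in> A} \<longleftrightarrow>
        {X \<in> HQ. ?E' X \<ominus>\<^bsub>R\<^esub> \<one>\<^bsub>R\<^esub> \<in> \<aa>} = {finite_radical G}) \<and>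
      (finite {x \<in> H. ?E x \<ominus>\<^bsub>kH\<^esub> \<one>\<^bsub>kH\<^esub> \<in> A} \<longleftrightarrow> finite {X \<in> HQ. ?E' X \<ominus>\<^bsub>R\<^esub> \<one>\<^bsub>R\<^esub> \<in> \<aa>})"
  proof (rule PG.faithful_iff[where c = "\<lambda>h. \<theta> (\<delta> h)"])
    show "H \<lhd> G" "finite (rcosets\<^bsub>G\<^esub> H)" "ideal A kH" "ideal \<aa> R" by (rule assms finGH)+
    show "finite_radical G \<lhd> G" "finite (finite_radical G)" "finite_radical G \<subseteq> H"
      using \<Delta>N \<Delta>fin assms(18) by (simp_all add: \<Delta>)
    show "?E x \<in> carrier kH" if "x \<in> H" for x using EH[OF that] by (simp add: C_def)
    show "?E (x \<otimes>\<^bsub>G\<^esub> y) = ?E x \<otimes>\<^bsub>kH\<^esub> ?E y" if "x \<in> H" "y \<in> H" for x y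
      using Emult[of x y] that by (simp add: kHC)
    show "?E \<one>\<^bsub>G\<^esub> = \<one>\<^bsub>kH\<^esub>" using Eone by (simp add: kHC)
    show "?E' X \<in> carrier R" if "X \<in> HQ" for X by (rule E'R[OF that])
    show "?E' (X <#>\<^bsub>G\<^esub> Y) = ?E' X \<otimes>\<^bsub>R\<^esub> ?E' Y" if "X \<in> HQ" "Y \<in> HQ" for X Y
      using E'mult[OF that] by (simp add: Q carrier_Mod)
    show "?E' (finite_radical G) = \<one>\<^bsub>R\<^esub>" using E'one by (simp add: Qone \<Delta>)
    show "HQ = {finite_radical G #>\<^bsub>G\<^esub> h |h. h \<in> H}" using HQ' by (simp add: \<Delta>)
    show "finite ((\<lambda>h. \<theta> (\<delta> h)) ` H)" by (rule finc)
    show "?E (inv\<^bsub>G\<^esub> h \<otimes>\<^bsub>G\<^esub> h') \<ominus>\<^bsub>kH\<^esub> \<one>\<^bsub>kH\<^esub> \<in> A \<longleftrightarrow>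
        ?E' (finite_radical G #>\<^bsub>G\<^esub> (inv\<^bsub>G\<^esub> h \<otimes>\<^bsub>G\<^esub> h')) \<ominus>\<^bsub>R\<^esub> \<one>\<^bsub>R\<^esub> \<in> \<aa>"
      if "h \<in> H" "h' \<in> H" "\<theta> (\<delta> h) = \<theta> (\<delta> h')" for h h' using key[OF that] by (simp add: \<Delta>)
  qed
  then have iii: "(almost_faithful k G T H A \<longleftrightarrow> faithful K Q TQ HQ \<aa>) \<and>
      (almost_faithful k G T H A \<longleftrightarrow> almost_faithful K Q TQ HQ \<aa>)"
    unfolding almost_faithful_def faithful_def dagA daga Qone \<Delta> .
  show ?thesis using i ii iii by blast
qed

end
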